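(* The constrained SPE existence problem for RP games is $\mathsf{EXPTIME}$-complete, already for two players. That is, the problem (for RP games with an arbitrary finite number of players) belongs to $\mathsf{EXPTIME}$, and it is $\mathsf{EXPTIME}$-hard even when restricted to RP games with two players.
   Context: **Arenas.** An arena is $A=(V,E,\mathcal P,(V_i)_{i\in\mathcal P})$ with $V$ a finite set of vertices, $E\subseteq V\times V$ such that every vertex has at least one successor, $\mathcal P$ a finite set of players, and $(V_i)_{i\in\mathcal P}$ a partition of $V$ ($V_i$ is the set of vertices owned by player $i$). A play (resp. history) is an infinite (resp. finite) sequence of vertices following edges. $\mathsf{Hist}(v)$ denotes the set of histories starting with $v$. **Games.** A game $\mathcal G=(A,(\mathsf{pay}_i)_{i\in\mathcal P})$ consists of an arena and, for each player $i$, a payoff function $\mathsf{pay}_i:V^\omega\to P_i$, where $P_i$ is a set equipped with a binary relation $\ltimes_i\subseteq P_i\times P_i$ (the preference relation; $p\ltimes_i p'$ means $p'$ is preferred to $p$). It is a *regular-payoff game* (RP game) if, for each $i$, $P_i$ is finite and $\mathsf{pay}_i^{-1}(p)$ is $\omega$-regular for each $p\in P_i$. No condition is imposed on $\ltimes_i$. As an input to a decision problem, an RP game is given by its arena, the finite sets $P_i$ and relations $\ltimes_i$ listed explicitly, and, for each $i$ and each $p\in P_i$, a deterministic parity automaton over the alphabet $V$ accepting $\mathsf{pay}_i^{-1}(p)$. **Strategies and equilibria.** A strategy $\sigma_i$ of player $i$ maps each history $hv$ with $v\in V_i$ to a successor of $v$. A strategy profile is $\bar\sigma=(\sigma_i)_{i\in\mathcal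 P}$; its outcome $\langle\bar\sigma\rangle_v$ is the unique play from $v$ consistent with all $\sigma_i$; $\bar\sigma_{-i}=(\sigma_j)_{j\neq i}$. A profile $\bar\sigma$ is a Nash equilibrium (NE) from $v$ if for every player $i$ and every strategy $\tau_i$ of player $i$, it is not the case that $\mathsf{pay}_i(\langle\bar\sigma\rangle_v)\ltimes_i\mathsf{pay}_i(\langle(\tau_i,\bar\sigma_{-i})\rangle_v)$. For a history $h$, the subgame $\mathcal G_{\restriction h}$ has the same arena and payoff functions $\pi\mapsto\mathsf{pay}_i(h\pi)$, and $\sigma_{i\upharpoonright h}(h')=\sigma_i(hh')$. A profile $\bar\sigma$ is a subgame perfect equilibrium (SPE) from $v_0$ if for all $hv\in\mathsf{Hist}(v_0)$ ($h$ possibly empty), $\bar\sigma_{\upharpoonright h}$ is an NE from $v$ in $\mathcal G_{\restriction h}$. **Problem.** The constrained SPE existence problem: given an RP game, a vertex $v$ and a payoff $p_i\in P_i$ for each player $i$, decide whether there exists an SPE $\bar\sigma$ from $v$ such that for all $i\in\mathcal P$, $p_i=\mathsf{pay}_i(\langle\bar\sigma\rangle_v)$ or $p_i\ltimes_i\mathsf{pay}_i(\langle\bar\sigma\rangle_v)$. *)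

theory Defs
  imports Complex_Main "HOL-Library.Landau_Symbols" "HOL-Library.Omega_Words_Fun"
    "HOL-Library.Disjoint_Sets"
begin

section \<open>Deterministic multi-tape Turing machines\<close>

text \<open>
  Control states are the numbers below \<open>tm_states\<close>, state 0 is initial and the number
  \<open>tm_states\<close> itself is the halting state.  Tape symbols are the numbers below \<open>tm_syms\<close>, where
  0 is the blank and 1, 2 stand for the bits.  Tapes are infinite in both directions.
\<close>

datatype tm_move = Move_Left | Stay | Move_Right

record tm =
  tm_tapes :: nat
  tm_syms :: nat
  tm_states :: nat
  tm_delta :: "nat \<Rightarrow> nat list \<Rightarrow> nat \<times> (nat \<times> tm_move) list"

definition wf_tm :: "tm \<Rightarrow> bool" where
  "wf_tm M \<longleftrightarrow> tm_tapes M \<ge> 1 \<and> tm_syms M \<ge> 3 \<and>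
     (\<forall>q<tm_states M. \<forall>ss. length ss = tm_tapes M \<and> set ss \<subseteq> {..<tm_syms M} \<longrightarrow>
        (case tm_delta M q ss of (q', acts) \<Rightarrow>
           q' \<le> tm_states M \<and> length acts = tm_tapes M \<and> fst ` set acts \<subseteq> {..<tm_syms M}))"

type_synonym tm_tape = "(int \<Rightarrow> nat) \<times> int"
type_synonym tm_config = "nat \<times> tm_tape list"

fun tape_read :: "tm_tape \<Rightarrow> nat" where
  "tape_read (c, h) = c h"

fun tape_act :: "nat \<times> tm_move \<Rightarrow> tm_tape \<Rightarrow> tm_tape" where
  "tape_act (s, m) (c, h) =
     (c(h := s), case m of Move_Left \<Rightarrow> h - 1 | Stay \<Rightarrow> h | Move_Right \<Rightarrow> h + 1)"

fun tm_step :: "tm \<Rightarrow> tm_config \<Rightarrow> tm_config" where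
  "tm_step M (q, ts) =
     (if q \<ge> tm_states M then (q, ts)
      else case tm_delta M q (map tape_read ts) of (q', acts) \<Rightarrow> (q', map2 tape_act acts ts))"

definition bit_sym :: "bool \<Rightarrow> nat" where
  "bit_sym b = (if b then 2 else 1)"

definition tape_of :: "bool list \<Rightarrow> tm_tape" where
  "tape_of x = (\<lambda>j. if 0 \<le> j \<and> j < int (length x) then bit_sym (x ! nat j) else 0, 0)"

definition tm_init :: "tm \<Rightarrow> bool list \<Rightarrow> tm_config" where
  "tm_init M x = (0, tape_of x # replicate (tm_tapes M - 1) (tape_of []))"

text \<open>The output is read from cell 0 onwards up to the first blank; cells elsewhere and the
  final head position are irrelevant.\<close>

fun tape_output :: "tm_tape \<Rightarrow> bool list \<Rightarrow> bool" where
  "tape_output (c, h) y \<longleftrightarrow>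
     (\<forall>j<length y. c (int j) = bit_sym (y ! j)) \<and> c (int (length y)) = 0"

definition tm_computes_in_time :: "tm \<Rightarrow> (bool list \<Rightarrow> bool list) \<Rightarrow> (nat \<Rightarrow> nat) \<Rightarrow> bool" where
  "tm_computes_in_time M f T \<longleftrightarrow> wf_tm M \<and>
     (\<forall>x. \<exists>t\<le>T (length x). case (tm_step M ^^ t) (tm_init M x) of (q, ts) \<Rightarrow>
        q = tm_states M \<and> tape_output (last ts) (f x))"

section \<open>Complexity classes\<close>

definition computable_in_time :: "(bool list \<Rightarrow> bool list) \<Rightarrow> (nat \<Rightarrow> real) \<Rightarrow> bool" where
  "computable_in_time f g \<longleftrightarrow>
     (\<exists>M T. tm_computes_in_time M f T \<and> (\<lambda>n. real (T n)) \<in> O(g))"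

definition DTIME :: "(nat \<Rightarrow> real) \<Rightarrow> bool list set set" where
  "DTIME g = {L. computable_in_time (\<lambda>x. [x \<in> L]) g}"

definition EXPTIME :: "bool list set set" where
  "EXPTIME = (\<Union>k. DTIME (\<lambda>n. 2 ^ (n ^ k)))"

definition polytime_computable :: "(bool list \<Rightarrow> bool list) \<Rightarrow> bool" where
  "polytime_computable f \<longleftrightarrow> (\<exists>k. computable_in_time f (\<lambda>n. real n ^ k))"

text \<open>Hardness of the problem \<open>L\<close> restricted to the inputs in \<open>D\<close>: every language in the class
  has a polynomial-time many-one reduction to \<open>L\<close> all of whose values lie in \<open>D\<close>.  For
  \<open>D = UNIV\<close> this is ordinary hardness of \<open>L\<close>.\<close>

definition EXPTIME_hard_on :: "bool list set \<Rightarrow> bool list set \<Rightarrow> bool" where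
  "EXPTIME_hard_on D L \<longleftrightarrow>
     (\<forall>L'\<in>EXPTIME. \<exists>f. polytime_computable f \<and> (\<forall>x. f x \<in> D \<and> (x \<in> L' \<longleftrightarrow> f x \<in> L)))"

section \<open>Deterministic parity automata\<close>

record ('q, 'a) dpa =
  dpa_states :: "'q set"
  dpa_init :: 'q
  dpa_delta :: "'q \<Rightarrow> 'a \<Rightarrow> 'q"
  dpa_prio :: "'q \<Rightarrow> nat"

definition wf_dpa :: "'a set \<Rightarrow> ('q, 'a) dpa \<Rightarrow> bool" where
  "wf_dpa \<Sigma> A \<longleftrightarrow> finite (dpa_states A) \<and> dpa_init A \<in> dpa_states A \<and>
     (\<forall>q\<in>dpa_states A. \<forall>a\<in>\<Sigma>. dpa_delta A q a \<in> dpa_states A)"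

primrec dpa_run :: "('q, 'a) dpa \<Rightarrow> 'a word \<Rightarrow> 'q word" where
  "dpa_run A w 0 = dpa_init A"
| "dpa_run A w (Suc n) = dpa_delta A (dpa_run A w n) (w n)"

definition dpa_accepts :: "('q, 'a) dpa \<Rightarrow> 'a word \<Rightarrow> bool" where
  "dpa_accepts A w \<longleftrightarrow> even (Max (limit (\<lambda>n. dpa_prio A (dpa_run A w n))))"

definition omega_words :: "'a set \<Rightarrow> 'a word set" where
  "omega_words \<Sigma> = {w. range w \<subseteq> \<Sigma>}"

definition dpa_language :: "'a set \<Rightarrow> ('q, 'a) dpa \<Rightarrow> 'a word set" where
  "dpa_language \<Sigma> A = {w \<in> omega_words \<Sigma>. dpa_accepts A w}"

text \<open>Over a finite alphabet, deterministic parity automata recognise exactly the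
  \<open>\<omega>\<close>-regular languages.  States can be taken to be natural numbers since they are finitely
  many.\<close>

definition omega_regular :: "'a set \<Rightarrow> 'a word set \<Rightarrow> bool" where
  "omega_regular \<Sigma> L \<longleftrightarrow> (\<exists>A :: (nat, 'a) dpa. wf_dpa \<Sigma> A \<and> dpa_language \<Sigma> A = L)"

section \<open>Arenas and games\<close>

record ('v, 'i) arena =
  verts :: "'v set"
  edges :: "('v \<times> 'v) set"
  players :: "'i set"
  owned :: "'i \<Rightarrow> 'v set"

text \<open>A player may own no vertex at all.\<close>

definition wf_arena :: "('v, 'i, 'x) arena_scheme \<Rightarrow> bool" where
  "wf_arena A \<longleftrightarrow> finite (verts A) \<and> edges A \<subseteq> verts A \<times> verts A \<and>
     (\<forall>u\<in>verts A. \<exists>u'. (u, u') \<in> edges A) \<and> finite (players A) \<and>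
     (\<Union>i\<in>players A. owned A i) = verts A \<and> disjoint_family_on (owned A) (players A)"

definition play :: "('v, 'i, 'x) arena_scheme \<Rightarrow> 'v word \<Rightarrow> bool" where
  "play A \<pi> \<longleftrightarrow> \<pi> \<in> omega_words (verts A) \<and> (\<forall>n. (\<pi> n, \<pi> (Suc n)) \<in> edges A)"

definition history :: "('v, 'i, 'x) arena_scheme \<Rightarrow> 'v list \<Rightarrow> bool" where
  "history A h \<longleftrightarrow> set h \<subseteq> verts A \<and> successively (\<lambda>u u'. (u, u') \<in> edges A) h"

definition Hist :: "('v, 'i, 'x) arena_scheme \<Rightarrow> 'v \<Rightarrow> 'v list set" where
  "Hist A v = {h. history A h \<and> h \<noteq> [] \<and> hd h = v}"

record ('v, 'i, 'p) game = "('v, 'i) arena" +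
  payoffs :: "'i \<Rightarrow> 'p set"
  pref :: "'i \<Rightarrow> ('p \<times> 'p) set"
  pay :: "'i \<Rightarrow> 'v word \<Rightarrow> 'p"

definition wf_game :: "('v, 'i, 'p) game \<Rightarrow> bool" where
  "wf_game G \<longleftrightarrow> wf_arena G \<and>
     (\<forall>i\<in>players G. pref G i \<subseteq> payoffs G i \<times> payoffs G i \<and>
        (\<forall>w\<in>omega_words (verts G). pay G i w \<in> payoffs G i))"

definition pay_preimage :: "('v, 'i, 'p) game \<Rightarrow> 'i \<Rightarrow> 'p \<Rightarrow> 'v word set" where
  "pay_preimage G i p = {w \<in> omega_words (verts G). pay G i w = p}"

definition RP_game :: "('v, 'i, 'p) game \<Rightarrow> bool" where
  "RP_game G \<longleftrightarrow> wf_game G \<and>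
     (\<forall>i\<in>players G. finite (payoffs G i) \<and>
        (\<forall>p\<in>payoffs G i. omega_regular (verts G) (pay_preimage G i p)))"

section \<open>Strategies and equilibria\<close>

definition strategy :: "('v, 'i, 'x) arena_scheme \<Rightarrow> 'i \<Rightarrow> ('v list \<Rightarrow> 'v) \<Rightarrow> bool" where
  "strategy A i s \<longleftrightarrow>
     (\<forall>h v. history A (h @ [v]) \<and> v \<in> owned A i \<longrightarrow> (v, s (h @ [v])) \<in> edges A)"

definition strategy_profile :: "('v, 'i, 'x) arena_scheme \<Rightarrow> ('i \<Rightarrow> 'v list \<Rightarrow> 'v) \<Rightarrow> bool" where
  "strategy_profile A \<sigma> \<longleftrightarrow> (\<forall>i\<in>players A. strategy A i (\<sigma> i))"

definition consistent :: "('v, 'i, 'x) arena_scheme \<Rightarrow> 'i \<Rightarrow> ('v list \<Rightarrow> 'v) \<Rightarrow> 'v word \<Rightarrow> bool" where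
  "consistent A i s \<pi> \<longleftrightarrow> (\<forall>n. \<pi> n \<in> owned A i \<longrightarrow> \<pi> (Suc n) = s (map \<pi> [0..<Suc n]))"

definition outcome :: "('v, 'i, 'x) arena_scheme \<Rightarrow> ('i \<Rightarrow> 'v list \<Rightarrow> 'v) \<Rightarrow> 'v \<Rightarrow> 'v word" where
  "outcome A \<sigma> v =
     (THE \<pi>. play A \<pi> \<and> \<pi> 0 = v \<and> (\<forall>i\<in>players A. consistent A i (\<sigma> i) \<pi>))"

definition is_NE :: "('v, 'i, 'p) game \<Rightarrow> 'v \<Rightarrow> ('i \<Rightarrow> 'v list \<Rightarrow> 'v) \<Rightarrow> bool" where
  "is_NE G v \<sigma> \<longleftrightarrow>
     (\<forall>i\<in>players G. \<forall>\<tau>. strategy G i \<tau> \<longrightarrow>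
        (pay G i (outcome G \<sigma> v), pay G i (outcome G (\<sigma>(i := \<tau>)) v)) \<notin> pref G i)"

definition subgame :: "('v, 'i, 'p) game \<Rightarrow> 'v list \<Rightarrow> ('v, 'i, 'p) game" where
  "subgame G h = G\<lparr>pay := \<lambda>i \<pi>. pay G i (h \<frown> \<pi>)\<rparr>"

definition restrict_profile :: "('i \<Rightarrow> 'v list \<Rightarrow> 'v) \<Rightarrow> 'v list \<Rightarrow> 'i \<Rightarrow> 'v list \<Rightarrow> 'v" where
  "restrict_profile \<sigma> h = (\<lambda>i h'. \<sigma> i (h @ h'))"

text \<open>The restriction of a strategy to \<open>h\<close> only has to prescribe successors on those histories
  \<open>h'\<close> for which \<open>h @ h'\<close> is a history; therefore being a strategy profile is required here of
  the whole profile and not in \<open>is_NE\<close>.\<close>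

definition is_SPE :: "('v, 'i, 'p) game \<Rightarrow> 'v \<Rightarrow> ('i \<Rightarrow> 'v list \<Rightarrow> 'v) \<Rightarrow> bool" where
  "is_SPE G v\<^sub>0 \<sigma> \<longleftrightarrow> strategy_profile G \<sigma> \<and>
     (\<forall>h v. h @ [v] \<in> Hist G v\<^sub>0 \<longrightarrow> is_NE (subgame G h) v (restrict_profile \<sigma> h))"

definition constrained_SPE_exists :: "('v, 'i, 'p) game \<Rightarrow> 'v \<Rightarrow> ('i \<Rightarrow> 'p) \<Rightarrow> bool" where
  "constrained_SPE_exists G v p \<longleftrightarrow>
     (\<exists>\<sigma>. is_SPE G v \<sigma> \<and>
        (\<forall>i\<in>players G. p i = pay G i (outcome G \<sigma> v) \<or> (p i, pay G i (outcome G \<sigma> v)) \<in> pref G i))"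

section \<open>Instances as finite data\<close>

text \<open>Vertices, players, payoffs and automaton states are initial segments of the natural numbers.
  Row \<open>q\<close> of \<open>code_table\<close> lists the successors of state \<open>q\<close> under each vertex.\<close>

record dpa_code =
  code_init :: nat
  code_table :: "nat list list"
  code_prios :: "nat list"

text \<open>The \<open>p\<close>-th automaton of a player recognises the words of payoff \<open>p\<close>; so the number of
  automata is the number of payoffs of that player.\<close>

record player_code =
  code_pref :: "(nat \<times> nat) list"
  code_automata :: "dpa_code list"

text \<open>\<open>inst_owner\<close> lists the owner of each vertex; its length is the number of vertices.\<close>

record instance_code =
  inst_owner :: "nat list"
  inst_edges :: "(nat \<times> nat) list"
  inst_players :: "player_code list"
  inst_start :: nat
  inst_bounds :: "nat list"

definition dpa_of :: "dpa_code \<Rightarrow> (nat, nat) dpa" where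
  "dpa_of C = \<lparr>dpa_states = {..<length (code_table C)}, dpa_init = code_init C,
     dpa_delta = (\<lambda>q a. code_table C ! q ! a), dpa_prio = (\<lambda>q. code_prios C ! q)\<rparr>"

definition num_payoffs :: "instance_code \<Rightarrow> nat \<Rightarrow> nat" where
  "num_payoffs I i = length (code_automata (inst_players I ! i))"

definition automaton :: "instance_code \<Rightarrow> nat \<Rightarrow> nat \<Rightarrow> (nat, nat) dpa" where
  "automaton I i p = dpa_of (code_automata (inst_players I ! i) ! p)"

definition game_of :: "instance_code \<Rightarrow> (nat, nat, nat) game" where
  "game_of I =
     \<lparr>verts = {..<length (inst_owner I)},
      edges = set (inst_edges I),
      players = {..<length (inst_players I)},
      owned = (\<lambda>i. {v. v < length (inst_owner I) \<and> inst_owner I ! v = i}),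
      payoffs = (\<lambda>i. {..<num_payoffs I i}),
      pref = (\<lambda>i. set (code_pref (inst_players I ! i))),
      pay = (\<lambda>i w. THE p. p < num_payoffs I i \<and> dpa_accepts (automaton I i p) w)\<rparr>"

definition wf_dpa_code :: "nat \<Rightarrow> dpa_code \<Rightarrow> bool" where
  "wf_dpa_code n C \<longleftrightarrow> wf_dpa {..<n} (dpa_of C) \<and>
     (\<forall>row\<in>set (code_table C). length row = n) \<and> length (code_prios C) = length (code_table C)"

text \<open>The condition on \<open>pay_preimage\<close> says that the automata present a function: every word over
  the vertices is accepted by exactly one automaton of each player.\<close>

definition valid_instance :: "instance_code \<Rightarrow> bool" where
  "valid_instance I \<longleftrightarrow> RP_game (game_of I) \<and>
     (\<forall>P\<in>set (inst_players I). \<forall>C\<in>set (code_automata P). wf_dpa_code (length (inst_owner I)) C) \<and>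
     (\<forall>i<length (inst_players I). \<forall>p<num_payoffs I i.
        dpa_language (verts (game_of I)) (automaton I i p) = pay_preimage (game_of I) i p) \<and>
     inst_start I \<in> verts (game_of I) \<and>
     length (inst_bounds I) = length (inst_players I) \<and>
     (\<forall>i<length (inst_players I). inst_bounds I ! i \<in> payoffs (game_of I) i)"

section \<open>Encoding of instances as bit strings\<close>

fun binary :: "nat \<Rightarrow> bool list" where
  "binary n = (if n = 0 then [] else odd n # binary (n div 2))"

declare binary.simps [simp del]

definition enc_list :: "('a \<Rightarrow> bool list) \<Rightarrow> 'a list \<Rightarrow> bool list" where
  "enc_list e xs = concat (map (\<lambda>x. True # e x) xs) @ [False]"

definition enc_nat :: "nat \<Rightarrow> bool list" where
  "enc_nat n = enc_list (\<lambda>b. [b]) (binary n)"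

fun enc_edge :: "nat \<times> nat \<Rightarrow> bool list" where
  "enc_edge (a, b) = enc_nat a @ enc_nat b"

definition enc_dpa :: "dpa_code \<Rightarrow> bool list" where
  "enc_dpa C = enc_nat (code_init C) @ enc_list (enc_list enc_nat) (code_table C) @
     enc_list enc_nat (code_prios C)"

definition enc_player :: "player_code \<Rightarrow> bool list" where
  "enc_player P = enc_list enc_edge (code_pref P) @ enc_list enc_dpa (code_automata P)"

definition enc_instance :: "instance_code \<Rightarrow> bool list" where
  "enc_instance I = enc_list enc_nat (inst_owner I) @ enc_list enc_edge (inst_edges I) @
     enc_list enc_player (inst_players I) @ enc_nat (inst_start I) @
     enc_list enc_nat (inst_bounds I)"

text \<open>All encodings are self-delimiting, so that instances can be recovered from bit strings.\<close>

definition self_delimiting :: "('a \<Rightarrow> bool list) \<Rightarrow> bool" where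
  "self_delimiting e \<longleftrightarrow> (\<forall>x y r s. e x @ r = e y @ s \<longrightarrow> x = y \<and> r = s)"

lemma self_delimitingD: "self_delimiting e \<Longrightarrow> e x @ r = e y @ s \<Longrightarrow> x = y \<and> r = s"
  unfolding self_delimiting_def by blast

lemma self_delimiting_list:
  assumes "self_delimiting e"
  shows "self_delimiting (enc_list e)"
proof -
  have "xs = ys \<and> r = s" if "enc_list e xs @ r = enc_list e ys @ s" for xs ys r s
    using that
  proof (induction xs arbitrary: ys)
    case Nil
    then show ?case by (cases ys) (auto simp: enc_list_def)
  next
    case (Cons x xs)
    from Cons.prems obtain y ys' where ys: "ys = y # ys'"
      by (cases ys) (auto simp: enc_list_def)
    have "e x @ enc_list e xs @ r = e y @ enc_list e ys' @ s"
      using Cons.prems by (simp add: ys enc_list_def)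
    from self_delimitingD[OF assms this] Cons.IH[of ys'] ys show ?case by auto
  qed
  then show ?thesis unfolding self_delimiting_def by blast
qed

lemma binary_inject: "binary m = binary n \<Longrightarrow> m = n"
proof (induction m arbitrary: n rule: less_induct)
  case (less m)
  show ?case
  proof (cases "m = 0 \<or> n = 0")
    case True
    then show ?thesis
      using less.prems by (auto simp: binary.simps[of m] binary.simps[of n] split: if_splits)
  next
    case False
    then have "odd m = odd n" "binary (m div 2) = binary (n div 2)"
      using less.prems by (simp_all add: binary.simps[of m] binary.simps[of n])
    then have "m div 2 = n div 2" "m mod 2 = n mod 2"
      using less.IH[of "m div 2" "n div 2"] False by (simp, simp add: mod2_eq_if)
    then show ?thesis by (metis div_mult_mod_eq)
  qed
qed

lemma self_delimiting_nat: "self_delimiting enc_nat"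
proof -
  have "self_delimiting (\<lambda>b. [b])" by (simp add: self_delimiting_def)
  note b = self_delimitingD[OF self_delimiting_list[OF this]]
  show ?thesis
    unfolding self_delimiting_def enc_nat_def using b binary_inject by blast
qed

lemma self_delimiting_append:
  assumes "self_delimiting e" "self_delimiting f"
  shows "self_delimiting (\<lambda>(a, b). e a @ f b)"
proof -
  have "x = y \<and> r = s"
    if eq: "(\<lambda>(a, b). e a @ f b) x @ r = (\<lambda>(a, b). e a @ f b) y @ s" for x y r s
  proof -
    obtain a b where x: "x = (a, b)" by (cases x)
    obtain a' b' where y: "y = (a', b')" by (cases y)
    from eq have "e a @ (f b @ r) = e a' @ (f b' @ s)" by (simp only: x y prod.case append_assoc)
    from self_delimitingD[OF assms(1) this] have "a = a'" and "f b @ r = f b' @ s" by simp_all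
    with self_delimitingD[OF assms(2) this(2)] show ?thesis by (simp add: x y)
  qed
  then show ?thesis unfolding self_delimiting_def by (intro allI impI)
qed

lemma self_delimiting_comp:
  assumes "self_delimiting e" "inj g" "\<And>x. f x = e (g x)"
  shows "self_delimiting f"
  unfolding self_delimiting_def
proof (intro allI impI)
  fix x y r s assume "f x @ r = f y @ s"
  then have "e (g x) @ r = e (g y) @ s" by (simp only: assms(3))
  then have "g x = g y \<and> r = s" by (rule self_delimitingD[OF assms(1)])
  then show "x = y \<and> r = s" using injD[OF assms(2)] by blast
qed

lemma self_delimiting_edge: "self_delimiting enc_edge"
proof -
  have "enc_edge = (\<lambda>(a, b). enc_nat a @ enc_nat b)"
    by (rule ext) (simp only: split_paired_all enc_edge.simps prod.case)
  then show ?thesis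
    using self_delimiting_append[OF self_delimiting_nat self_delimiting_nat] by simp
qed

lemma self_delimiting_dpa: "self_delimiting enc_dpa"
proof (rule self_delimiting_comp)
  show "inj (\<lambda>C :: dpa_code. (code_init C, code_table C, code_prios C))"
    by (rule injI) simp
qed (rule self_delimiting_append self_delimiting_list self_delimiting_nat | simp add: enc_dpa_def)+

lemma self_delimiting_player: "self_delimiting enc_player"
proof (rule self_delimiting_comp)
  show "inj (\<lambda>P :: player_code. (code_pref P, code_automata P))"
    by (rule injI) simp
qed (rule self_delimiting_append self_delimiting_list self_delimiting_edge self_delimiting_dpa
    | simp add: enc_player_def)+

lemma self_delimiting_instance: "self_delimiting enc_instance"
proof (rule self_delimiting_comp)
  show "inj (\<lambda>I :: instance_code.
      (inst_owner I, inst_edges I, inst_players I, inst_start I, inst_bounds I))"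
    by (rule injI) simp
qed (rule self_delimiting_append self_delimiting_list self_delimiting_nat self_delimiting_edge
      self_delimiting_player
    | simp add: enc_instance_def)+

lemma inj_enc_instance: "inj enc_instance"
proof (rule injI)
  fix I J assume "enc_instance I = enc_instance J"
  then have "enc_instance I @ [] = enc_instance J @ []" by simp
  from self_delimitingD[OF self_delimiting_instance this] show "I = J" by blast
qed

section \<open>The decision problem\<close>

definition constrained_SPE_problem :: "bool list set" where
  "constrained_SPE_problem = {enc_instance I | I. valid_instance I \<and>
     constrained_SPE_exists (game_of I) (inst_start I) (\<lambda>i. inst_bounds I ! i)}"

definition two_player_instances :: "bool list set" where
  "two_player_instances = {enc_instance I | I. valid_instance I \<and> card (players (game_of I)) = 2}"

end

theory Submission
  imports Defs
begin

text \<open>Membership.  A prover announces payoffs and proposes a play, a challenger lets players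
  deviate; the prover can be convincing for ever iff a suitable equilibrium exists, and the condition
  that no announced payoff is worse than the one reached is a Streett condition.  The first player of a
  Streett game wins iff he can keep the numbers of visits to each request set between grants below an
  explicit bound, which leaves a safety game of exponential size.

  Hardness.  Eve guesses the run of an exponential-time machine backwards from acceptance.  Time and
  head position are stored bitwise in the automata of the payoffs, and not in the vertices, so that the
  arena stays polynomial; a false update breaks one automaton, which Adam exploits by moving to the
  sink where its player profits exactly if it is broken.\<close>

section \<open>A stack language compiled to Turing machines\<close>

text \<open>That announcements are true and that deviations do not pay are conjunctions of parity
  conditions, each cancelled by infinitely many deviations of suitable players. As a Streett
  condition this takes two pairs per automaton and priority. The product of all automata is
  exponential, but there are only polynomially many counters, each with an exponential bound, so the
  safety game is still of exponential size. Membership includes recognising valid encodings: that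
  every word is accepted by exactly one automaton of each player is a one-player Streett question
  for the same solver. Since the classes are defined by concrete machines, algorithms are composed
  from combinators closed under polynomial time, with numbers in unary; an exponential number as an
  additional argument then yields exponential time. In the hardness game the required payoffs force
  Adam to abandon the game at once, which is stable iff Eve could have prevented every justified
  challenge. Going backwards keeps claims local: the content of one cell depends on the same cell
  one step earlier or on the symbols read.\<close>

datatype cmd = Push nat nat | Pop nat | Emit nat | Skip | Seq cmd cmd
 | Branch nat "nat => bool" cmd cmd | Loop nat "nat => bool" cmd

type_synonym store = "nat => nat list"

definition top_sym :: "nat list => nat" where
 "top_sym xs = (case xs of [] => 0 | a # _ => a)"

lemma top_sym_simps [simp]: "top_sym [] = 0" "top_sym (a # xs) = a"
 by (simp_all add: top_sym_def)

text \<open>Stack 4 is the output tape, which is only appended to.  Time is an upper bound.\<close>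

inductive big :: "cmd => store => nat => store => bool" where
 big_Push: "s' = s(k := a # s k) ==> big (Push k a) s 2 s'"
| big_Pop: "s' = s(k := tl (s k)) ==> big (Pop k) s 1 s'"
| big_Emit: "s' = s(4 := s 4 @ [a]) ==> big (Emit a) s 1 s'"
| big_Skip: "big Skip s 0 s"
| big_Seq: "big c s m s' ==> big d s' n s'' ==> big (Seq c d) s (m + n) s''"
| big_Branch_True: "b (top_sym (s k)) ==> big c s n s' ==> big (Branch k b c d) s (n + 2) s'"
| big_Branch_False: "~ b (top_sym (s k)) ==> big d s n s' ==> big (Branch k b c d) s (n + 2) s'"
| big_Loop_True: "b (top_sym (s k)) ==> big c s m s' ==> big (Loop k b c) s' n s'' ==>
   big (Loop k b c) s (m + n + 2) s''"
| big_Loop_False: "~ b (top_sym (s k)) ==> big (Loop k b c) s 1 s"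
| big_le: "big c s m s' ==> m <= n ==> big c s n s'"

primrec wf_cmd :: "cmd => bool" where
 "wf_cmd (Push k a) \<longleftrightarrow> k < 4 & a < 5"
| "wf_cmd (Pop k) \<longleftrightarrow> k < 4"
| "wf_cmd (Emit a) \<longleftrightarrow> a < 5"
| "wf_cmd Skip \<longleftrightarrow> True"
| "wf_cmd (Seq c d) \<longleftrightarrow> wf_cmd c & wf_cmd d"
| "wf_cmd (Branch k b c d) \<longleftrightarrow> k < 4 & wf_cmd c & wf_cmd d"
| "wf_cmd (Loop k b c) \<longleftrightarrow> k < 4 & wf_cmd c"

text \<open>A push costs two units and adds one symbol, so running time bounds growth. Size bounds
  for results thus follow from time bounds and need no proofs of their own.\<close>

lemma big_stack0_length:
 "big c s n s' ==> length (s' 0) <= length (s 0) + n"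
 by (induction rule: big.induct) auto

section \<open>Compilation of stack commands to a five-tape machine\<close>

type_synonym instr = "nat \<times> (nat => nat \<times> tm_move \<times> nat)"

primrec code_len :: "cmd => nat" where
 "code_len (Push k a) = 2"
| "code_len (Pop k) = 1"
| "code_len (Emit a) = 1"
| "code_len Skip = 0"
| "code_len (Seq c d) = code_len c + code_len d"
| "code_len (Branch k b c d) = 2 + code_len c + code_len d"
| "code_len (Loop k b c) = 2 + code_len c"

text \<open>The address \<open>q\<close> of the first instruction is an argument because jump
  targets are absolute. A test may be any predicate on symbols since transition functions of
  machines are functions of the logic. \<open>Push\<close> takes two instructions: stacks grow to
  the left and the head stands on the top symbol, so it has to move before it writes.\<close>

primrec compile :: "cmd => nat => instr list" where
 "compile (Push k a) q = [(k, %x. (x, Move_Left, q + 1)), (k, %x. (a, Stay, q + 2))]"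
| "compile (Pop k) q = [(k, %x. (x, Move_Right, q + 1))]"
| "compile (Emit a) q = [(4, %x. (a, Move_Right, q + 1))]"
| "compile Skip q = []"
| "compile (Seq c d) q = compile c q @ compile d (q + code_len c)"
| "compile (Branch k b c d) q =
   (k, %x. (x, Stay, if b x then q + 1 else q + 2 + code_len c)) # compile c (q + 1) @
   (k, %x. (x, Stay, q + 2 + code_len c + code_len d)) # compile d (q + 2 + code_len c)"
| "compile (Loop k b c) q =
   (k, %x. (x, Stay, if b x then q + 1 else q + 2 + code_len c)) # compile c (q + 1) @
   [(k, %x. (x, Stay, q))]"

lemma length_compile [simp]: "length (compile c q) = code_len c"
 by (induction c arbitrary: q) auto

definition machine :: "instr list => tm" where
 "machine p = \<lparr>tm_tapes = 5, tm_syms = 5, tm_states = length p,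
   tm_delta = (%q ss. case p ! q of (k, g) => case g (ss ! k) of (a, m, q') =>
    (q', map (%i. if i = k then (a, m) else (ss ! i, Stay)) [0..<5]))\<rparr>"

definition wf_instr :: "nat => instr => bool" where
 "wf_instr n I \<longleftrightarrow> fst I < 5 & (ALL a<5. fst (snd I a) < 5 & snd (snd (snd I a)) <= n)"

lemma wf_instr_mono: "wf_instr m I ==> m <= n ==> wf_instr n I"
 unfolding wf_instr_def by fastforce

lemma wf_compile: "wf_cmd c ==> I : set (compile c q) ==> wf_instr (q + code_len c) I"
proof (induction c arbitrary: q I)
 case (Seq c d)
 then consider "I : set (compile c q)" | "I : set (compile d (q + code_len c))" by auto
 thus ?case
 proof cases
  case 1
  with Seq have "wf_instr (q + code_len c) I" by simp
  thus ?thesis by (rule wf_instr_mono) simp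
 next
  case 2
  hence "wf_instr (q + code_len c + code_len d) I" using Seq.prems(1) by (intro Seq.IH(2)) simp_all
  thus ?thesis by (simp add: add.assoc)
 qed
next
 case (Branch k b c d)
 thus ?case
 proof (cases "I : set (compile c (q + 1))")
  case True
  thus ?thesis
   using Branch wf_instr_mono[of "q + 1 + code_len c" I] by fastforce
 next
  case False
  thus ?thesis
  proof (cases "I : set (compile d (q + 2 + code_len c))")
   case True
   thus ?thesis
    using Branch.prems Branch.IH(2)[of I "q + 2 + code_len c"] by (simp add: ac_simps)
  next
   case F: False
   thus ?thesis using Branch.prems False by (auto simp: wf_instr_def)
  qed
 qed
next
 case (Loop k b c)
 thus ?case
 proof (cases "I : set (compile c (q + 1))")
  case True
  thus ?thesis
   using Loop wf_instr_mono[of "q + 1 + code_len c" I] by fastforce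
 next
  case False
  thus ?thesis using Loop.prems by (auto simp: wf_instr_def)
 qed
qed (auto simp: wf_instr_def)

lemma wf_machine:
 assumes "ALL I:set p. wf_instr (length p) I"
 shows "wf_tm (machine p)"
proof -
 have "case tm_delta (machine p) q ss of (q', acts) =>
      q' <= length p & length acts = 5 & fst ` set acts <= {..<5}"
  if "q < length p" "length ss = 5" "set ss <= {..<5}" for q ss
 proof -
  obtain k g where kg: "p ! q = (k, g)" by fastforce
  with assms that(1) have w: "wf_instr (length p) (k, g)" by (metis nth_mem)
  hence k: "k < 5" unfolding wf_instr_def by simp
  have ss: "!!i. i < 5 ==> ss ! i < 5" using that(2,3) by (metis lessThan_iff nth_mem subsetD)
  obtain a m q' where g: "g (ss ! k) = (a, m, q')" by (metis prod_cases3)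
  from w have "ALL a<5. fst (g a) < 5 & snd (snd (g a)) <= length p" by (simp add: wf_instr_def)
  from this[rule_format, OF ss[OF k]] g have "a < 5" "q' <= length p" by simp_all
  moreover have "fst ` set (map (%i. if i = k then (a, m) else (ss ! i, Stay)) [0..<5]) <= {..<5}"
   using ss \<open>a < 5\<close> by (auto simp del: upt_rec_numeral)
  ultimately show ?thesis by (simp add: machine_def kg g del: upt_rec_numeral)
 qed
 thus ?thesis unfolding wf_tm_def by (simp add: machine_def)
qed

lemma tape_act_read_Stay [simp]: "tape_act (tape_read t, Stay) t = t"
 by (cases t) simp

lemma machine_step:
 assumes "q < length p" "p ! q = (k, g)" "k < 5" "length ts = 5"
  "g (tape_read (ts ! k)) = (a, m, q')"
 shows "tm_step (machine p) (q, ts) = (q', ts[k := tape_act (a, m) (ts ! k)])"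
proof -
 have "map2 tape_act (map (%i. if i = k then (a, m) else (map tape_read ts ! i, Stay)) [0..<5]) ts
   = ts[k := tape_act (a, m) (ts ! k)]"
  by (rule nth_equalityI) (use assms in "auto simp: nth_list_update")
 thus ?thesis using assms by (simp add: machine_def)
qed

text \<open>Only the cells from the head to the right are fixed. \<open>Pop\<close> may therefore
  leave garbage on the left, which a later \<open>Push\<close> overwrites.\<close>

fun stack_rep :: "nat list => tm_tape => bool" where
 "stack_rep xs (c, h) \<longleftrightarrow> (ALL i. c (h + int i) = (if i < length xs then xs ! i else 0))"

fun output_rep :: "nat list => tm_tape => bool" where
 "output_rep xs (c, h) \<longleftrightarrow>
   h = int (length xs) & (ALL i. c (int i) = (if i < length xs then xs ! i else 0))"

definition store_rep :: "store => tm_tape list => bool" where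
 "store_rep s ts \<longleftrightarrow> length ts = 5 & (ALL k<4. stack_rep (s k) (ts ! k)) & output_rep (s 4) (ts ! 4)"

lemma stack_rep_top: "stack_rep xs t ==> tape_read t = top_sym xs"
 by (cases t; cases xs) (auto dest: spec[of _ 0])

lemma stack_rep_pop: "stack_rep xs t ==> stack_rep (tl xs) (tape_act (tape_read t, Move_Right) t)"
proof (cases t)
 case (Pair c h)
 assume a: "stack_rep xs t"
 have "c (h + 1 + int i) = (if i < length (tl xs) then tl xs ! i else 0)" for i
 proof -
  have "c (h + int (Suc i)) = (if Suc i < length xs then xs ! Suc i else 0)"
   using a Pair by (metis stack_rep.simps)
  thus ?thesis by (cases xs) (auto simp: ac_simps)
 qed
 thus ?thesis by (simp add: Pair)
qed

lemma stack_rep_push: "stack_rep xs t ==>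
 stack_rep (a # xs) (tape_act (a, Stay) (tape_act (tape_read t, Move_Left) t))"
proof (cases t)
 case (Pair c h)
 assume a: "stack_rep xs t"
 have "(c(h - 1 := a)) (h - 1 + int i) = (if i < length (a # xs) then (a # xs) ! i else 0)" for i
 proof (cases i)
  case (Suc j)
  have "c (h + int j) = (if j < length xs then xs ! j else 0)"
   using a Pair by (metis stack_rep.simps)
  thus ?thesis by (simp add: Suc)
 qed simp
 thus ?thesis by (simp add: Pair)
qed

lemma output_rep_emit: "output_rep xs t ==> output_rep (xs @ [a]) (tape_act (a, Move_Right) t)"
 by (cases t) (auto simp: nth_append less_Suc_eq)

definition code_at :: "instr list => nat => instr list => bool" where
 "code_at p q is \<longleftrightarrow> (EX a b. p = a @ is @ b & length a = q)"

lemma code_at_append: "code_at p q (is @ js) ==> code_at p q is & code_at p (q + length is) js"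
 unfolding code_at_def by (metis append.assoc length_append)

lemma code_at_Cons:
 assumes "code_at p q (i # js)"
 shows "q < length p & p ! q = i & code_at p (q + 1) js"
proof -
 from assms obtain a b where *: "p = a @ (i # js) @ b" "length a = q" by (auto simp: code_at_def)
 hence "p = (a @ [i]) @ js @ b" "length (a @ [i]) = q + 1" by auto
 hence "code_at p (q + 1) js" unfolding code_at_def by blast
 with * show ?thesis by auto
qed

definition reaches :: "instr list => nat \<times> tm_tape list => nat => nat \<times> tm_tape list => bool" where
 "reaches p C n C' \<longleftrightarrow> (EX t<=n. (tm_step (machine p) ^^ t) C = C')"

lemma reaches_trans: "reaches p C m C' ==> reaches p C' n C'' ==> reaches p C (m + n) C''"
proof -
 assume "reaches p C m C'" "reaches p C' n C''"
 then obtain t u where "t <= m" "u <= n" "(tm_step (machine p) ^^ t) C = C'"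
  "(tm_step (machine p) ^^ u) C' = C''" by (auto simp: reaches_def)
 hence "(tm_step (machine p) ^^ (u + t)) C = C''" "u + t <= m + n" by (auto simp: funpow_add)
 thus ?thesis unfolding reaches_def by blast
qed

lemma reaches_step: "tm_step (machine p) C = C' ==> reaches p C 1 C'"
 unfolding reaches_def by (rule exI[of _ 1]) simp

lemma reaches_mono: "reaches p C m C' ==> m <= n ==> reaches p C n C'"
 unfolding reaches_def using le_trans by blast

lemma store_rep_update:
 assumes "store_rep s ts" "k < 4" "stack_rep xs t"
 shows "store_rep (s(k := xs)) (ts[k := t])"
 using assms by (auto simp: store_rep_def nth_list_update)

lemma store_rep_read: "store_rep s ts ==> k < 4 ==> tape_read (ts ! k) = top_sym (s k)"
 by (simp add: store_rep_def stack_rep_top)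

lemma jump_step:
 assumes "code_at p q ((k, %x. (x, Stay, f x)) # js)" "store_rep s ts" "k < 4"
 shows "reaches p (q, ts) 1 (f (top_sym (s k)), ts)"
proof (rule reaches_step)
 have l: "length ts = 5" using assms(2) by (simp add: store_rep_def)
 have "tm_step (machine p) (q, ts) = (f (tape_read (ts ! k)),
   ts[k := tape_act (tape_read (ts ! k), Stay) (ts ! k)])"
  by (rule machine_step[where g = "%x. (x, Stay, f x)"])
   (use code_at_Cons[OF assms(1)] assms(3) l in auto)
 thus "tm_step (machine p) (q, ts) = (f (top_sym (s k)), ts)"
  using store_rep_read[OF assms(2,3)] by (metis list_update_id tape_act_read_Stay)
qed

text \<open>The final tapes are existentially quantified because a store does not determine the
  garbage on them. The induction follows the derivation of \<open>big\<close>, which unfolds the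
  iterations of loops.\<close>

lemma compile_correct:
 assumes "big c s n s'" "wf_cmd c" "code_at p q (compile c q)" "store_rep s ts"
 shows "EX ts'. reaches p (q, ts) n (q + code_len c, ts') & store_rep s' ts'"
 using assms
proof (induction arbitrary: q ts rule: big.induct)
 case (big_Push s' s k a)
 let ?t = "tape_act (tape_read (ts ! k), Move_Left) (ts ! k)"
 let ?t' = "tape_act (a, Stay) ?t"
 have l: "length ts = 5" and k: "k < 4" using big_Push by (simp_all add: store_rep_def)
 from big_Push.prems(2) have c1: "code_at p q ((k, %x. (x, Move_Left, q + 1)) # [(k, %x. (a, Stay, q + 2))])"
  by simp
 note c1' = code_at_Cons[OF c1]
 note c2' = code_at_Cons[OF conjunct2[OF conjunct2[OF c1']]]
 have s1: "tm_step (machine p) (q, ts) = (q + 1, ts[k := ?t])"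
  by (rule machine_step[where g = "%x. (x, Move_Left, q + 1)"]) (use c1' k l in auto)
 have s2: "tm_step (machine p) (q + 1, ts[k := ?t]) = (q + 2, (ts[k := ?t])[k := tape_act (a, Stay) (ts[k := ?t] ! k)])"
  by (rule machine_step[where g = "%x. (a, Stay, q + 2)"]) (use c2' k l in auto)
 hence s2': "tm_step (machine p) (q + 1, ts[k := ?t]) = (q + 2, ts[k := ?t'])" using k l by simp
 have "reaches p (q, ts) 2 (q + 2, ts[k := ?t'])"
  using reaches_trans[OF reaches_step[OF s1] reaches_step[OF s2']] by (simp add: numeral_2_eq_2)
 moreover have "store_rep s' (ts[k := ?t'])"
  unfolding big_Push.hyps using big_Push.prems(3) k
  by (intro store_rep_update stack_rep_push) (auto simp: store_rep_def)
 ultimately show ?case by auto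
next
 case (big_Pop s' s k)
 let ?t = "tape_act (tape_read (ts ! k), Move_Right) (ts ! k)"
 have l: "length ts = 5" and k: "k < 4" using big_Pop by (simp_all add: store_rep_def)
 from big_Pop.prems(2) have c1: "code_at p q [(k, %x. (x, Move_Right, q + 1))]" by simp
 have "tm_step (machine p) (q, ts) = (q + 1, ts[k := ?t])"
  by (rule machine_step[where g = "%x. (x, Move_Right, q + 1)"]) (use code_at_Cons[OF c1] k l in auto)
 moreover have "store_rep s' (ts[k := ?t])"
  unfolding big_Pop.hyps using big_Pop.prems(3) k
  by (intro store_rep_update stack_rep_pop) (auto simp: store_rep_def)
 ultimately show ?case using reaches_step by fastforce
next
 case (big_Emit s' s a)
 let ?t = "tape_act (a, Move_Right) (ts ! 4)"
 have l: "length ts = 5" using big_Emit by (simp add: store_rep_def)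
 from big_Emit.prems(2) have c1: "code_at p q [(4, %x. (a, Move_Right, q + 1))]" by simp
 have "tm_step (machine p) (q, ts) = (q + 1, ts[4 := ?t])"
  by (rule machine_step[where g = "%x. (a, Move_Right, q + 1)"]) (use code_at_Cons[OF c1] l in auto)
 moreover have "store_rep s' (ts[4 := ?t])"
  unfolding big_Emit.hyps using big_Emit.prems(3) l output_rep_emit
  by (auto simp: store_rep_def)
 ultimately show ?case using reaches_step by fastforce
next
 case (big_Skip s)
 thus ?case by (auto simp: reaches_def)
next
 case (big_Seq c s m s' d n s'')
 from big_Seq.prems have c: "code_at p q (compile c q)" "code_at p (q + code_len c) (compile d (q + code_len c))"
  using code_at_append by fastforce+
 from big_Seq.IH(1)[OF _ c(1)] big_Seq.prems obtain ts' where
  1: "reaches p (q, ts) m (q + code_len c, ts')" "store_rep s' ts'" by auto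
 from big_Seq.IH(2)[OF _ c(2) 1(2)] big_Seq.prems obtain ts'' where
  2: "reaches p (q + code_len c, ts') n (q + code_len c + code_len d, ts'')" "store_rep s'' ts''" by auto
 from reaches_trans[OF 1(1) 2(1)] 2(2) show ?case by (auto simp: ac_simps)
next
 case (big_Branch_True b s k c n s' d)
 from big_Branch_True.prems(2) have c0: "code_at p q ((k, %x. (x, Stay, if b x then q + 1 else q + 2 + code_len c)) # compile c (q + 1) @
   (k, %x. (x, Stay, q + 2 + code_len c + code_len d)) # compile d (q + 2 + code_len c))" by simp
 from code_at_Cons[OF c0] have c1: "code_at p (q + 1) (compile c (q + 1))"
  and c2: "code_at p (q + 1 + code_len c) ((k, %x. (x, Stay, q + 2 + code_len c + code_len d)) # compile d (q + 2 + code_len c))"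
  using code_at_append by fastforce+
 have k: "k < 4" using big_Branch_True by simp
 from jump_step[OF c0 big_Branch_True.prems(3) k] big_Branch_True.hyps(1)
 have 0: "reaches p (q, ts) 1 (q + 1, ts)" by simp
 from big_Branch_True.IH[OF _ c1 big_Branch_True.prems(3)] big_Branch_True.prems(1) obtain ts' where
  1: "reaches p (q + 1, ts) n (q + 1 + code_len c, ts')" "store_rep s' ts'" by auto
 have "reaches p (q, ts) (1 + n + 1) (q + 2 + code_len c + code_len d, ts')"
  by (rule reaches_trans[OF reaches_trans[OF 0 1(1)] jump_step[OF c2 1(2) k]])
 hence "reaches p (q, ts) (n + 2) (q + code_len (Branch k b c d), ts')" by (simp add: ac_simps)
 with 1(2) show ?case by blast
next
 case (big_Branch_False b s k d n s' c)
 from big_Branch_False.prems(2) have c0: "code_at p q ((k, %x. (x, Stay, if b x then q + 1 else q + 2 + code_len c)) # compile c (q + 1) @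
   (k, %x. (x, Stay, q + 2 + code_len c + code_len d)) # compile d (q + 2 + code_len c))" by simp
 have c2: "code_at p (q + 2 + code_len c) (compile d (q + 2 + code_len c))"
  using code_at_Cons[OF conjunct2[OF code_at_append[OF conjunct2[OF conjunct2[OF code_at_Cons[OF c0]]]]]]
  by (simp add: ac_simps)
 have k: "k < 4" using big_Branch_False by simp
 from jump_step[OF c0 big_Branch_False.prems(3) k] big_Branch_False.hyps(1)
 have 0: "reaches p (q, ts) 1 (q + 2 + code_len c, ts)" by simp
 from big_Branch_False.IH[OF _ c2 big_Branch_False.prems(3)] big_Branch_False.prems(1) obtain ts' where
  1: "reaches p (q + 2 + code_len c, ts) n (q + 2 + code_len c + code_len d, ts')" "store_rep s' ts'" by auto
 from reaches_mono[OF reaches_trans[OF 0 1(1)], of "n + 2"] 1(2)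
 show ?case by (auto simp: ac_simps)
next
 case (big_Loop_True b s k c m s' n s'')
 from big_Loop_True.prems(2) have c0: "code_at p q ((k, %x. (x, Stay, if b x then q + 1 else q + 2 + code_len c)) # compile c (q + 1) @
   [(k, %x. (x, Stay, q))])" by simp
 from code_at_Cons[OF c0] have c1: "code_at p (q + 1) (compile c (q + 1))"
  and c2: "code_at p (q + 1 + code_len c) [(k, %x. (x, Stay, q))]"
  using code_at_append by fastforce+
 have k: "k < 4" using big_Loop_True by simp
 from jump_step[OF c0 big_Loop_True.prems(3) k] big_Loop_True.hyps(1)
 have 0: "reaches p (q, ts) 1 (q + 1, ts)" by simp
 from big_Loop_True.IH(1)[OF _ c1 big_Loop_True.prems(3)] big_Loop_True.prems(1) obtain ts' where
  1: "reaches p (q + 1, ts) m (q + 1 + code_len c, ts')" "store_rep s' ts'" by auto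
 from jump_step[OF c2 1(2) k] have 2: "reaches p (q + 1 + code_len c, ts') 1 (q, ts')" .
 from big_Loop_True.IH(2)[OF big_Loop_True.prems(1,2) 1(2)] obtain ts'' where
  3: "reaches p (q, ts') n (q + code_len (Loop k b c), ts'')" "store_rep s'' ts''" by auto
 have "reaches p (q, ts) (m + n + 2) (q + code_len (Loop k b c), ts'')"
  by (rule reaches_mono[OF reaches_trans[OF reaches_trans[OF reaches_trans[OF 0 1(1)] 2] 3(1)]]) simp
 with 3(2) show ?case by blast
next
 case (big_Loop_False b s k c)
 from big_Loop_False.prems(2) have c0: "code_at p q ((k, %x. (x, Stay, if b x then q + 1 else q + 2 + code_len c)) # compile c (q + 1) @
   [(k, %x. (x, Stay, q))])" by simp
 have k: "k < 4" using big_Loop_False by simp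
 from jump_step[OF c0 big_Loop_False.prems(3) k] big_Loop_False.hyps(1) big_Loop_False.prems(3)
 show ?case by auto
next
 case (big_le c s m s' n)
 thus ?case using reaches_mono by blast
qed

definition initial_store :: "bool list => store" where
 "initial_store x = (%_. [])(0 := map bit_sym x)"

lemma stack_language_computes:
 assumes wf: "wf_cmd c"
  and run: "!!x. EX s'. big c (initial_store x) (T x) s' & s' 4 = map bit_sym (f x)"
  and T: "!!x. T x <= T' (length x)"
 shows "tm_computes_in_time (machine (compile c 0)) f T'"
 unfolding tm_computes_in_time_def
proof (intro conjI allI)
 show "wf_tm (machine (compile c 0))"
  using wf_compile[OF wf, of _ 0] by (auto intro!: wf_machine)
next
 fix x
 let ?p = "compile c 0"
 have ini: "store_rep (initial_store x) (tape_of x # replicate 4 (tape_of []))"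
 proof -
  have 1: "stack_rep (map bit_sym x) (tape_of x)" "stack_rep [] (tape_of [])" "output_rep [] (tape_of [])"
   by (auto simp: tape_of_def)
  show ?thesis
   unfolding store_rep_def initial_store_def
   using 1 by (auto simp: less_Suc_eq numeral_eq_Suc)
 qed
 have at: "code_at ?p 0 ?p" unfolding code_at_def by (metis append_Nil append_Nil2 list.size(3))
 obtain s' where s': "big c (initial_store x) (T x) s'" "s' 4 = map bit_sym (f x)" using run by blast
 from compile_correct[OF s'(1) wf at ini] obtain ts' where
  "reaches ?p (0, tape_of x # replicate 4 (tape_of [])) (T x) (code_len c, ts')" "store_rep s' ts'" by auto
 then obtain t where t: "t <= T x"
   "(tm_step (machine ?p) ^^ t) (0, tape_of x # replicate 4 (tape_of [])) = (code_len c, ts')"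
   and r: "store_rep s' ts'" unfolding reaches_def by blast
 have "last ts' = ts' ! 4" using r by (auto simp: store_rep_def last_conv_nth simp del: One_nat_def) (metis Suc_eq_numeral diff_Suc_1 length_0_conv last_conv_nth numeral_eq_Suc zero_neq_numeral pred_numeral_simps(3))
 moreover have "output_rep (map bit_sym (f x)) (ts' ! 4)" using r s'(2) by (simp add: store_rep_def)
 ultimately have o: "tape_output (last ts') (f x)" by (cases "ts' ! 4") auto
 have "tm_init (machine ?p) x = (0, tape_of x # replicate 4 (tape_of []))"
  by (simp add: tm_init_def machine_def)
 thus "EX t<=T' (length x). case (tm_step (machine ?p) ^^ t) (tm_init (machine ?p) x) of
     (q, ts) => q = tm_states (machine ?p) & tape_output (last ts) (f x)"
  using t o T[of x] by (intro exI[of _ t]) (auto simp: machine_def)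
qed

section \<open>Polynomially bounded functions\<close>

text \<open>The base \<open>n + 2\<close> is at least 2 even for \<open>n = 0\<close>, so constants,
  factors and summands are absorbed by raising the exponent.\<close>

definition poly_bounded :: "(nat => nat) => bool" where
 "poly_bounded p \<longleftrightarrow> (EX k. ALL n. p n <= (n + 2) ^ k)"

named_theorems pb_intros

lemma poly_bounded_le: "poly_bounded q ==> (!!n. p n <= q n) ==> poly_bounded p"
 unfolding poly_bounded_def by (meson le_trans)

lemma le_two_power: "n <= (2::nat) ^ n"
 by (simp add: less_imp_le_nat)

lemma poly_bounded_const [pb_intros]: "poly_bounded (%_. c)"
proof -
 have "c <= (n + 2) ^ c" for n
  using le_two_power[of c] power_mono[of 2 "n + 2" c] by linarith
 thus ?thesis unfolding poly_bounded_def by blast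
qed

lemma poly_bounded_id [pb_intros]: "poly_bounded (%n. n)"
 unfolding poly_bounded_def by (rule exI[of _ 1]) simp

lemma poly_bounded_mult [pb_intros]:
 assumes "poly_bounded p" "poly_bounded q"
 shows "poly_bounded (%n. p n * q n)"
proof -
 from assms obtain j k where "!!n. p n <= (n + 2) ^ j" "!!n. q n <= (n + 2) ^ k"
  unfolding poly_bounded_def by blast
 hence "p n * q n <= (n + 2) ^ (j + k)" for n
  by (simp add: power_add mult_le_mono)
 thus ?thesis unfolding poly_bounded_def by blast
qed

lemma poly_bounded_add [pb_intros]:
 assumes "poly_bounded p" "poly_bounded q"
 shows "poly_bounded (%n. p n + q n)"
proof -
 have "p n + q n <= (p n + 1) * (q n + 1)" for n by simp
 moreover have "poly_bounded (%n. (p n + 1) * (q n + 1))"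
 proof -
  from assms obtain j k where jk: "!!n. p n <= (n + 2) ^ j" "!!n. q n <= (n + 2) ^ k"
   unfolding poly_bounded_def by blast
  have "p n + 1 <= (n + 2) ^ (j + 1) & q n + 1 <= (n + 2) ^ (k + 1)" for n
  proof -
   have "(n + 2) ^ j + 1 <= (n + 2) ^ (j + 1)" "(n + 2) ^ k + 1 <= (n + 2) ^ (k + 1)"
    by (simp_all add: Suc_le_eq)
   with jk[of n] show ?thesis by linarith
  qed
  hence "poly_bounded (%n. p n + 1)" "poly_bounded (%n. q n + 1)"
   unfolding poly_bounded_def by blast+
  thus ?thesis by (rule poly_bounded_mult)
 qed
 ultimately show ?thesis by (intro poly_bounded_le[of "%n. (p n + 1) * (q n + 1)" "%n. p n + q n"])
qed

lemma poly_bounded_Suc [pb_intros]: "poly_bounded p ==> poly_bounded (%n. Suc (p n))"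
 using poly_bounded_add[OF _ poly_bounded_const[of 1]] by simp

lemma poly_bounded_power [pb_intros]: "poly_bounded p ==> poly_bounded (%n. p n ^ k)"
 by (induction k) (auto intro: pb_intros)

lemma poly_bounded_comp:
 assumes "poly_bounded p" "poly_bounded q"
 shows "poly_bounded (%n. p (q n))"
proof -
 from assms(1) obtain k where "!!n. p n <= (n + 2) ^ k" unfolding poly_bounded_def by blast
 moreover have "poly_bounded (%n. (q n + 2) ^ k)" by (intro pb_intros assms(2))
 ultimately show ?thesis using poly_bounded_le by meson
qed

text \<open>The monotone majorant allows bounds to be weakened inside their argument.\<close>

lemma poly_bounded_mono_majorant:
 assumes "poly_bounded p"
 obtains q :: "nat => nat" where "poly_bounded q" "mono q" "!!n. p n <= q n" "!!n. n <= q n"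
proof -
 from assms obtain k where k: "!!n. p n <= (n + 2) ^ k" unfolding poly_bounded_def by blast
 show ?thesis
 proof (rule that[of "%n. (n + 2) ^ k + n"])
  show "poly_bounded (%n. (n + 2) ^ k + n)" by (intro pb_intros)
  show "mono (%n :: nat. (n + 2) ^ k + n)" by (intro monoI add_mono power_mono) auto
  show "p n <= (n + 2) ^ k + n" for n using k[of n] by simp
 qed simp
qed

section \<open>Binary trees as data\<close>

datatype tree = Lf | Nd tree tree

text \<open>Preorder is a prefix code: a program finds the end of its argument without a separator,
  and several arguments can lie on one stack.\<close>

primrec tree_word :: "tree => nat list" where
 "tree_word Lf = [1]"
| "tree_word (Nd a b) = 2 # tree_word a @ tree_word b"

lemma set_tree_word: "set (tree_word t) <= {1, 2}"
 by (induction t) auto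

lemma length_tree_word_pos: "1 <= length (tree_word t)"
 by (cases t) auto

definition store4 :: "nat list => nat list => nat list => nat list => nat list => store" where
 "store4 a b c d e = (%k. if k = 0 then a else if k = 1 then b else if k = 2 then c
   else if k = 3 then d else if k = 4 then e else [])"

abbreviation base :: "nat list => store" where
 "base a \<equiv> store4 a [] [] [] []"

lemma store4_simps [simp]:
 "store4 a b c d e 0 = a" "store4 a b c d e (Suc 0) = b" "store4 a b c d e 2 = c" "store4 a b c d e 3 = d"
 "store4 a b c d e 4 = e"
 by (simp_all add: store4_def)

lemma store4_update [simp]:
 "(store4 a b c d e)(0 := x) = store4 x b c d e"
 "(store4 a b c d e)(Suc 0 := x) = store4 a x c d e"
 "(store4 a b c d e)(2 := x) = store4 a b x d e"
 "(store4 a b c d e)(3 := x) = store4 a b c x e"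
 "(store4 a b c d e)(4 := x) = store4 a b c d x"
 by (auto simp: store4_def)

definition nonblank :: "nat => bool" where
 "nonblank a \<longleftrightarrow> a ~= 0"

lemma big_eq: "big c s m s' ==> s = t ==> s' = t' ==> m <= n ==> big c t n t'"
 using big_le by blast

lemma big_Loop_exit: "~ b (top_sym (s k)) ==> s = s' ==> 1 <= n ==> big (Loop k b c) s n s'"
 using big_le[OF big_Loop_False] by blast

definition copy_sym :: "bool => bool => nat => cmd" where
 "copy_sym p q a = Seq (if p then Push 1 a else Skip) (if q then Push 2 a else Skip)"

definition move_body :: "bool => bool => cmd" where
 "move_body p q = Seq (Pop 3) (Branch 0 (%a. a = 2)
   (Seq (Push 3 1) (Seq (Push 3 1) (Seq (Pop 0) (copy_sym p q 2))))
   (Seq (Pop 0) (copy_sym p q 1)))"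

text \<open>Removes a tree from stack 0 and appends its reversal to stacks 1 and 2 as selected; stack 3
 counts the subtrees still to be read.\<close>

definition move_tree :: "bool => bool => cmd" where
 "move_tree p q = Seq (Push 3 1) (Loop 3 nonblank (move_body p q))"

lemma copy_sym_run:
 "big (copy_sym p q a) (store4 s b c d e) 4
   (store4 s (if p then a # b else b) (if q then a # c else c) d e)"
proof -
 have 1: "big (if p then Push 1 a else Skip) (store4 s b c d e) 2 (store4 s (if p then a # b else b) c d e)"
  by (auto intro: big_Push big_le[OF big_Skip])
 have 2: "big (if q then Push 2 a else Skip) (store4 s b' c d e) 2 (store4 s b' (if q then a # c else c) d e)" for b'
  by (auto intro: big_Push big_le[OF big_Skip])
 show ?thesis unfolding copy_sym_def using big_Seq[OF 1 2] by simp
qed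

lemma move_body_run_Nd:
 "big (move_body p q) (store4 (2 # s) b c (1 # d) e) 20
   (store4 s (if p then 2 # b else b) (if q then 2 # c else c) (1 # 1 # d) e)"
proof -
 have 3: "big (Pop 3) (store4 (2 # s) b c (1 # d) e) 1 (store4 (2 # s) b c d e)" by (rule big_Pop) simp
 have a: "big (Push 3 1) (store4 (2 # s) b c d e) 2 (store4 (2 # s) b c (1 # d) e)" for d
  by (rule big_Push) simp
 have b: "big (Pop 0) (store4 (2 # s) b c d e) 1 (store4 s b c d e)" for d by (rule big_Pop) simp
 show ?thesis unfolding move_body_def
  by (rule big_le, rule big_Seq[OF 3], rule big_Branch_True)
   (simp, rule big_Seq[OF a], rule big_Seq[OF a], rule big_Seq[OF b], rule copy_sym_run, simp)
qed

lemma move_body_run_Lf: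
 "big (move_body p q) (store4 (1 # s) b c (1 # d) e) 20
   (store4 s (if p then 1 # b else b) (if q then 1 # c else c) d e)"
proof -
 have 3: "big (Pop 3) (store4 (1 # s) b c (1 # d) e) 1 (store4 (1 # s) b c d e)" by (rule big_Pop) simp
 have b: "big (Pop 0) (store4 (1 # s) b c d e) 1 (store4 s b c d e)" for d by (rule big_Pop) simp
 show ?thesis unfolding move_body_def
  by (rule big_le, rule big_Seq[OF 3], rule big_Branch_False)
   (simp, rule big_Seq[OF b], rule copy_sym_run, simp)
qed

text \<open>Reading an inner node replaces one pending tree by two smaller ones. Hence the statement
  is about a forest, with one mark on stack 3 for each tree, and the induction is on the total
  length of its code.\<close>

lemma move_loop_run:
 "big (Loop 3 nonblank (move_body p q))
   (store4 (concat (map tree_word ts) @ r) b c (replicate (length ts) 1) e)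
   (22 * length (concat (map tree_word ts)) + 1)
   (store4 r (if p then rev (concat (map tree_word ts)) @ b else b)
    (if q then rev (concat (map tree_word ts)) @ c else c) [] e)"
proof (induction "length (concat (map tree_word ts))" arbitrary: ts b c rule: less_induct)
 case less
 show ?case
 proof (cases ts)
  case Nil
  thus ?thesis by (intro big_Loop_exit) (simp_all add: nonblank_def)
 next
  case (Cons t us)
  let ?L = "Loop 3 nonblank (move_body p q)"
  show ?thesis
  proof (cases t)
   case Lf
   let ?b = "if p then 1 # b else b" and ?c = "if q then 1 # c else c"
   have eq: "store4 (concat (map tree_word ts) @ r) b c (replicate (length ts) 1) e =
    store4 (1 # (concat (map tree_word us) @ r)) b c (1 # replicate (length us) 1) e"
    by (simp add: Cons Lf)
   have "big ?L (store4 (concat (map tree_word us) @ r) ?b ?c (replicate (length us) 1) e)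
    (22 * length (concat (map tree_word us)) + 1)
    (store4 r (if p then rev (concat (map tree_word us)) @ ?b else ?b)
     (if q then rev (concat (map tree_word us)) @ ?c else ?c) [] e)"
    by (rule less) (simp add: Cons Lf)
   from big_Loop_True[OF _ move_body_run_Lf this]
   show ?thesis unfolding eq by (rule big_eq) (simp_all add: Cons Lf nonblank_def)
  next
   case (Nd x y)
   let ?b = "if p then 2 # b else b" and ?c = "if q then 2 # c else c"
   have eq: "store4 (concat (map tree_word ts) @ r) b c (replicate (length ts) 1) e =
    store4 (2 # (concat (map tree_word (x # y # us)) @ r)) b c (1 # replicate (length us) 1) e"
    by (simp add: Cons Nd)
   have "big ?L (store4 (concat (map tree_word (x # y # us)) @ r) ?b ?c (replicate (length (x # y # us)) 1) e)
    (22 * length (concat (map tree_word (x # y # us))) + 1)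
    (store4 r (if p then rev (concat (map tree_word (x # y # us))) @ ?b else ?b)
     (if q then rev (concat (map tree_word (x # y # us))) @ ?c else ?c) [] e)"
    by (rule less) (simp add: Cons Nd)
   hence "big ?L (store4 (concat (map tree_word (x # y # us)) @ r) ?b ?c (1 # 1 # replicate (length us) 1) e)
    (22 * length (concat (map tree_word (x # y # us))) + 1)
    (store4 r (if p then rev (concat (map tree_word (x # y # us))) @ ?b else ?b)
     (if q then rev (concat (map tree_word (x # y # us))) @ ?c else ?c) [] e)" by simp
   from big_Loop_True[OF _ move_body_run_Nd this]
   show ?thesis unfolding eq by (rule big_eq) (simp_all add: Cons Nd nonblank_def)
  qed
 qed
qed

lemma move_tree_run:
 "big (move_tree p q) (store4 (tree_word t @ r) b c [] e) (22 * length (tree_word t) + 3)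
   (store4 r (if p then rev (tree_word t) @ b else b) (if q then rev (tree_word t) @ c else c) [] e)"
proof -
 have "big (Push 3 1) (store4 (tree_word t @ r) b c [] e) 2 (store4 (tree_word t @ r) b c [1] e)"
  by (rule big_Push) simp
 moreover have "big (Loop 3 nonblank (move_body p q)) (store4 (tree_word t @ r) b c [1] e)
   (22 * length (tree_word t) + 1)
   (store4 r (if p then rev (tree_word t) @ b else b) (if q then rev (tree_word t) @ c else c) [] e)"
 proof -
  have 1: "concat (map tree_word [t]) = tree_word t" by simp
  show ?thesis using move_loop_run[of p q "[t]" r b c e, unfolded 1] by (rule big_eq) simp_all
 qed
 ultimately have "big (move_tree p q) (store4 (tree_word t @ r) b c [] e) (2 + (22 * length (tree_word t) + 1))
   (store4 r (if p then rev (tree_word t) @ b else b) (if q then rev (tree_word t) @ c else c) [] e)"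
  unfolding move_tree_def by (rule big_Seq)
 thus ?thesis by (rule big_le) simp
qed

definition flush :: "nat => cmd" where
 "flush k = Loop k nonblank (Seq (Branch k (%a. a = 2) (Push 0 2) (Push 0 1)) (Pop k))"

lemma flush1_run:
 "set b <= {1, 2} ==> big (flush 1) (store4 a b c d e) (10 * length b + 1) (store4 (rev b @ a) [] c d e)"
proof (induction b arbitrary: a)
 case Nil
 thus ?case unfolding flush_def by (intro big_Loop_exit) (simp_all add: nonblank_def)
next
 case (Cons x b)
 have 1: "big (Branch 1 (%a. a = 2) (Push 0 2) (Push 0 1)) (store4 a (x # b) c d e) 4 (store4 (x # a) (x # b) c d e)"
 proof (cases "x = 2")
  case True
  thus ?thesis by (intro big_le[OF big_Branch_True[OF _ big_Push]]) simp_all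
 next
  case False
  with Cons.prems have "x = 1" by simp
  thus ?thesis by (intro big_le[OF big_Branch_False[OF _ big_Push]]) simp_all
 qed
 have 2: "big (Pop 1) (store4 (x # a) (x # b) c d e) 1 (store4 (x # a) b c d e)" by (rule big_Pop) simp
 have "x ~= 0" using Cons.prems by auto
 hence t: "nonblank (top_sym (store4 a (x # b) c d e 1))" by (simp add: nonblank_def)
 have "set b <= {1, 2}" using Cons.prems by simp
 from big_Loop_True[of nonblank, OF t big_Seq[OF 1 2] Cons.IH[OF this, of "x # a", unfolded flush_def]]
 show ?case unfolding flush_def by (rule big_eq) simp_all
qed

lemma flush2_run:
 "set c <= {1, 2} ==> big (flush 2) (store4 a b c d e) (10 * length c + 1) (store4 (rev c @ a) b [] d e)"
proof (induction c arbitrary: a)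
 case Nil
 thus ?case unfolding flush_def by (intro big_Loop_exit) (simp_all add: nonblank_def)
next
 case (Cons x c)
 have 1: "big (Branch 2 (%a. a = 2) (Push 0 2) (Push 0 1)) (store4 a b (x # c) d e) 4 (store4 (x # a) b (x # c) d e)"
 proof (cases "x = 2")
  case True
  thus ?thesis by (intro big_le[OF big_Branch_True[OF _ big_Push]]) simp_all
 next
  case False
  with Cons.prems have "x = 1" by simp
  thus ?thesis by (intro big_le[OF big_Branch_False[OF _ big_Push]]) simp_all
 qed
 have 2: "big (Pop 2) (store4 (x # a) b (x # c) d e) 1 (store4 (x # a) b c d e)" by (rule big_Pop) simp
 have "x ~= 0" using Cons.prems by auto
 hence t: "nonblank (top_sym (store4 a b (x # c) d e 2))" by (simp add: nonblank_def)
 have "set c <= {1, 2}" using Cons.prems by simp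
 from big_Loop_True[of nonblank, OF t big_Seq[OF 1 2] Cons.IH[OF this, of "x # a", unfolded flush_def]]
 show ?case unfolding flush_def by (rule big_eq) simp_all
qed

definition drop_tree :: cmd where
 "drop_tree = move_tree False False"

definition dup_tree :: cmd where
 "dup_tree = Seq (move_tree True True) (Seq (flush 1) (flush 2))"

definition swap_trees :: cmd where
 "swap_trees = Seq (move_tree True False) (Seq (move_tree False True) (Seq (flush 1) (flush 2)))"

lemma wf_tree_cmds [simp]: "wf_cmd drop_tree" "wf_cmd dup_tree" "wf_cmd swap_trees"
 by (simp_all add: drop_tree_def dup_tree_def swap_trees_def move_tree_def move_body_def
   copy_sym_def flush_def)

lemma drop_tree_run:
 "big drop_tree (base (tree_word t @ r)) (50 * length (tree_word t)) (base r)"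
 unfolding drop_tree_def using length_tree_word_pos[of t]
 by (intro big_le[OF move_tree_run[of False False, simplified]]) simp

lemma dup_tree_run:
 "big dup_tree (base (tree_word t @ r)) (50 * length (tree_word t)) (base (tree_word t @ tree_word t @ r))"
proof -
 have s: "set (rev (tree_word t)) <= {1, 2}" using set_tree_word by simp
 from big_Seq[OF move_tree_run[of True True t r "[]" "[]" "[]", simplified]
   big_Seq[OF flush1_run[OF s] flush2_run[OF s]]]
 show ?thesis unfolding dup_tree_def by (rule big_eq) (use length_tree_word_pos[of t] in simp_all)
qed

lemma swap_trees_run:
 "big swap_trees (base (tree_word t @ tree_word u @ r)) (50 * (length (tree_word t) + length (tree_word u)))
   (base (tree_word u @ tree_word t @ r))"
proof -
 have s: "set (rev (tree_word t)) <= {1, 2}" "set (rev (tree_word u)) <= {1, 2}" using set_tree_word by simp_all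
 from big_Seq[OF move_tree_run[of True False t "tree_word u @ r" "[]" "[]" "[]", simplified]
   big_Seq[OF move_tree_run[of False True u r "rev (tree_word t)" "[]" "[]", simplified]
   big_Seq[OF flush1_run[OF s(1)] flush2_run[OF s(2)]]]]
 show ?thesis unfolding swap_trees_def by (rule big_eq) (use length_tree_word_pos[of t] in simp_all)
qed

primrec push_word :: "nat list => cmd" where
 "push_word [] = Skip"
| "push_word (a # w) = Seq (push_word w) (Push 0 a)"

lemma push_word_run: "big (push_word w) (base r) (2 * length w) (base (w @ r))"
proof (induction w)
 case (Cons a w)
 have "big (Push 0 a) (base (w @ r)) 2 (base (a # w @ r))" by (rule big_Push) simp
 from big_Seq[OF Cons this] show ?case unfolding push_word.simps by (rule big_eq) simp_all
qed (auto intro: big_Skip)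

lemma wf_push_word: "set w <= {1, 2} ==> wf_cmd (push_word w)"
 by (induction w) auto

section \<open>Functions computed by stack programs\<close>

class tcoded =
 fixes tcode :: "'a => tree"
 assumes inj_tcode: "inj tcode"

lemma tcode_eq_iff [simp]: "tcode x = tcode y \<longleftrightarrow> x = y"
 using inj_tcode by (auto dest: injD)

abbreviation word :: "'a::tcoded => nat list" where
 "word x \<equiv> tree_word (tcode x)"

definition csize :: "'a::tcoded => nat" where
 "csize x = length (word x)"

lemma csize_pos: "0 < csize x"
 using length_tree_word_pos[of "tcode x"] unfolding csize_def by linarith

instantiation unit :: tcoded begin
definition tcode_unit :: "unit => tree" where "tcode_unit u = Lf"
instance by standard (auto simp: inj_def)
end

instantiation bool :: tcoded begin
definition tcode_bool :: "bool => tree" where "tcode_bool b = (if b then Nd Lf Lf else Lf)"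
instance by standard (auto simp: inj_def tcode_bool_def split: if_splits)
end

instantiation prod :: (tcoded, tcoded) tcoded begin
fun tcode_prod :: "'a \<times> 'b => tree" where "tcode_prod (a, b) = Nd (tcode a) (tcode b)"
instance by standard (auto simp: inj_def)
end

instantiation list :: (tcoded) tcoded begin
primrec tcode_list :: "'a list => tree" where
 "tcode_list [] = Lf"
| "tcode_list (x # xs) = Nd (tcode x) (tcode_list xs)"
instance proof
 have "tcode x = tcode y ==> x = y" for x y :: "'a list"
 proof (induction x arbitrary: y)
  case Nil thus ?case by (cases y) auto
 next
  case (Cons a x) thus ?case by (cases y) auto
 qed
 thus "inj (tcode :: 'a list => tree)" by (rule injI)
qed
end

text \<open>Numbers are unary, so the size of a number is linear in its value. This is what lets a
  polynomial-time program with an exponential argument express exponential time.\<close>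

instantiation nat :: tcoded begin
primrec tcode_nat :: "nat => tree" where
 "tcode_nat 0 = Lf"
| "tcode_nat (Suc n) = Nd Lf (tcode_nat n)"
instance proof
 have "tcode x = tcode y ==> x = y" for x y :: nat
 proof (induction x arbitrary: y)
  case 0 thus ?case by (cases y) auto
 next
  case (Suc x) thus ?case by (cases y) auto
 qed
 thus "inj (tcode :: nat => tree)" by (rule injI)
qed
end

lemma csize_simps:
 "csize (u::unit) = 1" "csize False = 1" "csize True = 3" "csize (a, b) = 1 + csize a + csize b"
 "csize ([] :: 'c::tcoded list) = 1" "csize (x # xs) = 1 + csize x + csize xs" "csize n = 2 * n + 1"
 for a :: "'a::tcoded" and b :: "'b::tcoded" and x :: "'c::tcoded"
proof -
 show "csize n = 2 * n + 1" for n :: nat by (induction n) (auto simp: csize_def)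
qed (auto simp: csize_def tcode_unit_def tcode_bool_def)

text \<open>The rest \<open>r\<close> of the stack is arbitrary, so a program can run as a
  subroutine while further arguments lie below its own.\<close>

definition program_for :: "cmd => ('a::tcoded => 'b::tcoded) => ('a => nat) => bool" where
 "program_for c f T \<longleftrightarrow> wf_cmd c & (ALL x r. big c (base (word x @ r)) (T x) (base (word (f x) @ r)))"

definition computes :: "('a::tcoded => 'b::tcoded) => ('a => nat) => bool" where
 "computes f T \<longleftrightarrow> (EX c. program_for c f T)"

lemma computes_mono: "computes f T ==> (!!x. T x <= T' x) ==> computes f T'"
 unfolding computes_def program_for_def using big_le by blast

lemma computes_csize: "computes f T ==> csize (f x) <= csize x + T x"
proof -
 assume "computes f T"
 then obtain c where "!!x r. big c (base (word x @ r)) (T x) (base (word (f x) @ r))"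
  by (auto simp: computes_def program_for_def)
 from big_stack0_length[OF this[of x "[]"]] show ?thesis by (simp add: csize_def)
qed

text \<open>Types share codes: \<open>x # xs\<close> is coded like \<open>(x, xs)\<close>,
  \<open>Suc n\<close> like \<open>((), n)\<close>, and a list of units like its length. Passing
  from one type to another along such an identity costs no time.\<close>

lemma computes_cast:
 assumes "computes f T" "!!x. tcode (f x) = tcode (g x)"
 shows "computes g T"
 using assms by (simp add: program_for_def computes_def)

lemma computes_id: "computes (%x. x) (%_. 0)"
 unfolding computes_def program_for_def by (rule exI[of _ Skip]) (auto intro: big_Skip)

lemma program_comp:
 "program_for c f T ==> program_for d g U ==> program_for (Seq c d) (%x. g (f x)) (%x. T x + U (f x))"
 unfolding program_for_def wf_cmd.simps using big_Seq by metis

lemma computes_comp: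
 "computes f T ==> computes g U ==> computes (%x. g (f x)) (%x. T x + U (f x))"
 unfolding computes_def using program_comp by blast

lemma computes_const: "computes (%_. u) (%x. 50 * csize x + 2 * csize u)"
 unfolding computes_def program_for_def
proof (intro exI[of _ "Seq drop_tree (push_word (word u))"] conjI allI)
 show "big (Seq drop_tree (push_word (word u))) (base (word x @ r)) (50 * csize x + 2 * csize u)
      (base (word u @ r))" for x :: 'a and r
  unfolding csize_def by (rule big_Seq[OF drop_tree_run push_word_run])
qed (simp add: wf_push_word[OF set_tree_word])

lemma Pop0_run: "big (Pop 0) (base (a # r)) 1 (base r)"
 by (rule big_Pop) simp

lemma Push0_run: "big (Push 0 a) (base r) 2 (base (a # r))"
 by (rule big_Push) simp

lemma computes_snd: "computes snd (%x :: 'a::tcoded \<times> 'b::tcoded. 50 * csize x)"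
 unfolding computes_def program_for_def
proof (intro exI[of _ "Seq (Pop 0) drop_tree"] conjI allI)
 fix x :: "'a \<times> 'b" and r
 obtain a b where x: "x = (a, b)" by fastforce
 show "big (Seq (Pop 0) drop_tree) (base (word x @ r)) (50 * csize x) (base (word (snd x) @ r))"
  using big_Seq[OF Pop0_run drop_tree_run[of "tcode a" "word b @ r"], of 2]
  by (rule big_eq) (simp_all add: x csize_def)
qed simp

lemma computes_fst: "computes fst (%x :: 'a::tcoded \<times> 'b::tcoded. 100 * csize x)"
 unfolding computes_def program_for_def
proof (intro exI[of _ "Seq (Pop 0) (Seq swap_trees drop_tree)"] conjI allI)
 fix x :: "'a \<times> 'b" and r
 obtain a b where x: "x = (a, b)" by fastforce
 show "big (Seq (Pop 0) (Seq swap_trees drop_tree)) (base (word x @ r)) (100 * csize x) (base (word (fst x) @ r))"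
  using big_Seq[OF Pop0_run big_Seq[OF swap_trees_run[of "tcode a" "tcode b" r] drop_tree_run], of 2]
  by (rule big_eq) (simp_all add: x csize_def)
qed simp

lemma computes_pair:
 assumes "computes f T" "computes g U"
 shows "computes (%x. (f x, g x)) (%x. T x + U x + 50 * (2 * csize x + csize (g x)) + 2)"
proof -
 from assms obtain c d where c: "program_for c f T" and d: "program_for d g U"
  by (auto simp: computes_def)
 have "program_for (Seq dup_tree (Seq d (Seq swap_trees (Seq c (Push 0 2))))) (%x. (f x, g x))
   (%x. T x + U x + 50 * (2 * csize x + csize (g x)) + 2)"
  unfolding program_for_def
 proof (intro conjI allI)
  fix x r
  have "big d (base (word x @ word x @ r)) (U x) (base (word (g x) @ word x @ r))"
   "big c (base (word x @ word (g x) @ r)) (T x) (base (word (f x) @ word (g x) @ r))"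
   using c d by (simp_all add: program_for_def)
  from big_Seq[OF dup_tree_run big_Seq[OF this(1) big_Seq[OF swap_trees_run big_Seq[OF this(2) Push0_run[of 2]]]]]
  show "big (Seq dup_tree (Seq d (Seq swap_trees (Seq c (Push 0 2))))) (base (word x @ r))
    (T x + U x + 50 * (2 * csize x + csize (g x)) + 2) (base (word (f x, g x) @ r))"
   by (rule big_eq) (simp_all add: csize_def)
 qed (use c d in "simp_all add: program_for_def")
 thus ?thesis unfolding computes_def by blast
qed

lemma top_sym_word: "top_sym (tree_word t @ r) = (if t = Lf then 1 else 2)"
 by (cases t) auto

lemma computes_if_shape:
 assumes "computes s S" "computes f T" "computes g U"
 shows "computes (%x. if tcode (s x) ~= Lf then f x else g x)
   (%x. S x + T x + U x + 50 * (csize x + csize (s x)) + 2)"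
proof -
 from assms obtain b c d where b: "program_for b s S" and c: "program_for c f T" and d: "program_for d g U"
  by (auto simp: computes_def)
 let ?p = "Seq dup_tree (Seq b (Branch 0 (%a. a = 2) (Seq drop_tree c) (Seq drop_tree d)))"
 have "program_for ?p (%x. if tcode (s x) ~= Lf then f x else g x)
   (%x. S x + T x + U x + 50 * (csize x + csize (s x)) + 2)"
  unfolding program_for_def
 proof (intro conjI allI)
  fix x r
  have B: "big b (base (word x @ word x @ r)) (S x) (base (word (s x) @ word x @ r))"
   using b by (simp_all add: program_for_def)
  have C: "big (Seq drop_tree c) (base (word (s x) @ word x @ r)) (50 * csize (s x) + T x) (base (word (f x) @ r))"
   unfolding csize_def by (rule big_Seq[OF drop_tree_run]) (use c in "simp add: program_for_def")
  have D: "big (Seq drop_tree d) (base (word (s x) @ word x @ r)) (50 * csize (s x) + U x) (base (word (g x) @ r))"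
   unfolding csize_def by (rule big_Seq[OF drop_tree_run]) (use d in "simp add: program_for_def")
  have E: "big (Branch 0 (%a. a = 2) (Seq drop_tree c) (Seq drop_tree d)) (base (word (s x) @ word x @ r))
   (50 * csize (s x) + T x + U x + 2) (base (word (if tcode (s x) ~= Lf then f x else g x) @ r))"
  proof (cases "tcode (s x) = Lf")
   case True
   show ?thesis by (rule big_le[OF big_Branch_False]) (use True D in "auto simp: top_sym_word")
  next
   case False
   show ?thesis by (rule big_le[OF big_Branch_True]) (use False C in "auto simp: top_sym_word")
  qed
  show "big ?p (base (word x @ r)) (S x + T x + U x + 50 * (csize x + csize (s x)) + 2)
    (base (word (if tcode (s x) ~= Lf then f x else g x) @ r))"
   by (rule big_le[OF big_Seq[OF dup_tree_run big_Seq[OF B E]]]) (simp add: csize_def)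
 qed (use b c d in "simp_all add: program_for_def")
 thus ?thesis unfolding computes_def by blast
qed

text \<open>A nonempty list has the same code as the pair of its head and tail, so a program for \<open>g\<close>
 can be run on it directly.\<close>

lemma computes_case_shape:
 assumes "computes l S" "computes f T" "computes g U" "computes (%x. (x, l x)) V"
  and some: "!!x. tcode (l x) ~= Lf ==> tcode (l x) = tcode (p x)"
 shows "computes (%x. if tcode (l x) ~= Lf then g (x, p x) else f x)
   (%x. S x + T x + (if tcode (l x) ~= Lf then U (x, p x) + V x else 0) + 50 * (csize x + csize (l x)) + 2)"
proof -
 from assms(1-4) obtain b c d e where b: "program_for b l S" and c: "program_for c f T"
  and d: "program_for d g U" and e: "program_for e (%x. (x, l x)) V"
  by (auto simp: computes_def)
 let ?p = "Seq dup_tree (Seq b (Branch 0 (%a. a = 2) (Seq drop_tree (Seq e d)) (Seq drop_tree c)))"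
 let ?T = "%x. S x + T x + (if tcode (l x) ~= Lf then U (x, p x) + V x else 0) + 50 * (csize x + csize (l x)) + 2"
 have "program_for ?p (%x. if tcode (l x) ~= Lf then g (x, p x) else f x) ?T"
  unfolding program_for_def
 proof (intro conjI allI)
  fix x r
  have B: "big b (base (word x @ word x @ r)) (S x) (base (word (l x) @ word x @ r))"
   using b by (simp_all add: program_for_def)
  have C: "big (Seq drop_tree c) (base (word (l x) @ word x @ r)) (50 * csize (l x) + T x) (base (word (f x) @ r))"
   unfolding csize_def by (rule big_Seq[OF drop_tree_run]) (use c in "simp add: program_for_def")
  show "big ?p (base (word x @ r)) (?T x) (base (word (if tcode (l x) ~= Lf then g (x, p x) else f x) @ r))"
  proof (cases "tcode (l x) = Lf")
   case True
   have "big (Branch 0 (%a. a = 2) (Seq drop_tree (Seq e d)) (Seq drop_tree c)) (base (word (l x) @ word x @ r))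
   (50 * csize (l x) + T x + 2) (base (word (f x) @ r))"
    by (rule big_Branch_False[OF _ C]) (simp add: top_sym_word True)
   from big_Seq[OF dup_tree_run big_Seq[OF B this]] show ?thesis
    by (rule big_eq) (use True in "simp_all add: csize_def")
  next
   case False
   have E: "big e (base (word x @ r)) (V x) (base (word (x, p x) @ r))"
   proof -
    have "word (x, p x) = word (x, l x)" using some[OF False] by simp
    thus ?thesis using e unfolding program_for_def by metis
   qed
   have D: "big d (base (word (x, p x) @ r)) (U (x, p x)) (base (word (g (x, p x)) @ r))"
    using d by (simp add: program_for_def)
   have "big (Branch 0 (%a. a = 2) (Seq drop_tree (Seq e d)) (Seq drop_tree c)) (base (word (l x) @ word x @ r))
   (50 * csize (l x) + (V x + U (x, p x)) + 2) (base (word (g (x, p x)) @ r))"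
    unfolding csize_def
    by (rule big_Branch_True[OF _ big_Seq[OF drop_tree_run big_Seq[OF E D]]]) (simp add: top_sym_word False)
   from big_Seq[OF dup_tree_run big_Seq[OF B this]] show ?thesis
    by (rule big_eq) (use False in "simp_all add: csize_def")
  qed
 qed (use b c d e in "simp_all add: program_for_def")
 thus ?thesis unfolding computes_def by blast
qed

text \<open>The list lies on top of the pair of parameter and accumulator. One more symbol 2 in
  front makes all of this the code of a single pair, the argument of the body, and is removed
  afterwards. The symbol 1 left at the end is the code of the exhausted list.\<close>

lemma fold_loop_run:
 assumes c: "program_for c (%((x, xs), (z, a)). (xs, (z, F z x a))) U"
 shows "big (Loop 0 (%a. a = 2) (Seq (Push 0 2) (Seq c (Pop 0)))) (base (word xs @ word (z, a) @ r))
   ((\<Sum>i<length xs. U ((xs ! i, drop (Suc i) xs), (z, fold (F z) (take i xs) a)) + 5) + 1)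
   (base (1 # word (z, fold (F z) xs a) @ r))"
proof (induction xs arbitrary: a)
 case Nil
 thus ?case by (intro big_Loop_exit) (simp_all add: nonblank_def)
next
 case (Cons x xs)
 have 1: "big (Push 0 2) (base (word (x # xs) @ word (z, a) @ r)) 2 (base (2 # word (x # xs) @ word (z, a) @ r))"
  by (rule Push0_run)
 have 2: "big c (base (2 # word (x # xs) @ word (z, a) @ r)) (U ((x, xs), (z, a)))
   (base (2 # word xs @ word (z, F z x a) @ r))"
  using c[unfolded program_for_def, THEN conjunct2, rule_format, of "((x, xs), (z, a))" r] by simp
 have 3: "big (Pop 0) (base (2 # word xs @ word (z, F z x a) @ r)) 1 (base (word xs @ word (z, F z x a) @ r))"
  by (rule Pop0_run)
 have t: "top_sym (base (word (x # xs) @ word (z, a) @ r) 0) = 2" by simp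
 from big_Loop_True[of "%a. a = 2", OF t big_Seq[OF 1 big_Seq[OF 2 3]] Cons.IH]
 show ?case
  by (rule big_eq) (simp_all add: sum.lessThan_Suc_shift del: sum.lessThan_Suc)
qed

text \<open>The parameter \<open>z\<close> travels along with the accumulator because programs have
  no enclosing variables. The time remains a sum over the intermediate accumulators; their sizes can
  be estimated only where more is known about \<open>F\<close>.\<close>

lemma computes_fold:
 assumes "computes (%z. (l z, (z, i z))) S" "computes (%((x, xs), (z, a)). (xs, (z, F z x a))) U"
 shows "EX V. computes (%z. fold (F z) (l z) (i z)) V & (ALL z. V z = S z +
  (\<Sum>j<length (l z). U ((l z ! j, drop (Suc j) (l z)), (z, fold (F z) (take j (l z)) (i z))) + 5) + 4
    + 100 * (csize (z, fold (F z) (l z) (i z)) + 5))"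
proof -
 from assms obtain b c where b: "program_for b (%z. (l z, (z, i z))) S"
  and c: "program_for c (%((x, xs), (z, a)). (xs, (z, F z x a))) U" by (auto simp: computes_def)
 let ?p = "Seq b (Seq (Pop 0) (Seq (Loop 0 (%a. a = 2) (Seq (Push 0 2) (Seq c (Pop 0)))) (Pop 0)))"
 let ?U = "%z. S z + (\<Sum>j<length (l z). U ((l z ! j, drop (Suc j) (l z)), (z, fold (F z) (take j (l z)) (i z))) + 5) + 4"
 have "program_for ?p (%z. (z, fold (F z) (l z) (i z))) ?U"
  unfolding program_for_def
 proof (intro conjI allI)
  fix z r
  have B: "big b (base (word z @ r)) (S z) (base (2 # word (l z) @ word (z, i z) @ r))"
   using b[unfolded program_for_def, THEN conjunct2, rule_format, of z r] by simp
  show "big ?p (base (word z @ r)) (?U z) (base (word (z, fold (F z) (l z) (i z)) @ r))"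
   by (rule big_le[OF big_Seq[OF B big_Seq[OF Pop0_run big_Seq[OF fold_loop_run[OF c] Pop0_run]]]]) simp
 qed (use b c in "simp_all add: program_for_def")
 hence p: "computes (%z. (z, fold (F z) (l z) (i z))) ?U" unfolding computes_def by blast
 let ?V = "%z. ?U z + 50 * csize (z, fold (F z) (l z) (i z))"
 have V: "computes (%z. fold (F z) (l z) (i z)) ?V"
  using computes_comp[OF p computes_snd] by simp
 show ?thesis
  by (intro exI conjI, rule computes_mono[OF V, of "%z. S z +
  (\<Sum>j<length (l z). U ((l z ! j, drop (Suc j) (l z)), (z, fold (F z) (take j (l z)) (i z))) + 5) + 4
    + 100 * (csize (z, fold (F z) (l z) (i z)) + 5)"]) auto
qed

section \<open>Polynomial-time functions on coded data\<close>

definition feasible :: "('a::tcoded => 'b::tcoded) => bool" where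
 "feasible f \<longleftrightarrow> (EX T p. computes f T & poly_bounded p & (ALL x. T x <= p (csize x)))"

lemma feasibleI: "computes f T ==> poly_bounded p ==> (!!x. T x <= p (csize x)) ==> feasible f"
 unfolding feasible_def by blast

text \<open>One monotone polynomial bounds both the time and the size of the result. Monotonicity is
  what composition needs, where the second program is run on an argument whose size is only
  estimated.\<close>

lemma feasibleE:
 assumes "feasible f"
 obtains T p where "computes f T" "poly_bounded p" "mono p" "!!x. T x <= p (csize x)"
  "!!x. csize (f x) <= p (csize x)"
proof -
 from assms obtain T q where f: "computes f T" "poly_bounded q" "!!x. T x <= q (csize x)"
  by (auto simp: feasible_def)
 have "poly_bounded (%n. n + q n)" by (intro pb_intros f)
 then obtain r where r: "poly_bounded r" "mono r" "!!n. n + q n <= r n" "!!n. n <= r n"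
  using poly_bounded_mono_majorant by metis
 show ?thesis
 proof (rule that[OF f(1) r(1,2)])
  show "T x <= r (csize x)" for x using f(3)[of x] r(3)[of "csize x"] by linarith
  show "csize (f x) <= r (csize x)" for x
   using computes_csize[OF f(1), of x] f(3)[of x] r(3)[of "csize x"] by linarith
 qed
qed

named_theorems feas

lemma feasible_id [feas]: "feasible (%x. x)"
 using feasibleI[OF computes_id poly_bounded_const[of 0]] by simp

lemma feasible_const [feas]: "feasible (%_. c)"
 by (rule feasibleI[OF computes_const, of "%n. 50 * n + 2 * csize c"])
  (auto intro!: pb_intros)

lemma feasible_comp:
 assumes "feasible g" "feasible f"
 shows "feasible (%x. g (f x))"
proof -
 obtain T p where f: "computes f T" "poly_bounded p" "!!x. T x <= p (csize x)" "!!x. csize (f x) <= p (csize x)"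
  using feasibleE[OF assms(2)] by metis
 obtain U q where g: "computes g U" "poly_bounded q" "mono q" "!!x. U x <= q (csize x)"
  using feasibleE[OF assms(1)] by metis
 show ?thesis
 proof (rule feasibleI[OF computes_comp[OF f(1) g(1)]])
  show "poly_bounded (%n. p n + q (p n))"
   by (intro poly_bounded_add f poly_bounded_comp[OF g(2)])
  show "T x + U (f x) <= p (csize x) + q (p (csize x))" for x
   using f(3)[of x] g(4)[of "f x"] monoD[OF g(3) f(4)[of x]] by linarith
 qed
qed

lemma feasible_fst [feas]: "feasible f ==> feasible (%x. fst (f x))"
 by (rule feasible_comp, rule feasibleI[OF computes_fst, of "%n. 100 * n"])
  (auto intro!: pb_intros)

lemma feasible_snd [feas]: "feasible f ==> feasible (%x. snd (f x))"
 by (rule feasible_comp, rule feasibleI[OF computes_snd, of "%n. 50 * n"])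
  (auto intro!: pb_intros)

lemma feasible_pair [feas]:
 assumes "feasible f" "feasible g"
 shows "feasible (%x. (f x, g x))"
proof -
 obtain T p where f: "computes f T" "poly_bounded p" "!!x. T x <= p (csize x)"
  using feasibleE[OF assms(1)] by metis
 obtain U q where g: "computes g U" "poly_bounded q" "!!x. U x <= q (csize x)" "!!x. csize (g x) <= q (csize x)"
  using feasibleE[OF assms(2)] by metis
 show ?thesis
 proof (rule feasibleI[OF computes_pair[OF f(1) g(1)]])
  show "poly_bounded (%n. p n + q n + 50 * (2 * n + q n) + 2)"
   by (intro pb_intros f g)
  show "T x + U x + 50 * (2 * csize x + csize (g x)) + 2
    <= p (csize x) + q (csize x) + 50 * (2 * csize x + q (csize x)) + 2" for x
   using f(3)[of x] g(3,4)[of x] by simp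
 qed
qed

lemma feasible_cast:
 assumes "feasible f" "!!x. tcode (f x) = tcode (g x)"
 shows "feasible g"
 using assms computes_cast unfolding feasible_def by blast

lemma feasible_if [feas]:
 assumes "feasible b" "feasible f" "feasible g"
 shows "feasible (%x. if b x then f x else g x)"
proof -
 obtain S s where b: "computes b S" "poly_bounded s" "!!x. S x <= s (csize x)" "!!x. csize (b x) <= s (csize x)"
  using feasibleE[OF assms(1)] by metis
 obtain T p where f: "computes f T" "poly_bounded p" "!!x. T x <= p (csize x)"
  using feasibleE[OF assms(2)] by metis
 obtain U q where g: "computes g U" "poly_bounded q" "!!x. U x <= q (csize x)"
  using feasibleE[OF assms(3)] by metis
 have "feasible (%x. if tcode (b x) ~= Lf then f x else g x)"
 proof (rule feasibleI[OF computes_if_shape[OF b(1) f(1) g(1)]])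
  show "poly_bounded (%n. s n + p n + q n + 50 * (n + s n) + 2)"
   by (intro pb_intros b f g)
  show "S x + T x + U x + 50 * (csize x + csize (b x)) + 2
    <= s (csize x) + p (csize x) + q (csize x) + 50 * (csize x + s (csize x)) + 2" for x
   using f(3)[of x] g(3)[of x] b(3,4)[of x] by simp
 qed
 moreover have "tcode y ~= Lf \<longleftrightarrow> y" for y by (simp add: tcode_bool_def)
 ultimately show ?thesis by simp
qed

lemma feasible_case_shape:
 assumes "feasible l" "feasible f" "feasible g"
  and some: "!!x. tcode (l x) ~= Lf ==> tcode (l x) = tcode (h x)"
 shows "feasible (%x. if tcode (l x) ~= Lf then g (x, h x) else f x)"
proof -
 obtain S s where l: "computes l S" "poly_bounded s" "!!x. S x <= s (csize x)" "!!x. csize (l x) <= s (csize x)"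
  using feasibleE[OF assms(1)] by metis
 obtain T p where f: "computes f T" "poly_bounded p" "!!x. T x <= p (csize x)"
  using feasibleE[OF assms(2)] by metis
 obtain U q where g: "computes g U" "poly_bounded q" "mono q" "!!x. U x <= q (csize x)"
  using feasibleE[OF assms(3)] by metis
 obtain V r where v: "computes (%x. (x, l x)) V" "poly_bounded r" "!!x. V x <= r (csize x)"
  "!!x. csize (x, l x) <= r (csize x)"
  using feasibleE[OF feasible_pair[OF feasible_id assms(1)]] by metis
 show ?thesis
 proof (rule feasibleI[OF computes_case_shape[OF l(1) f(1) g(1) v(1) some]])
  show "poly_bounded (%n. s n + p n + (q (r n) + r n) + 50 * (n + s n) + 2)"
   by (intro pb_intros poly_bounded_comp[OF g(2)] l f g v)
  fix x
  have "U (x, h x) + V x <= q (r (csize x)) + r (csize x)" if "tcode (l x) ~= Lf"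
  proof -
   have "csize (x, h x) = csize (x, l x)" using some[OF that] by (simp add: csize_def)
   hence "q (csize (x, h x)) <= q (r (csize x))" using monoD[OF g(3)] v(4)[of x] by metis
   thus ?thesis using g(4)[of "(x, h x)"] v(3)[of x] by linarith
  qed
  thus "S x + T x + (if tcode (l x) ~= Lf then U (x, h x) + V x else 0) + 50 * (csize x + csize (l x)) + 2
   <= s (csize x) + p (csize x) + (q (r (csize x)) + r (csize x)) + 50 * (csize x + s (csize x)) + 2"
   using f(3)[of x] l(3,4)[of x] by (cases "tcode (l x) = Lf") auto
 qed
qed

lemma feasible_case_list [feas]:
 assumes "feasible l" "feasible f" "feasible (%p. g (fst p) (fst (snd p)) (snd (snd p)))"
 shows "feasible (%x. case l x of [] => f x | y # ys => g x y ys)"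
proof -
 have "feasible (%x. if tcode (l x) ~= Lf
   then (%p. g (fst p) (fst (snd p)) (snd (snd p))) (x, (hd (l x), tl (l x))) else f x)"
  by (rule feasible_case_shape[OF assms]) (auto split: list.split simp: neq_Nil_conv elim: list.exhaust,
   case_tac "l x", auto)
 moreover have "(%x. case l x of [] => f x | y # ys => g x y ys) = (%x. if tcode (l x) ~= Lf
   then (%p. g (fst p) (fst (snd p)) (snd (snd p))) (x, (hd (l x), tl (l x))) else f x)"
  by (rule ext) (simp split: list.split)
 ultimately show ?thesis by simp
qed

lemma feasible_case_nat [feas]:
 assumes "feasible l" "feasible f" "feasible (%p. g (fst p) (snd p))"
 shows "feasible (%x. case l x of 0 => f x | Suc n => g x n)"
proof -
 have "feasible (%p :: _ \<times> unit \<times> nat. (fst p, snd (snd p)))" by (intro feas)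
 from feasible_comp[OF assms(3) this]
 have "feasible (%p :: _ \<times> unit \<times> nat. g (fst p) (snd (snd p)))" by simp
 hence "feasible (%x. if tcode (l x) ~= Lf
   then (%p :: _ \<times> unit \<times> nat. g (fst p) (snd (snd p))) (x, ((), l x - 1)) else f x)"
 proof (rule feasible_case_shape[OF assms(1,2)])
  show "tcode (l x) ~= Lf ==> tcode (l x) = tcode ((), l x - 1)" for x
   by (cases "l x") (auto simp: tcode_unit_def)
 qed
 moreover have "(%x. case l x of 0 => f x | Suc n => g x n) = (%x. if tcode (l x) ~= Lf
   then (%p :: _ \<times> unit \<times> nat. g (fst p) (snd (snd p))) (x, ((), l x - 1)) else f x)"
  by (rule ext) (simp split: nat.split)
 ultimately show ?thesis by simp
qed

lemma feasible_case_prod [feas]: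
 "feasible (%x. f x (fst (g x)) (snd (g x))) ==> feasible (%x. case g x of (a, b) => f x a b)"
 by (simp add: case_prod_beta)

lemma feasible_let [feas]:
 "feasible g ==> feasible (%p. f (fst p) (snd p)) ==> feasible (%x. let y = g x in f x y)"
 using feasible_comp[OF _ feasible_pair[OF feasible_id], of "%p. f (fst p) (snd p)" g] by (simp add: Let_def)

abbreviation "feasible2 f \<equiv> feasible (%p. f (fst p) (snd p))"

text \<open>Functions of several arguments are shown feasible on tuples. Composition with feasible
  argument functions turns such a fact into a rule that resolves with goals in any context of bound
  variables, which makes the collection \<open>feas\<close> syntax directed.\<close>

lemma feasible_comp2:
 assumes "feasible2 f" "feasible a" "feasible b"
 shows "feasible (%x. f (a x) (b x))"
 using feasible_comp[OF assms(1) feasible_pair[OF assms(2,3)]] by simp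

abbreviation "feasible3 f \<equiv> feasible (%p. f (fst p) (fst (snd p)) (snd (snd p)))"

lemma feasible_comp3:
 assumes "feasible3 f" "feasible a" "feasible b" "feasible c"
 shows "feasible (%x. f (a x) (b x) (c x))"
 using feasible_comp[OF assms(1) feasible_pair[OF assms(2) feasible_pair[OF assms(3,4)]]] by simp

abbreviation "feasible4 f \<equiv> feasible (%p. f (fst p) (fst (snd p)) (fst (snd (snd p))) (snd (snd (snd p))))"

lemma feasible_comp4:
 assumes "feasible4 f"
  "feasible a" "feasible b" "feasible c" "feasible d"
 shows "feasible (%x. f (a x) (b x) (c x) (d x))"
 using feasible_comp[OF assms(1) feasible_pair[OF assms(2) feasible_pair[OF assms(3) feasible_pair[OF assms(4,5)]]]]
 by simp

lemma feasible_Cons [feas]: "feasible f ==> feasible g ==> feasible (%x. f x # g x)"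
 by (rule feasible_cast[OF feasible_pair]) auto

lemma feasible_Suc [feas]: "feasible f ==> feasible (%x. Suc (f x))"
 by (rule feasible_cast[OF feasible_pair[OF feasible_const[of "()"]]]) (auto simp: tcode_unit_def)

text \<open>A fold over a list of units is a loop with a prescribed number of rounds.\<close>

lemma feasible_units [feas]: "feasible f ==> feasible (%x. replicate (f x) ())"
proof (rule feasible_cast)
 show "tcode n = tcode (replicate n ())" for n by (induction n) (auto simp: tcode_unit_def)
qed

lemma length_le_csize: "length xs <= csize xs"
 by (induction xs) (auto simp: csize_simps)

lemma csize_member: "x : set xs ==> csize x < csize xs"
 by (induction xs) (auto simp: csize_simps)

lemma csize_append: "csize (xs @ ys) + 1 = csize xs + csize ys"
 by (induction xs) (auto simp: csize_simps)

lemma csize_drop_nth: "j < length xs ==> csize (drop j xs) = 1 + csize (xs ! j) + csize (drop (Suc j) xs)"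
 by (simp add: Cons_nth_drop_Suc[symmetric] csize_simps)

lemma csize_drop: "csize (drop j xs) <= csize xs"
 using csize_append[of "take j xs" "drop j xs"] csize_pos[of "take j xs"] by simp

text \<open>A polynomial-time step is not enough, as a step that doubles the accumulator yields
  exponential data. Therefore all intermediate accumulators have to be polynomially bounded.\<close>

lemma feasible_fold:
 fixes F :: "'z::tcoded => 'x::tcoded => 'a::tcoded => 'a"
 assumes F: "feasible (%p. F (fst p) (fst (snd p)) (snd (snd p)))" and l: "feasible l" and i: "feasible i"
  and q: "poly_bounded q" "!!z n. csize (fold (F z) (take n (l z)) (i z)) <= q (csize z)"
 shows "feasible (%z. fold (F z) (l z) (i z))"
proof -
 have fF: "feasible (%((x, xs :: 'x list), (z, a)). (xs, (z, F z x a)))"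
  unfolding case_prod_beta
  by (intro feas feasible_comp3[OF F])
 obtain U u where u: "computes (%((x, xs :: 'x list), (z, a)). (xs, (z, F z x a))) U" "poly_bounded u" "mono u"
  "!!x. U x <= u (csize x)" by (rule feasibleE[OF fF]) blast
 have fI: "feasible (%z. (l z, (z, i z)))" by (intro feas l i)
 obtain S s where s: "computes (%z. (l z, (z, i z))) S" "poly_bounded s" "!!x. S x <= s (csize x)"
  by (rule feasibleE[OF fI]) blast
 obtain T t where t: "poly_bounded t" "!!x. csize (l x) <= t (csize x)"
  using feasibleE[OF l] by metis
 from computes_fold[OF s(1) u(1)] obtain V where V: "computes (%z. fold (F z) (l z) (i z)) V"
  "!!z. V z = S z + (\<Sum>j<length (l z). U ((l z ! j, drop (Suc j) (l z)), (z, fold (F z) (take j (l z)) (i z))) + 5) + 4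
    + 100 * (csize (z, fold (F z) (l z) (i z)) + 5)" by blast
 let ?u = "%n. u (3 + t n + n + q n)"
 show ?thesis
 proof (rule feasibleI[OF V(1)])
  show "poly_bounded (%n. s n + t n * (?u n + 5) + 4 + 100 * (1 + n + q n + 5))"
   by (intro pb_intros s t q poly_bounded_comp[OF u(2)])
  fix z
  have "U ((l z ! j, drop (Suc j) (l z)), (z, fold (F z) (take j (l z)) (i z))) <= ?u (csize z)"
   if j: "j < length (l z)" for j
  proof -
   have "csize ((l z ! j, drop (Suc j) (l z)), (z, fold (F z) (take j (l z)) (i z)))
    <= 3 + t (csize z) + csize z + q (csize z)"
    using csize_drop_nth[OF j] csize_drop[of j "l z"] t(2)[of z] q(2)[where z = z and n = j] by (simp add: csize_simps)
   from monoD[OF u(3) this] u(4) show ?thesis using le_trans by blast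
  qed
  hence "(\<Sum>j<length (l z). U ((l z ! j, drop (Suc j) (l z)), (z, fold (F z) (take j (l z)) (i z))) + 5)
   <= (\<Sum>j<length (l z). ?u (csize z) + 5)" by (intro sum_mono) simp
  also have "... <= t (csize z) * (?u (csize z) + 5)"
   using length_le_csize[of "l z"] t(2)[of z] by (simp add: mult_le_mono)
  finally show "V z <= s (csize z) + t (csize z) * (?u (csize z) + 5) + 4 + 100 * (1 + csize z + q (csize z) + 5)"
   using s(3)[of z] q(2)[where z = z and n = "length (l z)"] unfolding V(2) by (simp add: csize_simps)
 qed
qed

lemma fold_invariant:
 assumes "P a" "!!x a. x : set xs ==> P a ==> P (f x a)"
 shows "P (fold f xs a)"
 using assms by (induction xs arbitrary: a) auto

text \<open>The usual way to control accumulators: each round adds an amount that depends only on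
  the size of the parameter \<open>z\<close>. The invariant is for steps whose growth is bounded
  only on the accumulators that actually occur.\<close>

lemma feasible_fold_inv:
 assumes F: "feasible (%p. F (fst p) (fst (snd p)) (snd (snd p)))" and l: "feasible l" and i: "feasible i"
  and r: "poly_bounded r" and I: "!!z. I z (i z)"
  and step: "!!z x a. x : set (l z) ==> I z a ==> I z (F z x a) & csize (F z x a) <= csize a + r (csize z)"
 shows "feasible (%z. fold (F z) (l z) (i z))"
proof -
 obtain S s where s: "poly_bounded s" "!!x. csize (i x) <= s (csize x)" using feasibleE[OF i] by metis
 obtain T t where t: "poly_bounded t" "!!x. csize (l x) <= t (csize x)" using feasibleE[OF l] by metis
 show ?thesis
 proof (rule feasible_fold[OF F l i])
  show "poly_bounded (%n. s n + t n * r n)" by (intro pb_intros s t r)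
  fix z n
  have "I z (fold (F z) xs a) & csize (fold (F z) xs a) <= csize a + length xs * r (csize z)"
   if "set xs <= set (l z)" "I z a" for xs a
   using that
  proof (induction xs arbitrary: a)
   case (Cons x xs)
   from Cons.prems step[of x z a] have "I z (F z x a)" "csize (F z x a) <= csize a + r (csize z)" by auto
   with Cons.IH[OF _ this(1)] Cons.prems show ?case by auto
  qed auto
  from this[OF set_take_subset I[of z], of n]
  have "csize (fold (F z) (take n (l z)) (i z)) <= csize (i z) + length (take n (l z)) * r (csize z)" by simp
  also have "... <= s (csize z) + t (csize z) * r (csize z)"
   using s(2)[of z] t(2)[of z] length_le_csize[of "l z"] by (intro add_mono mult_le_mono) auto
  finally show "csize (fold (F z) (take n (l z)) (i z)) <= s (csize z) + t (csize z) * r (csize z)" .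
 qed
qed

lemmas feasible_fold_additive = feasible_fold_inv[where I = "%_ _. True", simplified]

lemma csize_member_bound:
 assumes "feasible l"
 obtains t where "poly_bounded t" "mono t" "!!z x. x : set (l z) ==> csize x <= t (csize z)"
  "!!z. csize (l z) <= t (csize z)"
proof -
 obtain T t where t: "poly_bounded t" "mono t" "!!x. csize (l x) <= t (csize x)" using feasibleE[OF assms] by metis
 moreover have "x : set (l z) ==> csize x <= t (csize z)" for x z using csize_member[of x "l z"] t(3)[of z] by linarith
 ultimately show ?thesis using that by blast
qed

section \<open>Closure under operations on lists, truth values and numbers\<close>

lemma feasible_rev [feas]:
 assumes l: "feasible l"
 shows "feasible (%x. rev (l x))"
proof -
 obtain t where t: "poly_bounded t" "!!z x. x : set (l z) ==> csize x <= t (csize z)"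
  using csize_member_bound[OF l] by metis
 have "feasible (%z. fold (%x a. x # a) (l z) [])"
 proof (rule feasible_fold_additive[where r = "%n. t n + 1"])
  show "csize (x # a) <= csize a + (t (csize z) + 1)" if "x : set (l z)" for z x and a :: "'b list"
   using t(2)[OF that] by (simp add: csize_simps)
 qed (intro feas pb_intros l t(1))+
 thus ?thesis by (simp add: rev_conv_fold)
qed

lemma feasible_append [feas]:
 assumes l: "feasible l" and m: "feasible m"
 shows "feasible (%x. l x @ m x)"
proof -
 obtain t where t: "poly_bounded t" "!!z x. x : set (l z) ==> csize x <= t (csize z)"
  using csize_member_bound[OF l] by metis
 have "feasible (%z. fold (%x a. x # a) (rev (l z)) (m z))"
 proof (rule feasible_fold_additive[where r = "%n. t n + 1"])
  show "csize (x # a) <= csize a + (t (csize z) + 1)" if "x : set (rev (l z))" for z x and a :: "'b list"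
   using t(2)[of x z] that by (simp add: csize_simps)
 qed (intro feas pb_intros l m t(1))+
 moreover have "fold (%x a. x # a) (rev xs) ys = xs @ ys" for xs ys :: "'b list"
  by (induction xs) auto
 ultimately show ?thesis by simp
qed

lemma feasible_map [feas]:
 assumes F: "feasible (%p. f (fst p) (snd p))" and l: "feasible l"
 shows "feasible (%x. map (f x) (l x))"
proof -
 obtain t where t: "poly_bounded t" "!!z x. x : set (l z) ==> csize x <= t (csize z)"
  using csize_member_bound[OF l] by metis
 obtain u where u: "poly_bounded u" "mono u" "!!p. csize (f (fst p) (snd p)) <= u (csize p)"
  using feasibleE[OF F] by metis
 have "feasible (%z. fold (%x a. f z x # a) (l z) [])"
 proof (rule feasible_fold_additive[where r = "%n. u (1 + n + t n) + 1"])
  show "poly_bounded (%n. u (1 + n + t n) + 1)" by (intro pb_intros t poly_bounded_comp[OF u(1)])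
  show "csize (f z x # a) <= csize a + (u (1 + csize z + t (csize z)) + 1)" if "x : set (l z)" for z x a
  proof -
   have "csize (z, x) <= 1 + csize z + t (csize z)" using t(2)[OF that] by (simp add: csize_simps)
   from monoD[OF u(2) this] u(3)[of "(z, x)"] show ?thesis by (simp add: csize_simps)
  qed
 qed (intro feas feasible_comp2[OF F] l)+
 moreover have "rev (fold (%x a. g x # a) xs ys) = rev ys @ map g xs" for g :: "'b => 'c" and xs ys
  by (induction xs arbitrary: ys) auto
 ultimately show ?thesis using feasible_rev by fastforce
qed

lemma feasible_filter [feas]:
 assumes F: "feasible (%p. f (fst p) (snd p))" and l: "feasible l"
 shows "feasible (%x. filter (f x) (l x))"
proof -
 obtain t where t: "poly_bounded t" "!!z x. x : set (l z) ==> csize x <= t (csize z)"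
  using csize_member_bound[OF l] by metis
 have "feasible (%z. fold (%x a. if f z x then x # a else a) (l z) [])"
 proof (rule feasible_fold_additive[where r = "%n. t n + 1"])
  show "csize (if f z x then x # a else a) <= csize a + (t (csize z) + 1)" if "x : set (l z)" for z x and a :: "'b list"
   using t(2)[OF that] by (simp add: csize_simps)
 qed (intro feas pb_intros l t(1) feasible_comp2[OF F])+
 moreover have "rev (fold (%x a. if g x then x # a else a) xs ys) = rev ys @ filter g xs" for g :: "'b => bool" and xs ys
  by (induction xs arbitrary: ys) auto
 ultimately show ?thesis using feasible_rev by fastforce
qed

lemma feasible_concat [feas]:
 assumes l: "feasible l"
 shows "feasible (%x. concat (l x))"
proof -
 obtain t where t: "poly_bounded t" "!!z x. x : set (l z) ==> csize x <= t (csize z)"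
  using csize_member_bound[OF l] by metis
 have "feasible (%z. fold (%x a. a @ x) (l z) [])"
 proof (rule feasible_fold_additive[where r = t])
  show "csize (a @ x) <= csize a + t (csize z)" if "x : set (l z)" for z x and a :: "'b list"
   using t(2)[OF that] csize_append[of a x] by linarith
 qed (intro feas l t(1))+
 moreover have "fold (%x a. a @ x) xs ys = ys @ concat xs" for xs and ys :: "'b list"
  by (induction xs arbitrary: ys) auto
 ultimately show ?thesis by simp
qed

lemma feasible_length [feas]:
 assumes l: "feasible l"
 shows "feasible (%x. length (l x))"
proof -
 have "feasible (%z. fold (%x a. Suc a) (l z) 0)"
  by (rule feasible_fold_additive[where r = "%n. 2"])
   (intro feas pb_intros l | simp add: csize_simps)+
 moreover have "fold (%x a. Suc a) xs k = k + length xs" for xs :: "'b list" and k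
  by (induction xs arbitrary: k) auto
 ultimately show ?thesis by simp
qed

lemma feasible_conj [feas]: "feasible f ==> feasible g ==> feasible (%x. f x & g x)"
proof -
 assume "feasible f" "feasible g"
 hence "feasible (%x. if f x then g x else False)" by (intro feasible_if feasible_const)
 moreover have "(%x. if f x then g x else False) = (%x. f x & g x)" by auto
 ultimately show ?thesis by simp
qed

lemma feasible_disj [feas]: "feasible f ==> feasible g ==> feasible (%x. f x | g x)"
proof -
 assume "feasible f" "feasible g"
 hence "feasible (%x. if f x then True else g x)" by (intro feasible_if feasible_const)
 moreover have "(%x. if f x then True else g x) = (%x. f x | g x)" by auto
 ultimately show ?thesis by simp
qed

lemma feasible_not [feas]: "feasible f ==> feasible (%x. ~ f x)"
proof -
 assume "feasible f"
 hence "feasible (%x. if f x then False else True)" by (intro feasible_if feasible_const)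
 moreover have "(%x. if f x then False else True) = (%x. ~ f x)" by auto
 ultimately show ?thesis by simp
qed

lemma feasible_imp [feas]: "feasible f ==> feasible g ==> feasible (%x. f x --> g x)"
 unfolding imp_conv_disj by (intro feasible_disj feasible_not)

lemma feasible_list_ex [feas]:
 assumes F: "feasible (%p. f (fst p) (snd p))" and l: "feasible l"
 shows "feasible (%x. list_ex (f x) (l x))"
proof -
 have "feasible (%x. case filter (f x) (l x) of [] => False | _ # _ => True)"
  by (intro feas F l)
 moreover have "(case filter g xs of [] => False | _ # _ => True) = list_ex g xs" for g :: "'b => bool" and xs
  by (induction xs) auto
 ultimately show ?thesis by simp
qed

lemma feasible_list_all [feas]:
 assumes F: "feasible (%p. f (fst p) (snd p))" and l: "feasible l"
 shows "feasible (%x. list_all (f x) (l x))"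
proof -
 have "feasible (%x. ~ list_ex (%y. ~ f x y) (l x))"
  by (intro feas F l)
 moreover have "(~ list_ex (%y. ~ g y) xs) = list_all g xs" for g :: "'b => bool" and xs
  by (induction xs) auto
 ultimately show ?thesis by simp
qed

lemma csize_tl: "csize (tl xs) <= csize xs"
 by (cases xs) (auto simp: csize_simps)

lemma feasible_tl [feas]: "feasible l ==> feasible (%x. tl (l x))"
 unfolding tl_def by (intro feas)

lemma feasible_drop [feas]:
 assumes n: "feasible n" and l: "feasible l"
 shows "feasible (%x. drop (n x) (l x))"
proof -
 have "feasible (%z. fold (%x a. tl a) (replicate (n z) ()) (l z))"
  by (rule feasible_fold_additive[where r = "%n. 0"])
   (intro feas pb_intros n l | simp add: csize_tl)+
 moreover have "fold (%x a. tl a) (replicate k ()) xs = drop k xs" for xs :: "'b list" and k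
  by (induction k arbitrary: xs) (auto simp: drop_Suc)
 ultimately show ?thesis by simp
qed

lemma feasible_pred [feas]: "feasible n ==> feasible (%x. n x - 1 :: nat)"
proof -
 assume "feasible n"
 hence "feasible (%x. case n x of 0 => 0 | Suc m => m)" by (intro feas)
 moreover have "(case n x of 0 => 0 | Suc m => m) = n x - 1" for x by (simp split: nat.split)
 ultimately show ?thesis by simp
qed

lemma feasible_minus [feas]:
 assumes m: "feasible m" and n: "feasible n"
 shows "feasible (%x. m x - n x :: nat)"
proof -
 have "feasible (%x. length (drop (n x) (replicate (m x) ())))" by (intro feas m n)
 thus ?thesis by simp
qed

lemma feasible_plus [feas]:
 assumes m: "feasible m" and n: "feasible n"
 shows "feasible (%x. m x + n x :: nat)"
proof -
 have "feasible (%x. length (replicate (m x) () @ replicate (n x) ()))" by (intro feas m n)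
 thus ?thesis by simp
qed

lemma feasible_times [feas]:
 assumes m: "feasible m" and n: "feasible n"
 shows "feasible (%x. m x * n x :: nat)"
proof -
 have "feasible (%x. length (concat (map (%_. replicate (n x) ()) (replicate (m x) ()))))"
  by (intro feas m n feasible_comp[OF n])
 thus ?thesis by (simp add: length_concat comp_def sum_list_replicate)
qed

lemma feasible_power [feas]: "feasible m ==> feasible (%x. m x ^ k :: nat)"
 by (induction k) (simp_all add: feasible_const feasible_times)

lemma feasible_eq_0: "feasible n ==> feasible (%x. n x = (0::nat))"
proof -
 assume "feasible n"
 hence "feasible (%x. case n x of 0 => True | Suc _ => False)" by (intro feas)
 moreover have "(case n x of 0 => True | Suc _ => False) = (n x = 0)" for x by (simp split: nat.split)
 ultimately show ?thesis by simp
qed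

lemma feasible_le [feas]:
 assumes m: "feasible m" and n: "feasible n"
 shows "feasible (%x. m x <= (n x :: nat))"
 using feasible_eq_0[OF feasible_minus[OF m n]] by simp

lemma feasible_less [feas]:
 assumes m: "feasible m" and n: "feasible n"
 shows "feasible (%x. m x < (n x :: nat))"
 using feasible_le[OF feasible_Suc[OF m] n] by (simp add: Suc_le_eq)

lemma feasible_min [feas]: "feasible m ==> feasible n ==> feasible (%x. min (m x) (n x :: nat))"
 unfolding min_def by (intro feas)

text \<open>Equality is decided type by type. A predicate on types allows the rules for pairs and
  lists to inherit it from their components.\<close>

definition feasible_equality :: "'a::tcoded itself => bool" where
 "feasible_equality t \<longleftrightarrow> feasible (%p :: 'a \<times> 'a. fst p = snd p)"

lemma feasible_eq [feas]:
 "feasible_equality TYPE('b::tcoded) ==> feasible f ==> feasible g ==> feasible (%x. f x = (g x :: 'b))"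
 unfolding feasible_equality_def by (rule feasible_comp2)

lemma feasible_equality_unit [feas]: "feasible_equality TYPE(unit)"
 unfolding feasible_equality_def by (simp add: feasible_const)

lemma feasible_equality_nat [feas]: "feasible_equality TYPE(nat)"
 unfolding feasible_equality_def
proof -
 have "feasible (%p :: nat \<times> nat. fst p <= snd p & snd p <= fst p)" by (intro feas)
 thus "feasible (%p :: nat \<times> nat. fst p = snd p)" by (simp add: eq_iff)
qed

lemma feasible_equality_bool [feas]: "feasible_equality TYPE(bool)"
 unfolding feasible_equality_def
proof -
 have "feasible (%p :: bool \<times> bool. (fst p --> snd p) & (snd p --> fst p))" by (intro feas)
 moreover have "(a --> b) & (b --> a) \<longleftrightarrow> a = b" for a b by blast
 ultimately show "feasible (%p :: bool \<times> bool. fst p = snd p)" by simp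
qed

lemma feasible_equality_prod [feas]:
 assumes "feasible_equality TYPE('a::tcoded)" "feasible_equality TYPE('b::tcoded)"
 shows "feasible_equality TYPE('a \<times> 'b)"
 unfolding feasible_equality_def
proof -
 have "feasible (%p :: ('a \<times> 'b) \<times> ('a \<times> 'b). fst (fst p) = fst (snd p) & snd (fst p) = snd (snd p))"
  by (intro feas assms)
 thus "feasible (%p :: ('a \<times> 'b) \<times> ('a \<times> 'b). fst p = snd p)" by (simp add: prod_eq_iff)
qed

lemma feasible_equality_list [feas]:
 assumes "feasible_equality TYPE('a::tcoded)"
 shows "feasible_equality TYPE('a list)"
 unfolding feasible_equality_def
proof -
 let ?F = "%x (a :: bool \<times> 'a list). case snd a of [] => (False, []) | y # ys => (fst a & x = y, ys)"
 have "feasible (%p :: 'a list \<times> 'a list. fold ?F (fst p) (True, snd p))"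
 proof (rule feasible_fold_additive[where r = "%n. 2"])
  have b: "1 <= csize b" "csize b <= 3" for b :: bool by (cases b; simp add: csize_simps)+
  show "csize (?F x a) <= csize a + 2" for x a
  proof (cases a)
   case (Pair c ys)
   thus ?thesis
   proof (cases ys)
    case (Cons y zs)
    thus ?thesis using b(2)[of "c & x = y"] b(1)[of c] by (simp add: Pair csize_simps)
   qed (use b(1)[of c] in "simp add: csize_simps")
  qed
 qed (intro feas pb_intros assms)+
 hence "feasible (%p :: 'a list \<times> 'a list. case fold ?F (fst p) (True, snd p) of
   (b, r) => b & length r = 0)" by (intro feas feasible_eq_0)
 moreover have "(case fold ?F xs (b, ys) of (b, r) => b & length r = 0) \<longleftrightarrow> b & xs = ys" for xs ys :: "'a list" and b
 proof (induction xs arbitrary: b ys)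
  case (Cons x xs)
  note IH = Cons
  show ?case
  proof (cases ys)
   case Nil
   show ?thesis using IH[of False "[]"] by (simp add: Nil)
  next
   case (Cons y zs)
   thus ?thesis using IH by auto
  qed
 qed auto
 ultimately show "feasible (%p :: 'a list \<times> 'a list. fst p = snd p)" by simp
qed

lemma feasible_member [feas]:
 assumes "feasible_equality TYPE('b::tcoded)" and f: "feasible f" and l: "feasible l"
 shows "feasible (%x. (f x :: 'b) : set (l x))"
proof -
 have "feasible (%x. list_ex (%y. y = f x) (l x))" by (intro feas assms(1) l feasible_comp[OF f])
 moreover have "list_ex (%y. y = a) xs \<longleftrightarrow> a : set xs" for a :: 'b and xs by (induction xs) auto
 ultimately show ?thesis by simp
qed

definition nthd :: "'a => 'a list => nat => 'a" where
 "nthd d xs n = (if n < length xs then xs ! n else d)"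

lemma nthd_eq_nth [simp]: "n < length xs ==> nthd d xs n = xs ! n"
 by (simp add: nthd_def)

lemma feasible_nthd [feas]:
 assumes "feasible d" "feasible l" "feasible n"
 shows "feasible (%x. nthd (d x) (l x) (n x))"
proof -
 have "feasible (%x. case drop (n x) (l x) of [] => d x | y # _ => y)"
  by (intro feas assms)
 moreover have "(case drop k xs of [] => e | y # _ => y) = nthd e xs k" for k xs and e :: 'b
  by (auto simp: nthd_def Cons_nth_drop_Suc[symmetric])
 ultimately show ?thesis by simp
qed

lemma feasible_take [feas]:
 assumes n: "feasible n" and l: "feasible l"
 shows "feasible (%x. take (n x) (l x))"
proof -
 have "feasible (%x. rev (drop (length (l x) - n x) (rev (l x))))" by (intro feas n l)
 moreover have "rev (drop (length xs - k) (rev xs)) = take k xs" for xs :: "'b list" and k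
  by (cases "k <= length xs") (simp_all add: rev_drop)
 ultimately show ?thesis by simp
qed

lemma feasible_upt [feas]:
 assumes n: "feasible n"
 shows "feasible (%x. [0..<n x])"
proof -
 obtain T t where t: "poly_bounded t" "!!x. csize (n x) <= t (csize x)" using feasibleE[OF n] by metis
 \<comment> \<open>The test keeps \<open>k\<close> at most \<open>n z\<close> without counting
   rounds, which makes the size bound an inductive invariant.\<close>
 have "feasible (%z. fold (%_ (k, a). (if k < n z then Suc k else k, a @ [k])) (replicate (n z) ()) (0, []))"
 proof (rule feasible_fold_inv[where r = "%m. 10 + t m" and I = "%z (k, a). k <= n z"])
  show "(case (case a of (k, a) => (if k < n z then Suc k else k, a @ [k])) of (k, a) => k <= n z) &
    csize (case a of (k, a) => (if k < n z then Suc k else k, a @ [k])) <= csize a + (10 + t (csize z))"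
   if "case a of (k, a) => k <= n z" for z a and x :: unit
  proof (cases a)
   case (Pair k l)
   have "csize (l @ [k]) + 1 = csize l + (2 + csize k)" unfolding csize_append by (simp add: csize_simps)
   moreover have "csize k <= t (csize z)" using that t(2)[of z] by (simp add: Pair csize_simps)
   ultimately show ?thesis using that by (simp add: Pair csize_simps)
  qed
 qed ((unfold case_prod_beta)?, intro feas pb_intros t(1) feasible_comp[OF n] n | simp)+
 hence "feasible (%z. snd (fold (%_ (k, a). (if k < n z then Suc k else k, a @ [k])) (replicate (n z) ()) (0, [])))"
  by (rule feasible_snd)
 moreover have "fold (%_ (k, a). (if k < N then Suc k else k, a @ [k])) (replicate j ()) (k, l) = (k + j, l @ [k..<k + j])"
  if "k + j <= N" for N j k l
  using that
 proof (induction j arbitrary: k l)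
  case (Suc j)
  from Suc.IH[of "Suc k" "l @ [k]"] Suc.prems show ?case by (simp add: upt_rec)
 qed simp
 ultimately show ?thesis by simp
qed

lemma feasible_zip [feas]:
 assumes l: "feasible l" and m: "feasible m"
 shows "feasible (%x. zip (l x) (m x))"
proof -
 obtain t where t: "poly_bounded t" "!!z x. x : set (l z) ==> csize x <= t (csize z)"
  using csize_member_bound[OF l] by metis
 let ?F = "%x (a :: ('b \<times> 'c) list \<times> 'c list). case snd a of [] => a | y # r => (fst a @ [(x, y)], r)"
 have "feasible (%z. fold ?F (l z) ([], m z))"
 proof (rule feasible_fold_additive[where r = "%n. t n + 2"])
  fix z x a assume "x : set (l z)"
  from t(2)[OF this] show "csize (?F x a) <= csize a + (t (csize z) + 2)"
  proof (cases a)
   case (Pair u v)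
   show ?thesis
   proof (cases v)
    case (Cons y r)
    have "csize (u @ [(x, y)]) + 1 = csize u + (3 + csize x + csize y)" unfolding csize_append by (simp add: csize_simps)
    thus ?thesis using t(2)[OF \<open>x : set (l z)\<close>] by (simp add: Pair Cons csize_simps)
   qed (simp add: Pair)
  qed
 qed (intro feas pb_intros l m t(1))+
 hence "feasible (%z. fst (fold ?F (l z) ([], m z)))" by (rule feasible_fst)
 moreover have "fst (fold ?F xs (us, ys)) = us @ zip xs ys" for xs us ys
 proof (induction xs arbitrary: us ys)
  case (Cons x xs)
  show ?case
  proof (cases ys)
   case Nil
   thus ?thesis using Cons[of us "[]"] by simp
  qed (simp add: Cons)
 qed simp
 ultimately show ?thesis by simp
qed

text \<open>Doubling with a cap stays polynomial in the cap.\<close>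

lemma feasible_capped_power [feas]:
 assumes P: "feasible P" and n: "feasible n"
 shows "feasible (%x. min (P x) (2 ^ n x :: nat))"
proof -
 obtain T t where t: "poly_bounded t" "!!x. csize (P x) <= t (csize x)" using feasibleE[OF P] by metis
 have "feasible (%z. fold (%_ a. min (P z) (a + a)) (replicate (n z) ()) (min (P z) 1))"
 proof (rule feasible_fold_additive[where r = t])
  show "csize (min (P z) (a + a)) <= csize a + t (csize z)" for z a
   using t(2)[of z] by (simp add: csize_simps min_def)
 qed (intro feas P n t(1) feasible_comp[OF P])+
 moreover have "fold (%_ a. min c (a + a)) (replicate k ()) (min c m) = min c (2 ^ k * m)" for c k m :: nat
 proof (induction k arbitrary: m)
  case (Suc k)
  have "min c (min c m + min c m) = min c (m + m)" by (simp add: min_def)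
  thus ?case using Suc[of "m + m"] by (simp add: mult.commute mult.left_commute mult_2 algebra_simps)
 qed simp
 ultimately show ?thesis by (simp add: mult.commute)
qed

text \<open>Parity and half are produced together by a single loop that toggles a bit and counts
  every second round.\<close>

definition mod2div2 :: "nat => bool \<times> nat" where
 "mod2div2 n = (odd n, n div 2)"

lemma feasible_mod2div2: "feasible n ==> feasible (%x. mod2div2 (n x))"
proof (rule feasible_comp[of mod2div2 n])
 have "feasible (%n. fold (%_ (b, m). if b then (False, Suc m) else (True, m)) (replicate n ()) (False, 0))"
 proof (rule feasible_fold_additive[where r = "%n. 4"])
  show "csize (case a of (b, m) => if b then (False, Suc m) else (True, m)) <= csize a + 4" for a
   by (cases a) (auto simp: csize_simps)
 qed ((unfold case_prod_beta)?, intro feas pb_intros)+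
 moreover have "fold (%_ (b, m). if b then (False, Suc m) else (True, m)) (replicate n ()) (False, 0) = mod2div2 n" for n
 proof (induction n)
  case (Suc n)
  have "replicate (Suc n) () = replicate n () @ [()]" by (simp add: replicate_append_same)
  thus ?case using Suc by (auto simp: mod2div2_def)
 qed (simp add: mod2div2_def)
 ultimately show "feasible mod2div2" by simp
qed

lemma feasible_odd [feas]: "feasible n ==> feasible (%x. odd (n x :: nat))"
 using feasible_fst[OF feasible_mod2div2] by (simp add: mod2div2_def)

lemma feasible_even [feas]: "feasible n ==> feasible (%x. even (n x :: nat))"
 using feasible_not[OF feasible_odd] by simp

lemma feasible_div2 [feas]: "feasible n ==> feasible (%x. n x div (2::nat))"
 using feasible_snd[OF feasible_mod2div2] by (simp add: mod2div2_def)

section \<open>From stack programs to complexity classes\<close>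

text \<open>The code of a list ends with the symbol 1 of the empty list and has to be pushed from
  its end, hence the initial reversal. A bit contributes the symbol 2 of its list cell followed by
  its own code, which is 1 or 2 1 1.\<close>

definition read_input :: cmd where
 "read_input = Seq (Loop 0 nonblank (Seq (Branch 0 (%a. a = 2) (Push 1 2) (Push 1 1)) (Pop 0)))
   (Seq (Push 0 1) (Loop 1 nonblank (Seq (Branch 1 (%a. a = 2)
    (Seq (Push 0 1) (Seq (Push 0 1) (Seq (Push 0 2) (Push 0 2)))) (Seq (Push 0 1) (Push 0 2))) (Pop 1))))"

definition write_output :: cmd where
 "write_output = Loop 0 (%a. a = 2) (Seq (Pop 0) (Branch 0 (%a. a = 2)
   (Seq (Pop 0) (Seq (Pop 0) (Seq (Pop 0) (Emit 2)))) (Seq (Pop 0) (Emit 1))))"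

lemma reverse_input_run:
 "big (Loop 0 nonblank (Seq (Branch 0 (%a. a = 2) (Push 1 2) (Push 1 1)) (Pop 0)))
   (store4 (map bit_sym x) b c d e) (10 * length x + 1) (store4 [] (rev (map bit_sym x) @ b) c d e)"
proof (induction x arbitrary: b)
 case Nil
 thus ?case by (intro big_Loop_exit) (simp_all add: nonblank_def)
next
 case (Cons a x)
 let ?x = "map bit_sym x"
 have 1: "big (Branch 0 (%a. a = 2) (Push 1 2) (Push 1 1)) (store4 (bit_sym a # ?x) b c d e) 4
   (store4 (bit_sym a # ?x) (bit_sym a # b) c d e)"
 proof (cases a)
  case True
  thus ?thesis by (intro big_le[OF big_Branch_True[OF _ big_Push]]) (simp_all add: bit_sym_def)
 next
  case False
  thus ?thesis by (intro big_le[OF big_Branch_False[OF _ big_Push]]) (simp_all add: bit_sym_def)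
 qed
 have 2: "big (Pop 0) (store4 (bit_sym a # ?x) (bit_sym a # b) c d e) 1 (store4 ?x (bit_sym a # b) c d e)"
  by (rule big_Pop) simp
 have t: "nonblank (top_sym (store4 (bit_sym a # ?x) b c d e 0))" by (simp add: nonblank_def bit_sym_def)
 from big_Loop_True[of nonblank, OF t big_Seq[OF 1 2] Cons.IH]
 show ?case by (rule big_eq) simp_all
qed

lemma code_input_run:
 "big (Loop 1 nonblank (Seq (Branch 1 (%a. a = 2)
    (Seq (Push 0 1) (Seq (Push 0 1) (Seq (Push 0 2) (Push 0 2)))) (Seq (Push 0 1) (Push 0 2))) (Pop 1)))
   ((base (word y))(1 := rev (map bit_sym x))) (20 * length x + 1) (base (word (x @ y)))"
proof (induction x arbitrary: y rule: rev_induct)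
 case Nil
 thus ?case by (intro big_Loop_exit) (simp_all add: nonblank_def)
next
 case (snoc a x)
 let ?x = "rev (map bit_sym x)"
 let ?s = "%w. (base w)(1 := bit_sym a # ?x)"
 have 1: "big (Branch 1 (%a. a = 2) (Seq (Push 0 1) (Seq (Push 0 1) (Seq (Push 0 2) (Push 0 2)))) (Seq (Push 0 1) (Push 0 2)))
   (?s (word y)) 10 (?s (word (a # y)))"
 proof (cases a)
  case True
  have "big (Seq (Push 0 1) (Seq (Push 0 1) (Seq (Push 0 2) (Push 0 2)))) (?s (word y)) 8 (?s (word (a # y)))"
   by (rule big_le, rule big_Seq[OF big_Push[OF refl] big_Seq[OF big_Push[OF refl] big_Seq[OF big_Push[OF refl] big_Push]]])
    (auto simp: True tcode_bool_def)
  from big_Branch_True[OF _ this, of "%a. a = 2" 1] show ?thesis by (rule big_eq) (simp_all add: bit_sym_def True)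
 next
  case False
  have "big (Seq (Push 0 1) (Push 0 2)) (?s (word y)) 4 (?s (word (a # y)))"
   by (rule big_le, rule big_Seq[OF big_Push[OF refl] big_Push])
    (simp_all add: False tcode_bool_def)
  from big_Branch_False[OF _ this, of "%a. a = 2" 1] show ?thesis by (rule big_eq) (simp_all add: bit_sym_def False)
 qed
 have 2: "big (Pop 1) (?s (word (a # y))) 1 ((base (word (a # y)))(1 := ?x))"
  by (rule big_Pop) simp
 have t: "nonblank (top_sym (?s (word y) 1))" by (simp add: nonblank_def bit_sym_def)
 from big_Loop_True[of nonblank, OF t big_Seq[OF 1 2] snoc.IH]
 show ?case by (rule big_eq) simp_all
qed

lemma read_input_run: "big read_input (initial_store x) (30 * length x + 10) (base (word x))"
proof -
 have i: "initial_store x = base (map bit_sym x)" by (auto simp: initial_store_def store4_def)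
 have p: "big (Push 0 1) (store4 [] (rev (map bit_sym x)) [] [] []) 2 ((base (word ([] :: bool list)))(1 := rev (map bit_sym x)))"
  by (rule big_Push) simp
 from reverse_input_run[of x "[]" "[]" "[]" "[]"]
 have "big (Loop 0 nonblank (Seq (Branch 0 (%a. a = 2) (Push 1 2) (Push 1 1)) (Pop 0)))
   (base (map bit_sym x)) (10 * length x + 1) (store4 [] (rev (map bit_sym x)) [] [] [])" by simp
 from big_Seq[OF this big_Seq[OF p code_input_run]]
 show ?thesis unfolding read_input_def i by (rule big_eq) simp_all
qed

lemma write_output_run:
 "big write_output (store4 (word y) [] [] [] e) (20 * length y + 1) (store4 [1] [] [] [] (e @ map bit_sym y))"
proof (induction y arbitrary: e)
 case Nil
 thus ?case unfolding write_output_def by (intro big_Loop_exit) simp_all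
next
 case (Cons a y)
 let ?s = "%w e. store4 w [] [] [] e"
 have 1: "big (Branch 0 (%a. a = 2) (Seq (Pop 0) (Seq (Pop 0) (Seq (Pop 0) (Emit 2)))) (Seq (Pop 0) (Emit 1)))
   (?s (word a @ word y) e) 10 (?s (word y) (e @ [bit_sym a]))"
 proof (cases a)
  case True
  have "big (Seq (Pop 0) (Seq (Pop 0) (Seq (Pop 0) (Emit 2)))) (?s (word a @ word y) e) 4 (?s (word y) (e @ [bit_sym a]))"
   by (rule big_le, rule big_Seq[OF big_Pop[OF refl] big_Seq[OF big_Pop[OF refl] big_Seq[OF big_Pop[OF refl] big_Emit]]])
    (simp_all add: True tcode_bool_def bit_sym_def)
  from big_Branch_True[OF _ this, of "%a. a = 2" 0] show ?thesis by (rule big_eq) (simp_all add: tcode_bool_def True)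
 next
  case False
  have "big (Seq (Pop 0) (Emit 1)) (?s (word a @ word y) e) 4 (?s (word y) (e @ [bit_sym a]))"
   by (rule big_le, rule big_Seq[OF big_Pop[OF refl] big_Emit])
    (simp_all add: False tcode_bool_def bit_sym_def)
  from big_Branch_False[OF _ this, of "%a. a = 2" 0] show ?thesis by (rule big_eq) (simp_all add: tcode_bool_def False)
 qed
 have 2: "big (Pop 0) (?s (word (a # y)) e) 1 (?s (word a @ word y) e)" by (rule big_Pop) simp
 have t: "top_sym (?s (word (a # y)) e 0) = 2" by simp
 from big_Loop_True[of "%a. a = 2", OF t big_Seq[OF 2 1] Cons.IH[unfolded write_output_def]]
 show ?case unfolding write_output_def by (rule big_eq) simp_all
qed

lemma csize_bits: "csize (x :: bool list) <= 4 * length x + 1" "2 * length x + 1 <= csize x"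
proof -
 have "csize (x :: bool list) <= 4 * length x + 1 & 2 * length x + 1 <= csize x"
 proof (induction x)
  case (Cons a x)
  thus ?case by (cases a) (auto simp: csize_simps)
 qed (simp add: csize_simps)
 thus "csize (x :: bool list) <= 4 * length x + 1" "2 * length x + 1 <= csize x" by auto
qed

lemma computes_in_time:
 fixes f :: "bool list => bool list"
 assumes f: "computes f T" and T: "!!x. T x <= U (length x)"
 shows "EX M. tm_computes_in_time M f (%n. 100 * (n + U n + 1))"
proof -
 from f obtain c where c: "program_for c f T" by (auto simp: computes_def)
 let ?p = "Seq read_input (Seq c write_output)"
 show ?thesis
 proof (rule exI, rule stack_language_computes[of ?p "%x. 30 * length x + 10 + (T x + (20 * length (f x) + 1))"])
  show "wf_cmd ?p" using c by (simp add: program_for_def read_input_def write_output_def)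
  show "EX s'. big ?p (initial_store x) (30 * length x + 10 + (T x + (20 * length (f x) + 1))) s' & s' 4 = map bit_sym (f x)" for x
  proof -
   have "big c (base (word x)) (T x) (base (word (f x)))"
    using c[unfolded program_for_def, THEN conjunct2, rule_format, of x "[]"] by simp
   from big_Seq[OF read_input_run big_Seq[OF this write_output_run]] show ?thesis by fastforce
  qed
  show "30 * length x + 10 + (T x + (20 * length (f x) + 1)) <= 100 * (length x + U (length x) + 1)" for x
   using T[of x] csize_bits(2)[of "f x"] csize_bits(1)[of x] computes_csize[OF f, of x] by simp
 qed
qed

lemma polytime_computableI:
 assumes "feasible f"
 shows "polytime_computable f"
proof -
 obtain T p where f: "computes f T" "poly_bounded p" "mono p" "!!x. T x <= p (csize x)"
  using feasibleE[OF assms] by metis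
 have T: "T x <= p (4 * length x + 1)" for x
  using f(4)[of x] monoD[OF f(3) csize_bits(1)[of x]] by linarith
 from computes_in_time[OF f(1), of "%n. p (4 * n + 1)", OF T] obtain M where
  M: "tm_computes_in_time M f (%n. 100 * (n + p (4 * n + 1) + 1))" by blast
 have "poly_bounded (%n. 100 * (n + p (4 * n + 1) + 1))"
  by (intro pb_intros poly_bounded_comp[OF f(2)])
 then obtain k where k: "!!n. 100 * (n + p (4 * n + 1) + 1) <= (n + 2) ^ k" by (auto simp: poly_bounded_def)
 have "(%n. real (100 * (n + p (4 * n + 1) + 1))) : O(%n. real n ^ k)"
 proof (rule bigoI[of _ "3 ^ k"], rule eventually_at_top_linorderI[of 1])
  fix n :: nat assume "1 <= n"
  hence "(n + 2) ^ k <= (3 * n) ^ k" by (intro power_mono) auto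
  with k[of n] have "100 * (n + p (4 * n + 1) + 1) <= 3 ^ k * n ^ k" by (simp add: power_mult_distrib)
  hence "real (100 * (n + p (4 * n + 1) + 1)) <= real (3 ^ k * n ^ k)" by (simp only: of_nat_le_iff)
  thus "norm (real (100 * (n + p (4 * n + 1) + 1))) <= 3 ^ k * norm (real n ^ k)" by simp
 qed
 thus ?thesis unfolding polytime_computable_def computable_in_time_def using M by blast
qed

text \<open>Powers of two are not feasible, as the unary result is exponentially long. Repeated
  doubling is polynomial in that result, however, which an exponential time bound permits.\<close>

lemma computes_power2:
 "EX T p. computes (%n :: nat. 2 ^ n :: nat) T & poly_bounded p & (ALL n. T n <= p (2 ^ n))"
proof -
 have i: "feasible (%z :: nat. (replicate z (), (z, 1 :: nat)))" by (intro feas)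
 obtain S s where s: "computes (%z. (replicate z (), (z, 1 :: nat))) S" "poly_bounded s" "mono s"
  "!!x. S x <= s (csize x)" by (rule feasibleE[OF i]) blast
 have "feasible (%((x :: unit, xs), (z :: nat, a)). (xs :: unit list, (z, (%_ _ a :: nat. a + a) z x a)))"
  unfolding case_prod_beta by (intro feas)
 note fU = this
 obtain U u where u: "computes (%((x :: unit, xs), (z :: nat, a)). (xs :: unit list, (z, (%_ _ a :: nat. a + a) z x a))) U"
  "poly_bounded u" "mono u" "!!x. U x <= u (csize x)" by (rule feasibleE[OF fU]) blast
 have fold: "((%a. a + a) ^^ j) m = 2 ^ j * m" for j m :: nat
  by (induction j) (auto simp: algebra_simps)
 from computes_fold[OF s(1) u(1)] obtain V where V: "computes (%z :: nat. 2 ^ z :: nat) V"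
  "!!z. V z = S z + (\<Sum>j<z. U ((replicate z () ! j, drop (Suc j) (replicate z ())), (z, 2 ^ min z j)) + 5) + 4
    + 100 * (csize (z, 2 ^ z :: nat) + 5)" by (auto simp: fold)
 let ?c = "%N. s (2 * N + 1) + N * (u (20 * N + 20) + 5) + 4 + 100 * (4 * N + 8)"
 have "V z <= ?c (2 ^ z)" for z
 proof -
  have z: "z <= 2 ^ z" by (rule le_two_power)
  have cs: "csize (replicate z ()) = 2 * z + 1" for z by (induction z) (auto simp: csize_simps)
  have "U ((replicate z () ! j, drop (Suc j) (replicate z ())), (z, 2 ^ min z j)) <= u (20 * 2 ^ z + 20)" if "j < z" for j
  proof -
   have "(2::nat) ^ min z j <= 2 ^ z" by (rule power_increasing) auto
   moreover have "csize (drop (Suc j) (replicate z ())) <= 2 * z + 1" using csize_drop[of "Suc j" "replicate z ()"] cs by simp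
   ultimately have "csize ((replicate z () ! j, drop (Suc j) (replicate z ())), (z, 2 ^ min z j :: nat)) <= 20 * 2 ^ z + 20"
    using z by (simp only: csize_simps)
   thus ?thesis using u(4) monoD[OF u(3)] le_trans by blast
  qed
  hence "(\<Sum>j<z. U ((replicate z () ! j, drop (Suc j) (replicate z ())), (z, 2 ^ min z j)) + 5)
   <= (\<Sum>j<z. u (20 * 2 ^ z + 20) + 5)" by (intro sum_mono) simp
  also have "... <= 2 ^ z * (u (20 * 2 ^ z + 20) + 5)" using z by (simp add: mult_le_mono)
  finally have 1: "(\<Sum>j<z. U ((replicate z () ! j, drop (Suc j) (replicate z ())), (z, 2 ^ min z j)) + 5)
   <= 2 ^ z * (u (20 * 2 ^ z + 20) + 5)" .
  have "csize z <= 2 * 2 ^ z + 1" using z by (simp add: csize_simps)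
  hence 2: "S z <= s (2 * 2 ^ z + 1)" using s(4)[of z] monoD[OF s(3)] le_trans by blast
  have 3: "csize (z, 2 ^ z :: nat) + 5 <= 4 * 2 ^ z + 8" using z by (simp add: csize_simps)
  show ?thesis unfolding V(2) by (rule add_mono[OF add_mono[OF add_mono[OF 2 1] order.refl] mult_le_mono[OF order.refl 3]])
 qed
 moreover have "poly_bounded ?c"
  by (intro pb_intros poly_bounded_comp[OF s(2)] poly_bounded_comp[OF u(2)])
 ultimately show ?thesis using V(1) by blast
qed

text \<open>A language is in "EXPTIME" once it is decided in time polynomial in the input together with
 an exponentially large number in unary.\<close>

lemma EXPTIME_I:
 fixes g :: "bool list => nat => bool"
 assumes g: "feasible (%z. g (fst z) (snd z))"
  and L: "!!x. x : L \<longleftrightarrow> g x (2 ^ ((length x + 2) ^ d))"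
 shows "L : EXPTIME"
proof -
 have "feasible (%x :: bool list. (length x + 2) ^ d)" by (intro feas)
 then obtain T p where f: "computes (%x :: bool list. (length x + 2) ^ d) T" "poly_bounded p" "mono p" "!!x. T x <= p (csize x)"
  using feasibleE by metis
 obtain W w where w: "computes (%n :: nat. 2 ^ n :: nat) W" "poly_bounded w" "!!n. W n <= w (2 ^ n)"
  using computes_power2 by blast
 have fU: "feasible (%z. [g (fst z) (snd z)])" by (intro feas g)
 obtain U u where u: "computes (%z. [g (fst z) (snd z)]) U" "poly_bounded u" "mono u" "!!x. U x <= u (csize x)"
  by (rule feasibleE[OF fU]) blast
 let ?N = "%x :: bool list. 2 ^ ((length x + 2) ^ d) :: nat"
 have "computes (%x. (x, ?N x)) (%x. 0 + (T x + W ((length x + 2) ^ d)) + 50 * (2 * csize x + csize (?N x)) + 2)"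
  by (rule computes_pair[OF computes_id computes_comp[OF f(1) w(1)]])
 from computes_comp[OF this u(1)]
 have main: "computes (%x. [x : L]) (%x. 0 + (T x + W ((length x + 2) ^ d)) + 50 * (2 * csize x + csize (?N x)) + 2 + U (x, ?N x))"
  (is "computes _ ?T") by (simp add: L)
 obtain w' where w': "poly_bounded w'" "mono w'" "!!n. w n <= w' n" using poly_bounded_mono_majorant[OF w(2)] by metis
 let ?c = "%N. p (4 * N + 1) + w' N + 50 * (2 * (4 * N + 1) + (2 * N + 1)) + 2 + u (20 * N + 20)"
 have pc: "poly_bounded (%N. 100 * (N + ?c N + 1))"
  by (intro pb_intros poly_bounded_comp[OF f(2)] poly_bounded_comp[OF u(2)] w')
 then obtain k where k: "!!n. 100 * (n + ?c n + 1) <= (n + 2) ^ k" by (auto simp: poly_bounded_def)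
 \<comment> \<open>With \<open>Suc d\<close> in place of \<open>d\<close> this number dominates the
   length of the input as well, also when \<open>d = 0\<close>.\<close>
 define N where "N n = (2::nat) ^ ((n + 2) ^ Suc d)" for n
 have len: "n <= N n" for n
 proof -
  have "n <= 2 ^ n" by (rule le_two_power)
  also have "... <= 2 ^ ((n + 2) ^ Suc d)"
   by (rule power_increasing) (use self_le_power[of "n + 2" "Suc d"] in auto)
  finally show ?thesis by (simp add: N_def)
 qed
 have N: "?N x <= N (length x)" for x
  unfolding N_def by (rule power_increasing) auto
 have T: "?T x <= ?c (N (length x))" for x
 proof -
  have cx: "csize x <= 4 * N (length x) + 1" using csize_bits(1)[of x] len[of "length x"] by linarith
  have 1: "T x <= p (4 * N (length x) + 1)" using f(4)[of x] monoD[OF f(3) cx] by linarith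
  have 3: "csize (?N x) <= 2 * N (length x) + 1" using N[of x] by (simp add: csize_simps)
  have "csize (x, ?N x) <= 20 * N (length x) + 20" using cx 3 by (simp add: csize_simps)
  hence 4: "U (x, ?N x) <= u (20 * N (length x) + 20)" using u(4)[of "(x, ?N x)"] monoD[OF u(3)] le_trans by blast
  have 2: "W ((length x + 2) ^ d) <= w (?N x)" by (rule w(3))
  have "W ((length x + 2) ^ d) <= w' (N (length x))" using 2 w'(3)[of "?N x"] monoD[OF w'(2) N] le_trans by meson
  thus ?thesis using 1 3 4 cx by simp
 qed
 from computes_in_time[OF main, of "%n. ?c (N n)", OF T] obtain M where
  M: "tm_computes_in_time M (%x. [x : L]) (%n. 100 * (n + ?c (N n) + 1))" by blast
 \<comment> \<open>For large \<open>n\<close>, the square of \<open>n\<close> exceeds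
   \<open>n + 2\<close>, which doubles the exponent \<open>Suc d\<close>. The outer power
   \<open>k\<close> multiplies the exponent of 2 by \<open>k\<close>; together with the additive
   constant this is a factor of at most \<open>2 * k\<close>, absorbed by
   \<open>n ^ k\<close>.\<close>
 have "(%n. real (100 * (n + ?c (N n) + 1))) : O(%n. 2 ^ (n ^ (2 * Suc d + k)))"
 proof (rule bigoI[of _ 1], rule eventually_at_top_linorderI[of "k + 3"])
  fix n :: nat assume n: "k + 3 <= n"
  have "100 * (n + ?c (N n) + 1) <= (N n + 2) ^ k" using k[of "N n"] len[of n] by (simp add: le_trans)
  also have "... <= (2 ^ (n ^ (2 * Suc d) + 1)) ^ k"
  proof (rule power_mono)
   have "(n + 2) <= n ^ 2"
   proof -
    have "3 * n <= n * n" using n by (intro mult_le_mono1) auto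
    hence "n + 2 <= n * n" using n by linarith
    thus ?thesis by (simp add: power2_eq_square)
   qed
   hence "(n + 2) ^ Suc d <= (n ^ 2) ^ Suc d" by (rule power_mono) simp
   hence "N n <= 2 ^ (n ^ (2 * Suc d))" unfolding N_def power_mult[symmetric] by (rule power_increasing) simp
   moreover have "2 <= (2::nat) ^ (n ^ (2 * Suc d))" using n by (intro self_le_power[of 2, simplified]) simp
   ultimately show "N n + 2 <= 2 ^ (n ^ (2 * Suc d) + 1)" by simp
  qed simp
  also have "... = 2 ^ ((n ^ (2 * Suc d) + 1) * k)" by (rule power_mult[symmetric])
  also have "... <= 2 ^ (n ^ (2 * Suc d + k))"
  proof (rule power_increasing)
   have "(n ^ (2 * Suc d) + 1) * k <= n ^ (2 * Suc d) * (2 * k)" using n by (simp add: algebra_simps)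
   also have "2 * k <= n ^ k"
   proof (cases k)
    case (Suc j)
    show ?thesis
    proof (cases j)
     case (Suc i)
     have "2 <= n" "k <= n" using n by auto
     hence "2 * k <= n * n" by (rule mult_le_mono)
     also have "n * n = n ^ 2" by (simp add: power2_eq_square)
     also have "n ^ 2 <= n ^ k" by (rule power_increasing) (use n \<open>k = Suc j\<close> Suc in auto)
     finally show ?thesis .
    qed (use n \<open>k = Suc j\<close> in simp)
   qed simp
   finally show "(n ^ (2 * Suc d) + 1) * k <= n ^ (2 * Suc d + k)" by (simp add: power_add)
  qed simp
  finally have "real (100 * (n + ?c (N n) + 1)) <= real (2 ^ (n ^ (2 * Suc d + k)))" by (simp only: of_nat_le_iff)
  thus "norm (real (100 * (n + ?c (N n) + 1))) <= 1 * norm ((2::real) ^ (n ^ (2 * Suc d + k)))" by simp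
 qed
 hence "L : DTIME (%n. 2 ^ (n ^ (2 * Suc d + k)))"
  unfolding DTIME_def computable_in_time_def using M by blast
 thus ?thesis unfolding EXPTIME_def by blast
qed

section \<open>Streett games\<close>

definition streett :: "('i => 's set) => ('i => 's set) => 'i set => (nat => 's) => bool" where
 "streett R G I rh \<longleftrightarrow> (ALL i:I. (ALL m. EX n>=m. rh n : R i) --> (ALL m. EX n>=m. rh n : G i))"

text \<open>In state \<open>s\<close> the first player chooses a set \<open>A \<in> mv s\<close> and the second player an element of
 \<open>A\<close>.  A strategy of the first player is the tree \<open>H\<close> of histories compatible with it.\<close>

definition wins_by ::
 "('s => 's set set) => ('i => 's set) => ('i => 's set) => 'i set => 's list set => 's => bool" where
 "wins_by mv R G I H s \<longleftrightarrow> [s] : H & (ALL h t. h @ [t] : H --> h = [] | h : H) &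
   (ALL h:H. h ~= [] & (EX A:mv (last h). ALL t:A. h @ [t] : H)) &
   (ALL rh. rh 0 = s --> (ALL n. map rh [0..<Suc n] : H) --> streett R G I rh)"

definition wins where
 "wins mv R G I s \<longleftrightarrow> (EX H. wins_by mv R G I H s)"

lemma streett_suffix: "streett R G I rh ==> streett R G I (%n. rh (n + k))"
proof -
 assume s: "streett R G I rh"
 have eq: "(ALL m. EX n>=m. rh n : A) \<longleftrightarrow> (ALL m. EX n>=m. rh (n + k) : A)" for A
 proof safe
  fix m assume "ALL m. EX n>=m. rh n : A"
  then obtain n where "m + k <= n" "rh n : A" by blast
  thus "EX n>=m. rh (n + k) : A" by (intro exI[of _ "n - k"]) auto
 next
  fix m assume "ALL m. EX n>=m. rh (n + k) : A"
  then obtain n where "m <= n" "rh (n + k) : A" by blast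
  thus "EX n>=m. rh n : A" by (intro exI[of _ "n + k"]) auto
 qed
 show ?thesis using s unfolding streett_def eq .
qed

lemma wins_byD:
 assumes "wins_by mv R G I H s"
 shows "[s] : H" "!!h t. h @ [t] : H ==> h ~= [] ==> h : H" "!!h. h : H ==> h ~= []"
  "!!h. h : H ==> EX A:mv (last h). ALL t:A. h @ [t] : H"
  "!!rh. rh 0 = s ==> (!!n. map rh [0..<Suc n] : H) ==> streett R G I rh"
 using assms unfolding wins_by_def by blast+

lemma prefix_in_tree:
 assumes "!!h t. h @ [t] : H ==> h ~= [] ==> h : H" "h @ g : H" "h ~= []"
 shows "h : H"
 using assms(2)
proof (induction g rule: rev_induct)
 case (snoc t g)
 hence "(h @ g) @ [t] : H" by simp
 from assms(1)[OF this] assms(3) have "h @ g : H" by simp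
 thus ?case by (rule snoc.IH)
qed simp

text \<open>Restricting a winning tree below one of its nodes, to extensions satisfying \<open>Q\<close>, wins every
 game \<open>mv'\<close> that offers the corresponding moves.\<close>

lemma wins_by_subtree:
 assumes H: "wins_by mv R G I H s" and h: "h @ [t] : H" "hd (h @ [t]) = s" and Q: "Q [t]"
  and Qp: "!!g u. Q (g @ [u]) ==> g ~= [] ==> Q g"
  and mv': "!!g A. h @ g : H ==> Q g ==> g ~= [] ==> hd g = t ==> A : mv (last g) ==>
    (!!u. u : A ==> (h @ g) @ [u] : H) ==> {u : A. Q (g @ [u])} : mv' (last g)"
  and J: "J <= I"
 shows "wins_by mv' R G J {g. g ~= [] & hd g = t & h @ g : H & Q g} t"
 unfolding wins_by_def
proof (intro conjI allI ballI impI)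
 note W = wins_byD[OF H]
 let ?H = "{g. g ~= [] & hd g = t & h @ g : H & Q g}"
 show "[t] : ?H" using h Q by simp
 show "g = [] | g : ?H" if "g @ [u] : ?H" for g u
 proof (cases "g = []")
  case False
  from that have "(h @ g) @ [u] : H" by simp
  from W(2)[OF this] False have "h @ g : H" by simp
  thus ?thesis using that Qp[of g u] False by (auto simp: hd_append)
 qed simp
 show "g ~= []" if "g : ?H" for g using that by simp
 show "EX A:mv' (last g). ALL u:A. g @ [u] : ?H" if g: "g : ?H" for g
 proof -
  from W(4)[of "h @ g"] g obtain A where A: "A : mv (last g)" "!!u. u : A ==> (h @ g) @ [u] : H" by auto
  have "{u : A. Q (g @ [u])} : mv' (last g)" using g A by (intro mv') auto
  moreover have "g @ [u] : ?H" if "u : {u : A. Q (g @ [u])}" for u using that A g by auto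
  ultimately show ?thesis by blast
 qed
 fix rh assume r: "rh 0 = t" "ALL n. map rh [0..<Suc n] : ?H"
 let ?r = "h \<frown> rh"
 have "map ?r [0..<Suc n] : H" for n
 proof -
  have eq: "map ?r [0..<length h + Suc m] = h @ map rh [0..<Suc m]" for m
   by (rule nth_equalityI) (auto simp: nth_append conc_def simp del: upt_Suc)
  have 1: "map ?r [0..<length h + Suc n] : H" using r(2) by (simp only: eq) blast
  have "map ?r [0..<length h + Suc n] = map ?r [0..<Suc n] @ map ?r [Suc n..<length h + Suc n]"
   using upt_add_eq_append[of 0 "Suc n" "length h"] by (metis add.commute le0 map_append)
  with 1 have "map ?r [0..<Suc n] @ map ?r [Suc n..<length h + Suc n] : H" by (simp only:)
  from prefix_in_tree[OF W(2) this] show ?thesis by simp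
 qed
 moreover have "?r 0 = s" using h(2) r(1) by (cases h) (auto simp: conc_def)
 ultimately have "streett R G I ?r" using W(5) by blast
 from streett_suffix[OF this, of "length h"] have "streett R G I rh" by simp
 thus "streett R G J rh" using J unfolding streett_def by blast
qed

lemma wins_subtree:
 assumes H: "wins_by mv R G I H s" and h: "h @ [t] : H" "hd (h @ [t]) = s"
 shows "wins mv R G I t"
 unfolding wins_def
 by (rule exI, rule wins_by_subtree[OF H h, where Q = "%_. True" and J = I and mv' = mv]) auto

section \<open>Bounding the number of requests between grants\<close>

definition upd :: "('i => 's set) => ('i => 's set) => ('i => nat) => 's => 'i => nat" where
 "upd R G c s = (%i. if s : G i then 0 else if s : R i then Suc (c i) else c i)"

text \<open>Counter \<open>i\<close> is the number of visits to \<open>R i\<close> since the last visit to \<open>G i\<close>; in "X" the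
 first player keeps all counters below \<open>k\<close> until the play enters the exit region \<open>E\<close>.\<close>

definition safe where
 "safe mv R G I k E X \<longleftrightarrow> (ALL (s, c):X. (ALL i:I. c i <= k) &
   (EX A:mv s. ALL t:A. t : E | (t, upd R G c t) : X))"

abbreviation start_count where
 "start_count R G s \<equiv> upd R G (%_. 0) s"

lemma upd_mono: "c i <= c' i + d ==> upd R G c s i <= upd R G c' s i + d"
 by (simp add: upd_def)

lemma upd_le_Suc: "upd R G c s i <= Suc (c i)"
 by (simp add: upd_def)

text \<open>Dependent choice glues the extensions into one branch. Its main use is by
  contraposition: where no branch may meet \<open>A\<close> infinitely often, some node has no
  proper descendant in \<open>A\<close>.\<close>

lemma infinite_branch:
 assumes H: "!!h t. h @ [t] : H ==> h ~= [] ==> h : H" and y: "[y] : H"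
  and ext: "!!h. h : H ==> EX g. g ~= [] & h @ g : H & last g : A"
 obtains rh where "rh 0 = y" "!!n. map rh [0..<Suc n] : H" "ALL m. EX n>=m. rh n : A"
proof -
 have "EX f. ALL n::nat. (f n : H & take 1 (f n) = [y]) & (EX g. g ~= [] & f (Suc n) = f n @ g & last g : A)"
 proof (rule dependent_nat_choice)
  show "EX x. x : H & take 1 x = [y]" by (rule exI[of _ "[y]"]) (simp add: y)
  fix x assume x: "x : H & take 1 x = [y]"
  with ext obtain g where "g ~= []" "x @ g : H" "last g : A" by blast
  thus "EX z. (z : H & take 1 z = [y]) & (EX g. g ~= [] & z = x @ g & last g : A)"
   using x by (intro exI[of _ "x @ g"]) (cases x; auto)
 qed
 then obtain f where f: "!!n. f n : H" "!!n. take 1 (f n) = [y]"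
  "!!n. EX g. g ~= [] & f (Suc n) = f n @ g & last g : A" by metis
 have len: "n < length (f n)" for n
 proof (induction n)
  case 0
  show ?case using f(2)[of 0] by (cases "f 0") auto
 next
  case (Suc n)
  obtain g where "g ~= []" "f (Suc n) = f n @ g" using f(3) by blast
  with Suc show ?case by (cases g) auto
 qed
 have ext': "EX g. f (n + k) = f n @ g" for n k
 proof (induction k)
  case (Suc k)
  thus ?case using f(3)[of "n + k"] by auto
 qed simp
 define rh where "rh n = f n ! n" for n
 have nth: "f k ! n = rh n" if "n < length (f k)" for n k
 proof (cases "n <= k")
  case True
  then obtain g where "f k = f n @ g" using ext'[of n "k - n"] by auto
  thus ?thesis using len[of n] by (simp add: rh_def nth_append)
 next
  case False
  then obtain g where "f n = f k @ g" using ext'[of k "n - k"] by auto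
  thus ?thesis using that by (simp add: rh_def nth_append)
 qed
 show ?thesis
 proof
  show "rh 0 = y" using f(2)[of 0] by (cases "f 0") (auto simp: rh_def)
  show "map rh [0..<Suc n] : H" for n
  proof -
   have "map rh [0..<Suc n] = take (Suc n) (f n)"
    by (rule nth_equalityI) (use len[of n] nth[of _ n] in "auto simp del: upt_Suc")
   moreover have "take (Suc n) (f n) : H"
    by (rule prefix_in_tree[where g = "drop (Suc n) (f n)"]) (use f(1) len[of n] H in auto)
   ultimately show ?thesis by simp
  qed
  show "ALL m. EX n>=m. rh n : A"
  proof
   fix m
   obtain g where g: "g ~= []" "f (Suc m) = f m @ g" "last g : A" using f(3) by blast
   let ?n = "length (f (Suc m)) - 1"
   have "?n < length (f (Suc m))" using len[of "Suc m"] by linarith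
   hence "rh ?n = last (f (Suc m))" using nth[of ?n "Suc m"] g by (simp add: last_conv_nth)
   thus "EX n>=m. rh n : A" using g len[of "Suc m"] by (intro exI[of _ ?n]) auto
  qed
 qed
qed

text \<open>If \<open>b\<close> bounds the counters for one pair less, then waiting for a grant of
  one chosen pair costs at most \<open>N * (b + 1)\<close>, as there are at most \<open>N\<close>
  layers of states and each contributes \<open>b + 1\<close>. One more request may come with the
  granting state itself, and every pair is served once in a round of \<open>Suc m\<close>
  phases.\<close>

primrec streett_bound :: "nat => nat => nat" where
 "streett_bound N 0 = 0"
| "streett_bound N (Suc m) = Suc m * (N * (streett_bound N m + 1) + 1)"

text \<open>The induction hypothesis ranges over all move functions on \<open>S\<close> because it
  is applied to a subgame in which moves have been restricted.\<close>

locale streett_step =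
 fixes mv :: "'s => 's set set" and R G :: "'i => 's set" and I :: "'i set" and S :: "'s set" and b :: nat
 assumes S: "finite S" "!!s A. A : mv s ==> A <= S"
  and IH: "!!mv' i. i : I ==> (!!s A. A : mv' s ==> A <= S) ==>
   EX X. safe mv' R G (I - {i}) b {} X & (ALL s:S. wins mv' R G (I - {i}) s --> (s, start_count R G s) : X)"
begin

definition W where
 "W = {s : S. wins mv R G I s}"

lemma W_move:
 assumes "s : W"
 obtains A where "A : mv s" "A <= W"
proof -
 from assms obtain H where H: "wins_by mv R G I H s" by (auto simp: W_def wins_def)
 from wins_byD(4)[OF H wins_byD(1)[OF H]] obtain A where A: "A : mv s" "!!t. t : A ==> [s] @ [t] : H" by auto
 have "t : W" if "t : A" for t
  using wins_subtree[OF H A(2)[OF that]] S(2)[OF A(1)] that by (auto simp: W_def)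
 with A(1) that show ?thesis by blast
qed

text \<open>From \<open>Z\<close> the counters can be kept at most \<open>k\<close> until a grant of
  pair \<open>i\<close> occurs inside \<open>W\<close>. That such a grant occurs is not promised,
  for requests of \<open>i\<close> may cease.\<close>

definition settled where
 "settled i Z k \<longleftrightarrow> W \<inter> G i <= Z & Z <= W &
   (EX X. safe mv R G I k (W \<inter> G i) X & (ALL s:Z - W \<inter> G i. (s, start_count R G s) : X))"

text \<open>Entering \<open>X\<close> with counters that are too high by at most \<open>d\<close> is
  tolerable: updates never enlarge the excess, so the same moves work with a bound raised by
  \<open>d\<close>.\<close>

definition slack where
 "slack d X = {(s, c). EX c'. (s, c') : X & (ALL i:I. c i <= c' i + (d::nat))}"

lemma slackI: "(s, c') : X ==> (!!i. i : I ==> c i <= c' i + d) ==> (s, c) : slack d X"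
 unfolding slack_def by blast

lemma safe_slack:
 assumes X: "safe mv R G I k E X" and s: "(s, c) : slack d X"
 shows "(ALL i:I. c i <= k + d) & (EX A:mv s. ALL t:A. t : E | (t, upd R G c t) : slack d X)"
proof -
 from s obtain c' where c': "(s, c') : X" "!!i. i : I ==> c i <= c' i + d" by (auto simp: slack_def)
 with X obtain A where A: "ALL i:I. c' i <= k" "A : mv s" "ALL t:A. t : E | (t, upd R G c' t) : X"
  unfolding safe_def by blast
 have "(t, upd R G c t) : slack d X" if "(t, upd R G c' t) : X" for t
  by (rule slackI[OF that], rule upd_mono, rule c'(2))
 with A c'(2) show ?thesis by (meson add_le_mono1 le_trans)
qed

text \<open>If some state of \<open>W - Z\<close> has a move entirely into \<open>Z\<close>, it is
  added. Otherwise a winning strategy can be followed for ever inside \<open>W - Z\<close>, against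
  an opponent who stays there. If \<open>R i\<close> could be met again after all of these
  histories, some branch would contain infinitely many requests of \<open>i\<close> but no grant,
  since the grants of \<open>i\<close> in \<open>W\<close> lie in \<open>Z\<close>. So after some
  history \<open>R i\<close> is avoided while the play stays in \<open>W - Z\<close>, and there the
  remaining pairs are served by the induction hypothesis.\<close>

lemma settled_grow:
 assumes i: "i : I" and Z: "settled i Z k" "Z ~= W"
 shows "EX Z'. Z \<subset> Z' & settled i Z' (k + (b + 1))"
proof -
 let ?E = "W \<inter> G i"
 from Z obtain X where X: "safe mv R G I k ?E X" "!!s. s : Z - ?E ==> (s, start_count R G s) : X"
  and ZW: "?E <= Z" "Z <= W" by (auto simp: settled_def)
 define Y where "Y = W - Z"
 have ZY: "t : Z | t : Y" if "t : W" for t using that by (auto simp: Y_def)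
 have zero: "!!d. start_count R G t i <= start_count R G t i + d" for t i by simp
 show ?thesis
 proof (cases "EX s:Y. EX A:mv s. A <= Z")
  case True
  then obtain s A where s: "s : Y" "A : mv s" "A <= Z" by blast
  let ?X = "insert (s, start_count R G s) (slack (b + 1) X)"
  have "safe mv R G I (k + (b + 1)) ?E ?X"
   unfolding safe_def
  proof (clarify, intro conjI)
   fix t c assume tc: "(t, c) : ?X"
   show "ALL i:I. c i <= k + (b + 1)"
   proof (cases "(t, c) : slack (b + 1) X")
    case True
    from safe_slack[OF X(1) this] show ?thesis by (simp add: add.assoc)
   next
    case False
    thus ?thesis using tc by (auto simp: upd_def)
   qed
   show "EX A:mv t. ALL u:A. u : ?E | (u, upd R G c u) : ?X"
   proof (cases "(t, c) : slack (b + 1) X")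
    case True
    thus ?thesis using safe_slack[OF X(1) True] by blast
   next
    case False
    with tc have tc: "t = s" "c = start_count R G s" by auto
    have "u : ?E | (u, upd R G c u) : slack (b + 1) X" if "u : A" for u
    proof (cases "u : ?E")
     case False
     with that s X(2) have "(u, start_count R G u) : X" by blast
     hence "(u, upd R G c u) : slack (b + 1) X"
      by (rule slackI) (rule upd_mono, simp add: tc upd_def)
     thus ?thesis ..
    qed simp
    thus ?thesis using s(2) tc(1) by blast
   qed
  qed
  moreover have "(t, start_count R G t) : ?X" if "t : insert s Z - ?E" for t
  proof (cases "t = s")
   case False
   hence "(t, start_count R G t) : X" using that X(2) by blast
   hence "(t, start_count R G t) : slack (b + 1) X" by (rule slackI) simp
   thus ?thesis by blast
  qed simp
  ultimately have "settled i (insert s Z) (k + (b + 1))"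
   unfolding settled_def using s(1) ZW by (auto simp: Y_def)
  moreover have "Z \<subset> insert s Z" using s(1) by (auto simp: Y_def)
  ultimately show ?thesis by blast
 next
  case no: False
  \<comment> \<open>A play that leaves \<open>Y\<close> enters \<open>Z\<close>, where the known
    strategy takes over; hence only the part of a move inside \<open>Y\<close> matters. Moves that
    might meet \<open>R i\<close> in \<open>Y\<close> are discarded.\<close>
  define mv1 where "mv1 s = (if s : Y - R i then {A \<inter> Y | A. A : mv s & A <= W & A \<inter> Y \<inter> R i = {}} else {})" for s
  have "A <= S" if "A : mv1 s" for s A using that by (auto simp: mv1_def Y_def W_def split: if_splits)
  then obtain X1 where "safe mv1 R G (I - {i}) b {} X1 &
   (ALL s:S. wins mv1 R G (I - {i}) s --> (s, start_count R G s) : X1)"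
   using IH[OF i, of mv1] by (elim exE meta_impE) auto
  hence X1: "safe mv1 R G (I - {i}) b {} X1"
   "!!s. s : S ==> wins mv1 R G (I - {i}) s ==> (s, start_count R G s) : X1" by blast+
  define W1 where "W1 = {s : Y - R i. wins mv1 R G (I - {i}) s}"
  obtain y where y: "y : Y" using Z ZW by (auto simp: Y_def)
  have "EX t. t : W1"
  proof -
   from y have "wins mv R G I y" by (simp add: Y_def W_def)
   then obtain H where H: "wins_by mv R G I H y" by (auto simp: wins_def)
   note HD = wins_byD[OF H]
   define HY where "HY = {h : H. set h <= Y & hd h = y}"
   have HYp: "h : HY" if "h @ [t] : HY" "h ~= []" for h t
    using that HD(2) by (auto simp: HY_def)
   have yHY: "[y] : HY" using HD(1) y by (simp add: HY_def)
   have sub: "A <= W" if "h : HY" "A : mv (last h)" "!!t. t : A ==> h @ [t] : H" for h A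
   proof
    fix t assume t: "t : A"
    have "h ~= []" using HD(3) that(1) by (auto simp: HY_def)
    hence "hd (h @ [t]) = y" using that(1) by (simp add: HY_def)
    from wins_subtree[OF H that(3)[OF t] this] S(2)[OF that(2)] t show "t : W" by (auto simp: W_def)
   qed
   have step: "EX t. h @ [t] : HY" if h: "h : HY" for h
   proof -
    have hn: "h ~= []" using HD(3) h by (auto simp: HY_def)
    have "h : H" using h by (simp add: HY_def)
    from HD(4)[OF this] obtain A where A: "A : mv (last h)" "!!t. t : A ==> h @ [t] : H" by blast
    have "last h : Y" using h hn by (auto simp: HY_def)
    with no A(1) have "~ A <= Z" by blast
    with sub[OF h A] obtain t where "t : A" "t : Y" using ZY by blast
    thus ?thesis using A(2) h hn by (intro exI[of _ t]) (auto simp: HY_def)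
   qed
   have "EX h:HY. ~ (EX g. g ~= [] & h @ g : HY & last g : R i)"
   proof (rule ccontr)
    assume "~ ?thesis"
    hence ext: "!!h. h : HY ==> EX g. g ~= [] & h @ g : HY & last g : R i" by blast
    obtain rh where r: "rh 0 = y" "!!n. map rh [0..<Suc n] : HY"
     "ALL m. EX n>=m. rh n : R i"
     by (rule infinite_branch[of HY y "R i"], erule (1) HYp, rule yHY, erule ext, blast)
    have "streett R G I rh" using r(2) by (intro HD(5) r(1)) (simp add: HY_def)
    with r(3) i obtain n where "rh n : G i" unfolding streett_def by blast
    moreover have "rh n : Y" using r(2)[of n] by (simp add: HY_def)
    ultimately show False using ZW by (auto simp: Y_def)
   qed
   then obtain h where h: "h : HY" "!!g. g ~= [] ==> h @ g : HY ==> last g \<notin> R i" by blast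
   from step[OF h(1)] obtain t where t: "h @ [t] : HY" by blast
   have hn: "h ~= []" using HD(3) h by (auto simp: HY_def)
   have "wins_by mv1 R G (I - {i}) {g. g ~= [] & hd g = t & h @ g : H & h @ g : HY} t"
   proof (rule wins_by_subtree[OF H])
    show "h @ [t] : H" "hd (h @ [t]) = y" "h @ [t] : HY" using t by (auto simp: HY_def)
    show "h @ g : HY" if "h @ g @ [u] : HY" for g u
     using HYp[of "h @ g" u] that hn by simp
    fix g A assume g: "h @ g : HY" "g ~= []" and A: "A : mv (last g)" "!!u. u : A ==> (h @ g) @ [u] : H"
    have eq: "{u : A. h @ g @ [u] : HY} = A \<inter> Y"
     using A(2) g hn by (auto simp: HY_def)
    have "A <= W" using sub[of "h @ g" A] g A by simp
    moreover have "A \<inter> Y \<inter> R i = {}" using h(2)[of "g @ [u]" for u] eq by auto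
    moreover have "last g : Y - R i" using h(2)[OF g(2,1)] g by (auto simp: HY_def)
    ultimately show "{u : A. h @ g @ [u] : HY} : mv1 (last g)" using A(1) unfolding eq mv1_def by auto
   qed auto
   moreover have "t : Y - R i" using t h(2)[of "[t]"] by (auto simp: HY_def)
   ultimately show ?thesis unfolding W1_def wins_def by blast
  qed
  then obtain t0 where t0: "t0 : W1" ..
  \<comment> \<open>The induction hypothesis says nothing about counter \<open>i\<close>. It stays 0
    here because \<open>R i\<close> is avoided.\<close>
  define X1' where "X1' = {(t, c) : X1. c i = 0}"
  let ?X = "X1' \<union> slack (b + 1) X"
  have "safe mv R G I (k + (b + 1)) ?E ?X"
   unfolding safe_def
  proof (clarify, intro conjI)
   fix t c assume tc: "(t, c) : ?X"
   have cb: "c j <= b" if "(t, c) : X1'" "j : I" for j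
    using that X1(1) by (cases "j = i") (auto simp: X1'_def safe_def)
   show "ALL i:I. c i <= k + (b + 1)"
    using tc safe_slack[OF X(1), of t c "b + 1"] cb by fastforce
   show "EX A:mv t. ALL u:A. u : ?E | (u, upd R G c u) : ?X"
   proof (cases "(t, c) : slack (b + 1) X")
    case True
    thus ?thesis using safe_slack[OF X(1) True] by blast
   next
    case False
    with tc have tc: "(t, c) : X1'" by auto
    then obtain B where B: "B : mv1 t" "ALL u:B. (u, upd R G c u) : X1"
     using X1(1) unfolding X1'_def safe_def by blast
    then obtain A where A: "B = A \<inter> Y" "A : mv t" "A <= W" "A \<inter> Y \<inter> R i = {}"
     by (auto simp: mv1_def split: if_splits)
    have "u : ?E | (u, upd R G c u) : ?X" if u: "u : A" for u
    proof (cases "u : Y")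
     case True
     hence "(u, upd R G c u) : X1" "u \<notin> R i" using u A B by auto
     hence "(u, upd R G c u) : X1'" using tc by (simp add: X1'_def upd_def)
     thus ?thesis by blast
    next
     case False
     hence uZ: "u : Z" using u A(3) ZY by blast
     show ?thesis
     proof (cases "u : ?E")
      case False
      with X(2) uZ have "(u, start_count R G u) : X" by blast
      hence "(u, upd R G c u) : slack (b + 1) X"
      proof (rule slackI)
       fix j assume "j : I"
       hence "c j <= b" by (rule cb[OF tc])
       thus "upd R G c u j <= start_count R G u j + (b + 1)" by (intro upd_mono) simp
      qed
      thus ?thesis by blast
     qed simp
    qed
    thus ?thesis using A(2) by blast
   qed
  qed
  moreover have "(t, start_count R G t) : ?X" if "t : Z \<union> W1 - ?E" for t
  proof (cases "t : W1")
   case True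
   hence "(t, start_count R G t) : X1" by (intro X1(2)) (auto simp: W1_def Y_def W_def)
   moreover have "start_count R G t i = 0" using True by (auto simp: W1_def upd_def)
   ultimately show ?thesis by (simp add: X1'_def)
  next
   case False
   hence "(t, start_count R G t) : X" using that X(2) by blast
   hence "(t, start_count R G t) : slack (b + 1) X" by (rule slackI) simp
   thus ?thesis by blast
  qed
  ultimately have "settled i (Z \<union> W1) (k + (b + 1))"
   unfolding settled_def using ZW by (auto simp: W1_def Y_def)
  moreover have "Z \<subset> Z \<union> W1" using t0 by (auto simp: W1_def Y_def)
  ultimately show ?thesis by blast
 qed
qed

text \<open>Starting from the grants themselves with bound 0, every enlargement adds a state and
  raises the bound by \<open>b + 1\<close>.\<close>

lemma settled_all:
 assumes i: "i : I"
 shows "EX k <= card S * (b + 1). settled i W k"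
proof -
 have "settled i Z k ==> EX k' <= k + card (W - Z) * (b + 1). settled i W k'" for Z k
 proof (induction "card (W - Z)" arbitrary: Z k rule: less_induct)
  case less
  show ?case
  proof (cases "Z = W")
   case True
   thus ?thesis using less.prems by auto
  next
   case False
   from settled_grow[OF i less.prems False] obtain Z' where
    Z': "Z \<subset> Z'" "settled i Z' (k + (b + 1))" by blast
   have fin: "finite W" using S(1) by (simp add: W_def)
   have "Z' <= W" using Z'(2) by (simp add: settled_def)
   hence lt: "card (W - Z') < card (W - Z)" using Z'(1) fin by (intro psubset_card_mono) auto
   from less.hyps[OF lt Z'(2)] obtain k' where
    k': "k' <= k + (b + 1) + card (W - Z') * (b + 1)" "settled i W k'" by blast
   have "Suc (card (W - Z')) * (b + 1) <= card (W - Z) * (b + 1)" using lt by (intro mult_le_mono1) simp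
   hence "k' <= k + card (W - Z) * (b + 1)" using k'(1) by simp
   thus ?thesis using k'(2) by blast
  qed
 qed
 moreover have "settled i (W \<inter> G i) 0"
  unfolding settled_def by (intro conjI exI[of _ "{}"]) (auto simp: safe_def)
 ultimately obtain k' where "k' <= 0 + card (W - W \<inter> G i) * (b + 1)" "settled i W k'" by blast
 moreover have "card (W - W \<inter> G i) <= card S" using S(1) by (intro card_mono) (auto simp: W_def)
 ultimately show ?thesis by (metis add_0 le_trans mult_le_mono1)
qed

text \<open>Number of completed phases since the last completion of phase \<open>l\<close>, during phase \<open>j\<close> of a
 round of \<open>M\<close> phases.\<close>

definition lag :: "nat => nat => nat => nat" where
 "lag M j l = (if l < j then j - 1 - l else j + M - 1 - l)"

lemma lag_next:
 assumes "j < M" "l < M"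
 shows "lag M (if Suc j = M then 0 else Suc j) l = (if l = j then 0 else lag M j l + 1)"
 using assms by (auto simp: lag_def)

lemma lag_le: "j < M ==> l < M ==> lag M j l <= M - 1"
 by (auto simp: lag_def)

text \<open>Phase \<open>j\<close> waits for a grant of \<open>e j\<close> with counters restarted
  at its beginning. A true counter was 0 when its own phase was last completed, and each later phase
  has added at most \<open>k + 1\<close>, so it exceeds the restarted counter by at most
  \<open>k + 1\<close> times \<open>lag\<close>.\<close>

lemma combine_phases:
 assumes fin: "finite I" and ne: "I ~= {}"
 shows "EX X. safe mv R G I (card I * (card S * (b + 1) + 1)) {} X &
   (ALL s:W. (s, start_count R G s) : X)"
proof -
 define M where "M = card I"
 have M: "M > 0" using fin ne by (simp add: M_def card_gt_0_iff)
 obtain e where e: "bij_betw e {0..<M} I" using ex_bij_betw_nat_finite[OF fin] by (auto simp: M_def)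
 have eI: "e j : I" if "j < M" for j using that e by (auto simp: bij_betw_def)
 have Ie: "EX j<M. i = e j" if "i : I" for i using that e by (auto simp: bij_betw_def)
 have einj: "e j = e l \<longleftrightarrow> j = l" if "j < M" "l < M" for j l
  using that e by (auto simp: bij_betw_def inj_on_def)
 define k where "k = card S * (b + 1)"
 have "EX X. safe mv R G I k (W \<inter> G (e j)) X & (ALL s:W - W \<inter> G (e j). (s, start_count R G s) : X)" if "j < M" for j
 proof -
  from settled_all[OF eI[OF that]] obtain k' X where X: "k' <= k" "safe mv R G I k' (W \<inter> G (e j)) X"
   "ALL s:W - W \<inter> G (e j). (s, start_count R G s) : X" by (auto simp: settled_def k_def)
  have "safe mv R G I k (W \<inter> G (e j)) X" using X(1,2) unfolding safe_def by fastforce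
  with X(3) show ?thesis by blast
 qed
 then obtain X where X: "!!j. j < M ==> safe mv R G I k (W \<inter> G (e j)) (X j)"
  "!!j s. j < M ==> s : W ==> s \<notin> G (e j) ==> (s, start_count R G s) : X j"
  by (metis Diff_iff Int_iff)
 \<comment> \<open>The bound \<open>k + 1\<close> covers the arrival at a granting state: the last
   step from \<open>X j\<close> may itself be a request of another pair.\<close>
 define T where "T j = X j \<union> {(s, c). s : W \<inter> G (e j) & (ALL i:I. c i <= k + 1)}" for j
 \<comment> \<open>Here \<open>c\<close> is the true counter and \<open>c'\<close> the one restarted
   in phase \<open>j\<close>. When the grant of phase \<open>j\<close> is present, the true counter
   of \<open>e j\<close> is 0, so its lag may start afresh.\<close>
 define XX where "XX = {(s, c). EX j<M. EX c'. (s, c') : T j & (s : G (e j) --> c (e j) = 0) &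
  (ALL l<M. c (e l) <= c' (e l) + (k + 1) * lag M j l)}"
 have start: "(s, start_count R G s) : T j" if "j < M" "s : W" for s j
  using X(2)[OF that] that by (cases "s : G (e j)") (auto simp: T_def upd_def)
 have enter: "(t, upd R G c t) : XX" if j: "j < M" and t: "t : W" and c: "!!l. l < M ==> c (e l) <= (k + 1) * lag M j l" for t c j
 proof -
  have "upd R G c t (e l) <= start_count R G t (e l) + (k + 1) * lag M j l" if "l < M" for l
   by (rule upd_mono) (use c[OF that] in simp)
  moreover have "t : G (e j) ==> upd R G c t (e j) = 0" by (simp add: upd_def)
  ultimately show ?thesis unfolding XX_def using start[OF j t] j by blast
 qed
 have "safe mv R G I (M * (k + 1)) {} XX"
  unfolding safe_def
 proof (clarify, intro conjI)
  fix s c assume "(s, c) : XX"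
  then obtain j c' where j: "j < M" and c': "(s, c') : T j" and z: "s : G (e j) ==> c (e j) = 0"
   and le: "!!l. l < M ==> c (e l) <= c' (e l) + (k + 1) * lag M j l" by (auto simp: XX_def)
  have c'b: "c' i <= k + 1" if "i : I" for i
   using c' X(1)[OF j] that unfolding T_def safe_def by fastforce
  show "ALL i:I. c i <= M * (k + 1)"
  proof
   fix i assume "i : I"
   then obtain l where l: "l < M" "i = e l" using Ie by blast
   have "c i <= (k + 1) + (k + 1) * (M - 1)"
    using le[OF l(1)] c'b[OF \<open>i : I\<close>] mult_le_mono2[OF lag_le[OF j l(1)], of "k + 1"]
    unfolding l(2) by (meson add_mono le_trans)
   also have "... = M * (k + 1)" using M by (cases M) auto
   finally show "c i <= M * (k + 1)" .
  qed
  show "EX A:mv s. ALL t:A. t : {} | (t, upd R G c t) : XX"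
  proof (cases "s : W \<inter> G (e j)")
   case True
   then obtain A where A: "A : mv s" "A <= W" using W_move by blast
   let ?j = "if Suc j = M then 0 else Suc j"
   have j': "?j < M" using j by auto
   have "c (e l) <= (k + 1) * lag M ?j l" if l: "l < M" for l
   proof (cases "l = j")
    case True
    thus ?thesis using z \<open>s : W \<inter> G (e j)\<close> by simp
   next
    case False
    thus ?thesis using le[OF l] c'b[OF eI[OF l]] unfolding lag_next[OF j l] by (simp add: algebra_simps)
   qed
   from enter[OF j' _ this] A show ?thesis by blast
  next
   case False
   hence "(s, c') : X j" using c' by (auto simp: T_def)
   then obtain A where A: "A : mv s" "ALL t:A. t : W \<inter> G (e j) | (t, upd R G c' t) : X j" and ck: "ALL i:I. c' i <= k"
    using X(1)[OF j] unfolding safe_def by blast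
   have "(t, upd R G c t) : XX" if t: "t : A" for t
   proof -
    have "upd R G c' t i <= k + 1" if "i : I" for i
     using ck that upd_le_Suc[of R G c' t i] by (metis Suc_eq_plus1 Suc_le_mono le_trans)
    hence "(t, upd R G c' t) : T j" using A(2) t by (auto simp: T_def)
    moreover have "upd R G c t (e l) <= upd R G c' t (e l) + (k + 1) * lag M j l" if "l < M" for l
     by (rule upd_mono, rule le[OF that])
    moreover have "t : G (e j) ==> upd R G c t (e j) = 0" by (simp add: upd_def)
    ultimately show ?thesis unfolding XX_def using j by blast
   qed
   thus ?thesis using A(1) by blast
  qed
 qed
 moreover have "(s, start_count R G s) : XX" if "s : W" for s
  by (rule enter[OF M that]) simp
 ultimately show ?thesis unfolding M_def k_def by blast
qed

end

text \<open>The first player can bound all counters if he wins at all: he serves the pairs in turn, and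
 while waiting for \<open>G i\<close> he follows a strategy for the remaining pairs inside the region where
 \<open>R i\<close> can be avoided.\<close>

theorem streett_bounded:
 assumes "finite S" "!!s A. A : mv s ==> A <= S" "finite I"
 shows "EX X. safe mv R G I (streett_bound (card S) (card I)) {} X &
  (ALL s:S. wins mv R G I s --> (s, start_count R G s) : X)"
 using assms(2,3)
proof (induction "card I" arbitrary: mv I)
 case 0
 hence I: "I = {}" by simp
 let ?X = "{(s, c). wins mv R G I s}"
 have "EX A:mv s. ALL t:A. wins mv R G I t" if "wins mv R G I s" for s
 proof -
  from that obtain H where H: "wins_by mv R G I H s" by (auto simp: wins_def)
  from wins_byD(4)[OF H wins_byD(1)[OF H]] obtain A where A: "A : mv s" "!!t. t : A ==> [s] @ [t] : H" by auto
  thus ?thesis using wins_subtree[OF H A(2)] by auto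
 qed
 thus ?case by (intro exI[of _ ?X]) (auto simp: safe_def I)
next
 case (Suc m)
 have ne: "I ~= {}" using Suc.hyps(2) by auto
 interpret streett_step mv R G I S "streett_bound (card S) m"
 proof
  fix mv' :: "'a => 'a set set" and i assume i: "i : I" and mv': "!!s A. A : mv' s ==> A <= S"
  have m: "m = card (I - {i})" using Suc.hyps(2) i Suc.prems(2) by simp
  from Suc.hyps(1)[OF m mv' finite_Diff[OF Suc.prems(2)]] show "EX X. safe mv' R G (I - {i}) (streett_bound (card S) m) {} X &
   (ALL s:S. wins mv' R G (I - {i}) s --> (s, start_count R G s) : X)" by (simp only: m[symmetric])
 qed (use assms Suc.prems in auto)
 have "streett_bound (card S) (card I) = card I * (card S * (streett_bound (card S) m + 1) + 1)"
  unfolding Suc.hyps(2)[symmetric] by simp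
 with combine_phases[OF Suc.prems(2) ne] show ?case by (auto simp: W_def)
qed

text \<open>Staying inside the safe set is a strategy with the counters as memory. If some pair were
  requested infinitely often with grants ceasing, its counter would eventually exceed
  \<open>k\<close>.\<close>

lemma safe_wins:
 assumes X: "safe mv R G I k {} X" and s: "(s, start_count R G s) : X"
 shows "wins mv R G I s"
proof -
 have "ALL p:X. EX A. A : mv (fst p) & (ALL t:A. (t, upd R G (snd p) t) : X)"
  using X unfolding safe_def by fastforce
 then obtain pick where pick: "!!p. p : X ==> pick p : mv (fst p) & (ALL t:pick p. (t, upd R G (snd p) t) : X)"
  by metis
 define cnt where "cnt h = fold (%t c. upd R G c t) h (%_. 0)" for h
 define H where "H = {h. h ~= [] & hd h = s &
   (ALL g t u. h = g @ [t] | (EX r. h = g @ [t] @ r) --> g ~= [] --> t : pick (last g, cnt g))}"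
 have Hp: "h : H" if "h @ [t] : H" "h ~= []" for h t
  using that unfolding H_def by (auto simp: hd_append)
 have inX: "(last h, cnt h) : X" if "h : H" for h
  using that
 proof (induction h rule: rev_induct)
  case (snoc t h)
  show ?case
  proof (cases "h = []")
   case True
   thus ?thesis using snoc.prems s by (simp add: H_def cnt_def)
  next
   case False
   from snoc.IH[OF Hp[OF snoc.prems False]] have "(last h, cnt h) : X" .
   moreover have "t : pick (last h, cnt h)" using snoc.prems False unfolding H_def by blast
   ultimately show ?thesis using pick[of "(last h, cnt h)"] by (simp add: cnt_def)
  qed
 qed (simp add: H_def)
 have "wins_by mv R G I H s"
  unfolding wins_by_def
 proof (intro conjI allI ballI impI)
  show "[s] : H" by (auto simp: H_def Cons_eq_append_conv)
  show "h = [] | h : H" if "h @ [t] : H" for h t using Hp[OF that] by blast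
  show "h ~= []" if "h : H" for h using that by (simp add: H_def)
  show "EX A:mv (last h). ALL t:A. h @ [t] : H" if h: "h : H" for h
  proof -
   have "h @ [t] : H" if t: "t : pick (last h, cnt h)" for t
   proof -
    have "u : pick (last g, cnt g)" if "h @ [t] = g @ [u] @ r" "g ~= []" for g u r
    proof (cases r rule: rev_cases)
     case Nil
     thus ?thesis using that t by auto
    next
     case (snoc r' v)
     hence "h = g @ [u] @ r'" using that(1) by simp
     thus ?thesis using h that(2) unfolding H_def by blast
    qed
    thus ?thesis using h unfolding H_def by (auto simp: hd_append)
   qed
   thus ?thesis using pick[OF inX[OF h]] by auto
  qed
  fix rh assume r: "ALL n. map rh [0..<Suc n] : H"
  define c where "c n = cnt (map rh [0..<Suc n])" for n
  have cS: "c (Suc n) = upd R G (c n) (rh (Suc n))" for n by (simp add: c_def cnt_def)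
  have ck: "c n i <= k" if "i : I" for n i
   using inX[OF r[rule_format, of n]] X that unfolding safe_def c_def by blast
  show "streett R G I rh"
   unfolding streett_def
  proof (intro ballI impI, rule ccontr)
   fix i assume i: "i : I" and inf: "ALL m. EX n>=m. rh n : R i" and "~ (ALL m. EX n>=m. rh n : G i)"
   then obtain m where m: "!!n. n >= m ==> rh n \<notin> G i" by blast
   have "EX n>=m. b <= c n i" for b
   proof (induction b)
    case (Suc b)
    then obtain n where n: "n >= m" "b <= c n i" by blast
    from inf obtain n' where n': "n' >= Suc n" "rh n' : R i" by blast
    then obtain j where j: "n' = Suc j" "n <= j" by (cases n') auto
    have mono: "c n i <= c (n + d) i" for d
    proof (induction d)
     case (Suc d)
     have "c (n + d) i <= c (Suc (n + d)) i" using m[of "Suc (n + d)"] n(1) unfolding cS by (simp add: upd_def)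
     with Suc show ?case by simp
    qed simp
    have "c n i <= c j i" using mono[of "j - n"] j by simp
    moreover have "c n' i = Suc (c j i)" unfolding j(1) cS using m[of n'] n' n(1) j by (simp add: upd_def)
    ultimately have "Suc b <= c n' i" using n(2) by simp
    thus ?case using n'(1) n(1) by (intro exI[of _ n']) auto
   qed auto
   from this[of "Suc k"] ck[OF i] show False by (meson Suc_n_not_le_n le_trans)
  qed
 qed
 thus ?thesis unfolding wins_def by blast
qed

section \<open>Subgame perfect equilibria as strategies in a Streett game\<close>

text \<open>The highest priority seen infinitely often is not exceeded infinitely often, so if every
  priority of the wrong parity is, the highest one has the right parity. This holds for acceptance
  and rejection alike, so both outcomes of an automaton are Streett conditions.\<close>

lemma parity_streett:
 fixes x :: "nat => nat"
 assumes fin: "finite (range x)"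
 shows "even (Max (limit x)) = b \<longleftrightarrow>
  (ALL c. even c ~= b --> (ALL m. EX n>=m. x n = c) --> (ALL m. EX n>=m. c < x n))"
proof -
 have lim: "c : limit x \<longleftrightarrow> (ALL m. EX n>=m. x n = c)" for c
  by (auto simp: limit_def INFM_nat_le)
 have flim: "finite (limit x)" using fin limit_in_range by (rule finite_subset[rotated])
 have ne: "limit x ~= {}" using limit_nonempty[OF fin] by blast
 let ?M = "Max (limit x)"
 have M: "?M : limit x" using flim ne by (rule Max_in)
 have above: "~ (ALL m. EX n>=m. ?M < x n)"
 proof
  assume "ALL m. EX n>=m. ?M < x n"
  hence "INFM n. x n : {c : range x. ?M < c}" by (auto simp: INFM_nat_le)
  hence "limit x \<inter> {c : range x. ?M < c} ~= {}" using fin by (subst fin_ex_inf_eq_limit[symmetric]) simp_all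
  then obtain c where "c : limit x" "?M < c" by blast
  moreover from this have "c <= ?M" using flim by simp
  ultimately show False by simp
 qed
 show ?thesis
 proof
  assume b: "even ?M = b"
  show "ALL c. even c ~= b --> (ALL m. EX n>=m. x n = c) --> (ALL m. EX n>=m. c < x n)"
  proof (intro allI impI)
   fix c m assume c: "even c ~= b" "ALL m. EX n>=m. x n = c"
   hence "c <= ?M" using flim lim by simp
   with c(1) b have "c < ?M" by (metis le_neq_implies_less)
   thus "EX n>=m. c < x n" using M lim by metis
  qed
 next
  assume a: "ALL c. even c ~= b --> (ALL m. EX n>=m. x n = c) --> (ALL m. EX n>=m. c < x n)"
  show "even ?M = b" using a M above lim by blast
 qed
qed

type_synonym pstate = "nat \<times> nat list \<times> nat list \<times> nat list \<times> nat"

text \<open>Lookups use \<open>nthd\<close>, so that all functions below are computable on arbitrary arguments.\<close>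

definition player_at :: "instance_code => nat => player_code" where
 "player_at I i = nthd \<lparr>code_pref = [], code_automata = []\<rparr> (inst_players I) i"

definition auts :: "instance_code => (nat \<times> nat) list" where
 "auts I = concat (map (%i. map (%p. (i, p)) [0..<length (code_automata (player_at I i))])
   [0..<length (inst_players I)])"

definition aut_at :: "instance_code => nat => nat \<times> nat" where
 "aut_at I k = nthd (0, 0) (auts I) k"

definition aut_code :: "instance_code => nat => dpa_code" where
 "aut_code I k = nthd \<lparr>code_init = 0, code_table = [], code_prios = []\<rparr>
   (code_automata (player_at I (fst (aut_at I k)))) (snd (aut_at I k))"

definition step_states :: "instance_code => nat list => nat => nat list" where
 "step_states I qs v = map (%k. nthd 0 (nthd [] (code_table (aut_code I k)) (nthd 0 qs k)) v) [0..<length (auts I)]"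

definition start_states :: "instance_code => nat list" where
 "start_states I = map (%k. code_init (aut_code I k)) [0..<length (auts I)]"

text \<open>Automaton \<open>k\<close> is flagged when its payoff is preferred, by its player, to some payoff announced
 since the last deviation of another player.\<close>

definition flag_bad :: "instance_code => nat list => nat => nat list => nat list" where
 "flag_bad I bs i ws = map (%k. case aut_at I k of (j, p) =>
   if (j = i & nthd 0 bs k = 1) | (nthd 0 ws j, p) : set (code_pref (player_at I j)) then 1 else 0)
   [0..<length (auts I)]"

definition profiles :: "instance_code => nat list set" where
 "profiles I = {ws. length ws = length (inst_players I) & (ALL i<length (inst_players I). ws ! i < num_payoffs I i)}"

definition words_below :: "nat => nat => nat list set" where
 "words_below M l = {xs. length xs = l & set xs <= {..<M}}"

text \<open>One common bound \<open>M\<close> for all entries turns the state set into a box: it is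
  easy to enumerate and its size is a product of powers.\<close>

definition pstates :: "instance_code => nat => pstate set" where
 "pstates I M = {..<M} \<times> words_below M (length (auts I)) \<times> words_below M (length (inst_players I)) \<times>
   words_below M (length (auts I)) \<times> {..M}"

text \<open>The first player (the prover) announces payoffs and proposes a successor; the second player
 accepts the proposal or lets the owner of the vertex deviate, whereupon the prover announces new
 payoffs.  The last component of a state is \<open>Suc i\<close> after a deviation of player \<open>i\<close> and 0
 otherwise.\<close>

definition accept :: "instance_code => pstate => nat => pstate" where
 "accept I = (%(v, qs, ws, bs, f) u. (u, step_states I qs v, ws, bs, 0))"

definition deviate :: "instance_code => pstate => nat => nat list => pstate" where
 "deviate I = (%(v, qs, ws, bs, f) u ws'.
   (u, step_states I qs v, ws', flag_bad I bs (nthd 0 (inst_owner I) v) ws', Suc (nthd 0 (inst_owner I) v)))"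

text \<open>A move is the set of states left to the challenger. Further members of \<open>A\<close>
  only widen the challenger's choice, so requiring certain members is enough.\<close>

definition pmoves :: "instance_code => nat => pstate => pstate set set" where
 "pmoves I M s = {A. A <= pstates I M & (EX u. (fst s, u) : set (inst_edges I) & accept I s u : A &
   (ALL u'. (fst s, u') : set (inst_edges I) & u' ~= u --> (EX ws:profiles I. deviate I s u' ws : A)))}"

definition pstart :: "instance_code => nat list => pstate" where
 "pstart I ws = (inst_start I, start_states I, ws, flag_bad I (replicate (length (auts I)) 0) 0 ws, 0)"

definition prio_at :: "instance_code => nat => nat list => nat" where
 "prio_at I k qs = nthd 0 (code_prios (aut_code I k)) (nthd 0 qs k)"

text \<open>For \<open>b = True\<close> the pairs say that the announced payoff comes true: its
  automaton has to accept unless deviations go on for ever. For \<open>b = False\<close> they say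
  that a flagged automaton has to reject unless players other than its own deviate for ever. In both
  cases \<open>c\<close> is a priority of the wrong parity, to be answered by a higher one or by
  such a deviation.\<close>

definition request :: "instance_code => bool \<times> nat \<times> nat => pstate set" where
 "request I = (%(b, k, c). {(v, qs, ws, bs, f). prio_at I k qs = c & even c ~= b &
   (if b then nthd 0 ws (fst (aut_at I k)) = snd (aut_at I k) else nthd 0 bs k = 1)})"

definition grant :: "instance_code => bool \<times> nat \<times> nat => pstate set" where
 "grant I = (%(b, k, c). {(v, qs, ws, bs, f). c < prio_at I k qs |
   (f ~= 0 & (b | f ~= Suc (fst (aut_at I k))))})"

definition pair_index :: "instance_code => (bool \<times> nat \<times> nat) set" where
 "pair_index I = {(b, k, c). k < length (auts I) & c : set (code_prios (aut_code I k))}"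

section \<open>Runs of the automata of an instance\<close>

locale instance_data =
 fixes I :: instance_code
begin

abbreviation "G \<equiv> game_of I"
abbreviation "np \<equiv> length (inst_players I)"
abbreviation "own v \<equiv> inst_owner I ! v"
abbreviation "E \<equiv> set (inst_edges I)"
abbreviation "m \<equiv> length (auts I)"
abbreviation "pl k \<equiv> fst (aut_at I k)"
abbreviation "po k \<equiv> snd (aut_at I k)"

lemma G_simps [simp]: "verts G = {..<length (inst_owner I)}" "edges G = E" "players G = {..<np}"
 "owned G i = {v. v < length (inst_owner I) & own v = i}"
 "payoffs G i = {..<num_payoffs I i}" "pref G i = set (code_pref (inst_players I ! i))"
 by (simp_all add: game_of_def)

lemma player_at [simp]: "i < np ==> player_at I i = inst_players I ! i"
 by (simp add: player_at_def)

lemma auts_nth: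
 assumes "k < m"
 shows "pl k < np" "po k < num_payoffs I (pl k)"
proof -
 have "aut_at I k : set (auts I)" using assms by (simp add: aut_at_def)
 thus "pl k < np" "po k < num_payoffs I (pl k)" by (auto simp: auts_def num_payoffs_def)
qed

lemma auts_ex: "i < np ==> p < num_payoffs I i ==> EX k<m. aut_at I k = (i, p)"
proof -
 assume "i < np" "p < num_payoffs I i"
 hence "(i, p) : set (auts I)" unfolding auts_def set_concat set_map
  by (intro UN_I[of "map (%p. (i, p)) [0..<num_payoffs I i]"]) (auto simp: num_payoffs_def)
 thus ?thesis by (auto simp: in_set_conv_nth aut_at_def)
qed

lemma aut: "k < m ==> automaton I (pl k) (po k) = dpa_of (aut_code I k)"
 using auts_nth[of k] by (simp add: automaton_def aut_code_def num_payoffs_def)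

end

text \<open>Only the syntax of the automata is assumed, so that these facts are also available to
  the test whether the payoffs are well defined at all.\<close>

locale wf_automata = instance_data +
 assumes codes_wf: "!!P C. P : set (inst_players I) ==> C : set (code_automata P) ==>
  wf_dpa_code (length (inst_owner I)) C"
begin

lemma aut_wf:
 assumes "k < m"
 shows "wf_dpa_code (length (inst_owner I)) (aut_code I k)"
proof -
 have "inst_players I ! pl k : set (inst_players I)" using auts_nth[OF assms] by simp
 moreover have "aut_code I k : set (code_automata (inst_players I ! pl k))"
  using auts_nth[OF assms] by (simp add: aut_code_def num_payoffs_def)
 ultimately show ?thesis using codes_wf by blast
qed

lemma run_less:
 assumes "k < m" "w : omega_words (verts G)"
 shows "dpa_run (dpa_of (aut_code I k)) w n < length (code_table (aut_code I k))"
proof (induction n)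
 case 0
 thus ?case using aut_wf[OF assms(1)] by (simp add: wf_dpa_code_def wf_dpa_def dpa_of_def)
next
 case (Suc n)
 have "w n < length (inst_owner I)" using assms(2) by (auto simp: omega_words_def)
 thus ?case using aut_wf[OF assms(1)] Suc by (simp add: wf_dpa_code_def wf_dpa_def dpa_of_def)
qed

definition run_prio :: "nat => nat word => nat => nat" where
 "run_prio k w n = code_prios (aut_code I k) ! dpa_run (dpa_of (aut_code I k)) w n"

lemma run_prio_in:
 assumes "k < m" "w : omega_words (verts G)"
 shows "run_prio k w n : set (code_prios (aut_code I k))"
 using run_less[OF assms, of n] aut_wf[OF assms(1)] by (auto simp: run_prio_def wf_dpa_code_def)

lemma accepts_streett:
 assumes "k < m" "w : omega_words (verts G)"
 shows "dpa_accepts (dpa_of (aut_code I k)) w = b \<longleftrightarrow>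
  (ALL c. even c ~= b --> (ALL m. EX n>=m. run_prio k w n = c) --> (ALL m. EX n>=m. c < run_prio k w n))"
proof -
 have "finite (range (run_prio k w))"
  by (rule finite_subset[of _ "set (code_prios (aut_code I k))"]) (use run_prio_in[OF assms] in auto)
 moreover have "dpa_accepts (dpa_of (aut_code I k)) w = even (Max (limit (run_prio k w)))"
  by (simp add: dpa_accepts_def run_prio_def[abs_def] dpa_of_def)
 ultimately show ?thesis using parity_streett[of "run_prio k w" b] by simp
qed

abbreviation run_states :: "nat word => nat => nat list" where
 "run_states w n \<equiv> map (%k. dpa_run (dpa_of (aut_code I k)) w n) [0..<m]"

lemma run_states_0: "start_states I = run_states w 0"
 by (simp add: start_states_def dpa_of_def)

lemma run_states_Suc:
 assumes w: "w : omega_words (verts G)"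
 shows "step_states I (run_states w n) (w n) = run_states w (Suc n)"
proof -
 have "nthd 0 (nthd [] (code_table (aut_code I k)) (dpa_run (dpa_of (aut_code I k)) w n)) (w n)
  = dpa_run (dpa_of (aut_code I k)) w (Suc n)" if k: "k < m" for k
 proof -
  note r = run_less[OF k w, of n]
  have "length (code_table (aut_code I k) ! dpa_run (dpa_of (aut_code I k)) w n) = length (inst_owner I)"
   using aut_wf[OF k] r by (simp add: wf_dpa_code_def)
  moreover have "w n < length (inst_owner I)" using w by (auto simp: omega_words_def)
  ultimately show ?thesis using r by (simp add: dpa_of_def)
 qed
 thus ?thesis by (simp add: step_states_def del: dpa_run.simps)
qed

lemma prio_run_states:
 "w : omega_words (verts G) ==> k < m ==> prio_at I k (run_states w n) = run_prio k w n"
 using run_less[of k w n] aut_wf[of k]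
 by (simp add: prio_at_def run_prio_def wf_dpa_code_def)

end

lemma words_below_iff: "xs : words_below N l \<longleftrightarrow> length xs = l & (ALL k<l. xs ! k < N)"
 by (auto simp: words_below_def set_conv_nth)

lemma words_belowD: "xs : words_below N l ==> length xs = l"
 by (simp add: words_below_def)

locale instance_game = instance_data I for I +
 fixes M :: nat
 assumes valid: "valid_instance I"
  and M_verts: "length (inst_owner I) <= M" and M_players: "length (inst_players I) <= M" and M2: "2 <= M"
  and M_states: "!!k. k < length (auts I) ==> length (code_table (aut_code I k)) <= M"
  and M_payoffs: "!!i. i < length (inst_players I) ==> num_payoffs I i <= M"
begin

sublocale wf_automata I
 by unfold_locales (use valid in "auto simp: valid_instance_def")

lemma wf: "wf_arena G" "!!i w. i < np ==> w : omega_words (verts G) ==> pay G i w < num_payoffs I i"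
 using valid by (auto simp: valid_instance_def RP_game_def wf_game_def)

lemma edge_verts: "(u, v) : E ==> u < length (inst_owner I) & v < length (inst_owner I)"
 using wf(1) by (auto simp: wf_arena_def)

lemma edge_ex: "u < length (inst_owner I) ==> EX v. (u, v) : E"
 using wf(1) by (auto simp: wf_arena_def)

lemma own_less: "u < length (inst_owner I) ==> own u < np"
 using wf(1) by (auto simp: wf_arena_def set_eq_iff)

lemma accepts_iff:
 assumes "k < m" "w : omega_words (verts G)"
 shows "dpa_accepts (dpa_of (aut_code I k)) w \<longleftrightarrow> pay G (pl k) w = po k"
proof -
 have "dpa_language (verts G) (automaton I (pl k) (po k)) = pay_preimage G (pl k) (po k)"
  using valid auts_nth[OF assms(1)] by (simp add: valid_instance_def)
 thus ?thesis using assms(2) by (auto simp: aut[OF assms(1)] dpa_language_def pay_preimage_def)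
qed

lemma pay_streett:
 assumes "k < m" "w : omega_words (verts G)"
 shows "(pay G (pl k) w = po k) = b \<longleftrightarrow> (ALL c. even c ~= b --> (ALL m. EX n>=m. run_prio k w n = c) -->
  (ALL m. EX n>=m. c < run_prio k w n))"
 using accepts_streett[OF assms] accepts_iff[OF assms] by simp

lemma play_words: "play G pp ==> pp : omega_words (verts G)"
 by (simp add: play_def)

lemma play_less: "play G pp ==> pp n < length (inst_owner I)"
 by (auto simp: play_def omega_words_def)

lemma play_prefix_Hist:
 assumes "play G pp"
 shows "map pp [0..<Suc n] : Hist G (pp 0)"
proof -
 have "successively (%u u'. (u, u') : E) (map pp [0..<Suc n])"
  using assms by (auto simp: successively_conv_nth play_def simp del: upt_Suc)
 moreover have "set (map pp [0..<Suc n]) <= verts G" using play_less[OF assms] by auto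
 moreover have "hd (map pp [0..<Suc n]) = pp 0" by (simp add: hd_map del: upt_Suc)
 ultimately show ?thesis by (simp add: Hist_def history_def del: upt_Suc)
qed

lemma Hist_snoc:
 assumes "h ~= []"
 shows "h @ [u] : Hist G v \<longleftrightarrow> h : Hist G v & (last h, u) : E"
 using assms edge_verts by (auto simp: Hist_def history_def successively_append_iff)

lemma Hist_single: "[u] : Hist G v \<longleftrightarrow> u = v & v < length (inst_owner I)"
 by (auto simp: Hist_def history_def)

lemma play_of_prefixes:
 assumes "!!n. map pp [0..<Suc n] : Hist G v"
 shows "play G pp & pp 0 = v"
proof -
 have "(pp n, pp (Suc n)) : E" for n
  using assms[of "Suc n"] Hist_snoc[of "map pp [0..<Suc n]" "pp (Suc n)" v] by simp
 moreover have "pp n < length (inst_owner I)" for n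
  using assms[of n] by (auto simp: Hist_def history_def)
 ultimately show ?thesis using assms[of 0] by (auto simp: play_def omega_words_def Hist_single)
qed

lemma Hist_last: "h : Hist G v ==> last h < length (inst_owner I)"
 by (cases h rule: rev_cases) (auto simp: Hist_def history_def)

section \<open>Equilibria in terms of plays\<close>

definition follows :: "(nat => nat list => nat) => nat word => nat => bool" where
 "follows sg pp n \<longleftrightarrow> pp (Suc n) = sg (own (pp n)) (map pp [0..<Suc n])"

lemma consistent_iff:
 assumes "play G pp"
 shows "(ALL i:players G. consistent G i (sg i) pp) \<longleftrightarrow> (ALL n. follows sg pp n)"
 using play_less[OF assms] own_less by (auto simp: consistent_def follows_def simp del: upt_Suc)

lemma outcome_eqI:
 assumes "play G pp" "pp 0 = v" "!!n. follows sg pp n"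
 shows "outcome G sg v = pp"
 unfolding outcome_def
proof (rule the_equality)
 show "play G pp & pp 0 = v & (ALL i:players G. consistent G i (sg i) pp)"
  using assms consistent_iff by blast
 fix pp' assume a: "play G pp' & pp' 0 = v & (ALL i:players G. consistent G i (sg i) pp')"
 hence f: "!!n. follows sg pp' n" using consistent_iff by blast
 have "map pp' [0..<Suc n] = map pp [0..<Suc n]" for n
 proof (induction n)
  case 0
  thus ?case using a assms(2) by simp
 next
  case (Suc n)
  hence "pp' n = pp n" by simp
  with f[of n] assms(3)[of n] Suc have "pp' (Suc n) = pp (Suc n)" unfolding follows_def by metis
  with Suc show ?case by simp
 qed
 thus "pp' = pp" by (intro ext) (metis diff_zero length_upt less_Suc_eq nth_map_upt plus_nat.add_0 diff_Suc_1)
qed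

text \<open>The play that begins with \<open>h\<close> and then obeys the profile. Working with such
  plays of the whole game avoids shifted payoffs and restricted profiles;
  \<open>suffix_outcome\<close> makes the connection.\<close>

definition cont :: "(nat => nat list => nat) => nat list => nat word" where
 "cont sg h n = ((%h. h @ [sg (own (last h)) h]) ^^ Suc n) h ! n"

lemma cont_prefix:
 assumes "h ~= []"
 shows "map (cont sg h) [0..<length h + j] = ((%h. h @ [sg (own (last h)) h]) ^^ j) h"
proof -
 let ?f = "%h. h @ [sg (own (last h)) h]"
 have len: "length ((?f ^^ j) h) = length h + j" for j by (induction j) auto
 have ext: "EX g. (?f ^^ (j + d)) h = (?f ^^ j) h @ g" for j d by (induction d) auto
 have nth: "(?f ^^ j) h ! n = cont sg h n" if "n < length h + j" for n j
 proof (cases "j <= Suc n")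
  case True
  then obtain g where "(?f ^^ Suc n) h = (?f ^^ j) h @ g" using ext[of j "Suc n - j"] by auto
  thus ?thesis using that len[of j] unfolding cont_def by (simp add: nth_append del: funpow.simps)
 next
  case False
  then obtain g where "(?f ^^ j) h = (?f ^^ Suc n) h @ g" using ext[of "Suc n" "j - Suc n"] by auto
  thus ?thesis using len[of "Suc n"] unfolding cont_def by (simp add: nth_append del: funpow.simps)
 qed
 show ?thesis by (rule nth_equalityI) (use len nth in auto)
qed

lemma cont_follows:
 assumes "h ~= []" "length h <= Suc n"
 shows "follows sg (cont sg h) n"
proof -
 obtain j where j: "Suc n = length h + j" using assms(2) by (metis le_add_diff_inverse)
 let ?f = "%h. h @ [sg (own (last h)) h]"
 have "map (cont sg h) [0..<Suc (Suc n)] = ?f (map (cont sg h) [0..<Suc n])"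
  using cont_prefix[OF assms(1), of sg j] cont_prefix[OF assms(1), of sg "Suc j"] j by (simp del: upt_Suc)
 thus ?thesis by (simp add: follows_def)
qed

lemma cont_start: "h ~= [] ==> map (cont sg h) [0..<length h] = h"
 using cont_prefix[of h sg 0] by simp

lemma cont_eqI:
 assumes "h = map pp [0..<Suc n]" "!!k. k >= n ==> follows sg pp k"
 shows "cont sg h = pp"
proof -
 have "map (cont sg h) [0..<Suc n + j] = map pp [0..<Suc n + j]" for j
 proof (induction j)
  case 0
  thus ?case using cont_start[of h sg] assms(1) by simp
 next
  case (Suc j)
  have "follows sg (cont sg h) (n + j)" by (rule cont_follows) (use assms(1) in auto)
  moreover have "follows sg pp (n + j)" using assms(2) by simp
  moreover have "cont sg h (n + j) = pp (n + j)" using Suc by simp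
  moreover have "map (cont sg h) [0..<Suc (n + j)] = map pp [0..<Suc (n + j)]" using Suc by simp
  ultimately have "cont sg h (Suc (n + j)) = pp (Suc (n + j))" unfolding follows_def by metis
  thus ?case using Suc by simp
 qed
 hence "map (cont sg h) [0..<Suc n + j] ! j = map pp [0..<Suc n + j] ! j" for j by metis
 thus ?thesis by (intro ext) (simp del: upt_Suc)
qed

lemma cont_snoc: "h ~= [] ==> cont sg (h @ [sg (own (last h)) h]) = cont sg h"
proof -
 assume h: "h ~= []"
 have "h @ [sg (own (last h)) h] = map (cont sg h) [0..<Suc (length h)]"
  using cont_prefix[OF h, of sg 1] by simp
 thus ?thesis
  by (rule cont_eqI) (use h in "auto intro!: cont_follows")
qed

lemma profile_edge:
 assumes "strategy_profile G sg" "h : Hist G v"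
 shows "(last h, sg (own (last h)) h) : E"
proof -
 from assms(2) obtain g u where h: "h = g @ [u]" by (cases h rule: rev_cases) (auto simp: Hist_def)
 with assms(2) have "history G (g @ [u])" "u < length (inst_owner I)" by (auto simp: Hist_def history_def)
 with assms(1) own_less show ?thesis by (auto simp: strategy_profile_def strategy_def h)
qed

lemma cont_play:
 assumes "strategy_profile G sg" "h : Hist G v"
 shows "play G (cont sg h)" "cont sg h 0 = v"
proof -
 have h: "h ~= []" using assms(2) by (simp add: Hist_def)
 have H: "((%h. h @ [sg (own (last h)) h]) ^^ j) h : Hist G v & ((%h. h @ [sg (own (last h)) h]) ^^ j) h ~= []" for j
 proof (induction j)
  case (Suc j)
  thus ?case using profile_edge[OF assms(1)] by (auto simp: Hist_snoc)
 qed (use assms h in simp)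
 have "map (cont sg h) [0..<Suc n] : Hist G v" for n
 proof -
  have "map (cont sg h) [0..<length h + Suc n] = map (cont sg h) [0..<Suc n] @ map (cont sg h) [Suc n..<length h + Suc n]"
   using upt_add_eq_append[of 0 "Suc n" "length h"] by (metis add.commute le0 map_append)
  hence "map (cont sg h) [0..<Suc n] @ map (cont sg h) [Suc n..<length h + Suc n] : Hist G v"
   using H[of "Suc n"] cont_prefix[OF h, of sg "Suc n"] by metis
  thus ?thesis by (auto simp: Hist_def history_def successively_append_iff hd_append simp del: upt_Suc)
 qed
 from play_of_prefixes[OF this] show "play G (cont sg h)" "cont sg h 0 = v" by auto
qed

lemma suffix_outcome:
 assumes "strategy_profile G sg" "h @ [v] : Hist G v0"
 shows "h \<frown> outcome G (restrict_profile sg h) v = cont sg (h @ [v])"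
proof -
 let ?c = "cont sg (h @ [v])"
 let ?pp = "%n. ?c (length h + n)"
 have pre: "map ?c [0..<length h + Suc n] = h @ map ?pp [0..<Suc n]" for n
 proof -
  have "map ?c [0..<Suc (length h)] = h @ [v]" using cont_start[of "h @ [v]" sg] by simp
  hence "map ?c [0..<length h] = h" by simp
  moreover have "map ?c [length h..<length h + Suc n] = map ?pp [0..<Suc n]"
   by (rule nth_equalityI) (auto simp del: upt_Suc)
  ultimately show ?thesis using upt_add_eq_append[of 0 "length h" "Suc n"] by (metis add_0 le0 map_append)
 qed
 have p: "play G ?c" by (rule cont_play[OF assms])
 have "outcome G (restrict_profile sg h) v = ?pp"
 proof (rule outcome_eqI)
  show "play G ?pp" using p by (auto simp: play_def omega_words_def)
  show "?pp 0 = v" using cont_start[of "h @ [v]" sg] by simp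
  fix n
  have "follows sg ?c (length h + n)" by (rule cont_follows) auto
  thus "follows (restrict_profile sg h) ?pp n"
   using pre[of n] by (simp add: follows_def restrict_profile_def del: upt_Suc)
 qed
 moreover have "h \<frown> ?pp = ?c"
 proof
  fix n
  have "map ?c [0..<Suc (length h)] = h @ [v]" using cont_start[of "h @ [v]" sg] by simp
  hence "map ?c [0..<length h] = h" by simp
  hence "n < length h ==> h ! n = ?c n" by (metis add_0 diff_zero length_upt nth_map_upt)
  thus "(h \<frown> ?pp) n = ?c n" by (simp add: conc_def)
 qed
 ultimately show ?thesis by simp
qed

lemma subgame_simps [simp]: "pref (subgame G h) = pref G" "players (subgame G h) = players G"
 "pay (subgame G h) i pp = pay G i (h \<frown> pp)" "outcome (subgame G h) = outcome G" "strategy (subgame G h) = strategy G"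
 by (simp_all add: subgame_def outcome_def play_def consistent_def strategy_def history_def fun_eq_iff)

definition only_deviates :: "(nat => nat list => nat) => nat word => nat => nat => bool" where
 "only_deviates sg pp n j \<longleftrightarrow> (ALL k>=n. own (pp k) ~= j --> follows sg pp k)"

text \<open>A deviating strategy matters only through the play that it produces, so subgame
  perfection quantifies over plays along which, from some point on, only one player departs from the
  profile.\<close>

lemma SPE_iff:
 "is_SPE G v0 sg \<longleftrightarrow> strategy_profile G sg & (ALL pp n j. play G pp --> pp 0 = v0 --> j < np -->
   only_deviates sg pp n j --> (pay G j (cont sg (map pp [0..<Suc n])), pay G j pp) \<notin> pref G j)"
proof
 assume spe: "is_SPE G v0 sg"
 hence sp: "strategy_profile G sg" by (simp add: is_SPE_def)
 have "(pay G j (cont sg (map pp [0..<Suc n])), pay G j pp) \<notin> pref G j"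
  if pi: "play G pp" "pp 0 = v0" and j: "j < np" "only_deviates sg pp n j" for pp n j
 proof -
  let ?h = "map pp [0..<n]" and ?v = "pp n"
  have hv: "?h @ [?v] : Hist G v0" using play_prefix_Hist[OF pi(1), of n] pi(2) by simp
  let ?p = "%k. pp (n + k)"
  have pre: "?h @ map ?p [0..<Suc k] = map pp [0..<Suc (n + k)]" for k
  proof -
   have "map pp [n..<n + Suc k] = map ?p [0..<Suc k]" by (rule nth_equalityI) (auto simp del: upt_Suc)
   thus ?thesis using upt_add_eq_append[of 0 n "Suc k"] by (metis add_0 add_Suc_right le0 map_append)
  qed
  \<comment> \<open>Along \<open>pp\<close> the deviation depends on the length of the history only.
    Elsewhere it obeys the profile to remain a strategy, with the prefix in front only where this
    joins up to a history.\<close>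
  define \<tau> where "\<tau> g = (if EX k. g = map ?p [0..<Suc k] then ?p (length g) else sg j (if hd g = ?v then ?h @ g else g))" for g
  have \<tau>: "strategy G j \<tau>"
   unfolding strategy_def
  proof (intro allI impI)
   fix g u assume g: "history G (g @ [u]) & u : owned G j"
   show "(u, \<tau> (g @ [u])) : edges G"
   proof (cases "EX k. g @ [u] = map ?p [0..<Suc k]")
    case True
    then obtain k where k: "g @ [u] = map ?p [0..<Suc k]" by blast
    hence l: "length g = k" by (metis Suc_inject diff_zero length_append_singleton length_map length_upt)
    have "u = ?p k" using k by simp
    thus ?thesis using pi(1) True l by (auto simp: \<tau>_def play_def)
   next
    case False
    have s: "strategy G j (sg j)" using sp j by (simp add: strategy_profile_def)
    have "history G (?h @ g @ [u])" if "hd (g @ [u]) = ?v"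
    proof -
     have "?h @ [?v] : Hist G v0" by (fact hv)
     thus ?thesis using g that unfolding Hist_def history_def
      by (auto simp: successively_append_iff hd_append simp del: upt_Suc split: if_splits)
    qed
    hence "(u, sg j (if hd (g @ [u]) = ?v then ?h @ g @ [u] else g @ [u])) : E"
     using s g unfolding strategy_def by (cases "hd (g @ [u]) = ?v") (simp_all add: append_assoc[symmetric] del: append_assoc)
    moreover have "\<tau> (g @ [u]) = sg j (if hd (g @ [u]) = ?v then ?h @ g @ [u] else g @ [u])"
     using False unfolding \<tau>_def by (subst if_not_P) auto
    ultimately show ?thesis by simp
   qed
  qed
  have "outcome G ((restrict_profile sg ?h)(j := \<tau>)) ?v = ?p"
  proof (rule outcome_eqI)
   show "play G ?p" using pi(1) by (auto simp: play_def omega_words_def)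
   fix k
   show "follows ((restrict_profile sg ?h)(j := \<tau>)) ?p k"
   proof (cases "own (?p k) = j")
    case True
    have "\<tau> (map ?p [0..<Suc k]) = ?p (Suc k)" unfolding \<tau>_def by (subst if_P) (auto simp del: upt_Suc)
    thus ?thesis using True by (simp add: follows_def del: upt_Suc)
   next
    case False
    hence "follows sg pp (n + k)" using j(2) by (simp add: only_deviates_def)
    thus ?thesis using False pre[of k] by (simp add: follows_def restrict_profile_def del: upt_Suc)
   qed
  qed simp
  moreover have "?h \<frown> ?p = pp" by (auto simp: conc_def fun_eq_iff)
  moreover have "?h \<frown> outcome G (restrict_profile sg ?h) ?v = cont sg (map pp [0..<Suc n])"
   using suffix_outcome[OF sp hv] by simp
  moreover have "is_NE (subgame G ?h) ?v (restrict_profile sg ?h)" using spe hv unfolding is_SPE_def by blast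
  hence "(pay (subgame G ?h) j (outcome (subgame G ?h) (restrict_profile sg ?h) ?v),
    pay (subgame G ?h) j (outcome (subgame G ?h) ((restrict_profile sg ?h)(j := \<tau>)) ?v)) \<notin> pref (subgame G ?h) j"
   using j(1) \<tau> unfolding is_NE_def by (metis (no_types) G_simps(3) lessThan_iff subgame_simps(2,5))
  ultimately show ?thesis by (simp only: subgame_simps not_False_eq_True)
 qed
 with sp show "strategy_profile G sg & (ALL pp n j. play G pp --> pp 0 = v0 --> j < np -->
   only_deviates sg pp n j --> (pay G j (cont sg (map pp [0..<Suc n])), pay G j pp) \<notin> pref G j)" by blast
next
 assume a: "strategy_profile G sg & (ALL pp n j. play G pp --> pp 0 = v0 --> j < np -->
   only_deviates sg pp n j --> (pay G j (cont sg (map pp [0..<Suc n])), pay G j pp) \<notin> pref G j)"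
 hence sp: "strategy_profile G sg" by blast
 show "is_SPE G v0 sg"
  unfolding is_SPE_def
 proof (intro conjI allI impI)
  fix h v assume hv: "h @ [v] : Hist G v0"
  show "is_NE (subgame G h) v (restrict_profile sg h)"
   unfolding is_NE_def
  proof (intro ballI allI impI)
   fix j \<tau> assume j: "j : players (subgame G h)" and "strategy (subgame G h) j \<tau>"
   hence \<tau>: "strategy G j \<tau>" by simp
   let ?rh = "(restrict_profile sg h)(j := \<tau>)"
   text \<open>Extending the profile by arbitrary choices outside the subgame makes it a strategy profile.\<close>
   define rh' where "rh' i g = (if history G g & g ~= [] & hd g = v then ?rh i g else sg i g)" for i g
   have sp': "strategy_profile G rh'"
    unfolding strategy_profile_def strategy_def
   proof (intro ballI allI impI)
    fix i g u assume i: "i : players G" and g: "history G (g @ [u]) & u : owned G i"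
    have s: "strategy G i (sg i)" using sp i by (simp add: strategy_profile_def)
    show "(u, rh' i (g @ [u])) : edges G"
    proof (cases "hd (g @ [u]) = v & i ~= j")
     case True
     have "history G (h @ g @ [u])"
      using hv g True unfolding Hist_def history_def
      by (auto simp: successively_append_iff hd_append split: if_splits)
     hence "(u, sg i (h @ g @ [u])) : edges G" using s g unfolding strategy_def by (metis append_assoc)
     thus ?thesis using True g by (simp add: rh'_def restrict_profile_def)
    next
     case False
     thus ?thesis using s g \<tau> unfolding rh'_def strategy_def by (auto simp: strategy_def)
    qed
   qed
   have v: "[v] : Hist G v" using Hist_last[OF hv] by (simp add: Hist_single)
   let ?p = "cont rh' [v]"
   have p: "play G ?p" "?p 0 = v" using cont_play[OF sp' v] .
   have f: "follows ?rh ?p k" for k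
   proof -
    have "follows rh' ?p k" by (rule cont_follows) auto
    moreover have "map ?p [0..<Suc k] : Hist G v" using play_prefix_Hist[OF p(1)] p(2) by metis
    ultimately show ?thesis by (simp add: follows_def rh'_def Hist_def del: upt_Suc)
   qed
   have out: "outcome G ?rh v = ?p" by (rule outcome_eqI[OF p f])
   let ?pp = "h \<frown> ?p" and ?n = "length h"
   have pre: "map ?pp [0..<Suc (?n + k)] = h @ map ?p [0..<Suc k]" for k
    by (rule nth_equalityI) (auto simp: nth_append conc_def simp del: upt_Suc)
   have pre0: "map ?pp [0..<Suc ?n] = h @ [v]" using pre[of 0] p(2) by simp
   have HH: "map ?pp [0..<Suc (?n + k)] : Hist G v0" for k
   proof -
    have "map ?p [0..<Suc k] : Hist G v" using play_prefix_Hist[OF p(1)] p(2) by metis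
    thus ?thesis using hv unfolding pre Hist_def history_def
     by (auto simp: successively_append_iff hd_append simp del: upt_Suc split: if_splits)
   qed
   have "map ?pp [0..<Suc k] : Hist G v0" for k
   proof -
    have "map ?pp [0..<Suc k + ?n] = map ?pp [0..<Suc k] @ map ?pp [Suc k..<Suc k + ?n]"
     using upt_add_eq_append[of 0 "Suc k" "?n"] by (metis le0 map_append)
    hence "map ?pp [0..<Suc k] @ map ?pp [Suc k..<Suc k + ?n] : Hist G v0"
     using HH[of k] by (metis add.commute add_Suc)
    thus ?thesis by (auto simp: Hist_def history_def successively_append_iff hd_append simp del: upt_Suc)
   qed
   from play_of_prefixes[OF this] have pl: "play G ?pp" "?pp 0 = v0" by auto
   have "only_deviates sg ?pp ?n j"
    unfolding only_deviates_def
   proof (intro allI impI)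
    fix k assume k: "?n <= k" "own (?pp k) ~= j"
    then obtain d where d: "k = ?n + d" using le_iff_add by blast
    from f[of d] k(2) show "follows sg ?pp k"
     unfolding follows_def d pre by (simp add: conc_def restrict_profile_def del: upt_Suc)
   qed
   hence "(pay G j (cont sg (map ?pp [0..<Suc ?n])), pay G j ?pp) \<notin> pref G j"
    using a pl j by (metis G_simps(3) lessThan_iff subgame_simps(2))
   hence "(pay G j (cont sg (h @ [v])), pay G j ?pp) \<notin> pref G j" unfolding pre0 .
   thus "(pay (subgame G h) j (outcome (subgame G h) (restrict_profile sg h) v),
      pay (subgame G h) j (outcome (subgame G h) ?rh v)) \<notin> pref (subgame G h) j"
    by (simp add: suffix_outcome[OF sp hv] out)
  qed
 qed (rule sp)
qed


section \<open>From an equilibrium to a winning strategy of the prover\<close>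

lemma states_ok: "play G pp ==> map (%k. dpa_run (dpa_of (aut_code I k)) pp n) [0..<m] : words_below M m"
proof -
 assume p: "play G pp"
 have "dpa_run (dpa_of (aut_code I k)) pp n < M" if "k < m" for k
  using run_less[OF that play_words[OF p], of n] M_states[OF that] by simp
 thus ?thesis by (simp add: words_below_iff)
qed

lemma profiles_below: "ws : profiles I ==> ws : words_below M np"
 using M_payoffs by (fastforce simp: profiles_def words_below_iff)

lemma flag_bad_below: "flag_bad I bs i ws : words_below M m"
 using M2 by (auto simp: words_below_iff flag_bad_def case_prod_beta)

lemma flag_bad_nth: "k < m ==> length bs = m ==> length ws = np ==> flag_bad I bs i ws ! k = 1 \<longleftrightarrow>
  (pl k = i & bs ! k = 1) | (ws ! pl k, po k) : pref G (pl k)"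
 using auts_nth[of k] by (simp add: flag_bad_def case_prod_beta)

lemma length_flag_bad [simp]: "length (flag_bad I bs i ws) = m"
 by (simp add: flag_bad_def)

lemma cont_pay_profile:
 assumes "strategy_profile G sg" "h : Hist G v"
 shows "map (%j. pay G j (cont sg h)) [0..<np] : profiles I"
 using wf(2) play_words[OF cont_play(1)[OF assms]] by (auto simp: profiles_def)

definition announced :: "(nat => nat list => nat) => nat list => nat list" where
 "announced sg h = map (%j. pay G j (cont sg h)) [0..<np]"

lemma length_announced [simp]: "length (announced sg h) = np"
 by (simp add: announced_def)

lemma prio_run: "play G pp ==> k < m ==> prio_at I k (run_states pp n) = run_prio k pp n"
 by (rule prio_run_states[OF play_words])

text \<open>The history is reversed because the recursion has to peel off its last vertex.\<close>

fun rev_pstate :: "(nat => nat list => nat) => nat list => pstate" where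
 "rev_pstate sg [] = undefined"
| "rev_pstate sg [v] = pstart I (announced sg [v])"
| "rev_pstate sg (u # v # g) = (let h = rev (v # g); s = rev_pstate sg (v # g) in
   if u = sg (own v) h then accept I s u else deviate I s u (announced sg (h @ [u])))"

definition pstate_of :: "(nat => nat list => nat) => nat list => pstate" where
 "pstate_of sg h = rev_pstate sg (rev h)"

lemma pstate_of_single: "pstate_of sg [v] = pstart I (announced sg [v])"
 by (simp add: pstate_of_def)

lemma pstate_of_snoc:
 assumes "h ~= []"
 shows "pstate_of sg (h @ [u]) = (if u = sg (own (last h)) h then accept I (pstate_of sg h) u
   else deviate I (pstate_of sg h) u (announced sg (h @ [u])))"
proof -
 obtain v g where "rev h = v # g" using assms by (cases "rev h") auto
 moreover from this have "h = rev (v # g)" by (metis rev_rev_ident)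
 ultimately show ?thesis by (simp add: pstate_of_def Let_def)
qed

text \<open>The invariant gives flags their meaning: a flag for \<open>k\<close> points to a moment
  \<open>n'\<close> at which the announced payoff of the player of \<open>k\<close> was worse than
  that of \<open>k\<close>, and since which no other player has deviated.\<close>

lemma pstate_of_play:
 assumes sp: "strategy_profile G sg" and pi: "play G pp" "pp 0 = inst_start I"
 shows "EX bs f. pstate_of sg (map pp [0..<Suc n]) =
   (pp n, map (%k. dpa_run (dpa_of (aut_code I k)) pp n) [0..<m], announced sg (map pp [0..<Suc n]), bs, f) &
  bs : words_below M m & f <= M &
  (ALL k<m. bs ! k = 1 --> (EX n'<=n. (ALL l. n' <= l & l < n & own (pp l) ~= pl k --> follows sg pp l) &
    (announced sg (map pp [0..<Suc n']) ! pl k, po k) : pref G (pl k))) &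
  (ALL n'. n = Suc n' --> f = (if follows sg pp n' then 0 else Suc (own (pp n'))))"
proof (induction n)
 case 0
 have "bs : words_below M m" if "bs = flag_bad I (replicate m 0) 0 (announced sg [pp 0])" for bs
  using that flag_bad_below by simp
 moreover have "start_states I = map (%k. dpa_run (dpa_of (aut_code I k)) pp 0) [0..<m]"
  by (simp add: start_states_def dpa_of_def)
 ultimately show ?case using pi(2)
  using auts_nth(1) by (auto simp: pstate_of_single pstart_def flag_bad_nth[unfolded One_nat_def] flag_bad_nth)
next
 case (Suc n)
 let ?h = "map pp [0..<Suc n]"
 let ?q = "%n. map (%k. dpa_run (dpa_of (aut_code I k)) pp n) [0..<m]"
 let ?u = "pp (Suc n)"
 have h: "?h ~= []" "last ?h = pp n" "?h @ [?u] = map pp [0..<Suc (Suc n)]" by simp_all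
 from Suc obtain bs f where IH: "pstate_of sg ?h = (pp n, ?q n, announced sg ?h, bs, f)"
  "bs : words_below M m"
  "!!k. k < m ==> bs ! k = 1 ==> (EX n'<=n. (ALL l. n' <= l & l < n & own (pp l) ~= pl k --> follows sg pp l) &
    (announced sg (map pp [0..<Suc n']) ! pl k, po k) : pref G (pl k))" by blast
 note sn = pstate_of_snoc[OF h(1), of sg ?u, unfolded h(2,3) IH(1)]
 show ?case
 proof (cases "follows sg pp n")
  case True
  hence u: "?u = sg (own (pp n)) ?h" by (simp only: follows_def)
  have ann: "announced sg (map pp [0..<Suc (Suc n)]) = announced sg ?h"
   using cont_snoc[OF h(1), of sg] unfolding announced_def h(2) u[symmetric] h(3) by simp
  have st: "pstate_of sg (map pp [0..<Suc (Suc n)]) = (?u, ?q (Suc n), announced sg ?h, bs, 0)"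
   unfolding sn using u run_states_Suc[OF play_words[OF pi(1)], of n] by (simp add: accept_def del: upt_Suc)
  have "EX n'<=Suc n. (ALL l. n' <= l & l < Suc n & own (pp l) ~= pl k --> follows sg pp l) &
    (announced sg (map pp [0..<Suc n']) ! pl k, po k) : pref G (pl k)" if "k < m" "bs ! k = 1" for k
   using IH(3)[OF that] True by (metis le_SucI less_Suc_eq)
  thus ?thesis unfolding st ann using IH(2) True by auto
 next
  case False
  hence u: "?u ~= sg (own (pp n)) ?h" by (simp only: follows_def not_False_eq_True)
  let ?w = "announced sg (map pp [0..<Suc (Suc n)])"
  let ?b = "flag_bad I bs (own (pp n)) ?w"
  have st: "pstate_of sg (map pp [0..<Suc (Suc n)]) = (?u, ?q (Suc n), ?w, ?b, Suc (own (pp n)))"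
   unfolding sn using u run_states_Suc[OF play_words[OF pi(1)], of n] play_less[OF pi(1), of n] by (simp add: deviate_def del: upt_Suc)
  have "EX n'<=Suc n. (ALL l. n' <= l & l < Suc n & own (pp l) ~= pl k --> follows sg pp l) &
    (announced sg (map pp [0..<Suc n']) ! pl k, po k) : pref G (pl k)" if k: "k < m" "?b ! k = 1" for k
  proof (cases "(?w ! pl k, po k) : pref G (pl k)")
   case True
   thus ?thesis by (intro exI[of _ "Suc n"]) auto
  next
   case F: False
   with k flag_bad_nth[OF k(1) words_belowD[OF IH(2)] length_announced] have "pl k = own (pp n)" "bs ! k = 1" by blast+
   with IH(3)[OF k(1) this(2)] show ?thesis by (metis le_SucI less_Suc_eq)
  qed
  moreover have "own (pp n) < np" by (rule own_less[OF play_less[OF pi(1)]])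
  ultimately show ?thesis unfolding st using False flag_bad_below M_players by auto
 qed
qed

lemma pstate_of_fst: "h ~= [] ==> hd h = inst_start I ==> fst (pstate_of sg h) = last h"
proof (induction h rule: rev_induct)
 case (snoc u h)
 thus ?case
  by (cases "h = []") (auto simp: pstate_of_single pstart_def pstate_of_snoc accept_def deviate_def split: prod.splits)
qed simp

definition pstates_along :: "(nat => nat list => nat) => nat list => pstate list" where
 "pstates_along sg h = map (%n. pstate_of sg (take (Suc n) h)) [0..<length h]"

lemma pstates_along_snoc: "pstates_along sg (h @ [u]) = pstates_along sg h @ [pstate_of sg (h @ [u])]"
 by (auto simp: pstates_along_def)

lemma pstates_along_Hist:
 assumes "h : Hist G (inst_start I)"
 shows "map fst (pstates_along sg h) = h"
proof (rule nth_equalityI)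
 fix n assume "n < length (map fst (pstates_along sg h))"
 hence n: "n < length h" by (simp add: pstates_along_def)
 have "fst (pstate_of sg (take (Suc n) h)) = last (take (Suc n) h)"
  by (rule pstate_of_fst) (use assms n in "auto simp: Hist_def")
 thus "map fst (pstates_along sg h) ! n = h ! n" using n by (simp add: pstates_along_def take_Suc_conv_app_nth)
qed (simp add: pstates_along_def)

lemma play_through:
 assumes "h : Hist G v"
 obtains pp n where "play G pp" "pp 0 = v" "h = map pp [0..<Suc n]"
proof -
 let ?s = "%i h. SOME u. (last h, u) : E"
 have sp: "strategy_profile G ?s"
  unfolding strategy_profile_def strategy_def using edge_ex by (auto intro: someI_ex)
 have h: "h ~= []" using assms by (simp add: Hist_def)
 then obtain n where n: "length h = Suc n" by (cases h) auto
 show ?thesis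
  using that[OF cont_play[OF sp assms], of n] cont_start[OF h, of ?s] n by simp
qed

text \<open>The prover announces the payoffs of \<open>cont\<close> and proposes what the profile
  prescribes. Suppose a pair is requested infinitely often and granted only finitely often. For
  \<open>b = True\<close> deviations cease, so the play is the announced continuation and has the
  announced payoff. For \<open>b = False\<close> only the player of \<open>k\<close> still deviates,
  so the flag exhibits a profitable deviation.\<close>

lemma SPE_wins:
 assumes spe: "is_SPE G (inst_start I) sg"
 shows "wins (pmoves I M) (request I) (grant I) (pair_index I) (pstart I (announced sg [inst_start I]))"
proof -
 let ?v0 = "inst_start I"
 from spe have sp: "strategy_profile G sg" and NE: "!!pp n j. play G pp ==> pp 0 = ?v0 ==> j < np ==>
   only_deviates sg pp n j ==> (pay G j (cont sg (map pp [0..<Suc n])), pay G j pp) \<notin> pref G j"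
  unfolding SPE_iff by blast+
 let ?H = "pstates_along sg ` Hist G ?v0"
 have v0: "?v0 < length (inst_owner I)" using valid by (simp add: valid_instance_def)
 have S: "pstate_of sg h : pstates I M" if hH: "h : Hist G ?v0" for h
 proof -
  obtain pp n where pi: "play G pp" "pp 0 = ?v0" "h = map pp [0..<Suc n]" using play_through[OF hH] by blast
  from pstate_of_play[OF sp pi(1,2), of n] obtain bs f where
   "pstate_of sg h = (pp n, map (%k. dpa_run (dpa_of (aut_code I k)) pp n) [0..<m], announced sg h, bs, f)"
   "bs : words_below M m" "f <= M" unfolding pi(3) by blast
  thus ?thesis using states_ok[OF pi(1)] play_less[OF pi(1), of n] M_verts
    profiles_below[OF cont_pay_profile[OF sp hH]]
   by (auto simp: pstates_def announced_def)
 qed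
 have "wins_by (pmoves I M) (request I) (grant I) (pair_index I) ?H (pstart I (announced sg [?v0]))"
  unfolding wins_by_def
 proof (intro conjI allI ballI impI)
  have "pstates_along sg [?v0] = [pstart I (announced sg [?v0])]"
   by (simp add: pstates_along_def pstate_of_single)
  moreover have "[?v0] : Hist G ?v0" using v0 by (simp add: Hist_single)
  ultimately show "[pstart I (announced sg [?v0])] : ?H" by (metis image_eqI)
  fix g t assume "g @ [t] : ?H"
  then obtain h where h: "h : Hist G ?v0" "g @ [t] = pstates_along sg h" by blast
  then obtain h' u where hu: "h = h' @ [u]" by (cases h rule: rev_cases) (auto simp: Hist_def)
  hence g: "g = pstates_along sg h'" using h(2) by (simp add: pstates_along_snoc)
  show "g = [] | g : ?H"
  proof (cases "h' = []")
   case True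
   thus ?thesis by (simp add: g pstates_along_def)
  next
   case False
   thus ?thesis using h(1) by (simp add: hu Hist_snoc g)
  qed
 next
  fix g assume "g : ?H"
  then obtain h where h: "h : Hist G ?v0" "g = pstates_along sg h" by blast
  then obtain h' u where hu: "h = h' @ [u]" by (cases h rule: rev_cases) (auto simp: Hist_def)
  have hn: "h ~= []" using hu by simp
  show "g ~= []" by (simp add: h(2) hu pstates_along_snoc)
  have lg: "last g = pstate_of sg h" by (simp add: h(2) hu pstates_along_snoc)
  have fst: "fst (pstate_of sg h) = last h" using pstate_of_fst h(1) by (auto simp: Hist_def)
  let ?A = "{pstate_of sg (h @ [u]) | u. (last h, u) : E}"
  have e: "(last h, sg (own (last h)) h) : E" by (rule profile_edge[OF sp h(1)])
  have "?A : pmoves I M (last g)"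
  proof -
   have 1: "?A <= pstates I M" using S h(1) hn by (auto simp: Hist_snoc)
   have 2: "accept I (pstate_of sg h) (sg (own (last h)) h) : ?A"
    using e by (auto simp: pstate_of_snoc[OF hn] intro!: exI[of _ "sg (own (last h)) h"])
   have 3: "EX ws:profiles I. deviate I (pstate_of sg h) u' ws : ?A"
    if u': "(last h, u') : E & u' ~= sg (own (last h)) h" for u'
   proof -
   from u' have "announced sg (h @ [u']) : profiles I"
    unfolding announced_def using h(1) hn by (intro cont_pay_profile[OF sp, of _ ?v0]) (simp add: Hist_snoc)
   moreover have "deviate I (pstate_of sg h) u' (announced sg (h @ [u'])) : ?A"
    using u' by (auto simp: pstate_of_snoc[OF hn] intro!: exI[of _ u'])
   ultimately show ?thesis by blast
   qed
   show ?thesis unfolding pmoves_def lg fst using 1 2 3 e by blast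
  qed
  moreover have "g @ [t] : ?H" if t: "t : ?A" for t
  proof -
   from t obtain u where u: "t = pstate_of sg (h @ [u])" "(last h, u) : E" by blast
   hence "h @ [u] : Hist G ?v0" using h(1) hn by (simp add: Hist_snoc)
   thus ?thesis by (metis u(1) h(2) pstates_along_snoc image_eqI)
  qed
  ultimately show "EX A:pmoves I M (last g). ALL t:A. g @ [t] : ?H" by blast
 next
  fix rh :: "nat => pstate" assume r: "ALL n. map rh [0..<Suc n] : ?H"
  define pp where "pp n = fst (rh n)" for n
  have pre: "map pp [0..<Suc n] : Hist G ?v0 & map rh [0..<Suc n] = pstates_along sg (map pp [0..<Suc n])" for n
  proof -
   obtain h where h: "h : Hist G ?v0" "map rh [0..<Suc n] = pstates_along sg h" using r by blast
   have "map pp [0..<Suc n] = map fst (map rh [0..<Suc n])" by (simp add: pp_def)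
   also have "... = h" unfolding h(2) by (rule pstates_along_Hist[OF h(1)])
   finally show ?thesis using h by simp
  qed
  hence pi: "play G pp" "pp 0 = ?v0" using play_of_prefixes by blast+
  have rho: "rh n = pstate_of sg (map pp [0..<Suc n])" for n
  proof -
   have "rh n = last (map rh [0..<Suc n])" by simp
   also have "... = last (pstates_along sg (map pp [0..<n] @ [pp n]))" using pre[of n] by simp
   finally show ?thesis by (simp add: pstates_along_snoc)
  qed
  define bs where "bs n = fst (snd (snd (snd (rh n))))" for n
  define f where "f n = snd (snd (snd (snd (rh n))))" for n
  have inv: "rh n = (pp n, map (%k. dpa_run (dpa_of (aut_code I k)) pp n) [0..<m], announced sg (map pp [0..<Suc n]), bs n, f n) &
  (ALL k<m. bs n ! k = 1 --> (EX n'<=n. (ALL l. n' <= l & l < n & own (pp l) ~= pl k --> follows sg pp l) &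
    (announced sg (map pp [0..<Suc n']) ! pl k, po k) : pref G (pl k))) &
  (ALL n'. n = Suc n' --> f n = (if follows sg pp n' then 0 else Suc (own (pp n')))) & length (bs n) = m" for n
  proof -
   from pstate_of_play[OF sp pi, of n, folded rho] obtain b g where
    bg: "rh n = (pp n, map (%k. dpa_run (dpa_of (aut_code I k)) pp n) [0..<m], announced sg (map pp [0..<Suc n]), b, g) &
  b : words_below M m & g <= M &
  (ALL k<m. b ! k = 1 --> (EX n'<=n. (ALL l. n' <= l & l < n & own (pp l) ~= pl k --> follows sg pp l) &
    (announced sg (map pp [0..<Suc n']) ! pl k, po k) : pref G (pl k))) &
  (ALL n'. n = Suc n' --> g = (if follows sg pp n' then 0 else Suc (own (pp n'))))" by (elim exE)
   hence "bs n = b" "f n = g" unfolding bs_def f_def by (simp_all del: upt_Suc)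
   with bg words_belowD show ?thesis by blast
  qed
  have lb: "length (bs n) = m" for n using inv by blast
  note rn = conjunct1[OF inv]
  have bad: "EX n'<=n. (ALL l. n' <= l & l < n & own (pp l) ~= pl k --> follows sg pp l) &
    (announced sg (map pp [0..<Suc n']) ! pl k, po k) : pref G (pl k)" if "k < m" "bs n ! k = 1" for n k
   using conjunct1[OF conjunct2[OF inv[of n]]] that by blast
  have fl: "f (Suc n) = (if follows sg pp n then 0 else Suc (own (pp n)))" for n
   using conjunct2[OF conjunct2[OF inv[of "Suc n"]]] by blast
  have prio: "k < m ==> prio_at I k (map (%k. dpa_run (dpa_of (aut_code I k)) pp n) [0..<m]) = run_prio k pp n" for k n
   by (rule prio_run[OF pi(1)])
  show "streett (request I) (grant I) (pair_index I) rh"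
   unfolding streett_def
  proof (intro ballI impI, rule ccontr)
   fix x assume x: "x : pair_index I" and inf: "ALL n. EX n'>=n. rh n' : request I x"
    and fin: "~ (ALL n. EX n'>=n. rh n' : grant I x)"
   obtain b k c where bkc: "x = (b, k, c)" by (cases x)
   have k: "k < m" using x by (simp add: bkc pair_index_def)
   from fin obtain N where N: "!!n. n >= N ==> rh n \<notin> grant I x" by blast
   have parity: "even c ~= b" using inf by (auto simp: bkc request_def)
   have infc: "ALL n. EX n'>=n. run_prio k pp n' = c"
   proof
    fix n obtain n' where n': "n' >= n" "rh n' : request I x" using inf by blast
    hence "run_prio k pp n' = c" by (simp add: bkc request_def rn prio[OF k])
    with n' show "EX n'>=n. run_prio k pp n' = c" by blast
   qed
   have "~ (ALL m. EX n>=m. c < run_prio k pp n)"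
   proof
    assume "ALL m. EX n>=m. c < run_prio k pp n"
    then obtain n where "n >= N" "c < run_prio k pp n" by blast
    thus False using N[of n] by (simp add: bkc grant_def rn prio[OF k])
   qed
   hence not: "(pay G (pl k) pp = po k) ~= b"
    using pay_streett[OF k play_words[OF pi(1)], of b] parity infc by blast
   from inf obtain n0 where n0: "n0 >= N" "rh n0 : request I x" by blast
   show False
   proof (cases b)
    case True
    have "follows sg pp n" if "n >= N" for n
     using N[of "Suc n"] that fl[of n] by (auto simp: bkc grant_def rn True split: if_splits)
    hence "cont sg (map pp [0..<Suc n0]) = pp" using n0(1) by (intro cont_eqI) auto
    moreover have "announced sg (map pp [0..<Suc n0]) ! pl k = po k"
     using n0(2) auts_nth(1)[OF k] by (simp add: bkc request_def rn True del: upt_Suc)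
    ultimately have "pay G (pl k) pp = po k" using auts_nth(1)[OF k] by (simp add: announced_def del: upt_Suc)
    with not True show False by simp
   next
    case False
    have fol: "follows sg pp n" if "n >= N" "own (pp n) ~= pl k" for n
     using N[of "Suc n"] that fl[of n] by (auto simp: bkc grant_def rn False split: if_splits)
    have "bs n0 ! k = 1" using n0(2) k by (simp add: bkc request_def rn False lb del: upt_Suc)
    from bad[OF k this] obtain n' where n': "n' <= n0"
     "!!l. n' <= l ==> l < n0 ==> own (pp l) ~= pl k ==> follows sg pp l"
     "(announced sg (map pp [0..<Suc n']) ! pl k, po k) : pref G (pl k)" by blast
    have "follows sg pp l" if "n' <= l" "own (pp l) ~= pl k" for l
     using n'(2)[OF that(1) _ that(2)] fol[of l] that(2) n0(1) by (cases "l < n0") auto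
    hence "only_deviates sg pp n' (pl k)" by (simp add: only_deviates_def)
    from NE[OF pi auts_nth(1)[OF k] this] n'(3) have "pay G (pl k) pp ~= po k"
     using auts_nth(1)[OF k] by (auto simp: announced_def simp del: upt_Suc)
    with not False show False by simp
   qed
  qed
 qed
 thus ?thesis unfolding wins_def by blast
qed


section \<open>From a winning strategy of the prover to an equilibrium\<close>

fun rev_track :: "(pstate list => nat) => (pstate list => nat => nat list) => pstate => nat list => pstate list" where
 "rev_track U D s0 [] = []"
| "rev_track U D s0 [v] = [s0]"
| "rev_track U D s0 (u # v # g) = (let hs = rev_track U D s0 (v # g) in
   hs @ [if u = U hs then accept I (last hs) u else deviate I (last hs) u (D hs u)])"

text \<open>Every player adopts the prover's proposals. Winning along undisturbed continuations
  makes all announcements true, and winning along plays where a single player deviates makes the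
  flagged, that is preferred, payoffs impossible.\<close>

lemma wins_SPE:
 assumes ws: "ws : profiles I"
  and win: "wins (pmoves I M) (request I) (grant I) (pair_index I) (pstart I ws)"
 obtains sg where "is_SPE G (inst_start I) sg" "announced sg [inst_start I] = ws"
proof -
 let ?v0 = "inst_start I"
 have v0: "?v0 < length (inst_owner I)" using valid by (simp add: valid_instance_def)
 from win obtain H where H: "wins_by (pmoves I M) (request I) (grant I) (pair_index I) H (pstart I ws)"
  by (auto simp: wins_def)
 note HD = wins_byD[OF H]
 have "EX u D. hs : H --> (fst (last hs), u) : E & hs @ [accept I (last hs) u] : H &
   (ALL u'. (fst (last hs), u') : E & u' ~= u --> D u' : profiles I & hs @ [deviate I (last hs) u' (D u')] : H)" for hs
 proof (cases "hs : H")
  case True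
  from HD(4)[OF this] obtain A where A: "A : pmoves I M (last hs)" "ALL t:A. hs @ [t] : H" by blast
  then obtain u where u: "(fst (last hs), u) : E" "accept I (last hs) u : A"
   "ALL u'. (fst (last hs), u') : E & u' ~= u --> (EX ws:profiles I. deviate I (last hs) u' ws : A)"
   unfolding pmoves_def by blast
  from u(3) obtain D where "ALL u'. (fst (last hs), u') : E & u' ~= u --> D u' : profiles I & deviate I (last hs) u' (D u') : A"
   by metis
  with u(1,2) A(2) show ?thesis by blast
 qed simp
 then obtain U D where UD: "!!hs. hs : H ==> (fst (last hs), U hs) : E & hs @ [accept I (last hs) (U hs)] : H &
   (ALL u'. (fst (last hs), u') : E & u' ~= U hs --> D hs u' : profiles I & hs @ [deviate I (last hs) u' (D hs u')] : H)"
  by metis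
 define tr where "tr h = rev_track U D (pstart I ws) (rev h)" for h
 have tr1: "tr [v] = [pstart I ws]" for v by (simp add: tr_def)
 have trS: "tr (h @ [u]) = tr h @ [if u = U (tr h) then accept I (last (tr h)) u else deviate I (last (tr h)) u (D (tr h) u)]"
  if "h ~= []" for h u
 proof -
  obtain v g where "rev h = v # g" using \<open>h ~= []\<close> by (cases "rev h") auto
  thus ?thesis by (simp add: tr_def Let_def)
 qed
 have fst_acc: "fst (accept I s u) = u" "fst (deviate I s u w) = u" for s u w
  by (auto simp: accept_def deviate_def split: prod.splits)
 have trH: "tr h : H & fst (last (tr h)) = last h" if "h : Hist G ?v0" for h
  using that
 proof (induction h rule: rev_induct)
  case (snoc u h)
  show ?case
  proof (cases "h = []")
   case True
   thus ?thesis using snoc.prems HD(1) by (simp add: tr1 Hist_single pstart_def)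
  next
   case False
   hence h: "h : Hist G ?v0" "(last h, u) : E" using snoc.prems by (simp_all add: Hist_snoc)
   with snoc.IH UD[of "tr h"] show ?thesis by (auto simp: trS[OF False] fst_acc)
  qed
 qed (simp add: Hist_def)
 \<comment> \<open>The winning tree covers the histories from the initial vertex; on all others an
   arbitrary edge keeps the profile a strategy.\<close>
 define sg where "sg i h = (if h : Hist G ?v0 then U (tr h) else SOME u. (last h, u) : E)" for i :: nat and h
 have sp: "strategy_profile G sg"
  unfolding strategy_profile_def strategy_def
 proof (intro ballI allI impI)
  fix i h v assume "history G (h @ [v]) & v : owned G i"
  hence v: "v < length (inst_owner I)" by simp
  show "(v, sg i (h @ [v])) : edges G"
  proof (cases "h @ [v] : Hist G ?v0")
   case True
   thus ?thesis using trH[OF True] UD[of "tr (h @ [v])"] by (simp add: sg_def)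
  next
   case False
   thus ?thesis using someI_ex[OF edge_ex[OF v]] by (simp add: sg_def)
  qed
 qed
 define st where "st pp n = last (tr (map pp [0..<Suc n]))" for pp n
 have stS: "st pp (Suc n) = (if follows sg pp n then accept I (st pp n) (pp (Suc n))
   else deviate I (st pp n) (pp (Suc n)) (D (tr (map pp [0..<Suc n])) (pp (Suc n))))"
  if "play G pp" "pp 0 = ?v0" for pp n
 proof -
  let ?h = "map pp [0..<Suc n]"
  have h: "?h : Hist G ?v0" using play_prefix_Hist[OF that(1)] that(2) by metis
  have "map pp [0..<Suc (Suc n)] = ?h @ [pp (Suc n)]" by simp
  hence "tr (map pp [0..<Suc (Suc n)]) = tr ?h @ [if pp (Suc n) = U (tr ?h) then accept I (last (tr ?h)) (pp (Suc n))
    else deviate I (last (tr ?h)) (pp (Suc n)) (D (tr ?h) (pp (Suc n)))]" using trS[of ?h] by simp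
  moreover have "follows sg pp n \<longleftrightarrow> pp (Suc n) = U (tr ?h)" using h by (simp add: follows_def sg_def del: upt_Suc)
  ultimately show ?thesis by (simp add: st_def del: upt_Suc)
 qed
 have st0: "st pp 0 = pstart I ws" for pp by (simp add: st_def tr1)
 have branch: "streett (request I) (grant I) (pair_index I) (st pp)" if pi: "play G pp" "pp 0 = ?v0" for pp
 proof (rule HD(5))
  show "st pp 0 = pstart I ws" by (rule st0)
  show "map (st pp) [0..<Suc n] : H" for n
  proof -
   have "map (st pp) [0..<Suc n] = tr (map pp [0..<Suc n])"
   proof (induction n)
    case (Suc n)
    have "tr (map pp [0..<Suc (Suc n)]) = tr (map pp [0..<Suc n]) @ [st pp (Suc n)]"
     using trS[of "map pp [0..<Suc n]" "pp (Suc n)"] by (simp add: st_def)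
    with Suc show ?case by simp
   qed (simp add: st_def tr1)
   thus ?thesis using trH play_prefix_Hist[OF pi(1), of n] pi(2) by metis
  qed
 qed
 let ?q = "%pp n. map (%k. dpa_run (dpa_of (aut_code I k)) pp n) [0..<m]"
 have lenD: "w : profiles I ==> length w = np" for w by (simp add: profiles_def)
 have shape: "EX w b f. st pp n = (pp n, ?q pp n, w, b, f) & w : profiles I & length b = m &
   (ALL k<m. (w ! pl k, po k) : pref G (pl k) --> b ! k = 1)" if pi: "play G pp" "pp 0 = ?v0" for pp n
 proof (induction n)
  case 0
  have "start_states I = ?q pp 0" by (simp add: start_states_def dpa_of_def)
  thus ?case using ws pi(2) by (auto simp: st0 pstart_def lenD flag_bad_nth[unfolded One_nat_def])
 next
  case (Suc n)
  then obtain w b f where IH: "st pp n = (pp n, ?q pp n, w, b, f)" "w : profiles I" "length b = m"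
   "ALL k<m. (w ! pl k, po k) : pref G (pl k) --> b ! k = 1" by blast
  show ?case
  proof (cases "follows sg pp n")
   case True
   thus ?thesis using IH run_states_Suc[OF play_words[OF pi(1)], of n] by (auto simp: stS[OF pi] accept_def)
  next
   case False
   let ?h = "map pp [0..<Suc n]"
   have h: "?h : Hist G ?v0" using play_prefix_Hist[OF pi(1)] pi(2) by metis
   have "pp (Suc n) ~= U (tr ?h)" using False h by (simp add: follows_def sg_def del: upt_Suc)
   moreover have "(pp n, pp (Suc n)) : E" using pi(1) by (simp add: play_def)
   moreover have "fst (last (tr ?h)) = pp n" using trH[OF h] by simp
   ultimately have "D (tr ?h) (pp (Suc n)) : profiles I" using UD[of "tr ?h"] trH[OF h] by metis
   thus ?thesis using False IH(1,3) run_states_Suc[OF play_words[OF pi(1)], of n]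
     own_less[OF play_less[OF pi(1), of n]] play_less[OF pi(1), of n]
    by (auto simp: stS[OF pi] deviate_def lenD flag_bad_nth[unfolded One_nat_def] simp del: upt_Suc)
  qed
 qed
 note prio = prio_run
 have flag: "snd (snd (snd (snd (st pp (Suc n))))) = (if follows sg pp n then 0 else Suc (own (pp n)))"
  if pi: "play G pp" "pp 0 = ?v0" for pp n
  using shape[OF pi, of n] play_less[OF pi(1), of n] by (auto simp: stS[OF pi] accept_def deviate_def)
 text \<open>A request that is active in all late states, while no grant occurs through deviations,
  forces the automaton to answer as required.\<close>
 have answer: "(pay G (pl k) pp = po k) = b"
  if pi: "play G pp" "pp 0 = ?v0" and k: "k < m"
   and active: "!!l. l >= n ==> (case st pp l of (v, qs, ws, bs, f) => if b then ws ! pl k = po k else bs ! k = 1)"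
   and quiet: "!!l. l >= n ==> ~ follows sg pp l ==> ~ b & own (pp l) = pl k" for pp n k b
  unfolding pay_streett[OF k play_words[OF pi(1)]]
 proof (intro allI impI)
  fix c N assume c: "even c ~= b" "ALL N. EX l>=N. run_prio k pp l = c"
  hence "c : set (code_prios (aut_code I k))" using run_prio_in[OF k play_words[OF pi(1)]] by blast
  hence x: "(b, k, c) : pair_index I" using k by (simp add: pair_index_def)
  have "EX l>=N. st pp l : request I (b, k, c)" for N
  proof -
   obtain l where l: "l >= max N n" "run_prio k pp l = c" using c(2) by blast
   have "st pp l : request I (b, k, c)"
    using shape[OF pi, of l] active[of l] l c(1) k auts_nth(1)[OF k] by (auto simp: request_def prio[OF pi(1) k] lenD)
   thus ?thesis using l by auto
  qed
  with branch[OF pi] x have "ALL N. EX l>=N. st pp l : grant I (b, k, c)" unfolding streett_def by blast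
  then obtain l where l: "l >= max N (Suc n)" "st pp l : grant I (b, k, c)" by blast
  then obtain l' where l': "l = Suc l'" "l' >= n" by (cases l) auto
  have "c < run_prio k pp l"
   using shape[OF pi, of l] l(2) flag[OF pi, of l'] quiet[OF l'(2)]
   by (auto simp: grant_def prio[OF pi(1) k] l'(1) simp del: dpa_run.simps split: if_splits)
  thus "EX l>=N. c < run_prio k pp l" using l(1) by auto
 qed
 \<comment> \<open>Along the continuation nobody deviates, so the announcement stays constant and
   its automaton, requested for ever, has to accept.\<close>
 have outcome: "pay G j (cont sg (map pp [0..<Suc n])) = fst (snd (snd (st pp n))) ! j"
  if pi: "play G pp" "pp 0 = ?v0" and j: "j < np" for pp n j
 proof -
  let ?h = "map pp [0..<Suc n]"
  let ?c = "cont sg ?h"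
  have h: "?h : Hist G ?v0" using play_prefix_Hist[OF pi(1)] pi(2) by metis
  have c: "play G ?c" "?c 0 = ?v0" using cont_play[OF sp h] .
  obtain w b f where w: "st pp n = (pp n, ?q pp n, w, b, f)" "w : profiles I" using shape[OF pi, of n] by blast
  have fol: "follows sg ?c l" if "l >= n" for l by (rule cont_follows) (use that in auto)
  have pre: "map ?c [0..<Suc n] = ?h" using cont_start[of ?h sg] by simp
  have "fst (snd (snd (st ?c (n + d)))) = w" for d
  proof (induction d)
   case 0
   have "st ?c n = st pp n" unfolding st_def pre ..
   thus ?case by (simp add: w(1))
  next
   case (Suc d)
   thus ?case using fol[of "n + d"] by (auto simp: stS[OF c] accept_def simp del: upt_Suc split: prod.splits)
  qed
  hence late: "fst (snd (snd (st ?c l))) = w" if "l >= n" for l using that by (metis le_add_diff_inverse)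
  have "w ! j < num_payoffs I j" using w(2) j by (simp add: profiles_def)
  from auts_ex[OF j this] obtain k where k: "k < m" "aut_at I k = (j, w ! j)" by blast
  have "(pay G (pl k) ?c = po k) = True"
  proof (rule answer[OF c k(1), of n])
   show "case st ?c l of (v, qs, ws, bs, f) => if True then ws ! pl k = po k else bs ! k = 1" if "l >= n" for l
    using late[OF that] k(2) by (auto split: prod.splits)
  qed (use fol in auto)
  thus ?thesis by (simp add: k(2) w(1))
 qed
 have "is_SPE G ?v0 sg"
  unfolding SPE_iff
 proof (intro conjI sp allI impI notI)
  fix pp n j assume pi: "play G pp" "pp 0 = ?v0" and j: "j < np" and dev: "only_deviates sg pp n j"
   and pr: "(pay G j (cont sg (map pp [0..<Suc n])), pay G j pp) : pref G j"
  have "pay G j pp < num_payoffs I j" by (rule wf(2)[OF j play_words[OF pi(1)]])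
  from auts_ex[OF j this] obtain k where k: "k < m" "aut_at I k = (j, pay G j pp)" by blast
  \<comment> \<open>The flag is present at \<open>n\<close> because the announcement is true and
    worse than the payoff of \<open>pp\<close>. It survives accepted proposals and deviations of
    \<open>j\<close>, so the automaton of that very payoff has to reject \<open>pp\<close>.\<close>
  have "fst (snd (snd (snd (st pp (n + d))))) ! k = 1" for d
  proof (induction d)
   case 0
   thus ?case using shape[OF pi, of n] pr k outcome[OF pi j, of n] by (auto simp del: upt_Suc)
  next
   case (Suc d)
   obtain w b f where wb: "st pp (n + d) = (pp (n + d), ?q pp (n + d), w, b, f)" "length b = m"
    using shape[OF pi, of "n + d"] by blast
   have bk: "b ! k = 1" using Suc by (simp add: wb(1))
   show ?case
   proof (cases "follows sg pp (n + d)")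
    case True
    thus ?thesis using bk by (simp add: stS[OF pi] accept_def wb(1))
   next
    case False
    have own: "own (pp (n + d)) = j" using False dev le_add1[of n d] unfolding only_deviates_def by blast
    obtain w' b' f' where wb': "st pp (Suc (n + d)) = (pp (Suc (n + d)), ?q pp (Suc (n + d)), w', b', f')" "w' : profiles I"
     using shape[OF pi, of "Suc (n + d)"] by blast
    have "b' = flag_bad I b (own (pp (n + d))) w'"
     using wb'(1) False play_less[OF pi(1), of "n + d"] by (auto simp: stS[OF pi] wb(1) deviate_def simp del: upt_Suc)
    hence "b' ! k = 1" using bk flag_bad_nth[OF k(1) wb(2) lenD[OF wb'(2)]] own k(2) by simp
    thus ?thesis by (simp add: wb'(1))
   qed
  qed
  hence late: "fst (snd (snd (snd (st pp l)))) ! k = 1" if "l >= n" for l using that by (metis le_add_diff_inverse)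
  have "(pay G (pl k) pp = po k) = False"
  proof (rule answer[OF pi k(1), of n])
   show "case st pp l of (v, qs, ws, bs, f) => if False then ws ! pl k = po k else bs ! k = 1" if "l >= n" for l
    using late[OF that] by (auto split: prod.splits)
   show "~ False & own (pp l) = pl k" if "l >= n" "~ follows sg pp l" for l
    using dev that k(2) by (auto simp: only_deviates_def)
  qed
  thus False by (simp add: k(2))
 qed
 moreover have "announced sg [?v0] = ws"
 proof (rule nth_equalityI)
  show "length (announced sg [?v0]) = length ws" using ws by (simp add: announced_def profiles_def)
  fix j assume "j < length (announced sg [?v0])"
  hence j: "j < np" by (simp add: announced_def)
  have v: "[?v0] : Hist G ?v0" using v0 by (simp add: Hist_single)
  let ?pp = "cont sg [?v0]"
  from outcome[OF cont_play[OF sp v] j, of 0] show "announced sg [?v0] ! j = ws ! j"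
   using j cont_play(2)[OF sp v] by (simp add: announced_def st0 pstart_def)
 qed
 ultimately show ?thesis using that by blast
qed

theorem constrained_SPE_iff:
 "constrained_SPE_exists G (inst_start I) p \<longleftrightarrow>
  (EX ws:profiles I. (ALL i<np. p i = ws ! i | (p i, ws ! i) : set (code_pref (inst_players I ! i))) &
    wins (pmoves I M) (request I) (grant I) (pair_index I) (pstart I ws))"
proof -
 let ?v0 = "inst_start I"
 have v0: "[?v0] : Hist G ?v0" using valid by (simp add: valid_instance_def Hist_single)
 have out: "pay G i (outcome G sg ?v0) = announced sg [?v0] ! i" if "strategy_profile G sg" "i < np" for sg i
  using suffix_outcome[of sg "[]" ?v0 ?v0] that v0 by (simp add: restrict_profile_def announced_def)
 show ?thesis
 proof
  assume "constrained_SPE_exists G ?v0 p"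
  then obtain sg where s: "is_SPE G ?v0 sg"
   "ALL i:players G. p i = pay G i (outcome G sg ?v0) | (p i, pay G i (outcome G sg ?v0)) : pref G i"
   by (auto simp: constrained_SPE_exists_def)
  have sp: "strategy_profile G sg" using s(1) by (simp add: is_SPE_def)
  from SPE_wins[OF s(1)] s(2) out[OF sp] cont_pay_profile[OF sp v0] show
   "EX ws:profiles I. (ALL i<np. p i = ws ! i | (p i, ws ! i) : set (code_pref (inst_players I ! i))) &
    wins (pmoves I M) (request I) (grant I) (pair_index I) (pstart I ws)"
   by (intro bexI[of _ "announced sg [?v0]"]) (auto simp: announced_def[symmetric])
 next
  assume "EX ws:profiles I. (ALL i<np. p i = ws ! i | (p i, ws ! i) : set (code_pref (inst_players I ! i))) &
    wins (pmoves I M) (request I) (grant I) (pair_index I) (pstart I ws)"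
  then obtain ws where ws: "ws : profiles I" "ALL i<np. p i = ws ! i | (p i, ws ! i) : set (code_pref (inst_players I ! i))"
   "wins (pmoves I M) (request I) (grant I) (pair_index I) (pstart I ws)" by blast
  from wins_SPE[OF ws(1,3)] obtain sg where s: "is_SPE G ?v0 sg" "announced sg [?v0] = ws" by blast
  have sp: "strategy_profile G sg" using s(1) by (simp add: is_SPE_def)
  show "constrained_SPE_exists G ?v0 p"
   unfolding constrained_SPE_exists_def
   by (rule exI[of _ sg]) (use s ws(2) out[OF sp] in auto)
 qed
qed

end

section \<open>Solving Streett games on explicit state lists\<close>

definition update_counts :: "(bool \<times> bool) list => nat list => nat list" where
 "update_counts rg cs = map (%x. if snd (fst x) then 0 else if fst (fst x) then Suc (snd x) else snd x) (zip rg cs)"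

definition survives :: "('s => 's list list list) => ('s => (bool \<times> bool) list) => ('s \<times> nat list) list =>
  's \<times> nat list => bool" where
 "survives opts rg X sc = list_ex (%opt. list_all (%cl. list_ex (%t. (t, update_counts (rg t) (snd sc)) : set X) cl) opt)
   (opts (fst sc))"

definition product_list :: "'a list => 'b list => ('a \<times> 'b) list" where
 "product_list xs ys = concat (map (%x. map (%y. (x, y)) ys) xs)"

text \<open>An option of the first player is a list of clauses, each of which requires one of its states to
 be offered to the second player.\<close>

definition solve :: "'s list => nat list list => ('s => 's list list list) => ('s => (bool \<times> bool) list) => 's => bool" where
 "solve ss cs opts rg s0 \<longleftrightarrow> (s0, update_counts (rg s0) (map (%_. 0) (rg s0))) :
   set (fold (%_ X. filter (survives opts rg X) X) (product_list ss cs) (product_list ss cs))"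

lemma set_product_list: "set (product_list xs ys) = set xs \<times> set ys"
 by (auto simp: product_list_def)

text \<open>An unstable round removes at least one element, so as many rounds as there are elements
  reach a fixpoint.\<close>

lemma fold_filter_stable:
 fixes F :: "'a list => 'a => bool"
 defines "step \<equiv> (%_ :: 'b. %X. filter (F X) X)"
 assumes "length X0 <= length l"
 shows "step undefined (fold step l X0) = fold step l X0"
proof -
 have "step undefined (fold step l X) = fold step l X | length (fold step l X) + length l <= length X" for l X
 proof (induction l arbitrary: X)
  case (Cons x l)
  show ?case
  proof (cases "filter (F X) X = X")
   case True
   have "fold step l X = X" for l
    by (induction l) (auto simp: step_def True)
   thus ?thesis using True by (simp add: step_def)
  next
   case False
   hence "length (filter (F X) X) < length X"
    by (metis filter_id_conv length_filter_less)
   thus ?thesis using Cons[of "filter (F X) X"] by (auto simp: step_def)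
  qed
 qed simp
 from this[of l X0] show ?thesis
 proof
  assume "length (fold step l X0) + length l <= length X0"
  hence "fold step l X0 = []" using assms(2) by (cases "fold step l X0") auto
  thus ?thesis by (simp add: step_def)
 qed
qed

lemma update_counts_upd:
 assumes "length (rg t) = l"
 shows "update_counts (rg t) (map c [0..<l]) =
  map (upd (%i. {t. fst (rg t ! i)}) (%i. {t. snd (rg t ! i)}) c t) [0..<l]"
 by (rule nth_equalityI) (auto simp: update_counts_def upd_def assms)

definition option_moves :: "'s set => ('s => 's list list list) => 's => 's set set" where
 "option_moves S opts s = {A. A <= S & (EX opt:set (opts s). ALL cl:set opt. EX t:set cl. t : A)}"

text \<open>The remaining pairs of state and counters form a safe set with bound \<open>K\<close>,
  hence are winning. Conversely the safe set of \<open>streett_bounded\<close> survives every round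
  of filtering; counters up to \<open>K\<close> inclusive explain the alphabet
  \<open>Suc K\<close>.\<close>

theorem solve_correct:
 assumes len: "!!t. length (rg t) = l" and cs: "set cs = words_below (Suc K) l"
  and K: "streett_bound (card (set ss)) l <= K" and s0: "s0 : set ss"
 shows "solve ss cs opts rg s0 \<longleftrightarrow>
  wins (option_moves (set ss) opts) (%i. {t. fst (rg t ! i)}) (%i. {t. snd (rg t ! i)}) {..<l} s0"
  (is "_ \<longleftrightarrow> wins ?mv ?R ?G ?I s0")
proof -
 let ?X0 = "product_list ss cs"
 define Y where "Y = fold (%_ X. filter (survives opts rg X) X) ?X0 ?X0"
 have stable: "filter (survives opts rg Y) Y = Y"
  using fold_filter_stable[of ?X0 ?X0 "survives opts rg"] by (simp add: Y_def)
 have Y0: "set Y <= set ?X0"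
  unfolding Y_def by (rule fold_invariant[of "%X. set X <= set ?X0"]) auto
 have greatest: "Z <= set Y" if Z: "Z <= set ?X0" "!!X sc. Z <= set X ==> sc : Z ==> survives opts rg X sc" for Z
  unfolding Y_def by (rule fold_invariant[of "%X. Z <= set X"]) (use Z in auto)
 have start: "update_counts (rg s0) (map (%_. 0) (rg s0)) = map (start_count ?R ?G s0) [0..<l]"
 proof -
  have "map (%_. 0) (rg s0) = map (%_. 0 :: nat) [0..<l]" by (rule nth_equalityI) (auto simp: len)
  thus ?thesis using update_counts_upd[of rg s0 l "%_. 0"] len by simp
 qed
 show ?thesis
 proof
  assume "solve ss cs opts rg s0"
  hence s0Y: "(s0, map (start_count ?R ?G s0) [0..<l]) : set Y" by (simp add: solve_def start Y_def)
  let ?X = "{(s, c). (s, map c [0..<l]) : set Y}"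
  have "safe ?mv ?R ?G ?I K {} ?X"
   unfolding safe_def
  proof (clarify, intro conjI)
   fix s c assume sY: "(s, map c [0..<l]) : set Y"
   hence "map c [0..<l] : words_below (Suc K) l" using Y0 cs by (auto simp: set_product_list)
   thus "ALL i:{..<l}. c i <= K" by (auto simp: words_below_iff)
   let ?A = "{t : set ss. (t, map (upd ?R ?G c t) [0..<l]) : set Y}"
   have "(s, map c [0..<l]) : set (filter (survives opts rg Y) Y)" using sY by (simp only: stable)
   hence "survives opts rg Y (s, map c [0..<l])" by simp
   hence "EX opt:set (opts s). ALL cl:set opt. EX t:set cl. (t, map (upd ?R ?G c t) [0..<l]) : set Y"
    unfolding survives_def list_all_iff list_ex_iff by (simp add: update_counts_upd len)
   moreover have "t : set ss" if "(t, d) : set Y" for t d using that Y0 by (auto simp: set_product_list)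
   ultimately have "?A : ?mv s" unfolding option_moves_def by fastforce
   thus "EX A:?mv s. ALL t:A. t : {} | (t, upd ?R ?G c t) : ?X" by (rule rev_bexI) simp
  qed
  from safe_wins[OF this, of s0] s0Y show "wins ?mv ?R ?G ?I s0" by simp
 next
  assume w: "wins ?mv ?R ?G ?I s0"
  have "EX X. safe ?mv ?R ?G ?I (streett_bound (card (set ss)) (card ?I)) {} X &
   (ALL s:set ss. wins ?mv ?R ?G ?I s --> (s, start_count ?R ?G s) : X)"
   by (rule streett_bounded) (auto simp: option_moves_def)
  then obtain X where X: "safe ?mv ?R ?G ?I (streett_bound (card (set ss)) l) {} X"
   "(s0, start_count ?R ?G s0) : X" using w s0 by auto
  let ?Z = "{(s, map c [0..<l]) | s c. (s, c) : X & s : set ss}"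
  have "?Z <= set Y"
  proof (rule greatest)
   show "?Z <= set ?X0"
   proof clarify
    fix s c assume sc: "(s, c) : X" "s : set ss"
    hence "ALL i<l. c i <= streett_bound (card (set ss)) l" using X(1) by (auto simp: safe_def)
    hence "ALL i<l. c i < Suc K" using K by (meson le_imp_less_Suc le_trans)
    thus "(s, map c [0..<l]) : set ?X0" using sc(2) by (simp add: set_product_list cs words_below_iff)
   qed
   fix W sc assume W: "?Z <= set W" and "sc : ?Z"
   then obtain s c where sc: "sc = (s, map c [0..<l])" "(s, c) : X" "s : set ss" by blast
   with X(1) obtain A where A: "A : ?mv s" "ALL t:A. (t, upd ?R ?G c t) : X" unfolding safe_def by blast
   then obtain opt where opt: "opt : set (opts s)" "ALL cl:set opt. EX t:set cl. t : A" and AS: "A <= set ss"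
    by (auto simp: option_moves_def)
   have "(t, map (upd ?R ?G c t) [0..<l]) : set W" if "t : A" for t
    using A(2) AS that W by blast
   thus "survives opts rg W sc"
    unfolding survives_def list_all_iff list_ex_iff sc(1) using opt by (simp add: update_counts_upd len) blast
  qed
  moreover have "(s0, map (start_count ?R ?G s0) [0..<l]) : ?Z" using X(2) s0 by blast
  ultimately have "(s0, map (start_count ?R ?G s0) [0..<l]) : set Y" by blast
  thus "solve ss cs opts rg s0" by (simp add: solve_def start Y_def)
 qed
qed

lemma wins_reindex:
 assumes "set xs = I"
 shows "wins mv R G I s \<longleftrightarrow> wins mv (%i. R (xs ! i)) (%i. G (xs ! i)) {..<length xs} s"
proof -
 have "streett R G I rh \<longleftrightarrow> streett (%i. R (xs ! i)) (%i. G (xs ! i)) {..<length xs} rh" for rh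
  unfolding streett_def assms[symmetric] all_set_conv_all_nth by auto
 thus ?thesis by (simp add: wins_def wins_by_def)
qed

section \<open>Running time of the solver and enumeration of lists\<close>

lemma feasible_update_counts [feas]:
 "feasible f ==> feasible g ==> feasible (%z. update_counts (f z) (g z))"
 unfolding update_counts_def by (intro feas)

lemma feasible_product_list [feas]:
 assumes "feasible f" and g: "feasible g"
 shows "feasible (%z. product_list (f z) (g z))"
 unfolding product_list_def by (intro feas feasible_comp[OF g] assms)

lemma csize_filter: "csize (filter P xs) <= csize xs"
 by (induction xs) (auto simp: csize_simps)

lemma feasible_survives:
 fixes opts :: "'z::tcoded => 's::tcoded => 's list list list"
 assumes eq: "feasible_equality TYPE('s)"
  and opts: "feasible (%p. opts (fst p) (snd p))" and rg: "feasible (%p. rg (fst p) (snd p))"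
 shows "feasible (%p. survives (opts (fst p)) (rg (fst p)) (fst (snd p)) (snd (snd p)))"
 unfolding survives_def
 by (intro feas eq feasible_comp2[OF opts] feasible_comp2[OF rg])

lemma feasible_solve:
 fixes opts :: "'z::tcoded => 's::tcoded => 's list list list"
 assumes eq: "feasible_equality TYPE('s)"
  and opts: "feasible (%p. opts (fst p) (snd p))" and rg: "feasible (%p. rg (fst p) (snd p))"
  and "feasible ss" "feasible cs" "feasible s0"
 shows "feasible (%z. solve (ss z) (cs z) (opts z) (rg z) (s0 z))"
proof -
 note [feas] = feasible_comp2[OF rg] assms(4-6)
 have "feasible (%z. fold (%_ X. filter (survives (opts z) (rg z) X) X) (product_list (ss z) (cs z)) (product_list (ss z) (cs z)))"
 proof (rule feasible_fold_additive[where r = "%_. 0"])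
  show "feasible (%p. filter (survives (opts (fst p)) (rg (fst p)) (snd (snd p))) (snd (snd p)))"
   by (intro feas feasible_comp3[OF feasible_survives[OF eq opts rg]])
 qed (intro feas pb_intros | simp add: csize_filter)+
 thus ?thesis unfolding solve_def by (intro feas eq)
qed

text \<open>Truncating each round to \<open>P\<close> entries keeps the size polynomial in
  \<open>P\<close> for arbitrary arguments, as feasibility demands. The result is complete as soon
  as \<open>P\<close> is at least the full number of lists.\<close>

definition enum_lists :: "nat => 'a list => nat => 'a list list" where
 "enum_lists P xs l = fold (%_ ws. take P (concat (map (%w. map (%a. a # w) xs) ws))) (replicate l ()) [[]]"

abbreviation enum_words :: "nat => nat => nat => nat list list" where
 "enum_words P M l \<equiv> enum_lists P [0..<M] l"

lemma set_enum_lists: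
 assumes "length xs ^ l <= P" "xs ~= []"
 shows "set (enum_lists P xs l) = {ws. length ws = l & set ws <= set xs}" and "length (enum_lists P xs l) = length xs ^ l"
proof -
 let ?f = "%ws. take P (concat (map (%w. map (%a. a # w) xs) ws))"
 have "set ((?f ^^ j) [[]]) = {ws. length ws = j & set ws <= set xs} & length ((?f ^^ j) [[]]) = length xs ^ j" if "j <= l" for j
  using that
 proof (induction j)
  case (Suc j)
  let ?ws = "(?f ^^ j) [[]]"
  have IH: "set ?ws = {ws. length ws = j & set ws <= set xs}" "length ?ws = length xs ^ j" using Suc by simp_all
  have len: "length (concat (map (%w. map (%a. a # w) xs) ws)) = length ws * length xs" for ws
   by (induction ws) auto
  have "length xs ^ Suc j <= length xs ^ l" using Suc.prems assms(2) by (intro power_increasing) (simp_all add: Suc_le_eq)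
  hence f: "?f ?ws = concat (map (%w. map (%a. a # w) xs) ?ws)"
   using len[of ?ws] IH(2) assms(1) by (simp add: mult.commute)
  have "x : set (?f ?ws) \<longleftrightarrow> length x = Suc j & set x <= set xs" for x
   unfolding f using IH(1) by (cases x) auto
  thus ?case using len[of ?ws] IH(2) by (auto simp: f mult.commute)
 qed auto
 from this[of l] show "set (enum_lists P xs l) = {ws. length ws = l & set ws <= set xs}" "length (enum_lists P xs l) = length xs ^ l"
  by (simp_all add: enum_lists_def fold_replicate)
qed

lemma set_enum_words: "M ^ l <= P ==> 1 <= M ==> set (enum_words P M l) = words_below M l"
 using set_enum_lists(1)[of "[0..<M]" l P] by (simp add: words_below_def atLeast0LessThan)

lemma csize_le_length:
 assumes "!!x. x : set xs ==> csize x <= b"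
 shows "csize xs <= 1 + length xs * (b + 1)"
 using assms
proof (induction xs)
 case (Cons x xs)
 have "csize x <= b" "csize xs <= 1 + length xs * (b + 1)" using Cons by auto
 thus ?case by (simp add: csize_simps)
qed (simp add: csize_simps)

lemma feasible_enum_lists [feas]:
 assumes P: "feasible P" and xs: "feasible xs" and l: "feasible l"
 shows "feasible (%z. enum_lists (P z) (xs z) (l z))"
proof -
 obtain T p where p: "poly_bounded p" "!!x. csize (P x) <= p (csize x)" using feasibleE[OF P] by metis
 obtain u where u: "poly_bounded u" "!!z x. x : set (xs z) ==> csize x <= u (csize z)" using csize_member_bound[OF xs] by metis
 obtain V v where v: "poly_bounded v" "!!x. csize (l x) <= v (csize x)" using feasibleE[OF l] by metis
 let ?q = "%n. 1 + (p n + 1) * ((1 + v n * (u n + 1)) + 1)"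
 show ?thesis
  unfolding enum_lists_def
 proof (rule feasible_fold)
  show "poly_bounded ?q" by (intro pb_intros p u v)
  fix z n
  let ?f = "%_ :: unit. %ws. take (P z) (concat (map (%w. map (%a. a # w) (xs z)) ws))"
  have "length (fold ?f us [[]]) <= P z + 1 & (ALL w:set (fold ?f us [[]]). length w <= length us & set w <= set (xs z))" for us
  proof (induction us rule: rev_induct)
   case (snoc u us)
   thus ?case by (fastforce dest!: in_set_takeD)
  qed simp
  note * = this[of "take n (replicate (l z) ())"]
  define ws where "ws = fold ?f (take n (replicate (l z) ())) [[]]"
  have ws: "length ws <= P z + 1" "!!w. w : set ws ==> length w <= l z & set w <= set (xs z)"
   using * by (auto simp: ws_def)
  have "csize w <= 1 + v (csize z) * (u (csize z) + 1)" if "w : set ws" for w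
  proof -
   have "csize w <= 1 + length w * (u (csize z) + 1)" using ws(2)[OF that] u(2) by (intro csize_le_length) auto
   also have "... <= 1 + v (csize z) * (u (csize z) + 1)"
    using ws(2)[OF that] v(2)[of z] by (intro add_left_mono mult_le_mono1) (simp add: csize_simps)
   finally show ?thesis .
  qed
  from csize_le_length[OF this] have "csize ws <= 1 + length ws * ((1 + v (csize z) * (u (csize z) + 1)) + 1)" by simp
  also have "... <= ?q (csize z)"
   using ws(1) p(2)[of z] by (intro add_left_mono mult_le_mono1) (simp add: csize_simps)
  finally show "csize (fold ?f (take n (replicate (l z) ())) [[]]) <= ?q (csize z)" by (simp add: ws_def)
 qed (intro feas feasible_comp[OF P] feasible_comp[OF xs] l)+
qed

section \<open>Instances as coded data\<close>

instantiation dpa_code_ext :: (tcoded) tcoded begin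
definition tcode_dpa_code_ext :: "'a dpa_code_ext => tree" where
 "tcode_dpa_code_ext r = tcode (code_init r, code_table r, code_prios r, dpa_code.more r)"
instance by standard (auto simp: inj_def tcode_dpa_code_ext_def simp del: tcode_prod.simps)
end

instantiation player_code_ext :: (tcoded) tcoded begin
definition tcode_player_code_ext :: "'a player_code_ext => tree" where
 "tcode_player_code_ext r = tcode (code_pref r, code_automata r, player_code.more r)"
instance by standard (auto simp: inj_def tcode_player_code_ext_def simp del: tcode_prod.simps)
end

instantiation instance_code_ext :: (tcoded) tcoded begin
definition tcode_instance_code_ext :: "'a instance_code_ext => tree" where
 "tcode_instance_code_ext r = tcode (inst_owner r, inst_edges r, inst_players r, inst_start r, inst_bounds r, instance_code.more r)"
instance by standard (auto simp: inj_def tcode_instance_code_ext_def simp del: tcode_prod.simps)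
end

lemma feasible_dpa_code:
 assumes "feasible f"
 shows "feasible (%x. (code_init (f x :: dpa_code), code_table (f x), code_prios (f x), ()))"
 by (rule feasible_cast[OF assms]) (simp add: tcode_dpa_code_ext_def)

lemma feasible_player_code:
 assumes "feasible f"
 shows "feasible (%x. (code_pref (f x :: player_code), code_automata (f x), ()))"
 by (rule feasible_cast[OF assms]) (simp add: tcode_player_code_ext_def)

lemma feasible_instance_code:
 assumes "feasible f"
 shows "feasible (%x. (inst_owner (f x :: instance_code), inst_edges (f x), inst_players (f x), inst_start (f x), inst_bounds (f x), ()))"
 by (rule feasible_cast[OF assms]) (simp add: tcode_instance_code_ext_def)

lemma feasible_code_selectors [feas]:
 "feasible f ==> feasible (%x. code_init (f x :: dpa_code))"
 "feasible f ==> feasible (%x. code_table (f x :: dpa_code))"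
 "feasible f ==> feasible (%x. code_prios (f x :: dpa_code))"
 "feasible g ==> feasible (%x. code_pref (g x :: player_code))"
 "feasible g ==> feasible (%x. code_automata (g x :: player_code))"
 "feasible h ==> feasible (%x. inst_owner (h x :: instance_code))"
 "feasible h ==> feasible (%x. inst_edges (h x :: instance_code))"
 "feasible h ==> feasible (%x. inst_players (h x :: instance_code))"
 "feasible h ==> feasible (%x. inst_start (h x :: instance_code))"
 "feasible h ==> feasible (%x. inst_bounds (h x :: instance_code))"
proof -
 assume f: "feasible f"
 note d = feasible_dpa_code[OF f]
 show "feasible (%x. code_init (f x :: dpa_code))" using feasible_fst[OF d] by simp
 show "feasible (%x. code_table (f x :: dpa_code))" using feasible_fst[OF feasible_snd[OF d]] by simp
 show "feasible (%x. code_prios (f x :: dpa_code))" using feasible_fst[OF feasible_snd[OF feasible_snd[OF d]]] by simp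
next
 assume g: "feasible g"
 note d = feasible_player_code[OF g]
 show "feasible (%x. code_pref (g x :: player_code))" using feasible_fst[OF d] by simp
 show "feasible (%x. code_automata (g x :: player_code))" using feasible_fst[OF feasible_snd[OF d]] by simp
next
 assume h: "feasible h"
 note d = feasible_instance_code[OF h]
 note d1 = feasible_snd[OF d, simplified]
 note d2 = feasible_snd[OF d1, simplified]
 note d3 = feasible_snd[OF d2, simplified]
 note d4 = feasible_snd[OF d3, simplified]
 show "feasible (%x. inst_owner (h x :: instance_code))" using feasible_fst[OF d] by simp
 show "feasible (%x. inst_edges (h x :: instance_code))" using feasible_fst[OF d1] by simp
 show "feasible (%x. inst_players (h x :: instance_code))" using feasible_fst[OF d2] by simp
 show "feasible (%x. inst_start (h x :: instance_code))" using feasible_fst[OF d3] by simp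
 show "feasible (%x. inst_bounds (h x :: instance_code))" using feasible_fst[OF d4] by simp
qed

lemma feasible_dpa_code_make [feas]:
 assumes "feasible a" "feasible b" "feasible c"
 shows "feasible (%x. \<lparr>code_init = a x, code_table = b x, code_prios = c x\<rparr>)"
 by (rule feasible_cast[where f = "%x. (a x, b x, c x, ())"])
  (intro feas assms | simp add: tcode_dpa_code_ext_def)+

lemma feasible_player_code_make [feas]:
 assumes "feasible a" "feasible b"
 shows "feasible (%x. \<lparr>code_pref = a x, code_automata = b x\<rparr>)"
 by (rule feasible_cast[where f = "%x. (a x, b x, ())"])
  (intro feas assms | simp add: tcode_player_code_ext_def)+

lemma feasible_instance_code_make [feas]:
 assumes "feasible a" "feasible b" "feasible c" "feasible d" "feasible e"
 shows "feasible (%x. \<lparr>inst_owner = a x, inst_edges = b x, inst_players = c x, inst_start = d x, inst_bounds = e x\<rparr>)"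
 by (rule feasible_cast[where f = "%x. (a x, b x, c x, d x, e x, ())"])
  (intro feas assms | simp add: tcode_instance_code_ext_def)+

text \<open>A number admits fewer halvings than its value, so it can serve as its own number of
  rounds; surplus rounds leave the result alone.\<close>

lemma feasible_binary [feas]:
 assumes n: "feasible n"
 shows "feasible (%x. binary (n x))"
proof (rule feasible_comp[OF _ n])
 let ?F = "%_ :: unit. %(bs, k). if k = 0 then (bs, k) else (bs @ [odd k], k div 2)"
 have "feasible (%n :: nat. fold ?F (replicate n ()) ([], n))"
 proof (rule feasible_fold_additive[where r = "%_. 5"])
  show "csize (case a of (bs, k) => if k = 0 then (bs, k) else (bs @ [odd k], k div 2)) <= csize a + 5"
   for a :: "bool list \<times> nat"
  proof (cases a)
   case (Pair bs k)
   have "csize (bs @ [odd k]) + 1 = csize bs + (2 + csize (odd k))" unfolding csize_append by (simp add: csize_simps)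
   moreover have "csize b <= 3" for b :: bool by (cases b) (simp_all add: csize_simps)
   from this[of "odd k"] have "csize (odd k) <= 3" .
   ultimately have "csize (bs @ [odd k]) <= csize bs + 4" by linarith
   thus ?thesis by (auto simp: Pair csize_simps)
  qed
 qed ((unfold case_prod_beta)?, intro feas pb_intros)+
 hence "feasible (%n :: nat. fst (fold ?F (replicate n ()) ([], n)))" by (rule feasible_fst)
 moreover have "fold ?F (replicate j ()) (bs, k) = (bs @ binary k, 0)" if "k <= j" for j bs k
  using that
 proof (induction j arbitrary: bs k)
  case 0
  thus ?case by (simp add: binary.simps)
 next
  case (Suc j)
  show ?case
  proof (cases "k = 0")
   case True
   thus ?thesis using Suc.IH[of 0 bs] by (simp add: binary.simps)
  next
   case False
   hence "k div 2 <= j" using Suc.prems by linarith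
   with Suc.IH[OF this] False show ?thesis by (simp add: binary.simps[of k])
  qed
 qed
 ultimately show "feasible binary" by simp
qed

lemma feasible_enc_list:
 assumes e: "feasible e" and l: "feasible l"
 shows "feasible (%z. enc_list e (l z))"
 unfolding enc_list_def by (intro feas feasible_comp[OF e] l)

lemma feasible_enc_nat [feas]: "feasible n ==> feasible (%z. enc_nat (n z))"
 unfolding enc_nat_def by (intro feasible_enc_list feas)

lemma feasible_enc_edge [feas]: "feasible e ==> feasible (%z. enc_edge (e z))"
proof -
 assume e: "feasible e"
 have "enc_edge p = enc_nat (fst p) @ enc_nat (snd p)" for p by (cases p) simp
 thus ?thesis by (simp add: feas e)
qed

lemma feasible_enc_dpa [feas]: "feasible C ==> feasible (%z. enc_dpa (C z))"
 unfolding enc_dpa_def by (intro feas feasible_enc_list)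

lemma feasible_enc_player [feas]: "feasible C ==> feasible (%z. enc_player (C z))"
 unfolding enc_player_def by (intro feas feasible_enc_list)

lemma feasible_enc_instance [feas]: "feasible C ==> feasible (%z. enc_instance (C z))"
 unfolding enc_instance_def by (intro feas feasible_enc_list)

section \<open>Enumerating instances\<close>

text \<open>Bit strings are not parsed: all candidates are listed and their encodings compared with
  the input. In an encoding of length at most \<open>m\<close> every list has at most
  \<open>m\<close> entries and every number is below \<open>2 ^ m\<close>, so nested enumerations up
  to these limits contain the right instance.\<close>

definition enum_upto :: "nat => 'a list => nat => 'a list list" where
 "enum_upto P xs m = concat (map (%l. enum_lists P xs l) [0..<Suc m])"

definition dpa_list :: "nat => nat => dpa_code list" where
 "dpa_list P m = map (%(a, t, c). \<lparr>code_init = a, code_table = t, code_prios = c\<rparr>)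
   (product_list [0..<min P (2 ^ m)] (product_list (enum_upto P (enum_upto P [0..<min P (2 ^ m)] m) m) (enum_upto P [0..<min P (2 ^ m)] m)))"

definition edge_list :: "nat => nat => (nat \<times> nat) list" where
 "edge_list P m = product_list [0..<min P (2 ^ m)] [0..<min P (2 ^ m)]"

definition player_list :: "nat => nat => player_code list" where
 "player_list P m = map (%(r, A). \<lparr>code_pref = r, code_automata = A\<rparr>)
   (product_list (enum_upto P (edge_list P m) m) (enum_upto P (dpa_list P m) m))"

definition instance_list :: "nat => nat => instance_code list" where
 "instance_list P m = map (%(a, b, c, d, e).
   \<lparr>inst_owner = a, inst_edges = b, inst_players = c, inst_start = d, inst_bounds = e\<rparr>)
   (product_list (enum_upto P [0..<min P (2 ^ m)] m) (product_list (enum_upto P (edge_list P m) m)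
    (product_list (enum_upto P (player_list P m) m) (product_list [0..<min P (2 ^ m)] (enum_upto P [0..<min P (2 ^ m)] m)))))"

text \<open>One power of \<open>m\<close> comes from choosing up to \<open>m\<close> entries,
  another absorbs the sum over all lengths. Each level of nesting therefore raises the exponent by
  two.\<close>

lemma enum_upto:
 assumes "length xs <= 2 ^ (m ^ a)" "2 ^ (m ^ Suc a) <= P" "2 <= m" "xs ~= []"
 shows "set (enum_upto P xs m) = {ws. length ws <= m & set ws <= set xs}" "length (enum_upto P xs m) <= 2 ^ (m ^ (a + 2))"
  "enum_upto P xs m ~= []"
proof -
 have l: "length xs ^ l <= 2 ^ (m ^ Suc a)" if "l <= m" for l
 proof -
  have "length xs ^ l <= (2 ^ (m ^ a)) ^ l" by (rule power_mono[OF assms(1)]) simp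
  also have "... = 2 ^ (m ^ a * l)" by (rule power_mult[symmetric])
  also have "... <= 2 ^ (m ^ Suc a)" using that by (intro power_increasing) (simp_all add: mult.commute)
  finally show ?thesis .
 qed
 hence e: "set (enum_lists P xs l) = {ws. length ws = l & set ws <= set xs}" "length (enum_lists P xs l) <= 2 ^ (m ^ Suc a)" if "l <= m" for l
  using set_enum_lists[OF le_trans[OF _ assms(2)] assms(4), of l] that by auto
 thus "set (enum_upto P xs m) = {ws. length ws <= m & set ws <= set xs}"
  unfolding enum_upto_def set_concat set_map image_image set_upt by (auto simp: less_Suc_eq_le)
 hence "[] : set (enum_upto P xs m)" by simp
 thus "enum_upto P xs m ~= []" by auto
 have "length (enum_upto P xs m) = (\<Sum>l\<leftarrow>[0..<Suc m]. length (enum_lists P xs l))"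
  by (simp add: enum_upto_def length_concat comp_def)
 also have "... <= (\<Sum>l\<leftarrow>[0..<Suc m]. 2 ^ (m ^ Suc a))" by (rule sum_list_mono) (use e(2) in "auto simp: less_Suc_eq_le")
 also have "... = Suc m * 2 ^ (m ^ Suc a)" by (simp add: sum_list_triv del: upt_Suc)
 also have "... <= 2 ^ m * 2 ^ (m ^ Suc a)" using less_exp[of m] by (intro mult_le_mono1) (simp add: Suc_le_eq)
 also have "... = 2 ^ (m + m ^ Suc a)" by (rule power_add[symmetric])
 also have "... <= 2 ^ (m ^ (a + 2))"
 proof (rule power_increasing)
  have "m + m ^ Suc a <= m ^ Suc a * 2" using self_le_power[of m "Suc a"] assms(3) by simp
  also have "... <= m ^ Suc a * m" by (rule mult_le_mono2[OF assms(3)])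
  finally show "m + m ^ Suc a <= m ^ (a + 2)" by (simp add: mult.commute mult.left_commute)
 qed simp
 finally show "length (enum_upto P xs m) <= 2 ^ (m ^ (a + 2))" .
qed

lemma length_product_list: "length (product_list xs ys) = length xs * length ys"
 by (induction xs) (auto simp: product_list_def)

lemma length_enc_list: "length (enc_list e xs) = 1 + (\<Sum>x\<leftarrow>xs. 1 + length (e x))"
 by (induction xs) (auto simp: enc_list_def)

lemma length_enc_member: "x : set xs ==> length (e x) < length (enc_list e xs)"
 by (induction xs) (auto simp: enc_list_def)

lemma length_le_enc_list: "length xs < length (enc_list e xs)"
 by (induction xs) (auto simp: enc_list_def)

lemma less_two_power_enc: "n < 2 ^ length (enc_nat n)"
proof -
 have "n < 2 ^ length (binary n)"
 proof (induction n rule: less_induct)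
  case (less n)
  show ?case
  proof (cases "n = 0")
   case False
   hence "n div 2 < 2 ^ length (binary (n div 2))" using less by simp
   thus ?thesis using False by (simp add: binary.simps[of n])
  qed (simp add: binary.simps)
 qed
 also have "... <= 2 ^ length (enc_nat n)" by (rule power_increasing) (simp_all add: enc_nat_def length_enc_list sum_list_triv)
 finally show ?thesis .
qed

lemma instance_list_complete:
 assumes P: "P = 2 ^ (m ^ 12)" and m: "2 <= m" and I: "length (enc_instance I) <= m"
 shows "I : set (instance_list P m)"
proof -
 have pow: "(2::nat) ^ x <= 2 ^ y" if "x <= y" for x y using that by (rule power_increasing) simp
 have mm: "m ^ x <= m ^ y" if "x <= y" for x y using that m by (intro power_increasing) simp_all
 have P': "2 ^ (m ^ Suc a) <= P" if "a <= 11" for a using pow[OF mm[of "Suc a" 12]] that by (simp add: P)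
 have le2: "2 ^ (m ^ a + m ^ b) <= (2::nat) ^ (m ^ c)" if "a < c" "b < c" for a b c
 proof (rule pow)
  have "m ^ a <= m ^ (c - 1)" "m ^ b <= m ^ (c - 1)" using that by (auto intro!: mm)
  moreover have "m ^ c = m * m ^ (c - 1)" using that by (cases c) auto
  ultimately show "m ^ a + m ^ b <= m ^ c" using mult_le_mono1[OF m, of "m ^ (c - 1)"] by linarith
 qed
 have prod: "length (product_list xs ys) <= 2 ^ (m ^ c)" if "length xs <= 2 ^ (m ^ a)" "length ys <= 2 ^ (m ^ b)" "a < c" "b < c"
  for xs :: "'x list" and ys :: "'y list" and a b c
  using le_trans[OF mult_le_mono[OF that(1,2)], of "2 ^ (m ^ c)"] le2[OF that(3,4)] by (simp add: length_product_list power_add)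
 let ?B = "[0..<min P (2 ^ m)]"
 have B2: "min P (2 ^ m) = 2 ^ m" using pow[of m "m ^ 12"] self_le_power[of m 12] m by (simp add: P min_def)
 have B: "length ?B <= 2 ^ (m ^ 1)" "?B ~= []" unfolding B2 by simp_all
 note W = enum_upto[OF B(1) P' m B(2)]
 note T = enum_upto[OF W(2) P' m W(3)]
 \<comment> \<open>The sizes have the form \<open>2 ^ (m ^ a)\<close>: \<open>a\<close> is 1 for
   numbers, 3 for lists of numbers, 5 for tables, 7 for automata, 2 for pairs of numbers and 10 for
   players. Enumerating over \<open>a\<close> needs the cap \<open>2 ^ (m ^ Suc a)\<close>, which 12
   accommodates.\<close>
 have D: "length (dpa_list P m) <= 2 ^ (m ^ 7)" "dpa_list P m ~= []"
  using prod[OF B(1) prod[OF T(2) W(2), of 6]] B(2) T(3) W(3) by (auto simp: dpa_list_def product_list_def)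
 have E: "length (edge_list P m) <= 2 ^ (m ^ 2)" "edge_list P m ~= []"
  using prod[OF B(1) B(1), of 2] B(2) by (auto simp: edge_list_def product_list_def)
 note EL = enum_upto[OF E(1) P' m E(2)] and DL = enum_upto[OF D(1) P' m D(2)]
 have Q: "length (player_list P m) <= 2 ^ (m ^ 10)" "player_list P m ~= []"
  using prod[OF EL(2) DL(2), of 10] EL(3) DL(3) by (auto simp: player_list_def product_list_def)
 note QL = enum_upto[OF Q(1) P' m Q(2)]
 have nat: "n : set ?B" if "length (enc_nat n) <= m" for n
  using less_le_trans[OF less_two_power_enc pow[OF that]] unfolding B2 by simp
 have listI: "length xs <= m & set xs <= set ys" if "length (enc_list e xs) <= m" "!!x. length (e x) <= m ==> x : set ys"
  for e and xs ys :: "'x list"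
  using that length_le_enc_list[of xs e] length_enc_member[of _ xs e] by (meson le_trans less_imp_le subsetI)
 have w: "xs : set (enum_upto P ?B m)" if "length (enc_list enc_nat xs) <= m" for xs
  using listI[OF that nat] by (simp add: W(1))
 have edge: "e : set (edge_list P m)" if "length (enc_edge e) <= m" for e
  using that nat by (cases e) (simp add: edge_list_def set_product_list del: set_upt)
 have dpa: "C : set (dpa_list P m)" if "length (enc_dpa C) <= m" for C
 proof -
  have "code_table C : set (enum_upto P (enum_upto P ?B m) m)" using that listI[of "enc_list enc_nat" "code_table C", OF _ w] by (simp add: T(1) enc_dpa_def)
  hence "(code_init C, code_table C, code_prios C) : set (product_list ?B (product_list (enum_upto P (enum_upto P ?B m) m) (enum_upto P ?B m)))"
   using that w[of "code_prios C"] nat[of "code_init C"] by (simp add: enc_dpa_def set_product_list del: set_upt)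
  thus ?thesis unfolding dpa_list_def set_map by (rule rev_image_eqI) simp
 qed
 have player: "C : set (player_list P m)" if "length (enc_player C) <= m" for C
 proof -
  have "(code_pref C, code_automata C) : set (product_list (enum_upto P (edge_list P m) m) (enum_upto P (dpa_list P m) m))"
   using that listI[of "enc_edge" "code_pref C", OF _ edge] listI[of "enc_dpa" "code_automata C", OF _ dpa]
   by (simp add: enc_player_def set_product_list EL(1) DL(1))
  thus ?thesis unfolding player_list_def set_map by (rule rev_image_eqI) simp
 qed
 have "(inst_owner I, inst_edges I, inst_players I, inst_start I, inst_bounds I) : set (product_list (enum_upto P ?B m)
   (product_list (enum_upto P (edge_list P m) m) (product_list (enum_upto P (player_list P m) m) (product_list ?B (enum_upto P ?B m)))))"
  using I w[of "inst_owner I"] w[of "inst_bounds I"] nat[of "inst_start I"] listI[of "enc_edge" "inst_edges I", OF _ edge] listI[of "enc_player" "inst_players I", OF _ player]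
  by (simp add: enc_instance_def set_product_list EL(1) QL(1) del: set_upt)
 thus ?thesis unfolding instance_list_def set_map by (rule rev_image_eqI) simp
qed

lemma feasible_enum_upto [THEN feasible_comp3, feas]: "feasible3 enum_upto"
 unfolding enum_upto_def by (intro feas)

lemma feasible_dpa_list [feas]: "feasible f ==> feasible g ==> feasible (%z. dpa_list (f z) (g z))"
 unfolding dpa_list_def case_prod_beta by (intro feas)

lemma feasible_player_list [feas]: "feasible f ==> feasible g ==> feasible (%z. player_list (f z) (g z))"
 unfolding player_list_def edge_list_def case_prod_beta by (intro feas)

lemma feasible_instance_list [feas]: "feasible f ==> feasible g ==> feasible (%z. instance_list (f z) (g z))"
 unfolding instance_list_def edge_list_def case_prod_beta by (intro feas)

section \<open>The decision procedure\<close>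

definition check_dpa :: "nat => dpa_code => bool" where
 "check_dpa n C \<longleftrightarrow> code_init C < length (code_table C) &
   list_all (%row. length row = n & list_all (%q. q < length (code_table C)) row) (code_table C) &
   length (code_prios C) = length (code_table C)"

definition check_syntax :: "instance_code => bool" where
 "check_syntax I \<longleftrightarrow>
   list_all (%e. fst e < length (inst_owner I) & snd e < length (inst_owner I)) (inst_edges I) &
   list_all (%u. list_ex (%e. fst e = u) (inst_edges I)) [0..<length (inst_owner I)] &
   list_all (%i. i < length (inst_players I)) (inst_owner I) &
   list_all (%Q. list_all (%r. fst r < length (code_automata Q) & snd r < length (code_automata Q)) (code_pref Q) &
    list_all (%C. check_dpa (length (inst_owner I)) C) (code_automata Q)) (inst_players I) &
   inst_start I < length (inst_owner I) & length (inst_bounds I) = length (inst_players I) &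
   list_all (%i. nthd 0 (inst_bounds I) i < length (code_automata (player_at I i))) [0..<length (inst_players I)]"

lemma check_dpa_iff: "check_dpa n C \<longleftrightarrow> wf_dpa_code n C"
proof
 assume "check_dpa n C"
 hence c: "code_init C < length (code_table C)" "length (code_prios C) = length (code_table C)"
  "!!row q. row : set (code_table C) ==> length row = n & (q : set row --> q < length (code_table C))"
  by (auto simp: check_dpa_def list_all_iff)
 have "code_table C ! q ! a < length (code_table C)" if "q < length (code_table C)" "a < n" for q a
  using c(3)[of "code_table C ! q" "code_table C ! q ! a"] that by auto
 thus "wf_dpa_code n C"
  using c by (auto simp: wf_dpa_code_def wf_dpa_def dpa_of_def)
next
 assume w: "wf_dpa_code n C"
 have "q < length (code_table C)" if row: "row : set (code_table C)" and q: "q : set row" for row q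
 proof -
  obtain j where j: "j < length (code_table C)" "row = code_table C ! j" using row by (metis in_set_conv_nth)
  obtain a where a: "a < length row" "q = row ! a" using q by (metis in_set_conv_nth)
  have "length row = n" using w row by (simp add: wf_dpa_code_def)
  thus ?thesis using w j a by (simp add: wf_dpa_code_def wf_dpa_def dpa_of_def)
 qed
 thus "check_dpa n C" using w
  by (auto simp: check_dpa_def wf_dpa_code_def wf_dpa_def dpa_of_def list_all_iff)
qed

definition unique_payoffs :: "instance_code => bool" where
 "unique_payoffs I \<longleftrightarrow> (ALL i<length (inst_players I). ALL w:omega_words {..<length (inst_owner I)}.
   EX! p. p < num_payoffs I i & dpa_accepts (automaton I i p) w)"

text \<open>Beyond syntax, validity amounts to the automata of each player partitioning the words.
  Well-definedness of \<open>pay\<close> and regularity of its preimages follow, as the given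
  automata are themselves the witnesses.\<close>

lemma valid_instance_iff: "valid_instance I \<longleftrightarrow> check_syntax I & unique_payoffs I"
proof
 assume valid: "valid_instance I"
 interpret instance_data I .
 have arena: "wf_arena G" using valid by (simp add: valid_instance_def RP_game_def wf_game_def)
 have pref: "!!i. i < np ==> pref G i <= payoffs G i \<times> payoffs G i"
  using valid by (simp add: valid_instance_def RP_game_def wf_game_def)
 have owner: "i < np" if "i : set (inst_owner I)" for i
 proof -
  obtain v where v: "v < length (inst_owner I)" "own v = i" using \<open>i : set (inst_owner I)\<close> by (metis in_set_conv_nth)
  hence "v : (\<Union>i\<in>players G. owned G i)" using arena by (auto simp: wf_arena_def)
  thus ?thesis using v(2) by simp
 qed
 have prefs: "fst r < length (code_automata Q) & snd r < length (code_automata Q)"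
  if "Q : set (inst_players I)" "r : set (code_pref Q)" for Q r
 proof -
  obtain i where i: "i < np" "inst_players I ! i = Q" using \<open>Q : set (inst_players I)\<close> by (metis in_set_conv_nth)
  with pref[OF i(1)] that(2) show ?thesis by (auto simp: num_payoffs_def)
 qed
 have "check_syntax I"
  unfolding check_syntax_def list_all_iff check_dpa_iff list_ex_iff
  using arena owner prefs valid
  by (fastforce simp: wf_arena_def valid_instance_def num_payoffs_def)
 moreover have "unique_payoffs I"
  unfolding unique_payoffs_def
 proof (intro allI ballI impI)
  fix i w assume i: "i < np" and w: "w : omega_words {..<length (inst_owner I)}"
  have p: "pay G i w < num_payoffs I i" using valid i w by (auto simp: valid_instance_def RP_game_def wf_game_def)
  have acc: "dpa_accepts (automaton I i p) w \<longleftrightarrow> pay G i w = p" if "p < num_payoffs I i" for p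
  proof -
   have "dpa_language (verts G) (automaton I i p) = pay_preimage G i p"
    using valid i that by (simp add: valid_instance_def)
   thus ?thesis using w by (auto simp: dpa_language_def pay_preimage_def)
  qed
  show "EX! p. p < num_payoffs I i & dpa_accepts (automaton I i p) w" using p acc by auto
 qed
 ultimately show "check_syntax I & unique_payoffs I" ..
next
 assume a: "check_syntax I & unique_payoffs I"
 interpret instance_data I .
 from a have syn: "check_syntax I" and uni: "unique_payoffs I" by auto
 have own: "own v < np" if "v < length (inst_owner I)" for v
  using syn that by (auto simp: check_syntax_def list_all_iff)
 have arena: "wf_arena G"
  unfolding wf_arena_def
 proof (intro conjI)
  show "edges G <= verts G \<times> verts G" using syn by (auto simp: check_syntax_def list_all_iff)
  show "ALL u:verts G. EX u'. (u, u') : edges G"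
  proof
   fix u assume "u : verts G"
   hence "EX e:E. fst e = u" using syn by (simp add: check_syntax_def list_all_iff list_ex_iff)
   thus "EX u'. (u, u') : edges G" by (metis G_simps(2) prod.collapse)
  qed
 qed (use own in "auto simp: disjoint_family_on_def")
 have pay: "pay G i w < num_payoffs I i & (ALL p<num_payoffs I i. dpa_accepts (automaton I i p) w \<longleftrightarrow> pay G i w = p)"
  if "i < np" "w : omega_words {..<length (inst_owner I)}" for i w
 proof -
  have ex: "EX! p. p < num_payoffs I i & dpa_accepts (automaton I i p) w" using uni that by (simp add: unique_payoffs_def)
  hence "pay G i w < num_payoffs I i & dpa_accepts (automaton I i (pay G i w)) w"
   unfolding game_of_def by (simp add: theI'[OF ex])
  with ex show ?thesis by metis
 qed
 have lang: "dpa_language (verts G) (automaton I i p) = pay_preimage G i p" if "i < np" "p < num_payoffs I i" for i p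
  using pay[OF that(1)] that(2) by (auto simp: dpa_language_def pay_preimage_def)
 have codes: "wf_dpa_code (length (inst_owner I)) C" if "Q : set (inst_players I)" "C : set (code_automata Q)" for Q C
  using syn that by (auto simp: check_syntax_def list_all_iff check_dpa_iff)
 have pref: "pref G i <= payoffs G i \<times> payoffs G i" if "i < np" for i
  using syn that by (fastforce simp: check_syntax_def list_all_iff num_payoffs_def)
 have reg: "omega_regular (verts G) (pay_preimage G i p)" if "i < np" "p < num_payoffs I i" for i p
 proof -
  have "wf_dpa_code (length (inst_owner I)) (code_automata (inst_players I ! i) ! p)"
   using that by (intro codes[of "inst_players I ! i"]) (simp_all add: num_payoffs_def)
  hence "wf_dpa (verts G) (automaton I i p)" by (simp add: automaton_def wf_dpa_code_def lessThan_def[symmetric])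
  thus ?thesis unfolding omega_regular_def using lang[OF that] by blast
 qed
 show "valid_instance I"
  unfolding valid_instance_def RP_game_def wf_game_def
  using arena pay lang codes pref reg syn
  by (auto simp: check_syntax_def list_all_iff num_payoffs_def)
qed

definition prio_list :: "instance_code => (nat \<times> nat) list" where
 "prio_list I = concat (map (%k. map (%c. (k, c)) (code_prios (aut_code I k))) [0..<length (auts I)])"

definition word_opts :: "instance_code => nat list => nat list list list list" where
 "word_opts I qs = map (%a. [[step_states I qs a]]) [0..<length (inst_owner I)]"

text \<open>The one-player game of finding a word on which exactly the automata selected by \<open>pt\<close>, among
 those of player \<open>i\<close>, accept.\<close>

definition word_pairs :: "instance_code => nat => nat list => nat list => (bool \<times> bool) list" where
 "word_pairs I i pt qs = map (%x. (prio_at I (fst x) qs = snd x & fst (aut_at I (fst x)) = i &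
    even (snd x) ~= (nthd 0 pt (fst x) = 1), snd x < prio_at I (fst x) qs)) (prio_list I)"

text \<open>The lists \<open>pt\<close> run through all conceivable patterns of acceptance. One that
  does not select exactly one automaton of player \<open>i\<close> must not be realised by any
  word.\<close>

definition check_unique :: "instance_code => nat => nat => nat => bool" where
 "check_unique I M K P = list_all (%i. list_all (%pt.
   length (filter (%k. fst (aut_at I k) = i & nthd 0 pt k = 1) [0..<length (auts I)]) = 1 |
   ~ solve (enum_words P M (length (auts I))) (enum_words P (Suc K) (length (prio_list I)))
    (word_opts I) (word_pairs I i pt) (start_states I))
   (enum_words P 2 (length (auts I)))) [0..<length (inst_players I)]"

definition pair_list :: "instance_code => (bool \<times> nat \<times> nat) list" where
 "pair_list I = map (%x. (True, x)) (prio_list I) @ map (%x. (False, x)) (prio_list I)"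

definition game_opts :: "instance_code => nat list list => pstate => pstate list list list" where
 "game_opts I profs s = map (%e. [accept I s (snd e)] #
    map (%e'. map (%ws. deviate I s (snd e') ws) profs)
     (filter (%e'. fst e' = fst s & snd e' ~= snd e) (inst_edges I)))
   (filter (%e. fst e = fst s) (inst_edges I))"

definition in_request :: "instance_code => bool \<times> nat \<times> nat => pstate => bool" where
 "in_request I = (%(b, k, c) (v, qs, ws, bs, f). prio_at I k qs = c & even c ~= b &
   (if b then nthd 0 ws (fst (aut_at I k)) = snd (aut_at I k) else nthd 0 bs k = 1))"

definition in_grant :: "instance_code => bool \<times> nat \<times> nat => pstate => bool" where
 "in_grant I = (%(b, k, c) (v, qs, ws, bs, f). c < prio_at I k qs |
   (f ~= 0 & (b | f ~= Suc (fst (aut_at I k)))))"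

definition game_pairs :: "instance_code => pstate => (bool \<times> bool) list" where
 "game_pairs I s = map (%x. (in_request I x s, in_grant I x s)) (pair_list I)"

definition profile_list :: "instance_code => nat => nat => nat list list" where
 "profile_list I M P = filter (%ws. list_all (%i. nthd 0 ws i < length (code_automata (player_at I i)))
   [0..<length (inst_players I)]) (enum_words P M (length (inst_players I)))"

definition pstate_list :: "instance_code => nat => nat => pstate list" where
 "pstate_list I M P = product_list [0..<M] (product_list (enum_words P M (length (auts I)))
   (product_list (enum_words P M (length (inst_players I)))
    (product_list (enum_words P M (length (auts I))) [0..<Suc M])))"

definition check_SPE :: "instance_code => nat => nat => nat => bool" where
 "check_SPE I M K P = list_ex (%ws. list_all (%i. nthd 0 (inst_bounds I) i = nthd 0 ws i |
    (nthd 0 (inst_bounds I) i, nthd 0 ws i) : set (code_pref (player_at I i))) [0..<length (inst_players I)] &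
   solve (pstate_list I M P) (enum_words P (Suc K) (length (pair_list I)))
    (game_opts I (profile_list I M P)) (game_pairs I) (pstart I ws)) (profile_list I M P)"

text \<open>\<open>P\<close> is the exponential unary argument, intended to be
  \<open>2 ^ (M ^ 12)\<close>. The minimum makes \<open>K\<close> computable in polynomial time for
  every \<open>P\<close> and equals \<open>2 ^ (M ^ 9)\<close> for the intended one, which is at
  least the Streett bound.\<close>

definition decide_SPE :: "bool list => nat => bool" where
 "decide_SPE x P = (let M = length x + 2; K = min P (2 ^ (M ^ 9)) in
   list_ex (%I. enc_instance I = x & check_syntax I & check_unique I M K P & check_SPE I M K P) (instance_list P M))"

subsection \<open>Feasibility\<close>

lemma feasible_player_at [feas]: "feasible f ==> feasible g ==> feasible (%z. player_at (f z) (g z))"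
 unfolding player_at_def by (intro feas)

lemma feasible_auts [THEN feasible_comp, feas]: "feasible (%z. auts z)"
 unfolding auts_def by (intro feas)

lemma feasible_aut_at [feas]: "feasible f ==> feasible g ==> feasible (%z. aut_at (f z) (g z))"
 unfolding aut_at_def by (intro feas)

lemma feasible_aut_code [THEN feasible_comp2, feas]: "feasible2 aut_code"
 unfolding aut_code_def by (intro feas)

lemma feasible_step_states [THEN feasible_comp3, feas]: "feasible3 step_states"
 unfolding step_states_def by (intro feas)

lemma feasible_start_states [THEN feasible_comp, feas]: "feasible (%z. start_states z)"
 unfolding start_states_def by (intro feas)

lemma feasible_flag_bad [THEN feasible_comp4, feas]: "feasible4 flag_bad"
 unfolding flag_bad_def by (intro feas)

lemma feasible_accept [THEN feasible_comp3, feas]: "feasible3 accept"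
 unfolding accept_def case_prod_beta by (intro feas)

lemma feasible_deviate [THEN feasible_comp4, feas]: "feasible4 deviate"
 unfolding deviate_def case_prod_beta by (intro feas)

lemma feasible_zeros [feas]: "feasible n ==> feasible (%z. replicate (n z) (0::nat))"
proof -
 assume "feasible n"
 hence "feasible (%z. map (%_. 0::nat) (replicate (n z) ()))" by (intro feas)
 thus ?thesis by simp
qed

lemma feasible_pstart [feas]: "feasible f ==> feasible g ==> feasible (%z. pstart (f z) (g z))"
 unfolding pstart_def by (intro feas)

lemma feasible_prio_at [THEN feasible_comp3, feas]: "feasible3 prio_at"
 unfolding prio_at_def by (intro feas)

lemma feasible_prio_list [THEN feasible_comp, feas]: "feasible (%z. prio_list z)"
 unfolding prio_list_def by (intro feas)

lemma feasible_check_dpa [THEN feasible_comp2, feas]: "feasible2 check_dpa"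
 unfolding check_dpa_def by (intro feas)

lemma feasible_check_syntax [THEN feasible_comp, feas]: "feasible (%z. check_syntax z)"
 unfolding check_syntax_def by (intro feas)

lemma feasible_word_opts [THEN feasible_comp2, feas]: "feasible2 word_opts"
 unfolding word_opts_def by (intro feas)

lemma feasible_word_pairs [THEN feasible_comp4, feas]: "feasible4 word_pairs"
 unfolding word_pairs_def by (intro feas)

lemma feasible_check_unique [THEN feasible_comp4, feas]: "feasible4 check_unique"
 unfolding check_unique_def by (intro feas feasible_solve)

lemma feasible_pair_list [THEN feasible_comp, feas]: "feasible (%z. pair_list z)"
 unfolding pair_list_def by (intro feas)

lemma feasible_game_opts [THEN feasible_comp3, feas]: "feasible3 game_opts"
 unfolding game_opts_def by (intro feas)

lemma feasible_in_request [THEN feasible_comp3, feas]: "feasible3 in_request"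
 unfolding in_request_def case_prod_beta by (intro feas)

lemma feasible_in_grant [THEN feasible_comp3, feas]: "feasible3 in_grant"
 unfolding in_grant_def case_prod_beta by (intro feas)

lemma feasible_game_pairs [THEN feasible_comp2, feas]: "feasible2 game_pairs"
 unfolding game_pairs_def by (intro feas)

lemma feasible_profile_list [THEN feasible_comp3, feas]: "feasible3 profile_list"
 unfolding profile_list_def by (intro feas)

lemma feasible_pstate_list [THEN feasible_comp3, feas]: "feasible3 pstate_list"
 unfolding pstate_list_def by (intro feas)

lemma feasible_check_SPE [THEN feasible_comp4, feas]: "feasible4 check_SPE"
 unfolding check_SPE_def by (intro feas feasible_solve)

lemma feasible_decide_SPE: "feasible (%z. decide_SPE (fst z) (snd z))"
 unfolding decide_SPE_def by (intro feas)

section \<open>Correctness of the decision procedure\<close>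

lemma streett_bound_Suc: "streett_bound N m <= streett_bound N (Suc m)"
proof (cases "N = 0")
 case True
 have "streett_bound 0 m = m" by (induction m) auto
 thus ?thesis by (simp add: True)
next
 case False
 have "streett_bound N m <= N * (streett_bound N m + 1) + 1" using False by (cases N) auto
 thus ?thesis by simp
qed

lemma streett_bound_mono:
 assumes "N <= N'" "m <= m'"
 shows "streett_bound N m <= streett_bound N' m'"
proof -
 have "streett_bound N m <= streett_bound N' m"
 proof (induction m)
  case (Suc m)
  thus ?case using assms(1) unfolding streett_bound.simps by (intro mult_le_mono add_le_mono) auto
 qed simp
 also have "... <= streett_bound N' m'"
  using lift_Suc_mono_le[of "streett_bound N'", OF streett_bound_Suc assms(2)] .
 finally show ?thesis .
qed

text \<open>Unfolding one level multiplies the bound, increased by one, by at most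
  \<open>2 * (m + 1) * (N + 1)\<close>. So the bound is exponential in the number of pairs
  only.\<close>

lemma streett_bound_le: "streett_bound N m + 1 <= (2 * (m + 1) * (N + 1)) ^ m"
proof (induction m)
 case (Suc m)
 let ?b = "streett_bound N m + 1"
 have "streett_bound N (Suc m) + 1 = Suc m * (N * ?b + 1) + 1" by simp
 also have "... <= Suc m * (N * ?b + ?b) + Suc m * ((N + 1) * ?b)"
  by (intro add_le_mono mult_le_mono) auto
 also have "... = 2 * (m + 1) * (N + 1) * ?b" by (simp add: algebra_simps)
 also have "... <= 2 * (Suc m + 1) * (N + 1) * (2 * (Suc m + 1) * (N + 1)) ^ m"
 proof (intro mult_le_mono)
  have "(2 * (m + 1) * (N + 1)) ^ m <= (2 * (Suc m + 1) * (N + 1)) ^ m" by (rule power_mono) auto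
  with Suc show "?b <= (2 * (Suc m + 1) * (N + 1)) ^ m" by linarith
 qed auto
 finally show ?case by simp
qed simp

lemma card_words_below: "card (words_below M l) = M ^ l"
proof -
 have "words_below M l = {xs. set xs <= {..<M} & length xs = l}" by (auto simp: words_below_def)
 thus ?thesis by (simp add: card_lists_length_eq)
qed

lemma set_prio_list: "set (prio_list I) = {(k, c). k < length (auts I) & c : set (code_prios (aut_code I k))}"
 by (auto simp: prio_list_def)

lemma set_pair_list: "set (pair_list I) = pair_index I"
proof -
 have "(b, x) : set (pair_list I) \<longleftrightarrow> x : set (prio_list I)" for b x by (cases b) (auto simp: pair_list_def)
 thus ?thesis by (auto simp: pair_index_def set_prio_list)
qed

lemma option_moves_game:
 assumes "set profs = profiles I"
 shows "option_moves (pstates I M) (game_opts I profs) = pmoves I M"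
proof
 fix s
 have "(EX opt:set (game_opts I profs s). ALL cl:set opt. EX t:set cl. t : A) \<longleftrightarrow>
   (EX u. (fst s, u) : set (inst_edges I) & accept I s u : A &
   (ALL u'. (fst s, u') : set (inst_edges I) & u' ~= u --> (EX ws:profiles I. deviate I s u' ws : A)))" for A
 proof -
  let ?E = "set (inst_edges I)"
  have "(EX opt:set (game_opts I profs s). ALL cl:set opt. EX t:set cl. t : A) \<longleftrightarrow>
   (EX e:{e : ?E. fst e = fst s}. accept I s (snd e) : A &
    (ALL e':{e' : ?E. fst e' = fst s & snd e' ~= snd e}. EX ws:profiles I. deviate I s (snd e') ws : A))"
   by (simp only: game_opts_def list.set set_map set_filter ball_simps bex_simps assms simp_thms)
  also have "... \<longleftrightarrow> (EX u. (fst s, u) : ?E & accept I s u : A &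
   (ALL u'. (fst s, u') : ?E & u' ~= u --> (EX ws:profiles I. deviate I s u' ws : A)))"
   by (simp only: Bex_def[of "{e : ?E. fst e = fst s}"] Ball_def split_paired_Ex[of "%e :: nat \<times> nat. _ e & _ e"]
    split_paired_All fst_conv snd_conv mem_Collect_eq) blast
  finally show ?thesis .
 qed
 note eq = this
 show "option_moves (pstates I M) (game_opts I profs) s = pmoves I M s"
  unfolding option_moves_def pmoves_def by (intro Collect_cong conj_cong refl eq)
qed

lemma card_filter_one: "length (filter Q [0..<n]) = 1 \<longleftrightarrow> (EX! k. k < n & Q k)"
proof -
 have "length (filter Q [0..<n]) = card {k. k < n & Q k}"
  by (subst distinct_card[symmetric]) (auto intro: arg_cong[where f = card])
 hence "length (filter Q [0..<n]) = 1 \<longleftrightarrow> (EX x. {k. k < n & Q k} = {x})" by (simp add: card_1_singleton_iff)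
 thus ?thesis unfolding Ex1_def set_eq_iff mem_Collect_eq singleton_iff by metis
qed

text \<open>The conditions on \<open>P\<close> say that no enumeration is truncated, that on
  \<open>K\<close> that counters have enough room in the game on the box \<open>pstates\<close>. The
  smaller game that searches for words fits within the same limits.\<close>

locale checked_instance = wf_automata I for I +
 fixes M K P :: nat
 assumes M_verts: "length (inst_owner I) <= M" and M_players: "length (inst_players I) <= M" and M2: "2 <= M"
  and M_states: "!!k. k < length (auts I) ==> length (code_table (aut_code I k)) <= M"
  and M_payoffs: "!!i. i < length (inst_players I) ==> num_payoffs I i <= M"
  and P: "M ^ m <= P" "M ^ np <= P" "(Suc K) ^ (2 * length (prio_list I)) <= P"
  and K: "streett_bound (M * (M ^ m * (M ^ np * (M ^ m * Suc M)))) (2 * length (prio_list I)) <= K"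
begin

text \<open>The first player alone chooses the letters, so a play is the product run on a word, and
  the pairs translate into acceptance as prescribed by \<open>pt\<close>.\<close>

lemma word_game:
 assumes i: "i < np"
 shows "wins (option_moves (words_below M m) (word_opts I))
   (%x. {qs. prio_at I (fst x) qs = snd x & pl (fst x) = i & even (snd x) ~= (nthd 0 pt (fst x) = 1)})
   (%x. {qs. snd x < prio_at I (fst x) qs}) (set (prio_list I)) (start_states I) \<longleftrightarrow>
  (EX w:omega_words {..<length (inst_owner I)}. ALL k<m. pl k = i -->
   (dpa_accepts (dpa_of (aut_code I k)) w \<longleftrightarrow> nthd 0 pt k = 1))" (is "wins ?mv ?R ?G ?S _ \<longleftrightarrow> ?w")
proof
 have states: "run_states w n : words_below M m" if "w : omega_words (verts G)" for w n
 proof -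
  have "dpa_run (dpa_of (aut_code I k)) w n < M" if "k < m" for k
   using run_less[OF that \<open>w : omega_words (verts G)\<close>, of n] M_states[OF that] by simp
  thus ?thesis by (simp add: words_below_iff)
 qed
 have branch: "streett ?R ?G ?S (run_states w) \<longleftrightarrow> (ALL k<m. pl k = i -->
   (dpa_accepts (dpa_of (aut_code I k)) w \<longleftrightarrow> nthd 0 pt k = 1))" if w: "w : omega_words (verts G)" for w
 proof -
  have "streett ?R ?G ?S (run_states w) \<longleftrightarrow> (ALL k<m. pl k = i --> (ALL c:set (code_prios (aut_code I k)). even c ~= (nthd 0 pt k = 1) -->
   (ALL m. EX n>=m. run_prio k w n = c) --> (ALL m. EX n>=m. c < run_prio k w n)))"
  proof -
   have ev: "(ALL m. EX n>=m. Q n & B) \<longleftrightarrow> (ALL m. EX n>=m. Q n) & B" for Q :: "nat => bool" and B by blast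
   have "streett ?R ?G ?S (run_states w) \<longleftrightarrow> (ALL k<m. ALL c:set (code_prios (aut_code I k)).
    (ALL m. EX n>=m. run_prio k w n = c & (pl k = i & even c ~= (nthd 0 pt k = 1))) --> (ALL m. EX n>=m. c < run_prio k w n))"
    unfolding streett_def set_prio_list using prio_run_states[OF w] by simp blast
   thus ?thesis unfolding ev by blast
  qed
  also have "... \<longleftrightarrow> (ALL k<m. pl k = i --> (ALL c. even c ~= (nthd 0 pt k = 1) -->
   (ALL m. EX n>=m. run_prio k w n = c) --> (ALL m. EX n>=m. c < run_prio k w n)))"
  proof -
   have "c : set (code_prios (aut_code I k))" if "k < m" "ALL m. EX n>=m. run_prio k w n = c" for k c
    using that run_prio_in[OF \<open>k < m\<close> w] by metis
   thus ?thesis by (intro all_cong imp_cong refl) (simp only: Ball_def, blast)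
  qed
  also have "... \<longleftrightarrow> (ALL k<m. pl k = i --> dpa_accepts (dpa_of (aut_code I k)) w = (nthd 0 pt k = 1))"
   by (intro all_cong imp_cong refl accepts_streett[OF _ w, symmetric])
  finally show ?thesis .
 qed
 show "wins ?mv ?R ?G ?S (start_states I)" if ?w
 proof -
  from that obtain w where w: "w : omega_words (verts G)" "ALL k<m. pl k = i -->
   (dpa_accepts (dpa_of (aut_code I k)) w \<longleftrightarrow> nthd 0 pt k = 1)" by auto
  let ?q = "run_states w"
  let ?H = "range (%n. map ?q [0..<Suc n])"
  have "wins_by ?mv ?R ?G ?S ?H (start_states I)"
   unfolding wins_by_def
  proof (intro conjI allI ballI impI)
   show "[start_states I] : ?H" by (rule image_eqI[of _ _ 0]) (simp_all add: run_states_0[of w])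
   show "h = [] | h : ?H" if "h @ [t] : ?H" for h t
   proof -
    from that obtain n where "h @ [t] = map ?q [0..<Suc n]" by blast
    hence "h = map ?q [0..<n]" by simp
    thus ?thesis by (cases n) auto
   qed
   show "h ~= []" if "h : ?H" for h using that by auto
   show "EX A:?mv (last h). ALL t:A. h @ [t] : ?H" if "h : ?H" for h
   proof -
    from that obtain n where h: "h = map ?q [0..<Suc n]" by blast
    have "w n < length (inst_owner I)" using w(1) by (auto simp: omega_words_def)
    hence "{?q (Suc n)} : ?mv (last h)"
     using states[OF w(1), of "Suc n"] run_states_Suc[OF w(1), of n]
     unfolding h option_moves_def word_opts_def by (auto simp del: dpa_run.simps intro!: bexI[of _ "w n"])
    moreover have "h @ [?q (Suc n)] = map ?q [0..<Suc (Suc n)]" by (simp add: h del: dpa_run.simps)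
    ultimately show ?thesis by (intro bexI[of _ "{?q (Suc n)}"]) (auto simp del: dpa_run.simps upt_Suc)
   qed
   fix rh assume r: "ALL n. map rh [0..<Suc n] : ?H"
   have "rh n = ?q n" for n
   proof -
    from r obtain n' where "map rh [0..<Suc n] = map ?q [0..<Suc n']" by blast
    moreover from arg_cong[OF this, of length] have "n = n'" by simp
    ultimately show ?thesis by simp
   qed
   hence "rh = ?q" by blast
   thus "streett ?R ?G ?S rh" using branch[OF w(1)] w(2) by simp
  qed
  thus ?thesis unfolding wins_def by blast
 qed
 show ?w if "wins ?mv ?R ?G ?S (start_states I)"
 proof -
  from that obtain H where H: "wins_by ?mv ?R ?G ?S H (start_states I)" by (auto simp: wins_def)
  note HD = wins_byD[OF H]
  \<comment> \<open>Moves are closed under supersets, so the winning tree may contain states that no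
    letter produces. The branch is drawn from the histories that do follow letters.\<close>
  define succs where "succs q t \<longleftrightarrow> (EX a<length (inst_owner I). t = step_states I q a)" for q t
  let ?H = "{h : H. successively succs h}"
  obtain rh where r: "rh 0 = start_states I" "!!n. map rh [0..<Suc n] : ?H"
  proof (rule infinite_branch[of ?H "start_states I" UNIV])
   show "h : ?H" if "h @ [t] : ?H" "h ~= []" for h t
    using that HD(2)[of h t] by (auto simp: successively_append_iff)
   show "[start_states I] : ?H" using HD(1) by simp
   show "EX g. g ~= [] & h @ g : ?H & last g : UNIV" if "h : ?H" for h
   proof -
    from HD(4)[of h] that obtain A where A: "A : ?mv (last h)" "ALL t:A. h @ [t] : H" by blast
    then obtain a where a: "a < length (inst_owner I)" "step_states I (last h) a : A"
     by (auto simp: option_moves_def word_opts_def)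
    hence "h @ [step_states I (last h) a] : ?H"
     using A that HD(3)[of h] by (auto simp: successively_append_iff succs_def)
    thus ?thesis by blast
   qed
  qed blast
  have "succs (rh n) (rh (Suc n))" for n
   using r(2)[of "Suc n"] by (simp add: successively_append_iff)
  then obtain w where w: "!!n. w n < length (inst_owner I)" "!!n. rh (Suc n) = step_states I (rh n) (w n)"
   unfolding succs_def by metis
  have ww: "w : omega_words (verts G)" using w(1) by (auto simp: omega_words_def)
  have "rh n = run_states w n" for n
  proof (induction n)
   case 0
   thus ?case by (simp add: r(1) run_states_0[of w])
  next
   case (Suc n)
   thus ?case using run_states_Suc[OF ww, of n] by (simp add: w(2) del: dpa_run.simps)
  qed
  hence "rh = run_states w" by blast
  moreover have "streett ?R ?G ?S rh" by (rule HD(5)) (use r in auto)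
  ultimately show ?w using branch[OF ww] ww by auto
 qed
qed

lemma bound_K:
 assumes "card S <= M * (M ^ m * (M ^ np * (M ^ m * Suc M)))" "l <= 2 * length (prio_list I)"
 shows "streett_bound (card S) l <= K"
 using streett_bound_mono[OF assms] K by linarith

lemma P_prios: "(Suc K) ^ length (prio_list I) <= P"
proof -
 have "(Suc K) ^ length (prio_list I) <= (Suc K) ^ (2 * length (prio_list I))" by (rule power_increasing) auto
 thus ?thesis using P(3) by linarith
qed

lemma solve_word_game:
 assumes i: "i < np"
 shows "solve (enum_words P M m) (enum_words P (Suc K) (length (prio_list I))) (word_opts I) (word_pairs I i pt) (start_states I) \<longleftrightarrow>
  (EX w:omega_words {..<length (inst_owner I)}. ALL k<m. pl k = i -->
   (dpa_accepts (dpa_of (aut_code I k)) w \<longleftrightarrow> nthd 0 pt k = 1))"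
proof -
 let ?l = "length (prio_list I)"
 have ss: "set (enum_words P M m) = words_below M m" using P(1) M2 by (intro set_enum_words) auto
 have cs: "set (enum_words P (Suc K) ?l) = words_below (Suc K) ?l" using P_prios by (intro set_enum_words) auto
 have "M ^ m * 1 <= M * (M ^ m * (M ^ np * (M ^ m * Suc M)))"
 proof -
  have "1 <= M ^ np * (M ^ m * Suc M)" using M2 by (simp add: Suc_le_eq)
  hence "M ^ m * 1 <= M ^ m * (M ^ np * (M ^ m * Suc M))" by (rule mult_le_mono2)
  also have "... <= M * (M ^ m * (M ^ np * (M ^ m * Suc M)))" using M2 by (cases M) auto
  finally show ?thesis .
 qed
 hence K: "streett_bound (card (set (enum_words P M m))) ?l <= K"
  by (intro bound_K) (simp_all add: ss card_words_below)
 have "start_states I : words_below M m"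
 proof -
  have "code_init (aut_code I k) < M" if "k < m" for k
   using aut_wf[OF that] M_states[OF that] by (simp add: wf_dpa_code_def wf_dpa_def dpa_of_def)
  thus ?thesis by (simp add: words_below_iff start_states_def)
 qed
 from solve_correct[of "word_pairs I i pt" ?l "enum_words P (Suc K) ?l" K "enum_words P M m" "start_states I" "word_opts I"] this K
 have "solve (enum_words P M m) (enum_words P (Suc K) ?l) (word_opts I) (word_pairs I i pt) (start_states I) \<longleftrightarrow>
  wins (option_moves (words_below M m) (word_opts I)) (%j. {t. fst (word_pairs I i pt t ! j)})
   (%j. {t. snd (word_pairs I i pt t ! j)}) {..<?l} (start_states I)"
  by (simp add: cs ss word_pairs_def del: upt_Suc)
 also have "... \<longleftrightarrow> wins (option_moves (words_below M m) (word_opts I))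
   (%j. {qs. prio_at I (fst (prio_list I ! j)) qs = snd (prio_list I ! j) & pl (fst (prio_list I ! j)) = i &
     even (snd (prio_list I ! j)) ~= (nthd 0 pt (fst (prio_list I ! j)) = 1)})
   (%j. {qs. snd (prio_list I ! j) < prio_at I (fst (prio_list I ! j)) qs}) {..<?l} (start_states I)"
  unfolding wins_def wins_by_def streett_def by (simp add: word_pairs_def)
 also have "... \<longleftrightarrow> wins (option_moves (words_below M m) (word_opts I))
   (%x. {qs. prio_at I (fst x) qs = snd x & pl (fst x) = i & even (snd x) ~= (nthd 0 pt (fst x) = 1)})
   (%x. {qs. snd x < prio_at I (fst x) qs}) (set (prio_list I)) (start_states I)"
  by (rule wins_reindex[OF refl, symmetric])
 also note word_game[OF i]
 finally show ?thesis .
qed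

lemma distinct_concat_map_Pair:
 "distinct is ==> (!!i. distinct (f i)) ==> distinct (concat (map (%i. map (Pair i) (f i)) is))"
 by (induction "is") (auto simp: distinct_map inj_on_def)

lemma distinct_auts: "distinct (auts I)"
 unfolding auts_def by (rule distinct_concat_map_Pair) simp_all

lemma unique_accepting:
 assumes i: "i < np"
 shows "(EX! p. p < num_payoffs I i & dpa_accepts (automaton I i p) w) \<longleftrightarrow>
  (EX! k. k < m & (pl k = i & dpa_accepts (dpa_of (aut_code I k)) w))"
proof -
 have inj: "k = k'" if "k < m" "k' < m" "aut_at I k = aut_at I k'" for k k'
  using that distinct_auts by (simp add: aut_at_def nth_eq_iff_index_eq)
 show ?thesis
 proof
  assume "EX! p. p < num_payoffs I i & dpa_accepts (automaton I i p) w"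
  then obtain p where p: "p < num_payoffs I i" "dpa_accepts (automaton I i p) w"
   "!!p'. p' < num_payoffs I i ==> dpa_accepts (automaton I i p') w ==> p' = p" by blast
  obtain k where k: "k < m" "aut_at I k = (i, p)" using auts_ex[OF i p(1)] by blast
  show "EX! k. k < m & (pl k = i & dpa_accepts (dpa_of (aut_code I k)) w)"
  proof (rule ex1I[of _ k])
   show "k < m & pl k = i & dpa_accepts (dpa_of (aut_code I k)) w" using k p(2) aut[OF k(1)] by simp
   fix k' assume k': "k' < m & pl k' = i & dpa_accepts (dpa_of (aut_code I k')) w"
   hence "po k' = p" using p(3)[of "po k'"] auts_nth(2)[of k'] aut[of k'] by auto
   hence "aut_at I k' = aut_at I k" using k' k(2) by (metis prod.collapse)
   thus "k' = k" using inj k' k(1) by blast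
  qed
 next
  assume "EX! k. k < m & (pl k = i & dpa_accepts (dpa_of (aut_code I k)) w)"
  then obtain k where k: "k < m" "pl k = i" "dpa_accepts (dpa_of (aut_code I k)) w"
   "!!k'. k' < m ==> pl k' = i ==> dpa_accepts (dpa_of (aut_code I k')) w ==> k' = k" by blast
  show "EX! p. p < num_payoffs I i & dpa_accepts (automaton I i p) w"
  proof (rule ex1I[of _ "po k"])
   show "po k < num_payoffs I i & dpa_accepts (automaton I i (po k)) w"
    using k(1-3) auts_nth(2)[OF k(1)] aut[OF k(1)] by simp
   fix p assume p: "p < num_payoffs I i & dpa_accepts (automaton I i p) w"
   then obtain k' where k': "k' < m" "aut_at I k' = (i, p)" using auts_ex[OF i] by blast
   hence "k' = k" using p aut[OF k'(1)] by (intro k(4)) auto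
   thus "p = po k" using k' by simp
  qed
 qed
qed

lemma check_unique_iff: "check_unique I M K P \<longleftrightarrow> unique_payoffs I"
proof -
 have m2: "2 ^ m <= P" using power_mono[of 2 M m] M2 P(1) by linarith
 hence pts: "set (enum_words P 2 m) = words_below 2 m" by (intro set_enum_words) auto
 have "(ALL pt:words_below 2 m. length (filter (%k. pl k = i & nthd 0 pt k = 1) [0..<m]) = 1 |
   ~ (EX w:omega_words {..<length (inst_owner I)}. ALL k<m. pl k = i -->
   (dpa_accepts (dpa_of (aut_code I k)) w \<longleftrightarrow> nthd 0 pt k = 1))) \<longleftrightarrow>
  (ALL w:omega_words {..<length (inst_owner I)}. EX! p. p < num_payoffs I i & dpa_accepts (automaton I i p) w)" (is "?l \<longleftrightarrow> ?r")
  if i: "i < np" for i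
 proof
  assume l: ?l
  show ?r
  proof
   fix w assume w: "w : omega_words {..<length (inst_owner I)}"
   define pt where "pt = map (%k. if dpa_accepts (dpa_of (aut_code I k)) w then 1 else 0 :: nat) [0..<m]"
   have pt: "pt : words_below 2 m" by (simp add: pt_def words_below_iff)
   have ptk: "nthd 0 pt k = 1 \<longleftrightarrow> dpa_accepts (dpa_of (aut_code I k)) w" if "k < m" for k
    using that by (simp add: pt_def)
   have l1: "length (filter (%k. pl k = i & nthd 0 pt k = 1) [0..<m]) = 1"
    using l pt w ptk by blast
   have "filter (%k. pl k = i & dpa_accepts (dpa_of (aut_code I k)) w) [0..<m] = filter (%k. pl k = i & nthd 0 pt k = 1) [0..<m]"
    by (rule filter_cong) (simp_all add: ptk del: One_nat_def)
   hence "length (filter (%k. pl k = i & dpa_accepts (dpa_of (aut_code I k)) w) [0..<m]) = 1"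
    using l1 by (rule ssubst)
   thus "EX! p. p < num_payoffs I i & dpa_accepts (automaton I i p) w"
    unfolding card_filter_one unique_accepting[OF i] .
  qed
 next
  assume r: ?r
  show ?l
  proof (intro ballI disjCI)
   fix pt assume "pt : words_below 2 m" and "~ ~ (EX w:omega_words {..<length (inst_owner I)}. ALL k<m. pl k = i -->
   (dpa_accepts (dpa_of (aut_code I k)) w \<longleftrightarrow> nthd 0 pt k = 1))"
   then obtain w where w: "w : omega_words {..<length (inst_owner I)}" "ALL k<m. pl k = i -->
   (dpa_accepts (dpa_of (aut_code I k)) w \<longleftrightarrow> nthd 0 pt k = 1)" by blast
   with r have "EX! k. k < m & (pl k = i & dpa_accepts (dpa_of (aut_code I k)) w)" using unique_accepting[OF i] by blast
   hence "length (filter (%k. pl k = i & dpa_accepts (dpa_of (aut_code I k)) w) [0..<m]) = 1"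
    by (simp only: card_filter_one)
   moreover have "filter (%k. pl k = i & dpa_accepts (dpa_of (aut_code I k)) w) [0..<m] = filter (%k. pl k = i & nthd 0 pt k = 1) [0..<m]"
    by (rule filter_cong) (use w(2) in auto)
   ultimately show "length (filter (%k. pl k = i & nthd 0 pt k = 1) [0..<m]) = 1" by (simp only:)
  qed
 qed
 thus ?thesis
  unfolding check_unique_def unique_payoffs_def list_all_iff pts set_upt atLeast0LessThan Ball_def lessThan_iff
  by (simp only: solve_word_game Ball_def lessThan_iff cong: imp_cong)
qed

lemma check_SPE_iff:
 assumes valid: "valid_instance I"
 shows "check_SPE I M K P \<longleftrightarrow> constrained_SPE_exists G (inst_start I) (%i. inst_bounds I ! i)"
proof -
 interpret instance_game I M
  by unfold_locales (use valid M_verts M_players M2 M_states M_payoffs in auto)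
 let ?l = "length (pair_list I)"
 have l: "?l = 2 * length (prio_list I)" by (simp add: pair_list_def)
 have em: "set (enum_words P M m) = words_below M m" using P(1) M2 by (intro set_enum_words) auto
 have ep: "set (enum_words P M np) = words_below M np" using P(2) M2 by (intro set_enum_words) auto
 have ss: "set (pstate_list I M P) = pstates I M"
  by (simp add: pstate_list_def pstates_def set_product_list em ep atLeast0LessThan lessThan_Suc_atMost del: upt_Suc)
 have cs: "set (enum_words P (Suc K) ?l) = words_below (Suc K) ?l" using P(3) by (intro set_enum_words) (auto simp: l)
 have profs: "set (profile_list I M P) = profiles I"
 proof -
  have "ws : set (profile_list I M P) \<longleftrightarrow> ws : words_below M np & (ALL i<np. ws ! i < num_payoffs I i)" for ws
   by (auto simp: profile_list_def ep list_all_iff num_payoffs_def words_belowD)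
  thus ?thesis using profiles_below by (auto simp: profiles_def words_belowD)
 qed
 have card: "card (pstates I M) = M * (M ^ m * (M ^ np * (M ^ m * Suc M)))"
  by (simp add: pstates_def card_cartesian_product card_words_below)
 have "solve (pstate_list I M P) (enum_words P (Suc K) ?l) (game_opts I (profile_list I M P)) (game_pairs I) (pstart I ws) \<longleftrightarrow>
   wins (pmoves I M) (request I) (grant I) (pair_index I) (pstart I ws)" if ws: "ws : profiles I" for ws
 proof -
  have "pstart I ws : pstates I M"
  proof -
   have "start_states I : words_below M m"
   proof -
    have "code_init (aut_code I k) < M" if "k < m" for k
     using aut_wf[OF that] M_states[OF that] by (simp add: wf_dpa_code_def wf_dpa_def dpa_of_def)
    thus ?thesis by (simp add: words_below_iff start_states_def)
   qed
   moreover have "inst_start I < M" using valid M_verts by (simp add: valid_instance_def)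
   ultimately show ?thesis using profiles_below[OF ws] flag_bad_below by (simp add: pstart_def pstates_def)
  qed
  from solve_correct[of "game_pairs I" ?l "enum_words P (Suc K) ?l" K "pstate_list I M P" "pstart I ws" "game_opts I (profile_list I M P)"]
   this bound_K[of "pstates I M" ?l]
  have "solve (pstate_list I M P) (enum_words P (Suc K) ?l) (game_opts I (profile_list I M P)) (game_pairs I) (pstart I ws) \<longleftrightarrow>
   wins (pmoves I M) (%j. {t. fst (game_pairs I t ! j)}) (%j. {t. snd (game_pairs I t ! j)}) {..<?l} (pstart I ws)"
   by (simp add: cs ss card option_moves_game[OF profs] game_pairs_def del: upt_Suc) (simp add: l flip: l del: upt_Suc)
  also have "... \<longleftrightarrow> wins (pmoves I M) (%j. request I (pair_list I ! j)) (%j. grant I (pair_list I ! j)) {..<?l} (pstart I ws)"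
  proof -
   have "in_request I x s \<longleftrightarrow> s : request I x" "in_grant I x s \<longleftrightarrow> s : grant I x" for x s
    by (auto simp: in_request_def request_def in_grant_def grant_def split: prod.splits)
   thus ?thesis unfolding wins_def wins_by_def streett_def by (simp add: game_pairs_def)
  qed
  also have "... \<longleftrightarrow> wins (pmoves I M) (request I) (grant I) (pair_index I) (pstart I ws)"
   by (rule wins_reindex[OF set_pair_list, symmetric])
  finally show ?thesis .
 qed
 moreover have "(nthd 0 (inst_bounds I) i = nthd 0 ws i |
    (nthd 0 (inst_bounds I) i, nthd 0 ws i) : set (code_pref (player_at I i))) \<longleftrightarrow>
   (inst_bounds I ! i = ws ! i | (inst_bounds I ! i, ws ! i) : set (code_pref (inst_players I ! i)))"
  if "i < np" "ws : profiles I" for i ws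
  using that valid by (simp add: valid_instance_def profiles_def)
 ultimately show ?thesis
  unfolding check_SPE_def constrained_SPE_iff list_ex_iff profs list_all_iff set_upt atLeast0LessThan
  by (intro bex_cong refl conj_cong) (simp_all only: Ball_def lessThan_iff cong: imp_cong)
qed

end

subsection \<open>Size bounds\<close>

lemma elem_le_sum_list_nat: "x : set xs ==> f x <= (\<Sum>x\<leftarrow>xs. f x :: nat)"
 by (induction xs) auto

lemma sum_list_length_concat_le:
 "(!!x. x : set xs ==> f x <= (g x :: nat)) ==> (\<Sum>x\<leftarrow>xs. f x) <= (\<Sum>x\<leftarrow>xs. g x)"
 by (induction xs) (auto intro: add_mono)

lemma sum_list_concat_map: "(\<Sum>x\<leftarrow>concat (map g xs). f x) = (\<Sum>y\<leftarrow>xs. \<Sum>x\<leftarrow>g y. f x :: nat)"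
 by (induction xs) auto

lemma auts_codes: "map (aut_code I) [0..<length (auts I)] = concat (map code_automata (inst_players I))"
proof -
 let ?h = "%x. nthd \<lparr>code_init = 0, code_table = [], code_prios = []\<rparr> (code_automata (player_at I (fst x))) (snd x)"
 have "map (aut_code I) [0..<length (auts I)] = map (%k. ?h (auts I ! k)) [0..<length (auts I)]"
  by (auto simp: aut_code_def aut_at_def)
 also have "... = map ?h (map ((!) (auts I)) [0..<length (auts I)])" by simp
 also have "... = map ?h (auts I)" by (simp only: map_nth)
 also have "... = concat (map (%i. map (%p. nthd \<lparr>code_init = 0, code_table = [], code_prios = []\<rparr> (code_automata (player_at I i)) p)
   [0..<length (code_automata (player_at I i))]) [0..<length (inst_players I)])"
  unfolding auts_def by (simp add: map_concat comp_def)
 also have "... = concat (map (%i. code_automata (inst_players I ! i)) [0..<length (inst_players I)])"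
  by (intro arg_cong[of _ _ concat] map_cong refl) (auto simp: player_at_def intro: nth_equalityI)
 also have "... = concat (map code_automata (map ((!) (inst_players I)) [0..<length (inst_players I)]))"
  by (simp add: comp_def)
 finally show ?thesis by (simp only: map_nth)
qed

lemma instance_size_bounds:
 fixes I
 defines "L \<equiv> length (enc_instance I)"
 shows "length (inst_owner I) <= L" "length (inst_players I) <= L" "length (auts I) <= L"
  "length (prio_list I) <= L"
  "!!k. k < length (auts I) ==> length (code_table (aut_code I k)) <= L"
  "!!i. i < length (inst_players I) ==> num_payoffs I i <= L"
proof -
 have pl: "length (enc_list enc_player (inst_players I)) <= L" by (simp add: L_def enc_instance_def)
 show "length (inst_owner I) <= L" using length_le_enc_list[of "inst_owner I" enc_nat] by (simp add: L_def enc_instance_def)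
 show "length (inst_players I) <= L" using length_le_enc_list[of "inst_players I" enc_player] pl by linarith
 let ?cs = "map code_automata (inst_players I)"
 have dpas: "(\<Sum>C\<leftarrow>concat ?cs. length (enc_dpa C) + 1) <= L"
 proof -
  have "(\<Sum>C\<leftarrow>concat ?cs. length (enc_dpa C) + 1) = (\<Sum>Q\<leftarrow>inst_players I. \<Sum>C\<leftarrow>code_automata Q. length (enc_dpa C) + 1)"
   by (simp only: sum_list_concat_map)
  also have "... <= (\<Sum>Q\<leftarrow>inst_players I. 1 + length (enc_player Q))"
  proof (rule sum_list_length_concat_le)
   show "(\<Sum>C\<leftarrow>code_automata Q. length (enc_dpa C) + 1) <= 1 + length (enc_player Q)" for Q
    by (simp add: enc_player_def length_enc_list add.commute)
  qed
  also have "... <= L" using pl by (simp add: length_enc_list)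
  finally show ?thesis .
 qed
 have "length (auts I) = length (concat ?cs)" using arg_cong[OF auts_codes, of length] by simp
 also have "... = (\<Sum>C\<leftarrow>concat ?cs. 1)" by (simp add: sum_list_triv)
 also have "... <= (\<Sum>C\<leftarrow>concat ?cs. length (enc_dpa C) + 1)" by (rule sum_list_length_concat_le) simp
 finally show "length (auts I) <= L" using dpas by simp
 have "length (prio_list I) = (\<Sum>k\<leftarrow>[0..<length (auts I)]. length (code_prios (aut_code I k)))"
  by (simp add: prio_list_def length_concat comp_def)
 also have "... = (\<Sum>C\<leftarrow>map (aut_code I) [0..<length (auts I)]. length (code_prios C))" by (simp add: comp_def)
 also have "... = (\<Sum>C\<leftarrow>concat ?cs. length (code_prios C))" by (simp only: auts_codes)
 also have "... <= (\<Sum>C\<leftarrow>concat ?cs. length (enc_dpa C) + 1)"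
 proof (rule sum_list_length_concat_le)
  show "length (code_prios C) <= length (enc_dpa C) + 1" for C
   using length_le_enc_list[of "code_prios C" enc_nat] by (simp add: enc_dpa_def)
 qed
 finally show "length (prio_list I) <= L" using dpas by simp
 show "length (code_table (aut_code I k)) <= L" if "k < length (auts I)" for k
 proof -
  have "aut_code I k : set (concat ?cs)" unfolding auts_codes[symmetric] using that by simp
  hence "length (enc_dpa (aut_code I k)) + 1 <= (\<Sum>C\<leftarrow>concat ?cs. length (enc_dpa C) + 1)"
   by (intro elem_le_sum_list_nat) simp
  moreover have "length (code_table (aut_code I k)) <= length (enc_dpa (aut_code I k))"
   using length_le_enc_list[of "code_table (aut_code I k)" "enc_list enc_nat"] by (simp add: enc_dpa_def)
  ultimately show ?thesis using dpas by simp
 qed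
 show "num_payoffs I i <= L" if "i < length (inst_players I)" for i
 proof -
  have "length (enc_player (inst_players I ! i)) < length (enc_list enc_player (inst_players I))"
   using that by (intro length_enc_member) simp
  moreover have "num_payoffs I i <= length (enc_player (inst_players I ! i))"
   using length_le_enc_list[of "code_automata (inst_players I ! i)" enc_dpa] by (simp add: enc_player_def num_payoffs_def)
  ultimately show ?thesis using pl by simp
 qed
qed

text \<open>Origin of the exponents 9 and 12: the number of states is at most
  \<open>2 ^ (M ^ 5)\<close>, the base in \<open>streett_bound_le\<close> at most
  \<open>2 ^ (M ^ 7)\<close>, its power with exponent \<open>2 * l\<close> at most
  \<open>2 ^ (M ^ 9)\<close>, and the number of counter vectors at most
  \<open>2 ^ (M ^ 12)\<close>.\<close>

lemma exponential_bounds: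
 fixes M :: nat
 assumes M: "2 <= M" and a: "a <= M" and b: "b <= M" and l: "l + 2 <= M"
 shows "M ^ a <= 2 ^ (M ^ 12)"
  "streett_bound (M * (M ^ a * (M ^ b * (M ^ a * Suc M)))) (2 * l) <= 2 ^ (M ^ 9)"
  "(Suc (2 ^ (M ^ 9))) ^ (2 * l) <= (2::nat) ^ (M ^ 12)"
proof -
 have M2: "M <= 2 ^ M" by (rule le_two_power)
 have pw: "M ^ x <= 2 ^ (M * x)" for x
  using power_mono[OF M2, of x] by (simp add: power_mult)
 have inc: "x <= y ==> M ^ x <= M ^ y" for x y using M by (intro power_increasing) auto
 have two: "2 ^ x <= (2::nat) ^ y" if "x <= y" for x y using that by (rule power_increasing) simp
 have "M * a <= M ^ 12" using mult_le_mono2[OF a, of M] inc[of 2 12] unfolding power2_eq_square by linarith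
 thus "M ^ a <= 2 ^ (M ^ 12)" using pw[of a] two le_trans by blast
 have l2: "M ^ x * (2 * l) <= M ^ (x + 2)" for x
  using mult_le_mono[OF M, of l M] l by (simp add: power_add power2_eq_square)
 let ?B = "M * (M ^ a * (M ^ b * (M ^ a * Suc M)))"
 have "Suc M <= M ^ 2" using mult_le_mono1[OF M, of M] M unfolding power2_eq_square by linarith
 hence "?B <= M * (M ^ M * (M ^ M * (M ^ M * M ^ 2)))"
  using inc[OF a] inc[OF b] by (intro mult_le_mono) auto
 also have "... = M ^ (3 * M + 3)" by (simp add: power_add[symmetric] mult.assoc[symmetric] power_Suc[symmetric] del: power_Suc) (simp add: algebra_simps power_add eval_nat_numeral)
 finally have B: "?B <= 2 ^ (M * (3 * M + 3))" using pw[of "3 * M + 3"] le_trans by blast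
 have "M * (3 * M + 3) <= M ^ 5"
 proof -
  have "3 * M + 3 <= M * 5" using M by simp
  hence "M * (3 * M + 3) <= 5 * M ^ 2" using mult_le_mono2[of "3 * M + 3" "M * 5" M] by (simp add: power2_eq_square)
  also have "5 * M ^ 2 <= M ^ 3 * M ^ 2" using power_mono[OF M, of 3] by (intro mult_le_mono1) simp
  finally show ?thesis by (simp add: power_add[symmetric])
 qed
 with B two have B': "?B <= 2 ^ (M ^ 5)" using le_trans by blast
 have "2 * (2 * l + 1) * (?B + 1) <= 2 * (2 ^ M * 2) * (2 ^ (M ^ 5) * 2)"
 proof (intro mult_le_mono)
  show "2 * l + 1 <= 2 ^ M * 2" using l M2 by linarith
  have "(1::nat) <= 2 ^ (M ^ 5)" by simp
  thus "?B + 1 <= 2 ^ (M ^ 5) * 2" using B' by linarith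
 qed simp
 also have "... = 2 ^ (M + M ^ 5 + 3)" by (simp add: power_add)
 also have "... <= 2 ^ (M ^ 7)"
 proof (rule two)
  have "M + M ^ 5 + 3 <= M ^ 5 + M ^ 5 + M ^ 5"
   using inc[of 1 5] power_mono[OF M, of 5] by simp
  also have "... <= M ^ 2 * M ^ 5" using power_mono[OF M, of 2] mult_le_mono1[of 3 "M ^ 2" "M ^ 5"] by simp
  finally show "M + M ^ 5 + 3 <= M ^ 7" by (simp add: power_add[symmetric])
 qed
 finally have base: "2 * (2 * l + 1) * (?B + 1) <= 2 ^ (M ^ 7)" .
 show "streett_bound ?B (2 * l) <= 2 ^ (M ^ 9)"
 proof (cases l)
  case (Suc l')
  have "streett_bound ?B (2 * l) <= (2 * (2 * l + 1) * (?B + 1)) ^ (2 * l)"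
   using streett_bound_le[of ?B "2 * l"] by linarith
  also have "... <= (2 ^ (M ^ 7)) ^ (2 * l)" by (rule power_mono[OF base]) simp
  also have "... = 2 ^ (M ^ 7 * (2 * l))" by (simp add: power_mult)
  also have "... <= 2 ^ (M ^ 9)" using two l2[of 7] by simp
  finally show ?thesis .
 qed simp
 show "(Suc (2 ^ (M ^ 9))) ^ (2 * l) <= (2::nat) ^ (M ^ 12)"
 proof -
  have "Suc (2 ^ (M ^ 9)) <= 2 ^ (M ^ 9 + 1)" using M by (simp add: Suc_le_eq)
  hence "(Suc (2 ^ (M ^ 9))) ^ (2 * l) <= (2 ^ (M ^ 9 + 1)) ^ (2 * l)" by (rule power_mono) simp
  also have "... = 2 ^ ((M ^ 9 + 1) * (2 * l))" by (rule power_mult[symmetric])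
  also have "... <= 2 ^ (M ^ 12)"
  proof (rule two)
   have "M ^ 9 + 1 <= M ^ 10"
   proof -
    have "M ^ 9 + 1 <= M ^ 9 * 2" using M by simp
    also have "... <= M ^ 9 * M" by (rule mult_le_mono2[OF M])
    finally show ?thesis by (simp add: eval_nat_numeral mult.commute)
   qed
   hence "(M ^ 9 + 1) * (2 * l) <= M ^ 10 * (2 * l)" by (rule mult_le_mono1)
   with l2[of 10] show "(M ^ 9 + 1) * (2 * l) <= M ^ 12" by simp
  qed
  finally show ?thesis .
 qed
qed

subsection \<open>Membership in EXPTIME\<close>

theorem constrained_SPE_problem_EXPTIME: "constrained_SPE_problem : EXPTIME"
proof (rule EXPTIME_I[OF feasible_decide_SPE])
 fix x :: "bool list"
 define M where "M = length x + 2"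
 define P where "P = (2::nat) ^ (M ^ 12)"
 define K where "K = (2::nat) ^ (M ^ 9)"
 have M2: "2 <= M" by (simp add: M_def)
 have K_min: "min P (2 ^ (M ^ 9)) = K"
  using M2 by (simp add: P_def K_def min_def)
 have main: "check_syntax I & check_unique I M K P & check_SPE I M K P \<longleftrightarrow>
   valid_instance I & constrained_SPE_exists (game_of I) (inst_start I) (%i. inst_bounds I ! i)"
  if x: "x = enc_instance I" for I
 proof (cases "check_syntax I")
  case True
  have L: "length (enc_instance I) + 2 = M" by (simp add: M_def x)
  note b = instance_size_bounds[where I = I]
  note e = exponential_bounds[OF M2, where a = "length (auts I)" and b = "length (inst_players I)" and l = "length (prio_list I)"]
  interpret checked_instance I M K P
  proof
   show "wf_dpa_code (length (inst_owner I)) C" if "Q : set (inst_players I)" "C : set (code_automata Q)" for Q C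
    using True that by (auto simp: check_syntax_def list_all_iff check_dpa_iff)
   show "M ^ length (auts I) <= P" "Suc K ^ (2 * length (prio_list I)) <= P"
    using e b L by (simp_all add: P_def K_def)
   show "M ^ length (inst_players I) <= P"
    using exponential_bounds(1)[OF M2, of "length (inst_players I)" 0 0] b L by (simp add: P_def)
   show "streett_bound (M * (M ^ length (auts I) * (M ^ length (inst_players I) * (M ^ length (auts I) * Suc M)))) (2 * length (prio_list I)) <= K"
    using e(2) b L by (simp add: K_def)
   show "length (code_table (aut_code I k)) <= M" if "k < length (auts I)" for k using b(5)[OF that] L by linarith
   show "num_payoffs I i <= M" if "i < length (inst_players I)" for i using b(6)[OF that] L by linarith
  qed (use b(1-4) L M2 in linarith)+
  show ?thesis using True check_unique_iff check_SPE_iff valid_instance_iff[of I] by blast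
 next
  case False
  thus ?thesis unfolding valid_instance_iff[of I] by simp
 qed
 have "I : set (instance_list P M)" if "x = enc_instance I" for I
  by (rule instance_list_complete[OF P_def M2]) (simp add: M_def that)
 hence "x : constrained_SPE_problem \<longleftrightarrow> decide_SPE x P"
  unfolding decide_SPE_def Let_def M_def[symmetric] K_min list_ex_iff constrained_SPE_problem_def mem_Collect_eq
  using main by metis
 thus "x : constrained_SPE_problem \<longleftrightarrow> decide_SPE x (2 ^ ((length x + 2) ^ 12))" by (simp only: P_def M_def)
qed

section \<open>Two-player games with component automata\<close>

text \<open>A vertex \<open>(tag, p, ops, _)\<close> is the sink of an abandoned game (tag 0), a sink challenging
 component \<open>p\<close> (tag 1), or belongs to Eve (tag 2) or Adam (tag 3).  An operation \<open>(p, e, n)\<close>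
 changes bit \<open>p\<close> from \<open>e\<close> to \<open>n\<close>, where \<open>e = 2\<close> stands for any bit, and breaks component \<open>p\<close>
 (state 2) if the bit is not \<open>e\<close>.  States 3, 4 and 5 record a challenge that was justified, one
 that was not, and an irrelevant sink.\<close>

type_synonym ops = "(nat \<times> nat \<times> bool) list"
type_synonym 'c vert = "nat \<times> nat \<times> ops \<times> 'c"

definition op_step :: "ops => nat => nat => nat" where
 "op_step ops c b = fold (%x b. if fst x = c then
   (if b < 2 & fst (snd x) : {2, b} then (if snd (snd x) then 1 else 0) else 2) else b) ops b"

text \<open>Component \<open>K\<close> is no bit: it stays 0 while the game is undecided and then
  records which kind of sink was reached. Its initial 0 is the default of \<open>nthd\<close>, as
  the list of initial bits has length \<open>K\<close>.\<close>

definition letter :: "nat => nat => nat => 'c vert => nat" where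
 "letter K c b v =
  (if 2 < b then b
   else if fst v = 0 then (if c = K then 3 else 5)
   else if fst v = 1 then (if c = fst (snd v) then (if b = 2 then 3 else 4) else 5)
   else if c = K then b else op_step (fst (snd (snd v))) c b)"

definition component :: "nat => nat list => 'c vert list => nat => nat list => dpa_code" where
 "component K ini Vs c acc = \<lparr>code_init = nthd 0 ini c,
   code_table = map (%b. map (%v. letter K c b v) Vs) [0..<6],
   code_prios = map (%b. if b : set acc then 0 else 1) [0..<6]\<rparr>"

text \<open>A specification names a component and the states in which it must finally remain. Eve's
  payoff is 0 if the game is abandoned and 1 otherwise. Adam's is 0 if it is abandoned, 1 if no sink
  is reached, \<open>p + 2\<close> after a justified and \<open>K + 2 + p\<close> after an
  unjustified challenge of \<open>p\<close>.\<close>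

definition eve_specs :: "nat => (nat \<times> nat list) list" where
 "eve_specs K = [(K, [3]), (K, [0, 5])]"

definition adam_specs :: "nat => (nat \<times> nat list) list" where
 "adam_specs K = [(K, [3]), (K, [0])] @ map (%p. (p, [3])) [0..<K] @ map (%p. (p, [4])) [0..<K]"

text \<open>Eve has no preferences, so her bound 0 is met by payoff 0 only: the outcome must abandon
  the game. Adam prefers exactly the justified challenges to that.\<close>

definition game_instance :: "nat => nat list => 'c vert list => ('c vert => 'c vert list) => 'c vert => instance_code" where
 "game_instance K ini Vs succs d = \<lparr>
   inst_owner = map (%v. if fst v = 2 then 0 else 1) Vs,
   inst_edges = filter (%e. nthd d Vs (snd e) : set (succs (nthd d Vs (fst e))))
    (product_list [0..<length Vs] [0..<length Vs]),
   inst_players = [\<lparr>code_pref = [], code_automata = map (%s. component K ini Vs (fst s) (snd s)) (eve_specs K)\<rparr>,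
    \<lparr>code_pref = map (%p. (0, p + 2)) [0..<K],
    code_automata = map (%s. component K ini Vs (fst s) (snd s)) (adam_specs K)\<rparr>],
   inst_start = 0, inst_bounds = [0, 0]\<rparr>"

lemma op_step_le: "b <= 2 ==> op_step ops c b <= 2"
 unfolding op_step_def by (induction ops arbitrary: b) auto

lemma letter_less: "b < 6 ==> letter K c b v < 6"
 using op_step_le[of b "fst (snd (snd v))" c] by (auto simp: letter_def)

definition step_all :: "nat => 'c vert => (nat => nat) => nat => nat" where
 "step_all K v C = (%c. letter K c (C c) v)"

text \<open>What the equivalence with Eve's strategies needs of the graph: the game can be abandoned
  at the root only, and the root is never revisited.\<close>

locale succinct_game =
 fixes K :: nat and ini :: "nat list" and Vs :: "'c vert list" and succs :: "'c vert => 'c vert list" and d :: "'c vert"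
 assumes ini: "length ini = K" "set ini <= {0, 1}"
  and nonempty: "Vs ~= []" and root: "fst (Vs ! 0) = 3" and root_unique: "!!j. j < length Vs ==> Vs ! j = Vs ! 0 ==> j = 0"
  and succs_in: "!!v. v : set Vs ==> set (succs v) <= set Vs - {Vs ! 0}" and succs_ex: "!!v. v : set Vs ==> succs v ~= []"
  and challenge: "!!v. v : set Vs ==> fst v = 1 ==> fst (snd v) < K"
  and quit: "EX v:set (succs (Vs ! 0)). fst v = 0"
  and to_quit: "!!u v. v : set Vs ==> u : set (succs v) ==> fst u = 0 ==> v = Vs ! 0 | fst v = 0"
begin

abbreviation "Inst \<equiv> game_instance K ini Vs succs d"
abbreviation "Game \<equiv> game_of Inst"
abbreviation "owner j \<equiv> (if fst (Vs ! j) = 2 then 0 else 1 :: nat)"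

lemma simps [simp]: "length (inst_owner Inst) = length Vs" "length (inst_players Inst) = 2"
 "j < length Vs ==> inst_owner Inst ! j = owner j" "inst_start Inst = 0" "inst_bounds Inst = [0, 0]"
 "code_pref (inst_players Inst ! 0) = []" "code_pref (inst_players Inst ! Suc 0) = map (%p. (0, p + 2)) [0..<K]"
 by (simp_all add: game_instance_def)

lemma edges_iff: "(u, v) : set (inst_edges Inst) \<longleftrightarrow> u < length Vs & v < length Vs & Vs ! v : set (succs (Vs ! u))"
 by (auto simp: game_instance_def set_product_list)

lemma edge_index:
 assumes "u < length Vs" "v : set (succs (Vs ! u))"
 obtains j where "(u, j) : set (inst_edges Inst)" "Vs ! j = v"
proof -
 have "v : set Vs" using succs_in[of "Vs ! u"] assms by auto
 then obtain j where "j < length Vs" "Vs ! j = v" by (metis in_set_conv_nth)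
 with assms that show ?thesis by (auto simp: edges_iff)
qed

definition specs :: "nat => (nat \<times> nat list) list" where
 "specs i = (if i = 0 then eve_specs K else adam_specs K)"

lemma automata: "i < 2 ==> code_automata (inst_players Inst ! i) = map (%s. component K ini Vs (fst s) (snd s)) (specs i)"
 by (auto simp: game_instance_def specs_def less_2_cases_iff)

lemma num_payoffs: "i < 2 ==> num_payoffs Inst i = length (specs i)"
 by (simp add: num_payoffs_def automata)

lemma automaton: "i < 2 ==> p < length (specs i) ==>
  automaton Inst i p = dpa_of (component K ini Vs (fst (specs i ! p)) (snd (specs i ! p)))"
 by (simp add: automaton_def automata)

lemma start_le: "nthd 0 ini c <= 1"
proof (cases "c < K")
 case True
 hence "ini ! c : set ini" using ini(1) by simp
 hence "ini ! c : {0, 1}" using ini(2) by blast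
 thus ?thesis using ini(1) True by auto
qed (use ini in "simp add: nthd_def")

lemma instance_syntax: "check_syntax Inst"
proof -
 have "check_dpa (length Vs) (component K ini Vs c acc)" for c acc
  using start_le[of c] letter_less by (auto simp: check_dpa_def component_def list_all_iff)
 hence dpas: "list_all (%Q. list_all (%C. check_dpa (length Vs) C) (code_automata Q)) (inst_players Inst)"
  by (simp add: game_instance_def list_all_iff)
 have out: "list_ex (%e. fst e = u) (inst_edges Inst)" if u: "u < length Vs" for u
 proof -
  have "hd (succs (Vs ! u)) : set (succs (Vs ! u))" using succs_ex[of "Vs ! u"] u by simp
  from edge_index[OF u this] obtain j where "(u, j) : set (inst_edges Inst)" .
  thus ?thesis unfolding list_ex_iff by (rule rev_bexI) simp
 qed
 have "list_all (%i. nthd 0 [0, 0] i < length (code_automata (player_at Inst i))) [0..<2]"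
  by (auto simp: list_all_iff less_2_cases_iff automata specs_def eve_specs_def adam_specs_def player_at_def nthd_def)
 thus ?thesis
  using dpas out nonempty
  unfolding check_syntax_def simps
  by (auto simp: list_all_iff game_instance_def set_product_list adam_specs_def)
qed

section \<open>Runs of the components and payoffs of plays\<close>

definition comps :: "nat list => nat => nat" where
 "comps h = fold (%j C. step_all K (Vs ! j) C) h (%c. nthd 0 ini c)"

definition run :: "nat => nat word => nat => nat" where
 "run c w n = comps (map w [0..<n]) c"

lemma run_simps: "run c w 0 = nthd 0 ini c" "run c w (Suc n) = letter K c (run c w n) (Vs ! w n)"
 by (simp_all add: run_def comps_def step_all_def)

lemma run_less: "run c w n < 6"
proof (induction n)
 case 0
 thus ?case using start_le[of c] by (simp add: run_simps)
qed (simp only: run_simps letter_less)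

lemma dpa_run:
 assumes "w : omega_words {..<length Vs}"
 shows "dpa_run (dpa_of (component K ini Vs c acc)) w n = run c w n"
proof (induction n)
 case (Suc n)
 have "w n < length Vs" using assms by (auto simp: omega_words_def)
 thus ?case using Suc run_less[of c w n] by (simp add: run_simps dpa_of_def component_def)
qed (simp add: run_simps dpa_of_def component_def)

definition hits :: "nat word => nat \<times> nat list => bool" where
 "hits w s \<longleftrightarrow> (EX n0. ALL n>=n0. run (fst s) w n : set (snd s))"

text \<open>With priorities 0 and 1 acceptance is a co-Buchi condition: the run finally stays in
  \<open>acc\<close>. Membership in \<open>acc\<close> settles in all cases at hand.\<close>

lemma accepts_component:
 assumes w: "w : omega_words {..<length Vs}" and ev: "!!n. n >= n0 ==> run c w n : set acc \<longleftrightarrow> b"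
 shows "dpa_accepts (dpa_of (component K ini Vs c acc)) w \<longleftrightarrow> b" and "hits w (c, acc) \<longleftrightarrow> b"
proof -
 let ?r = "%n. dpa_prio (dpa_of (component K ini Vs c acc)) (dpa_run (dpa_of (component K ini Vs c acc)) w n)"
 have r: "?r n = (if b then 0 else 1)" if "n >= n0" for n
  using run_less[of c w n] ev[OF that] unfolding dpa_run[OF w] by (simp add: dpa_of_def component_def)
 have "limit ?r = {if b then 0 else 1}"
 proof (rule set_eqI)
  fix x
  show "x : limit ?r \<longleftrightarrow> x : {if b then 0 else 1}"
  proof
   assume "x : limit ?r"
   then obtain n where "n >= n0" "?r n = x" unfolding limit_def INFM_nat_le by blast
   thus "x : {if b then 0 else 1}" using r[of n] by simp
  next
   assume "x : {if b then 0 else 1}"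
   hence "?r (max n0 n) = x" for n using r[of "max n0 n"] by simp
   thus "x : limit ?r" unfolding limit_def INFM_nat_le mem_Collect_eq using max.cobounded2 by blast
  qed
 qed
 thus "dpa_accepts (dpa_of (component K ini Vs c acc)) w \<longleftrightarrow> b" unfolding dpa_accepts_def by simp
 show "hits w (c, acc) \<longleftrightarrow> b"
 proof (cases b)
  case True
  thus ?thesis using ev by (auto simp: hits_def)
 next
  case False
  have "EX n>=n1. run c w n \<notin> set acc" for n1 using ev[of "max n0 n1"] False by (intro exI[of _ "max n0 n1"]) simp
  thus ?thesis using False by (auto simp: hits_def)
 qed
qed

lemma run_stays: "n <= n' ==> 2 < run c w n ==> run c w n' = run c w n"
proof (induction n' rule: dec_induct)
 case (step k)
 thus ?case by (simp add: run_simps letter_def)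
qed simp

lemma run_normal: "(!!k. k < n ==> 1 < fst (Vs ! w k)) ==> run c w n <= 2 & run K w n = 0"
proof (induction n)
 case 0
 thus ?case using start_le[of c] ini(1) by (simp add: run_simps nthd_def)
next
 case (Suc n)
 have "1 < fst (Vs ! w n)" "run c w n <= 2" "run K w n = 0" using Suc by simp_all
 thus ?case using op_step_le[of "run c w n" "fst (snd (snd (Vs ! w n)))" c] by (simp add: run_simps letter_def)
qed

text \<open>On the first sink every component passes to a state above 2, which it never leaves. So
  the first sink decides everything.\<close>

lemma fate:
 assumes w: "w : omega_words {..<length Vs}"
 obtains (never) "!!c n. run c w n <= 2" "!!n. run K w n = 0"
 | (quits) n0 where "!!c n. n <= n0 ==> run c w n <= 2" "!!c n. n0 < n ==> run c w n = (if c = K then 3 else 5)"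
 | (challenged) n0 p where "p < K" "!!c n. n <= n0 ==> run c w n <= 2"
   "!!c n. n0 < n ==> run c w n = (if c = p then (if run p w n0 = 2 then 3 else 4) else 5)"
proof (cases "EX n. fst (Vs ! w n) <= 1")
 case False
 hence "1 < fst (Vs ! w k)" for k by (meson not_le)
 thus ?thesis using run_normal never by blast
next
 case True
 define n0 where "n0 = (LEAST n. fst (Vs ! w n) <= 1)"
 have n0: "fst (Vs ! w n0) <= 1" unfolding n0_def using True by (rule LeastI_ex)
 have "1 < fst (Vs ! w k)" if "k < n0" for k using not_less_Least[of k "%n. fst (Vs ! w n) <= 1"] that by (auto simp: n0_def)
 hence le: "run c w n <= 2" if "n <= n0" for c n using run_normal[of n w c] that by simp
 have const: "run c w n = letter K c (run c w n0) (Vs ! w n0)" if "n0 < n" for c n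
 proof -
  have "2 < run c w (Suc n0)" using n0 le[of n0 c] by (auto simp: run_simps letter_def)
  from run_stays[OF _ this, of n] that show ?thesis by (simp add: run_simps)
 qed
 consider "fst (Vs ! w n0) = 0" | "fst (Vs ! w n0) = 1" using n0 by linarith
 thus ?thesis
 proof cases
  case 1
  hence "run c w n = (if c = K then 3 else 5)" if "n0 < n" for c n
   using const[OF that, of c] le[of n0 c] by (simp add: letter_def)
  thus ?thesis using quits le by blast
 next
  case 2
  let ?p = "fst (snd (Vs ! w n0))"
  have "w n0 < length Vs" using w by (auto simp: omega_words_def)
  hence "?p < K" using challenge[of "Vs ! w n0"] 2 by simp
  moreover have "run c w n = (if c = ?p then (if run ?p w n0 = 2 then 3 else 4) else 5)" if "n0 < n" for c n
   using const[OF that, of c] le[of n0 c] 2 by (simp add: letter_def)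
  ultimately show ?thesis using challenged le by blast
 qed
qed

lemma distinct_specs: "distinct (specs i)"
 by (auto simp: specs_def eve_specs_def adam_specs_def distinct_map inj_on_def)

lemma set_specs: "set (specs 0) = {(K, [3]), (K, [0, 5])}"
 "set (specs (Suc 0)) = {(K, [3]), (K, [0])} \<union> {(p, [3]) | p. p < K} \<union> {(p, [4]) | p. p < K}"
 by (auto simp: specs_def eve_specs_def adam_specs_def)

text \<open>Each of the three fates fits exactly one specification of each player. This gives the
  partition property on which validity rests.\<close>

lemma winning_spec:
 assumes w: "w : omega_words {..<length Vs}" and i: "i < 2"
 obtains T where "T : set (specs i)" "!!s. s : set (specs i) ==> hits w s \<longleftrightarrow> s = T"
  "!!s. s : set (specs i) ==> dpa_accepts (dpa_of (component K ini Vs (fst s) (snd s))) w \<longleftrightarrow> s = T"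
proof -
 have "EX T n0. T : set (specs i) & (ALL s:set (specs i). ALL n>=n0. run (fst s) w n : set (snd s) \<longleftrightarrow> s = T)"
  using w
 proof (cases rule: fate)
  case never
  have ne: "run c w n ~= 3" "run c w n ~= 4" for c n using never(1)[of c n] by auto
  show ?thesis
  proof (cases "i = 0")
   case True
   show ?thesis by (rule exI[of _ "(K, [0, 5])"]) (simp add: True set_specs never)
  next
   case False
   hence i1: "i = Suc 0" using i by simp
   show ?thesis by (rule exI[of _ "(K, [0])"]) (auto simp: i1 set_specs never ne)
  qed
 next
  case (quits n0)
  show ?thesis
   by (rule exI[of _ "(K, [3])"], rule exI[of _ "Suc n0"]) (use i quits(2) in "auto simp: less_2_cases_iff set_specs Suc_le_eq")
 next
  case (challenged n0 p)
  show ?thesis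
  proof (cases "i = 0")
   case True
   show ?thesis
    by (rule exI[of _ "(K, [0, 5])"], rule exI[of _ "Suc n0"]) (use challenged in "auto simp: True set_specs Suc_le_eq")
  next
   case False
   hence i1: "i = Suc 0" using i by simp
   show ?thesis
    by (rule exI[of _ "(p, [if run p w n0 = 2 then 3 else 4])"], rule exI[of _ "Suc n0"])
     (use challenged in "auto simp: i1 set_specs Suc_le_eq")
  qed
 qed
 then obtain T n0 where T: "T : set (specs i)" "!!s n. s : set (specs i) ==> n >= n0 ==> run (fst s) w n : set (snd s) \<longleftrightarrow> s = T"
  by blast
 show ?thesis
 proof (rule that[OF T(1)])
  fix s assume s: "s : set (specs i)"
  show "hits w s \<longleftrightarrow> s = T" "dpa_accepts (dpa_of (component K ini Vs (fst s) (snd s))) w \<longleftrightarrow> s = T"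
   using accepts_component[OF w, of n0 "fst s" "snd s" "s = T"] T(2)[OF s] by simp_all
 qed
qed

lemma instance_valid: "valid_instance Inst"
proof -
 have "unique_payoffs Inst"
  unfolding unique_payoffs_def simps
 proof (intro allI ballI impI)
  fix i :: nat and w assume i: "i < 2" and w: "w : omega_words {..<length Vs}"
  obtain T where T: "T : set (specs i)"
   "!!s. s : set (specs i) ==> dpa_accepts (dpa_of (component K ini Vs (fst s) (snd s))) w \<longleftrightarrow> s = T"
   using winning_spec[OF w i] by metis
  obtain p where p: "p < length (specs i)" "specs i ! p = T" using T(1) by (metis in_set_conv_nth)
  show "EX! p. p < num_payoffs Inst i & dpa_accepts (automaton Inst i p) w"
  proof (rule ex1I[of _ p])
   show "p < num_payoffs Inst i & dpa_accepts (automaton Inst i p) w"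
    using p T by (simp add: num_payoffs i automaton)
   fix q assume q: "q < num_payoffs Inst i & dpa_accepts (automaton Inst i q) w"
   hence l: "q < length (specs i)" by (simp add: num_payoffs i)
   hence "specs i ! q = T" using q T(2)[of "specs i ! q"] automaton[OF i l] by simp
   thus "q = p" using nth_eq_iff_index_eq[OF distinct_specs l p(1)] p(2) by simp
  qed
 qed
 thus ?thesis using instance_syntax valid_instance_iff by blast
qed

sublocale instance_game Inst "length (enc_instance Inst) + 2"
 by unfold_locales (use instance_valid instance_size_bounds[where I = Inst] in "auto intro: le_SucI")

lemma two_players: "enc_instance Inst : two_player_instances"
 using instance_valid by (auto simp: two_player_instances_def)

lemma pay_iff:
 assumes "play Game pp" "i < 2" "p < length (specs i)"
 shows "pay Game i pp = p \<longleftrightarrow> hits pp (specs i ! p)"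
proof -
 have w: "pp : omega_words {..<length Vs}" using play_words[OF assms(1)] by simp
 obtain T where T: "!!s. s : set (specs i) ==> hits pp s \<longleftrightarrow> s = T"
   "!!s. s : set (specs i) ==> dpa_accepts (dpa_of (component K ini Vs (fst s) (snd s))) pp \<longleftrightarrow> s = T"
  using winning_spec[OF w assms(2)] by metis
 have "dpa_language (verts Game) (automaton Inst i p) = pay_preimage Game i p"
  using instance_valid assms(2,3) by (simp add: valid_instance_def num_payoffs)
 hence "pay Game i pp = p \<longleftrightarrow> dpa_accepts (automaton Inst i p) pp"
  using w by (auto simp: dpa_language_def pay_preimage_def)
 thus ?thesis using T assms by (simp add: automaton)
qed

lemma hits_absorbing: "2 < x ==> hits w (c, [x]) \<longleftrightarrow> (EX n. run c w n = x)"
proof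
 assume "2 < x" "EX n. run c w n = x"
 then obtain n where "run c w n = x" "2 < run c w n" by auto
 hence "run c w n' = x" if "n <= n'" for n' using run_stays[OF that, of c w] by simp
 thus "hits w (c, [x])" by (auto simp: hits_def)
qed (auto simp: hits_def)

lemma pay_quit: "play Game pp ==> i < 2 ==> pay Game i pp = 0 \<longleftrightarrow> (EX n. run K pp n = 3)"
 using pay_iff[of pp i 0] hits_absorbing[of 3 pp K] by (auto simp: specs_def eve_specs_def adam_specs_def less_2_cases_iff)

lemma pay_win: "play Game pp ==> p < K ==> pay Game 1 pp = p + 2 \<longleftrightarrow> (EX n. run p pp n = 3)"
 using pay_iff[of pp 1 "p + 2"] hits_absorbing[of 3 pp p] by (simp add: specs_def adam_specs_def nth_append)

lemma play_succ: "play Game pp ==> pp n < length Vs & Vs ! pp (Suc n) : set (succs (Vs ! pp n))"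
 using play_less[of pp n] by (auto simp: play_def edges_iff)

text \<open>Whether a play earns payoff 0 is settled by its first move. Hence in a later subgame all
  plays agree on it, and no preference can apply there.\<close>

lemma quit_first:
 assumes p: "play Game pp" "pp 0 = 0"
 shows "(EX n. run K pp n = 3) \<longleftrightarrow> fst (Vs ! pp 1) = 0"
proof
 assume "fst (Vs ! pp 1) = 0"
 hence "run K pp 2 = 3"
  using start_le[of K] root p(2) ini(1) by (simp add: numeral_2_eq_2 run_simps letter_def nthd_def)
 thus "EX n. run K pp n = 3" ..
next
 assume "EX n. run K pp n = 3"
 hence "EX n. fst (Vs ! pp n) = 0"
 proof (rule contrapos_pp)
  assume a: "~ (EX n. fst (Vs ! pp n) = 0)"
  have "run K pp n ~= 3 & (run K pp n <= 2 --> run K pp n = 0)" for n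
  proof (induction n)
   case 0
   thus ?case using ini(1) by (simp add: run_simps nthd_def)
  next
   case (Suc n)
   have "pp n < length Vs" using play_succ[OF p(1)] by blast
   hence "fst (Vs ! pp n) = 1 ==> fst (snd (Vs ! pp n)) < K" using challenge[of "Vs ! pp n"] by simp
   moreover have "fst (Vs ! pp n) ~= 0" using a by simp
   ultimately show ?case using Suc by (auto simp: run_simps letter_def)
  qed
  thus "~ (EX n. run K pp n = 3)" by blast
 qed
 then obtain n where n: "fst (Vs ! pp n) = 0" by blast
 thus "fst (Vs ! pp 1) = 0"
 proof (induction n)
  case 0
  thus ?case using root p(2) by simp
 next
  case (Suc n)
  note s = play_succ[OF p(1), of n]
  from s to_quit[of "Vs ! pp n" "Vs ! pp (Suc n)"] Suc.prems have "Vs ! pp n = Vs ! 0 | fst (Vs ! pp n) = 0" by simp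
  thus ?case
  proof
   assume e: "Vs ! pp n = Vs ! 0"
   show ?thesis
   proof (cases n)
    case (Suc k)
    have "Vs ! pp (Suc k) : set (succs (Vs ! pp k))" "pp k < length Vs" using play_succ[OF p(1), of k] by auto
    thus ?thesis using succs_in[of "Vs ! pp k"] e Suc by auto
   qed (use Suc.prems in simp)
  qed (rule Suc.IH)
 qed
qed

section \<open>Equilibria and safe strategies of Eve\<close>

definition safe_strategy :: "(nat list => nat) => bool" where
 "safe_strategy s \<longleftrightarrow> strategy Game 0 s &
  (ALL pp. play Game pp --> pp 0 = 0 --> consistent Game 0 s pp --> (ALL p<K. ALL n. run p pp n ~= 3))"

lemma pref_simps: "pref Game 0 = {}" "pref Game 1 = (%p. (0, p + 2)) ` {..<K}"
 by auto

lemma root_less: "0 < length Vs"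
 using nonempty by simp

lemma someI_edge: "v < length Vs ==> (v, SOME u. (v, u) : set (inst_edges Inst)) : set (inst_edges Inst)"
proof -
 assume "v < length Vs"
 hence "EX u. (v, u) : set (inst_edges Inst)" by (intro edge_ex) simp
 thus ?thesis by (rule someI_ex)
qed

lemma profileI:
 assumes "strategy Game 0 s" "!!h v. v < length Vs ==> (v, f (h @ [v])) : set (inst_edges Inst)"
 shows "strategy_profile Game (%i. if i = 0 then s else f)"
 unfolding strategy_profile_def
proof
 fix i
 show "strategy Game i (if i = 0 then s else f)"
 proof (cases "i = 0")
  case False
  have "(v, f (h @ [v])) : edges Game" if "history Game (h @ [v])" for h v
   unfolding G_simps by (rule assms(2)) (use that in "simp add: history_def")
  thus ?thesis using False unfolding strategy_def by simp
 qed (use assms(1) in simp)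
qed

text \<open>In an equilibrium with the required payoffs Adam abandons the game, and he must gain
  nothing by playing on; so Eve's strategy never allows a justified challenge. Conversely let Adam
  abandon at the root and move arbitrarily elsewhere: by \<open>quit_first\<close> only deviations
  at the root could pay, and a safe strategy of Eve excludes them.\<close>

theorem constrained_iff: "constrained_SPE_exists Game 0 (%i. [0, 0] ! i) \<longleftrightarrow> (EX s. safe_strategy s)"
proof
 assume "constrained_SPE_exists Game 0 (%i. [0, 0] ! i)"
 then obtain sg where spe: "is_SPE Game 0 sg"
  and b: "!!i. i < 2 ==> [0, 0] ! i = pay Game i (outcome Game sg 0) | ([0, 0] ! i, pay Game i (outcome Game sg 0)) : pref Game i"
  unfolding constrained_SPE_exists_def by (auto simp del: G_simps(6))
 have sp: "strategy_profile Game sg" using spe by (simp add: is_SPE_def)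
 have h0: "[0] : Hist Game 0" using root_less by (simp add: Hist_single)
 have out: "outcome Game sg 0 = cont sg [0]"
  using suffix_outcome[OF sp, of "[]" 0 0] h0 by (simp add: restrict_profile_def)
 note cp = cont_play[OF sp h0]
 have "pay Game 0 (cont sg [0]) = 0" using b[of 0] by (simp add: pref_simps out)
 hence pay1: "pay Game 1 (cont sg [0]) = 0" using pay_quit[OF cp(1)] by simp
 have "run p pp n ~= 3" if pi: "play Game pp" "pp 0 = 0" "consistent Game 0 (sg 0) pp" and p: "p < K" for pp p n
 proof
  assume r: "run p pp n = 3"
  have "only_deviates sg pp 0 1"
   using pi(3) play_succ[OF pi(1)] by (auto simp: only_deviates_def follows_def consistent_def simp del: upt_Suc)
  hence "(pay Game 1 (cont sg (map pp [0..<Suc 0])), pay Game 1 pp) \<notin> pref Game 1"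
   using conjunct2[OF iffD1[OF SPE_iff spe], rule_format, OF pi(1,2)] by (metis simps(2) one_less_numeral_iff semiring_norm(76))
  moreover have "pay Game 1 pp = p + 2" using pay_win[OF pi(1) p] r by blast
  ultimately show False using pay1 p pi(2) by (simp add: pref_simps[unfolded One_nat_def] del: G_simps(6))
 qed
 hence "safe_strategy (sg 0)" using sp by (simp add: safe_strategy_def strategy_profile_def)
 thus "EX s. safe_strategy s" by blast
next
 assume "EX s. safe_strategy s"
 then obtain s where s: "strategy Game 0 s" "!!pp p n. play Game pp ==> pp 0 = 0 ==> consistent Game 0 s pp ==> p < K ==> run p pp n ~= 3"
  by (auto simp: safe_strategy_def)
 obtain v where "v : set (succs (Vs ! 0))" "fst v = 0" using quit by blast
 then obtain j where j: "(0, j) : set (inst_edges Inst)" "fst (Vs ! j) = 0" using edge_index[OF root_less] by metis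
 define sg where "sg i = (if i = 0 then s else (%h. if h = [0] then j else (SOME v. (last h, v) : set (inst_edges Inst))))" for i :: nat
 have sp: "strategy_profile Game sg"
  unfolding sg_def using j(1) by (intro profileI s(1)) (auto simp: someI_edge)
 have h0: "[0] : Hist Game 0" using root_less by (simp add: Hist_single)
 have quits: "pay Game i (cont sg [0]) = 0" if "i < 2" for i
 proof -
  have "follows sg (cont sg [0]) 0" by (rule cont_follows) simp_all
  hence "cont sg [0] 1 = j" using cont_play(2)[OF sp h0] root root_less by (simp add: follows_def sg_def)
  thus ?thesis using pay_quit[OF cont_play(1)[OF sp h0] that] quit_first[OF cont_play[OF sp h0]] j(2) by simp
 qed
 have "is_SPE Game 0 sg"
  unfolding SPE_iff
 proof (intro conjI allI impI sp)
  fix pp n i assume pi: "play Game pp" "pp 0 = 0" and i: "i < length (inst_players Inst)" and dev: "only_deviates sg pp n i"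
  let ?h = "map pp [0..<Suc n]"
  have h: "?h : Hist Game 0" using play_prefix_Hist[OF pi(1)] pi(2) by simp
  note cp = cont_play[OF sp h]
  show "(pay Game i (cont sg ?h), pay Game i pp) \<notin> pref Game i"
  proof
   assume d: "(pay Game i (cont sg ?h), pay Game i pp) : pref Game i"
   hence i1: "i = 1" using i pref_simps(1) by (cases "i = 0") (auto simp del: G_simps(6))
   with d obtain p where p: "pay Game 1 (cont sg ?h) = 0" "pay Game 1 pp = p + 2" "p < K" unfolding i1 pref_simps by auto
   show False
   proof (cases n)
    case 0
    have "consistent Game 0 s pp"
     using dev play_succ[OF pi(1)] by (auto simp: 0 i1 only_deviates_def consistent_def follows_def sg_def simp del: upt_Suc)
    thus False using s(2)[OF pi _ p(3)] pay_win[OF pi(1) p(3)] p(2) by blast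
   next
    case (Suc n')
    have "cont sg ?h 1 = pp 1"
    proof -
     have "map (cont sg ?h) [0..<length ?h] ! 1 = ?h ! 1" by (subst cont_start) simp_all
     thus ?thesis by (simp add: Suc del: upt_Suc)
    qed
    moreover have "fst (Vs ! cont sg ?h 1) = 0" using p(1) pay_quit[OF cp(1), of 1] quit_first[OF cp] by simp
    ultimately have "pay Game 1 pp = 0" using pay_quit[OF pi(1), of 1] quit_first[OF pi] by simp
    thus False using p(2) by simp
   qed
  qed
 qed
 moreover have "outcome Game sg 0 = cont sg [0]"
  using suffix_outcome[OF sp, of "[]" 0 0] h0 by (simp add: restrict_profile_def)
 moreover have "[0, 0] ! i = pay Game i (cont sg [0])" if "i : players Game" for i
 proof -
  have "i < 2" using that by simp
  from this quits[OF this] show ?thesis by (cases "i = 0") (simp_all add: less_2_cases_iff)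
 qed
 ultimately show "constrained_SPE_exists Game 0 (%i. [0, 0] ! i)"
  unfolding constrained_SPE_exists_def by (intro exI[of _ sg] conjI ballI disjI1) simp_all
qed

corollary problem_iff: "enc_instance Inst : constrained_SPE_problem \<longleftrightarrow> (EX s. safe_strategy s)"
proof -
 have "enc_instance Inst : constrained_SPE_problem \<longleftrightarrow> constrained_SPE_exists Game (inst_start Inst) (%i. inst_bounds Inst ! i)"
  unfolding constrained_SPE_problem_def mem_Collect_eq using instance_valid injD[OF inj_enc_instance] by metis
 thus ?thesis using constrained_iff unfolding simps by simp
qed

lemma comps_snoc: "comps (h @ [j]) = step_all K (Vs ! j) (comps h)"
 by (simp add: comps_def)

lemma comps_root: "comps [0] = step_all K (Vs ! 0) (%c. nthd 0 ini c)"
 by (simp add: comps_def)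

text \<open>The invariant speaks of a vertex together with the components after reading that vertex.
  Eve's choice depends on the history only through these.\<close>

lemma safe_strategyI:
 assumes start: "Q (Vs ! 0) (comps [0])"
  and adam: "!!v C u. v : set Vs ==> Q v C ==> fst v ~= 2 ==> u : set (succs v) ==> Q u (step_all K u C)"
  and eve: "!!v C. v : set Vs ==> Q v C ==> fst v = 2 ==> EX u:set (succs v). Q u (step_all K u C)"
  and safe: "!!v C p. Q v C ==> p < K ==> C p ~= 3"
 shows "EX s. safe_strategy s"
proof -
 define good where "good h j \<longleftrightarrow> (last h, j) : set (inst_edges Inst) &
   (Q (Vs ! last h) (comps h) & fst (Vs ! last h) = 2 --> Q (Vs ! j) (comps (h @ [j])))" for h j
 define s where "s h = (SOME j. good h j)" for h
 have good: "good h (s h)" if l: "last h < length Vs" for h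
  unfolding s_def
 proof (rule someI_ex)
  have v: "Vs ! last h : set Vs" using l by simp
  show "EX j. good h j"
  proof (cases "Q (Vs ! last h) (comps h) & fst (Vs ! last h) = 2")
   case True
   then obtain u where u: "u : set (succs (Vs ! last h))" "Q u (step_all K u (comps h))" using eve[OF v] by blast
   from edge_index[OF l u(1)] obtain j where "(last h, j) : set (inst_edges Inst)" "Vs ! j = u" .
   with u(2) show ?thesis by (auto simp: good_def comps_snoc)
  next
   case False
   thus ?thesis using edge_ex[of "last h"] l by (auto simp: good_def)
  qed
 qed
 have "safe_strategy s"
  unfolding safe_strategy_def
 proof (intro conjI allI impI)
  show "strategy Game 0 s"
   unfolding strategy_def
  proof (intro allI impI)
   fix h v assume "history Game (h @ [v]) & v : owned Game 0"
   hence "v < length Vs" by (simp add: history_def)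
   thus "(v, s (h @ [v])) : edges Game" using good[of "h @ [v]"] by (simp add: good_def)
  qed
  fix pp p n assume pi: "play Game pp" "pp 0 = 0" "consistent Game 0 s pp" and p: "p < K"
  have "Q (Vs ! pp n) (comps (map pp [0..<Suc n]))" for n
  proof (induction n)
   case 0
   thus ?case using start pi(2) by simp
  next
   case (Suc n)
   let ?h = "map pp [0..<Suc n]"
   have e: "pp n < length Vs" "Vs ! pp (Suc n) : set (succs (Vs ! pp n))" using play_succ[OF pi(1), of n] by auto
   have snoc: "map pp [0..<Suc (Suc n)] = ?h @ [pp (Suc n)]" by simp
   show ?case
   proof (cases "fst (Vs ! pp n) = 2")
    case True
    hence "pp (Suc n) = s ?h" using pi(3) e(1) by (simp add: consistent_def del: upt_Suc)
    thus ?thesis using good[of ?h] e(1) True Suc unfolding snoc by (simp add: good_def)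
   next
    case False
    thus ?thesis using adam[OF _ Suc False e(2)] e(1) unfolding snoc comps_snoc by simp
   qed
  qed
  hence q: "Q (Vs ! pp (n - 1)) (comps (map pp [0..<Suc (n - 1)]))" .
  show "run p pp n ~= 3"
  proof (cases n)
   case 0
   thus ?thesis using start_le[of p] by (simp add: run_simps)
  next
   case (Suc k)
   thus ?thesis using safe[OF q p] by (simp add: run_def)
  qed
 qed
 thus ?thesis by blast
qed

text \<open>The attractor of the justified challenges. As it is a least fixpoint, induction over it
  leads any fixed strategy of Eve to such a challenge.\<close>

inductive adam_wins :: "'c vert => (nat => nat) => bool" where
 challenged: "p < K ==> C p = 3 ==> adam_wins v C"
| adam_move: "fst v ~= 2 ==> u : set (succs v) ==> adam_wins u (step_all K u C) ==> adam_wins v C"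
| eve_moves: "fst v = 2 ==> (!!u. u : set (succs v) ==> adam_wins u (step_all K u C)) ==> adam_wins v C"

lemma adam_wins_unsafe:
 assumes "adam_wins (Vs ! 0) (comps [0])"
 shows "~ safe_strategy s"
proof
 assume safe: "safe_strategy s"
 define ok where "ok h \<longleftrightarrow> h : Hist Game 0 & (ALL n. Suc n < length h --> fst (Vs ! (h ! n)) = 2 --> h ! Suc n = s (take (Suc n) h))" for h
 have ok_snoc: "ok (h @ [j])"
  if "ok h" "(last h, j) : set (inst_edges Inst)" "fst (Vs ! last h) = 2 ==> j = s h" for h j
 proof -
  have h: "h ~= []" using that(1) by (auto simp: ok_def Hist_def)
  have "h @ [j] : Hist Game 0" using that(1,2) h by (simp add: ok_def Hist_snoc)
  moreover have "(h @ [j]) ! Suc n = s (take (Suc n) (h @ [j]))"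
   if n: "Suc n < length (h @ [j])" "fst (Vs ! ((h @ [j]) ! n)) = 2" for n
  proof (cases "Suc n = length h")
   case True
   hence "(h @ [j]) ! n = last h" using h by (cases h rule: rev_cases) (simp_all add: nth_append)
   thus ?thesis using that(2) \<open>fst (Vs ! last h) = 2 ==> j = s h\<close> True by simp
  next
   case False
   thus ?thesis using that \<open>ok h\<close> by (simp add: ok_def nth_append)
  qed
  ultimately show ?thesis by (simp add: ok_def)
 qed
 have False if "adam_wins v C" "ok h" "Vs ! last h = v" "comps h = C" for v C h
  using that
 proof (induction arbitrary: h rule: adam_wins.induct)
  case (challenged p C v)
  hence h: "h : Hist Game 0" "h ~= []" by (auto simp: ok_def Hist_def)
  define sg where "sg i = (if i = 0 then s else (%h. SOME v. (last h, v) : set (inst_edges Inst)))" for i :: nat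
  have sp: "strategy_profile Game sg"
   unfolding sg_def using safe by (intro profileI) (auto simp: someI_edge safe_strategy_def)
  let ?pp = "cont sg h"
  note cp = cont_play[OF sp h(1)]
  have pre: "map ?pp [0..<length h] = h" by (rule cont_start[OF h(2)])
  hence nth: "?pp n = h ! n" if "n < length h" for n using that by (metis add_0 nth_map_upt diff_zero)
  have "?pp (Suc n) = s (map ?pp [0..<Suc n])" if "?pp n : owned Game 0" for n
  proof (cases "Suc n < length h")
   case True
   have own: "fst (Vs ! ?pp n) = 2" using that by (auto split: if_splits)
   have "map ?pp [0..<Suc n] = take (Suc n) (map ?pp [0..<length h])" using True by (simp add: take_map del: upt_Suc)
   hence "map ?pp [0..<Suc n] = take (Suc n) h" by (simp only: pre)
   thus ?thesis using challenged(3) True own nth[of n] nth[OF True] by (simp add: ok_def del: upt_Suc)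
  next
   case False
   hence "follows sg ?pp n" using h(2) by (intro cont_follows) auto
   thus ?thesis using that by (simp add: follows_def sg_def del: upt_Suc)
  qed
  hence "consistent Game 0 s ?pp" by (simp add: consistent_def del: upt_Suc)
  hence "run p ?pp (length h) ~= 3" using safe cp challenged(1) by (auto simp: safe_strategy_def)
  thus False using challenged by (simp add: run_def pre)
 next
  case (adam_move v u C)
  have "last h < length Vs" using Hist_last[of h 0] adam_move.prems by (simp add: ok_def)
  from edge_index[OF this, of u] adam_move obtain j where j: "(last h, j) : set (inst_edges Inst)" "Vs ! j = u" by metis
  show False by (rule adam_move.IH[of "h @ [j]"]) (use adam_move j in "auto intro: ok_snoc simp: comps_snoc")
 next
  case (eve_moves v C)
  have h: "h : Hist Game 0" "h ~= []" using eve_moves.prems by (auto simp: ok_def Hist_def)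
  have l: "last h < length Vs" using Hist_last[OF h(1)] by simp
  have "(last h, s h) : set (inst_edges Inst)"
  proof -
   have "history Game (butlast h @ [last h])" using h by (simp add: Hist_def)
   moreover have "last h : owned Game 0" using l eve_moves by simp
   ultimately have "(last h, s (butlast h @ [last h])) : edges Game" using safe unfolding safe_strategy_def strategy_def by blast
   thus ?thesis using h(2) by simp
  qed
  thus False
   by (intro eve_moves.IH[of "Vs ! s h" "h @ [s h]"]) (use eve_moves in "auto intro: ok_snoc simp: comps_snoc edges_iff")
 qed
 from this[OF assms, of "[0]"] show False using root_less by (simp add: ok_def Hist_single)
qed

end

section \<open>Counters\<close>

text \<open>Subtracting 1 flips exactly the bits up to the lowest one.\<close>

lemma decrement_bits:
 fixes x :: nat
 assumes "!!p. p < r ==> ~ bit x p" "bit x r"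
 shows "0 < x" "bit (x - 1) p \<longleftrightarrow> (if p <= r then p ~= r else bit x p)"
proof -
 have "0 < x & (bit (x - 1) p \<longleftrightarrow> (if p <= r then p ~= r else bit x p))" using assms
 proof (induction r arbitrary: x p)
  case 0
  then obtain y where x: "x = 2 * y + 1" by (auto simp: bit_0 elim: oddE)
  thus ?case by (cases p) (simp_all add: bit_0 bit_Suc)
 next
  case (Suc r)
  have "even x" using Suc.prems(1)[of 0] by (simp add: bit_0)
  then obtain y where x: "x = 2 * y" by (rule evenE)
  have y: "0 < y & (bit (y - 1) p \<longleftrightarrow> (if p <= r then p ~= r else bit y p))" for p
   by (rule Suc.IH) (use Suc.prems(1)[of "Suc _"] Suc.prems(2) in "auto simp: x bit_Suc")
  then obtain z where z: "y = Suc z" using gr0_implies_Suc by blast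
  have "x - 1 = 2 * z + 1" by (simp add: x z)
  thus ?case using y[of "p - 1"] by (cases p) (auto simp: x z bit_0 bit_Suc)
 qed
 thus "0 < x" "bit (x - 1) p \<longleftrightarrow> (if p <= r then p ~= r else bit x p)" by auto
qed

lemma decrement_ex:
 assumes "0 < x" "x < (2::nat) ^ l"
 obtains r where "r < l" "!!p. p < r ==> ~ bit x p" "bit x r"
proof -
 have "EX r<l. (ALL p<r. ~ bit x p) & bit x r" using assms
 proof (induction l arbitrary: x)
  case (Suc l)
  show ?case
  proof (cases "odd x")
   case False
   hence "0 < x div 2" "x div 2 < 2 ^ l" using Suc.prems by (auto elim: evenE)
   from Suc.IH[OF this] obtain r where "r < l" "ALL p<r. ~ bit (x div 2) p" "bit (x div 2) r" by blast
   thus ?thesis using False by (intro exI[of _ "Suc r"]) (auto simp: bit_Suc bit_0 less_Suc_eq_0_disj)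
  qed (auto simp: bit_0)
 qed simp
 thus ?thesis using that by blast
qed

lemma increment_bits:
 fixes x :: nat
 assumes "!!p. p < r ==> bit x p" "~ bit x r"
 shows "bit (x + 1) p \<longleftrightarrow> (if p <= r then p = r else bit x p)"
 using assms
proof (induction r arbitrary: x p)
 case 0
 then obtain y where x: "x = 2 * y" by (auto simp: bit_0 elim: evenE)
 thus ?case by (cases p) (simp_all add: bit_0 bit_Suc)
next
 case (Suc r)
 have "odd x" using Suc.prems(1)[of 0] by (simp add: bit_0)
 then obtain y where x: "x = 2 * y + 1" by (rule oddE)
 have y: "bit (y + 1) p \<longleftrightarrow> (if p <= r then p = r else bit y p)" for p
  by (rule Suc.IH) (use Suc.prems(1)[of "Suc _"] Suc.prems(2) in "auto simp: x bit_Suc")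
 have "x + 1 = 2 * (y + 1)" by (simp add: x)
 thus ?case using y[of "p - 1"] by (cases p) (auto simp: x bit_0 bit_Suc)
qed

lemma increment_ex:
 assumes "x + 1 < (2::nat) ^ l"
 obtains r where "r < l" "!!p. p < r ==> bit x p" "~ bit x r"
proof -
 have "EX r<l. (ALL p<r. bit x p) & ~ bit x r" using assms
 proof (induction l arbitrary: x)
  case (Suc l)
  show ?case
  proof (cases "even x")
   case False
   hence "x div 2 + 1 < 2 ^ l" using Suc.prems by (auto elim: oddE)
   from Suc.IH[OF this] obtain r where "r < l" "ALL p<r. bit (x div 2) p" "~ bit (x div 2) r" by blast
   thus ?thesis using False by (intro exI[of _ "Suc r"]) (auto simp: bit_Suc bit_0 less_Suc_eq_0_disj)
  qed (auto simp: bit_0)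
 qed simp
 thus ?thesis using that by blast
qed

lemma bit_less: "x < 2 ^ l ==> bit (x :: nat) r ==> r < l"
 by (metis bit_take_bit_iff take_bit_nat_eq_self)

lemma increment_less:
 assumes "x < (2::nat) ^ l" "~ bit x r" "r < l"
 shows "x + 1 < 2 ^ l"
proof -
 have "bit (2 ^ l - 1 :: nat) r" using bit_mask_iff[of l r, where 'a = nat] assms(3) by (simp add: mask_eq_exp_minus_1)
 hence "x ~= 2 ^ l - 1" using assms(2) by blast
 with assms(1) show ?thesis by linarith
qed

lemma bits_eqI: "x < (2::nat) ^ l ==> y < 2 ^ l ==> (!!p. p < l ==> bit x p = bit y p) ==> x = y"
 by (rule bit_eqI) (metis bit_less)

section \<open>Numbers stored bitwise in components\<close>

definition ops_on :: "nat list => (nat => nat) => (nat => bool) => ops" where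
 "ops_on ps e n = map (%p. (p, e p, n p)) ps"

definition num :: "bool => nat" where "num b = (if b then 1 else 0)"

lemma num_simps [simp]: "num b < 2" "num b ~= 2" "num b <= 2" "num b ~= 3" "num b = num c \<longleftrightarrow> b = c"
 by (simp_all add: num_def)

lemma op_step_on:
 assumes "distinct ps"
 shows "op_step (ops_on ps e n) c b =
  (if c : set ps then if b < 2 & e c : {2, b} then num (n c) else 2 else b)"
proof -
 have step: "op_step (ops_on (p # ps) e n) c b =
   op_step (ops_on ps e n) c (if p = c then if b < 2 & e c : {2, b} then num (n c) else 2 else b)" for p ps b
  by (auto simp: op_step_def ops_on_def num_def)
 have none: "op_step (ops_on ps e n) c b = b" if "c \<notin> set ps" for ps b
  using that by (induction ps) (simp_all add: step, simp add: op_step_def ops_on_def)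
 show ?thesis using assms
 proof (induction ps arbitrary: b)
  case Nil
  show ?case by (simp add: none)
 next
  case (Cons p ps)
  thus ?case by (cases "p = c") (simp_all add: step none)
 qed
qed

lemma op_step_append: "op_step (xs @ ys) c b = op_step ys c (op_step xs c b)"
 by (simp add: op_step_def)

lemma op_step_broken: "op_step ops c 2 = 2"
 unfolding op_step_def by (induction ops) auto

definition exec :: "ops => (nat => nat) => nat => nat" where
 "exec ops C = (%c. op_step ops c (C c))"

lemma exec_append: "exec (xs @ ys) C = exec ys (exec xs C)"
 by (simp add: exec_def op_step_append)

definition represents :: "nat => (nat => nat) => (nat => bool) => bool" where
 "represents K C \<beta> \<longleftrightarrow> (ALL c<K. C c = num (\<beta> c))"

definition broken :: "nat => (nat => nat) => bool" where
 "broken K C \<longleftrightarrow> (EX c<K. C c = 2)"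

lemma step_all_exec: "represents K C \<beta> ==> 1 < fst v ==> c < K ==> step_all K v C c = exec (fst (snd (snd v))) C c"
 by (auto simp: step_all_def letter_def represents_def exec_def num_def)

lemma step_all_represents:
 assumes "represents K C \<beta>" "1 < fst v"
 shows "represents K (step_all K v C) \<gamma> \<longleftrightarrow> represents K (exec (fst (snd (snd v))) C) \<gamma>"
  "broken K (step_all K v C) \<longleftrightarrow> broken K (exec (fst (snd (snd v))) C)"
 using step_all_exec[OF assms] by (auto simp: represents_def broken_def)

lemma broken_exec: "broken K C ==> broken K (exec ops C)"
 by (auto simp: broken_def exec_def op_step_broken)

lemma exec_onD:
 assumes "represents K C \<beta>" "distinct ps" "!!p. p : set ps ==> p < K" "~ broken K (exec (ops_on ps e n) C)" "p : set ps"
 shows "e p : {2, num (\<beta> p)}"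
proof (rule ccontr)
 assume "e p \<notin> {2, num (\<beta> p)}"
 hence "exec (ops_on ps e n) C p = 2" using assms by (auto simp: represents_def exec_def op_step_on)
 thus False using assms(3-5) by (auto simp: broken_def)
qed

lemma exec_onI:
 assumes "represents K C \<beta>" "distinct ps" "!!p. p : set ps ==> p < K" "!!p. p : set ps ==> e p : {2, num (\<beta> p)}"
  and "!!c. c < K ==> \<gamma> c \<longleftrightarrow> (if c : set ps then n c else \<beta> c)"
 shows "represents K (exec (ops_on ps e n) C) \<gamma>"
 using assms by (simp add: represents_def exec_def op_step_on)

text \<open>The components hold the time \<open>t\<close> in "N" bits and the number \<open>J\<close> in the bits above.\<close>

definition counters :: "nat => nat => nat => nat => bool" where
 "counters N t J = (%c. if c < N then bit t c else bit J (c - N))"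

text \<open>Eve names the position \<open>r\<close> of the lowest one. The operations test this and
  flip the bits up to \<open>r\<close>, so naming a wrong position breaks a component. For
  \<open>increment\<close> it is the lowest zero.\<close>

definition decrement :: "nat => nat => ops" where
 "decrement lo r = ops_on [lo..<Suc (lo + r)] (%p. num (p = lo + r)) (%p. p ~= lo + r)"

definition increment :: "nat => nat => ops" where
 "increment lo r = ops_on [lo..<Suc (lo + r)] (%p. num (p ~= lo + r)) (%p. p = lo + r)"

definition expect :: "nat => nat => (nat => bool) => ops" where
 "expect lo l b = ops_on [lo..<lo + l] (%p. num (b (p - lo))) (%p. b (p - lo))"

definition assign :: "nat => nat => (nat => bool) => ops" where
 "assign lo l b = ops_on [lo..<lo + l] (%p. 2) (%p. b (p - lo))"

text \<open>The number 0 has no lowest one, so at time 0 every choice of \<open>r\<close> breaks a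
  component. Eve cannot go back beyond the start of the run.\<close>

lemma exec_decrement_time:
 assumes C: "represents (N + B) C (counters N t J)"
 shows "0 < t ==> t < 2 ^ N ==> EX r<N. represents (N + B) (exec (decrement 0 r) C) (counters N (t - 1) J)"
  and "r < N ==> ~ broken (N + B) (exec (decrement 0 r) C) ==>
   0 < t & represents (N + B) (exec (decrement 0 r) C) (counters N (t - 1) J)"
proof -
 have main: "0 < t & represents (N + B) (exec (decrement 0 r) C) (counters N (t - 1) J)"
  if r: "r < N" "!!p. p <= r ==> bit t p \<longleftrightarrow> p = r" for r
  unfolding decrement_def
 proof (intro conjI exec_onI[OF C])
  show "0 < t" using decrement_bits(1)[of r t] r(2) by simp
  show "counters N (t - 1) J c \<longleftrightarrow> (if c : set [0..<Suc (0 + r)] then c ~= 0 + r else counters N t J c)" for c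
   using decrement_bits(2)[of r t c] r by (auto simp: counters_def less_Suc_eq_le)
 qed (use r in "auto simp: counters_def")
 show "EX r<N. represents (N + B) (exec (decrement 0 r) C) (counters N (t - 1) J)" if "0 < t" "t < 2 ^ N"
  using decrement_ex[OF that] main by (metis le_neq_implies_less)
 show "0 < t & represents (N + B) (exec (decrement 0 r) C) (counters N (t - 1) J)"
  if "r < N" "~ broken (N + B) (exec (decrement 0 r) C)"
 proof (rule main[OF that(1)])
  fix p assume "p <= r"
  have "q < N + B" if "q : set [0..<Suc (0 + r)]" for q using that \<open>r < N\<close> by auto
  from exec_onD[OF C distinct_upt this that(2)[unfolded decrement_def], of p] \<open>p <= r\<close> that(1)
  show "bit t p \<longleftrightarrow> p = r" by (auto simp: counters_def le_less)
 qed
qed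

lemma exec_decrement_offset:
 assumes C: "represents (N + B) C (counters N t J)" and J: "J < 2 ^ B"
 shows "0 < J ==> EX r<B. represents (N + B) (exec (decrement N r) C) (counters N t (J - 1))"
  and "r < B ==> ~ broken (N + B) (exec (decrement N r) C) ==>
   0 < J & represents (N + B) (exec (decrement N r) C) (counters N t (J - 1))"
proof -
 have main: "0 < J & represents (N + B) (exec (decrement N r) C) (counters N t (J - 1))"
  if r: "r < B" "!!p. p <= r ==> bit J p \<longleftrightarrow> p = r" for r
  unfolding decrement_def
 proof (intro conjI exec_onI[OF C])
  show "0 < J" using decrement_bits(1)[of r J] r(2) by simp
  show "counters N t (J - 1) c \<longleftrightarrow> (if c : set [N..<Suc (N + r)] then c ~= N + r else counters N t J c)" for c
   using decrement_bits(2)[of r J "c - N"] r by (auto simp: counters_def less_Suc_eq_le)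
 qed (use r in "auto simp: counters_def")
 show "EX r<B. represents (N + B) (exec (decrement N r) C) (counters N t (J - 1))" if "0 < J"
  using decrement_ex[OF that J] main by (metis le_neq_implies_less)
 show "0 < J & represents (N + B) (exec (decrement N r) C) (counters N t (J - 1))"
  if "r < B" "~ broken (N + B) (exec (decrement N r) C)"
 proof (rule main[OF that(1)])
  fix p assume "p <= r"
  have "q < N + B" if "q : set [N..<Suc (N + r)]" for q using that \<open>r < B\<close> by auto
  from exec_onD[OF C distinct_upt this that(2)[unfolded decrement_def], of "N + p"] \<open>p <= r\<close> that(1)
  show "bit J p \<longleftrightarrow> p = r" by (auto simp: counters_def le_less)
 qed
qed

lemma exec_increment_offset:
 assumes C: "represents (N + B) C (counters N t J)" and J: "J < 2 ^ B"
 shows "J + 1 < 2 ^ B ==> EX r<B. represents (N + B) (exec (increment N r) C) (counters N t (J + 1))"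
  and "r < B ==> ~ broken (N + B) (exec (increment N r) C) ==>
   J + 1 < 2 ^ B & represents (N + B) (exec (increment N r) C) (counters N t (J + 1))"
proof -
 have main: "J + 1 < 2 ^ B & represents (N + B) (exec (increment N r) C) (counters N t (J + 1))"
  if r: "r < B" "!!p. p <= r ==> bit J p \<longleftrightarrow> p ~= r" for r
  unfolding increment_def
 proof (intro conjI exec_onI[OF C])
  show "J + 1 < 2 ^ B" using increment_less[OF J, of r] r by simp
  show "counters N t (J + 1) c \<longleftrightarrow> (if c : set [N..<Suc (N + r)] then c = N + r else counters N t J c)" for c
   using increment_bits[of r J "c - N"] r by (auto simp: counters_def less_Suc_eq_le)
 qed (use r in "auto simp: counters_def")
 show "EX r<B. represents (N + B) (exec (increment N r) C) (counters N t (J + 1))" if "J + 1 < 2 ^ B"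
  using increment_ex[OF that] main by (metis le_neq_implies_less)
 show "J + 1 < 2 ^ B & represents (N + B) (exec (increment N r) C) (counters N t (J + 1))"
  if "r < B" "~ broken (N + B) (exec (increment N r) C)"
 proof (rule main[OF that(1)])
  fix p assume "p <= r"
  have "q < N + B" if "q : set [N..<Suc (N + r)]" for q using that \<open>r < B\<close> by auto
  from exec_onD[OF C distinct_upt this that(2)[unfolded increment_def], of "N + p"] \<open>p <= r\<close> that(1)
  show "bit J p \<longleftrightarrow> p ~= r" by (auto simp: counters_def)
 qed
qed

lemma exec_expect:
 assumes C: "represents K C \<beta>" and l: "lo + l <= K"
 shows "(!!p. p < l ==> \<beta> (lo + p) = b p) ==> represents K (exec (expect lo l b) C) \<beta>"
  and "~ broken K (exec (expect lo l b) C) ==> (ALL p<l. \<beta> (lo + p) = b p) & represents K (exec (expect lo l b) C) \<beta>"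
proof -
 have main: "represents K (exec (expect lo l b) C) \<beta>" if "!!p. p < l ==> \<beta> (lo + p) = b p"
 proof -
  have "\<beta> p = b (p - lo)" if "lo <= p" "p < lo + l" for p
   using \<open>!!p. p < l ==> \<beta> (lo + p) = b p\<close>[of "p - lo"] that by simp
  thus ?thesis unfolding expect_def using l by (intro exec_onI[OF C]) auto
 qed
 thus "(!!p. p < l ==> \<beta> (lo + p) = b p) ==> represents K (exec (expect lo l b) C) \<beta>" .
 assume nb: "~ broken K (exec (expect lo l b) C)"
 have "\<beta> (lo + p) = b p" if "p < l" for p
  using exec_onD[OF C _ _ nb[unfolded expect_def], of "lo + p"] that l by auto
 with main show "(ALL p<l. \<beta> (lo + p) = b p) & represents K (exec (expect lo l b) C) \<beta>" by blast
qed

lemma exec_assign: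
 assumes C: "represents K C \<beta>" and l: "lo + l <= K"
  and "!!c. c < K ==> \<gamma> c \<longleftrightarrow> (if lo <= c & c < lo + l then b (c - lo) else \<beta> c)"
 shows "represents K (exec (assign lo l b) C) \<gamma>"
 unfolding assign_def using assms by (intro exec_onI[OF C]) auto

section \<open>Guessing a machine run backwards\<close>

text \<open>A halted machine idles. So the result can be inspected at one fixed time
  \<open>2 ^ N - 1\<close>, however early the machine halts.\<close>

definition full_delta :: "tm => nat => nat list => nat \<times> (nat \<times> tm_move) list" where
 "full_delta M q s = (if tm_states M <= q then (q, map (%a. (a, Stay)) s) else tm_delta M q s)"

definition move_code :: "tm_move => nat" where
 "move_code m = (case m of Stay => 0 | Move_Right => 1 | Move_Left => 2)"

definition shift :: "nat => int" where
 "shift d = (if d = 1 then 1 else if d = 2 then - 1 else 0)"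

text \<open>Only this finite table of the machine enters the reduction. As the machine is fixed, the
  table is a constant, and feasibility asks nothing of \<open>tm_delta\<close>.\<close>

definition transitions :: "tm => (nat \<times> nat list \<times> nat \<times> (nat \<times> nat) list) list" where
 "transitions M = concat (map (%q. map (%s. (q, s, fst (full_delta M q s),
    map (%a. (fst a, move_code (snd a))) (snd (full_delta M q s))))
   (List.n_lists (tm_tapes M) [0..<tm_syms M])) [0..<Suc (tm_states M)])"

text \<open>The number \<open>J\<close> represents the offset \<open>J - 2 ^ (N + 2)\<close> from the head.\<close>

definition near :: "nat => nat => ops" where
 "near N v = expect N (N + 3) (%p. p = N + 2 | nthd False (binary v) p)"

text \<open>That two numbers differ is witnessed by one bit. The number of offset 0 is
  \<open>2 ^ (N + 2)\<close>, whose only one is bit \<open>N + 2\<close>.\<close>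

definition far :: "nat => nat => ops" where
 "far N r = expect (N + r) 1 (%_. r ~= N + 2)"

text \<open>Going back in time, the offset of a fixed cell from the head grows by the shift of the
  head: \<open>pos (Suc t) i + j\<close> equals \<open>pos t i + (j + shift d)\<close>. So a move to
  the right is undone by an increment.\<close>

definition moves :: "nat => nat => ops list" where
 "moves N d = (if d = 1 then map (increment N) [0..<N + 3] else if d = 2 then map (decrement N) [0..<N + 3] else [[]])"

lemma bit_binary: "nthd False (binary v) p = bit v p"
proof (induction v arbitrary: p rule: less_induct)
 case (less v)
 show ?case
 proof (cases "v = 0")
  case False
  have "nthd False (b # bs) p = (case p of 0 => b | Suc p' => nthd False bs p')" for b bs
   by (simp add: nthd_def split: nat.split)
  thus ?thesis using less[of "v div 2"] False
   by (simp add: binary.simps[of v] bit_0 bit_Suc split: nat.split)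
 qed (simp add: binary.simps nthd_def)
qed

lemma bit_add_power: "v < 2 ^ m ==> bit (v + 2 ^ m :: nat) p \<longleftrightarrow> p = m | bit v p"
proof -
 assume v: "v < 2 ^ m"
 hence "~ bit v m" using bit_less[OF v, of m] by blast
 hence "set_bit m v = v + 2 ^ m" by (simp add: set_bit_eq)
 thus ?thesis using bit_set_bit_iff[of m v p] by auto
qed

lemma bit_power: "bit (2 ^ m :: nat) p \<longleftrightarrow> p = m"
 using bit_add_power[of 0 m p] by simp

lemma exec_near:
 assumes C: "represents (N + (N + 3)) C (counters N t J)" and J: "J < 2 ^ (N + 3)" and v: "v < 2 ^ (N + 2)"
 shows "J = v + 2 ^ (N + 2) ==> represents (N + (N + 3)) (exec (near N v) C) (counters N t J)"
  and "~ broken (N + (N + 3)) (exec (near N v) C) ==>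
   J = v + 2 ^ (N + 2) & represents (N + (N + 3)) (exec (near N v) C) (counters N t J)"
proof -
 have l: "N + (N + 3) <= N + (N + 3)" by simp
 note e = exec_expect[OF C l, of "%p. p = N + 2 | nthd False (binary v) p", folded near_def]
 have b: "counters N t J (N + p) = bit J p" for p by (simp add: counters_def)
 show "represents (N + (N + 3)) (exec (near N v) C) (counters N t J)" if "J = v + 2 ^ (N + 2)"
  by (rule e(1), unfold b) (simp only: that bit_add_power[OF v] bit_binary)
 assume nb: "~ broken (N + (N + 3)) (exec (near N v) C)"
 have "J = v + 2 ^ (N + 2)"
 proof (rule bits_eqI[OF J])
  show "v + 2 ^ (N + 2) < 2 ^ (N + 3)" using v by (simp add: power_add)
  show "bit J p = bit (v + 2 ^ (N + 2)) p" if "p < N + 3" for p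
   using e(2)[OF nb] that unfolding b bit_binary bit_add_power[OF v] by blast
 qed
 thus "J = v + 2 ^ (N + 2) & represents (N + (N + 3)) (exec (near N v) C) (counters N t J)" using e(2)[OF nb] by blast
qed

lemma exec_far:
 assumes C: "represents (N + (N + 3)) C (counters N t J)" and r: "r < N + 3"
 shows "bit J r ~= (r = N + 2) ==> represents (N + (N + 3)) (exec (far N r) C) (counters N t J)"
  and "~ broken (N + (N + 3)) (exec (far N r) C) ==>
   bit J r ~= (r = N + 2) & represents (N + (N + 3)) (exec (far N r) C) (counters N t J)"
proof -
 have l: "N + r + 1 <= N + (N + 3)" using r by simp
 note e = exec_expect[OF C l, of "%_. r ~= N + 2", folded far_def]
 have b: "counters N t J (N + r + 0) = bit J r" by (simp add: counters_def)
 show "represents (N + (N + 3)) (exec (far N r) C) (counters N t J)" if "bit J r ~= (r = N + 2)"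
  using that by (intro e(1)) (auto simp: counters_def)
 assume "~ broken (N + (N + 3)) (exec (far N r) C)"
 from e(2)[OF this] b show "bit J r ~= (r = N + 2) & represents (N + (N + 3)) (exec (far N r) C) (counters N t J)" by auto
qed

lemma far_ex:
 assumes "J < (2::nat) ^ (N + 3)" "J ~= 2 ^ (N + 2)"
 shows "EX r<N + 3. bit J r ~= (r = N + 2)"
proof (rule ccontr)
 assume "~ (EX r<N + 3. bit J r ~= (r = N + 2))"
 hence "bit J r = bit (2 ^ (N + 2) :: nat) r" if "r < N + 3" for r using that bit_power[of "N + 2" r] by blast
 hence "J = 2 ^ (N + 2)" by (intro bits_eqI[OF assms(1)]) (simp_all add: power_add)
 with assms(2) show False ..
qed

text \<open>A witness that the offset lies outside of \<open>{0..<n}\<close> is a bit of value at least \<open>n\<close>.\<close>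

lemma far_beyond:
 assumes J: "J < 2 ^ (N + 3)" and r: "bit J r ~= (r = N + 2)" "n <= 2 ^ r" and j: "int J = j + 2 ^ (N + 2)"
 shows "j < 0 | int n <= j"
proof (rule ccontr)
 assume "~ (j < 0 | int n <= j)"
 then obtain v where v: "j = int v" "v < n" using nonneg_int_cases[of j] by auto
 hence Jv: "J = v + 2 ^ (N + 2)" using j by (subst of_nat_eq_iff[where 'a = int, symmetric]) simp
 hence v2: "v < 2 ^ (N + 2)" using J by (simp add: power_add)
 have "v < 2 ^ r" using v r by simp
 hence "~ bit v r" using bit_less by blast
 thus False using r(1) bit_add_power[OF v2, of r] bit_less[OF v2, of r] Jv by auto
qed

text \<open>The leading bit of a number of at least \<open>2 * n + 1\<close> has value more than
  half of that number, hence at least \<open>n\<close>. A negative offset shows in bit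
  \<open>N + 2\<close>. For this reason the offsets up to \<open>2 * n\<close> have to be treated
  individually.\<close>

lemma far_beyond_ex:
 assumes J: "J < 2 ^ (N + 3)" and j: "int J = j + 2 ^ (N + 2)" "j < 0 | 2 * int n + 1 <= j" and n: "n <= 2 ^ (N + 2)"
 obtains r where "r < N + 3" "bit J r ~= (r = N + 2)" "n <= 2 ^ r"
proof (cases "j < 0")
 case True
 hence "int J < 2 ^ (N + 2)" using j by simp
 hence "J < 2 ^ (N + 2)" by (subst of_nat_less_iff[where 'a = int, symmetric]) simp
 hence "~ bit J (N + 2)" using bit_less by blast
 thus ?thesis using that[of "N + 2"] n by simp
next
 case False
 then obtain v where v: "j = int v" using nonneg_int_cases[of j] by auto
 hence Jv: "J = v + 2 ^ (N + 2)" using j by (subst of_nat_eq_iff[where 'a = int, symmetric]) simp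
 hence v2: "v < 2 ^ (N + 2)" using J by (simp add: power_add)
 have nv: "2 * n + 1 <= v" using j(2) v by linarith
 then obtain r where r: "2 ^ r <= v" "v < 2 ^ (r + 1)" using ex_power_ivl1[of 2 v] by auto
 have "v div 2 ^ r = 1" using r by (intro div_nat_eqI) auto
 hence "bit v r" by (simp add: bit_iff_odd)
 hence "bit J r" "r < N + 2" using bit_add_power[OF v2] bit_less[OF v2] Jv by auto
 moreover have "n <= 2 ^ r" using nv r(2) by simp
 ultimately show ?thesis using that[of r] by simp
qed

lemma exec_moves:
 assumes C: "represents (N + B) C (counters N t J)" and J: "J < 2 ^ B" and B: "B = N + 3"
 shows "0 < J ==> J + 1 < 2 ^ B ==> EX mv:set (moves N d). EX J'<2 ^ B. int J' = int J + shift d &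
   represents (N + B) (exec mv C) (counters N t J')"
  and "mv : set (moves N d) ==> ~ broken (N + B) (exec mv C) ==> EX J'<2 ^ B. int J' = int J + shift d &
   represents (N + B) (exec mv C) (counters N t J')"
proof -
 note dec = exec_decrement_offset[OF C J]
 note inc = exec_increment_offset[OF C J]
 have id: "exec [] C = C" by (simp add: exec_def op_step_def)
 have dJ: "0 < J ==> int (J - 1) = int J - 1 & J - 1 < 2 ^ B" using J by auto
 show "EX mv:set (moves N d). EX J'<2 ^ B. int J' = int J + shift d & represents (N + B) (exec mv C) (counters N t J')"
  if J': "0 < J" "J + 1 < 2 ^ B"
 proof -
  consider "d = 1" | "d = 2" | "d ~= 1" "d ~= 2" by blast
  thus ?thesis
  proof cases
   case 1
   from inc(1)[OF J'(2)] obtain r where r: "r < B" "represents (N + B) (exec (increment N r) C) (counters N t (J + 1))" by blast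
   have "increment N r : set (moves N d)" using r(1) 1 B by (simp add: moves_def)
   thus ?thesis by (rule bexI[rotated]) (rule exI[of _ "J + 1"], use r J' 1 in "simp add: shift_def")
  next
   case 2
   from dec(1)[OF J'(1)] obtain r where r: "r < B" "represents (N + B) (exec (decrement N r) C) (counters N t (J - 1))" by blast
   have "decrement N r : set (moves N d)" using r(1) 2 B by (simp add: moves_def)
   thus ?thesis by (rule bexI[rotated]) (rule exI[of _ "J - 1"], use r dJ J' 2 in "simp add: shift_def")
  next
   case 3
   thus ?thesis using C J by (auto simp: moves_def shift_def id)
  qed
 qed
 show "EX J'<2 ^ B. int J' = int J + shift d & represents (N + B) (exec mv C) (counters N t J')"
  if mv: "mv : set (moves N d)" and nb: "~ broken (N + B) (exec mv C)"
 proof -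
  consider "d = 1" | "d = 2" | "d ~= 1" "d ~= 2" by blast
  thus ?thesis
  proof cases
   case 1
   with mv B obtain r where "r < B" "mv = increment N r" by (auto simp: moves_def)
   with inc(2)[of r] nb 1 show ?thesis by (intro exI[of _ "J + 1"]) (simp add: shift_def)
  next
   case 2
   with mv B obtain r where "r < B" "mv = decrement N r" by (auto simp: moves_def)
   with dec(2)[of r] nb 2 dJ show ?thesis by (intro exI[of _ "J - 1"]) (simp add: shift_def)
  next
   case 3
   thus ?thesis using C J mv by (auto simp: moves_def shift_def id)
  qed
 qed
qed

subsection \<open>Runs of the machine\<close>

locale tm_run =
 fixes M :: tm and x :: "bool list"
 assumes wf: "wf_tm M"
begin

abbreviation "k \<equiv> tm_tapes M"
abbreviation "halt \<equiv> tm_states M"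

definition cfg :: "nat => tm_config" where "cfg t = (tm_step M ^^ t) (tm_init M x)"
definition state :: "nat => nat" where "state t = fst (cfg t)"
definition reads :: "nat => nat list" where "reads t = map tape_read (snd (cfg t))"
definition pos :: "nat => nat => int" where "pos t i = snd (snd (cfg t) ! i)"
definition cell :: "nat => nat => int => nat" where "cell t i j = fst (snd (cfg t) ! i) (pos t i + j)"

lemma delta_ok:
 assumes "q < halt" "length s = k" "set s <= {..<tm_syms M}" "tm_delta M q s = (q', acts)"
 shows "q' <= halt" "length acts = k" "fst ` set acts <= {..<tm_syms M}"
proof -
 have "case tm_delta M q s of (q', acts) => q' <= halt & length acts = k & fst ` set acts <= {..<tm_syms M}"
  using wf[unfolded wf_tm_def, THEN conjunct2, THEN conjunct2, rule_format, OF assms(1) conjI[OF assms(2,3)]] .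
 thus "q' <= halt" "length acts = k" "fst ` set acts <= {..<tm_syms M}" by (simp_all add: assms(4))
qed

lemma cfg_ok: "length (snd (cfg t)) = k & state t <= halt & (ALL i<k. ALL j. fst (snd (cfg t) ! i) j < tm_syms M)"
proof (induction t)
 case 0
 have "1 <= k" "3 <= tm_syms M" using wf by (auto simp: wf_tm_def)
 thus ?case by (auto simp: cfg_def state_def tm_init_def nth_Cons tape_of_def bit_sym_def split: nat.splits)
next
 case (Suc t)
 obtain q ts where c: "cfg t = (q, ts)" by fastforce
 have len: "length ts = k" and q: "q <= halt" and syms: "!!i j. i < k ==> fst (ts ! i) j < tm_syms M"
  using Suc c by (auto simp: state_def)
 have cS: "cfg (Suc t) = tm_step M (q, ts)" using c by (simp add: cfg_def)
 show ?case
 proof (cases "halt <= q")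
  case True
  thus ?thesis using len q syms cS by (simp add: state_def)
 next
  case False
  obtain q' acts where d: "tm_delta M q (map tape_read ts) = (q', acts)" by fastforce
  have "set (map tape_read ts) <= {..<tm_syms M}"
  proof
   fix a assume "a : set (map tape_read ts)"
   then obtain i where "i < k" "a = tape_read (ts ! i)" using len by (auto simp: in_set_conv_nth)
   thus "a : {..<tm_syms M}" using syms[of i] by (cases "ts ! i") auto
  qed
  hence a: "q' <= halt" "length acts = k" "fst ` set acts <= {..<tm_syms M}"
   using delta_ok[OF _ _ _ d] False len by simp_all
  have "fst (tape_act (acts ! i) (ts ! i)) j < tm_syms M" if "i < k" for i j
  proof -
   have "fst (acts ! i) < tm_syms M" using a(2,3) that by (metis (no_types) image_subset_iff lessThan_iff nth_mem)
   thus ?thesis using syms[OF that, of j] by (cases "acts ! i"; cases "ts ! i") auto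
  qed
  thus ?thesis using a len False d cS by (simp add: state_def)
 qed
qed

lemma length_reads: "length (reads t) = k"
 using cfg_ok by (simp add: reads_def)

lemma reads_nth: "i < k ==> reads t ! i = cell t i 0"
 using cfg_ok[of t] by (cases "snd (cfg t) ! i") (simp add: reads_def cell_def pos_def)

lemma reads_in: "reads t : set (List.n_lists k [0..<tm_syms M])"
 using cfg_ok[of t] reads_nth length_reads by (auto simp: set_n_lists in_set_conv_nth cell_def)

lemma transition_run:
 obtains acts where "(state t, reads t, state (Suc t), acts) : set (transitions M)"
  "!!e. e : set (transitions M) ==> fst e = state t ==> fst (snd e) = reads t ==> snd (snd e) = (state (Suc t), acts)"
  "!!i j. i < k ==> cell (Suc t) i j = (if j + shift (snd (acts ! i)) = 0 then fst (acts ! i) else cell t i (j + shift (snd (acts ! i))))"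
  "!!i. i < k ==> pos (Suc t) i = pos t i + shift (snd (acts ! i))" "length acts = k"
proof -
 obtain q ts where c: "cfg t = (q, ts)" by fastforce
 have len: "length ts = k" using cfg_ok[of t] c by simp
 have cS: "cfg (Suc t) = tm_step M (q, ts)" using c by (simp add: cfg_def)
 obtain q' ms where d: "full_delta M q (map tape_read ts) = (q', ms)" by fastforce
 have lms: "length ms = k" and cS': "fst (cfg (Suc t)) = q'"
  and act: "!!i. i < k ==> snd (cfg (Suc t)) ! i = tape_act (ms ! i) (ts ! i)"
 proof -
  have *: "length ms = k & fst (cfg (Suc t)) = q' & (ALL i<k. snd (cfg (Suc t)) ! i = tape_act (ms ! i) (ts ! i))"
  proof (cases "halt <= q")
   case True
   have "tape_act (tape_read T, Stay) T = T" for T by (cases T) simp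
   thus ?thesis using True d len cS by (auto simp: full_delta_def)
  next
   case False
   hence "tm_delta M q (map tape_read ts) = (q', ms)" using d by (simp add: full_delta_def)
   moreover have "set (map tape_read ts) <= {..<tm_syms M}" using reads_in[of t] by (auto simp: reads_def c set_n_lists)
   ultimately have "length ms = k"
    using delta_ok(2)[of q "map tape_read ts" q' ms] False len by simp
   thus ?thesis using False d len cS by (simp add: full_delta_def)
  qed
  thus "length ms = k" "fst (cfg (Suc t)) = q'" "!!i. i < k ==> snd (cfg (Suc t)) ! i = tape_act (ms ! i) (ts ! i)" by auto
 qed
 let ?acts = "map (%a. (fst a, move_code (snd a))) ms"
 have q: "state t = q" and r: "reads t = map tape_read ts" and q': "state (Suc t) = q'" using c cS' by (simp_all add: state_def reads_def)
 have "q < Suc halt" using cfg_ok[of t] q by simp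
 hence "(state t, reads t, state (Suc t), ?acts) : set (transitions M)"
  using reads_in[of t] d unfolding q r q' transitions_def by (auto simp del: upt_Suc intro!: bexI[of _ q] image_eqI[of _ _ "map tape_read ts"])
 moreover have "snd (snd e) = (state (Suc t), ?acts)" if "e : set (transitions M)" "fst e = state t" "fst (snd e) = reads t" for e
  using that d q r q' by (auto simp: transitions_def)
 moreover have step: "pos (Suc t) i = pos t i + shift (snd (?acts ! i)) &
   cell (Suc t) i j = (if j + shift (snd (?acts ! i)) = 0 then fst (?acts ! i) else cell t i (j + shift (snd (?acts ! i))))" if "i < k" for i j
 proof -
  obtain a m where am: "ms ! i = (a, m)" by fastforce
  obtain f h where fh: "ts ! i = (f, h)" by fastforce
  have "(case m of Move_Left => h - 1 | Stay => h | Move_Right => h + 1) = h + shift (move_code m)"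
   by (cases m) (simp_all add: shift_def move_code_def)
  thus ?thesis using act[OF that] that lms am fh by (auto simp: pos_def cell_def c algebra_simps)
 qed
 ultimately show ?thesis using that[of ?acts] lms by auto
qed

lemma pos_bound: "i < k ==> \<bar>pos t i\<bar> <= int t"
proof (induction t)
 case 0
 thus ?case by (auto simp: pos_def cfg_def tm_init_def nth_Cons tape_of_def split: nat.splits)
next
 case (Suc t)
 obtain acts :: "(nat \<times> nat) list" where "pos (Suc t) i = pos t i + shift (snd (acts ! i))" using transition_run[of t] Suc.prems by metis
 thus ?case using Suc by (auto simp: shift_def)
qed

definition input_sym :: "nat => nat => nat" where
 "input_sym i v = (if i = 0 & v < length x then if nthd False x v then 2 else 1 else 0)"

lemma start: "state 0 = 0" "i < k ==> pos 0 i = 0"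
 "i < k ==> cell 0 i j = (if 0 <= j then input_sym i (nat j) else 0)"
 by (auto simp: state_def pos_def cell_def cfg_def tm_init_def nth_Cons tape_of_def input_sym_def bit_sym_def nat_less_iff split: nat.splits)

end

subsection \<open>The game\<close>

type_synonym vertex = "(nat \<times> nat list \<times> nat \<times> nat \<times> bool) vert"

definition plain :: "nat => nat => ops => vertex" where
 "plain tag idx ops = (tag, idx, ops, 0, [], 0, 0, False)"

text \<open>Eve claims that the state is \<open>q\<close> and that tape \<open>i\<close> holds \<open>a\<close> at the current offset; \<open>f\<close> says
 moreover that the latter is cell 0.  A move adds the claim that the symbols \<open>s\<close> are read.\<close>

definition claim :: "ops => nat => nat => nat => bool => vertex" where
 "claim ops q i a f = (2, 0, ops, q, [], i, a, f)"

definition move :: "ops => nat => nat list => nat => nat => bool => vertex" where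
 "move ops q s i a f = (3, 0, ops, q, s, i, a, f)"

definition reset :: "nat => ops" where
 "reset N = assign N (N + 3) (%p. p = N + 2)"

definition challenges :: "nat => vertex list" where
 "challenges N = map (%p. plain 1 p []) [0..<N + (N + 3)]"

text \<open>At time 0 the head is on cell 0, so the offset is the address of the cell. Offsets up to
  twice the input length are named exactly; all others are blank, with a single bit as witness. The
  minimum expresses \<open>length x <= 2 ^ r\<close> by a capped power, since the power itself is
  not feasible.\<close>

definition finals :: "nat => bool list => nat => nat => bool => ops list" where
 "finals N x i a f =
   map (near N) (filter (%v. (f --> v = 0) & a = (if i = 0 & v < length x then if nthd False x v then 2 else 1 else 0))
    [0..<2 * length x + 1]) @
   map (far N) (filter (%r. ~ f & a = 0 & min (length x) (2 ^ r) = length x) [0..<N + 3])"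

text \<open>After the update of the offset Eve says whether the cell was under the head. If it was,
  \<open>a\<close> must be the symbol written and the claim becomes one about the symbol read; if
  not, the symbol is unchanged.\<close>

definition predecessors :: "nat => nat => nat => bool => nat \<times> nat list \<times> nat \<times> (nat \<times> nat) list => vertex list" where
 "predecessors N i a f = (%(q, s, q', acts). concat (map (%r. concat (map (%mv.
   (if a = fst (nthd (0, 0) acts i) then [move (decrement 0 r @ mv @ near N 0) q s i (nthd 0 s i) f] else []) @
   map (%r'. move (decrement 0 r @ mv @ far N r') q s i a f) [0..<N + 3])
   (moves N (snd (nthd (0, 0) acts i))))) [0..<N]))"

text \<open>The first successor expects the impossible value 3 in component 0, hence breaks it. It
  provides a move even to claims that have no other, but a losing one.\<close>

definition claim_succs :: "tm => nat => bool list => nat => nat => nat => bool => vertex list" where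
 "claim_succs M N x q i a f = plain 3 2 [(0, 3, False)] #
   (if q = 0 then map (%ops. plain 3 2 (expect 0 N (%_. False) @ ops)) (finals N x i a f) else []) @
   concat (map (%e. if fst (snd (snd e)) = q then predecessors N i a f e else []) (transitions M))"

definition vertex_succs :: "tm => nat => bool list => vertex => vertex list" where
 "vertex_succs M N x = (%(tag, idx, ops, q, s, i, a, f).
   if tag <= 1 then [plain tag idx []]
   else if tag = 2 then if idx = 0 then claim_succs M N x q i a f
    else if idx <= N + 3 then [plain 2 (Suc idx) [], plain 2 (Suc idx) (assign (N + (idx - 1)) 1 (%_. True))]
    else [claim [] (tm_states M) (tm_tapes M - 1) 2 True]
   else if idx = 1 then [plain 0 0 [], plain 2 1 []]
   else challenges N @ (if idx = 0 then claim [] q i a f #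
    map (%i'. claim (reset N) q i' (nthd 0 s i') False) [0..<tm_tapes M] else []))"

definition claims :: "tm => nat => vertex list" where
 "claims M N = map (%(q, i, a, f, ops). claim ops q i a f) (product_list [0..<Suc (tm_states M)]
   (product_list [0..<tm_tapes M] (product_list [0..<tm_syms M] (product_list [False, True] [[], reset N]))))"

definition vertices :: "tm => nat => bool list => vertex list" where
 "vertices M N x = plain 3 1 [] # plain 0 0 [] # plain 2 1 [] # challenges N @
   concat (map (%p. [plain 2 (Suc (Suc p)) [], plain 2 (Suc (Suc p)) (assign (N + p) 1 (%_. True))]) [0..<N + 3]) @
   claims M N @ concat (map (vertex_succs M N x) (claims M N))"

text \<open>All ones in the time bits: play starts at time \<open>2 ^ N - 1\<close>. The offset bits
  are zero until Eve has set those of cell 0.\<close>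

definition start_bits :: "nat => nat list" where
 "start_bits N = map (%c. if c < N then 1 else 0) [0..<N + (N + 3)]"

lemma vertex_succs_simps:
 "vertex_succs M N x (plain 0 p ops) = [plain 0 p []]" "vertex_succs M N x (plain (Suc 0) p ops) = [plain 1 p []]"
 "vertex_succs M N x (plain 3 (Suc 0) ops) = [plain 0 0 [], plain 2 1 []]" "vertex_succs M N x (plain 3 2 ops) = challenges N"
 "vertex_succs M N x (claim ops q i a f) = claim_succs M N x q i a f"
 "vertex_succs M N x (move ops q s i a f) = challenges N @ claim [] q i a f #
    map (%i'. claim (reset N) q i' (nthd 0 s i') False) [0..<tm_tapes M]"
 "p < N + 3 ==> vertex_succs M N x (plain 2 (Suc p) ops) = [plain 2 (Suc (Suc p)) [], plain 2 (Suc (Suc p)) (assign (N + p) 1 (%_. True))]"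
 "vertex_succs M N x (plain 2 (Suc (N + 3)) ops) = [claim [] (tm_states M) (tm_tapes M - 1) 2 True]"
 by (simp_all add: vertex_succs_def plain_def claim_def move_def)

lemma claim_cases:
 assumes "u : set (claim_succs M N x q i a f)"
 obtains (fail) "u = plain 3 2 [(0, 3, False)]"
 | (final) ops where "u = plain 3 2 (expect 0 N (%_. False) @ ops)" "q = 0" "ops : set (finals N x i a f)"
 | (zero) s q' r mv acts where "(q', s, q, acts) : set (transitions M)" "r < N" "mv : set (moves N (snd (nthd (0, 0) acts i)))"
   "a = fst (nthd (0, 0) acts i)" "u = move (decrement 0 r @ mv @ near N 0) q' s i (nthd 0 s i) f"
 | (nonzero) s q' r mv acts r' where "(q', s, q, acts) : set (transitions M)" "r < N" "mv : set (moves N (snd (nthd (0, 0) acts i)))"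
   "r' < N + 3" "u = move (decrement 0 r @ mv @ far N r') q' s i a f"
 using assms by (auto simp: claim_succs_def predecessors_def split: if_splits)

context tm_run
begin

lemma transitions_ok: "(q', s, q, acts) : set (transitions M) ==> q' <= halt & length s = k & set s <= {..<tm_syms M}"
 by (auto simp: transitions_def set_n_lists simp del: upt_Suc)

lemma claims_iff: "v : set (claims M N) \<longleftrightarrow>
  (EX ops q i a f. v = claim ops q i a f & q <= halt & i < k & a < tm_syms M & ops : {[], reset N})"
proof -
 have "v : set (claims M N) \<longleftrightarrow> v : (%(q, i, a, f, ops). claim ops q i a f) `
   ({..halt} \<times> {..<k} \<times> {..<tm_syms M} \<times> UNIV \<times> {[], reset N})"
  unfolding claims_def set_map set_product_list by (simp add: atLeast0LessThan lessThan_Suc_atMost UNIV_bool del: upt_Suc)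
 thus ?thesis by (simp add: image_iff) blast
qed

lemma claimI: "ops : {[], reset N} ==> q <= halt ==> i < k ==> a < tm_syms M ==> claim ops q i a f : set (claims M N)"
 unfolding claims_iff by blast

lemma move_claims:
 assumes "i < k" "a < tm_syms M" "u : set (claim_succs M N x q i a f)"
 shows "(EX ops. u = plain 3 2 ops) | (EX ops q s a. u = move ops q s i a f & q <= halt & length s = k & set s <= {..<tm_syms M} & a < tm_syms M)"
 using assms(3)
proof (cases rule: claim_cases)
 case (zero s q' r mv acts)
 note t = transitions_ok[OF zero(1)]
 hence "s ! i : set s" using assms(1) by simp
 hence "s ! i : {..<tm_syms M}" using t by blast
 hence "nthd 0 s i < tm_syms M" using t assms(1) by simp
 thus ?thesis using zero t by blast
next
 case (nonzero s q' r mv acts r')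
 thus ?thesis using transitions_ok[OF nonzero(1)] assms(2) by blast
qed blast+

lemma vertex_kinds:
 assumes "v : set (vertices M N x)"
 obtains "v = plain 3 1 []" | "v = plain 0 0 []" | p where "v = plain 1 p []" "p < N + (N + 3)"
 | p ops where "v = plain 2 (Suc p) ops" "p <= N + 3" | ops where "v = plain 3 2 ops"
 | "v : set (claims M N)"
 | ops q s i a f where "v = move ops q s i a f" "q <= halt" "i < k" "length s = k" "set s <= {..<tm_syms M}" "a < tm_syms M"
proof -
 note kinds = that
 have ?thesis if c: "w : set (claims M N)" "v : set (vertex_succs M N x w)" for w
 proof -
  from c(1) obtain ops q i a f where w: "w = claim ops q i a f" "i < k" "a < tm_syms M" by (auto simp: claims_iff)
  have "v : set (claim_succs M N x q i a f)" using c(2) w(1) by (simp add: vertex_succs_simps)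
  from move_claims[OF w(2,3) this] w(2) show ?thesis by (elim disjE exE conjE) (use kinds in blast)+
 qed
 thus ?thesis using assms kinds by (auto simp: vertices_def challenges_def)
qed

lemma succinct: "succinct_game (N + (N + 3)) (start_bits N) (vertices M N x) (vertex_succs M N x)"
proof
 have kS: "1 <= k" "3 <= tm_syms M" using wf by (auto simp: wf_tm_def)
 let ?V = "vertices M N x"
 show "length (start_bits N) = N + (N + 3)" "set (start_bits N) <= {0, 1}" by (auto simp: start_bits_def)
 show "?V ~= []" "fst (?V ! 0) = 3" by (simp_all add: vertices_def plain_def)
 have no_root: "u ~= plain 3 1 [] & u : set ?V" if v: "v : set ?V" and u: "u : set (vertex_succs M N x v)" for u v
 proof -
  have ch: "w : set (challenges N) ==> w ~= plain 3 1 [] & w : set ?V" for w by (auto simp: vertices_def challenges_def plain_def)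
  have cl: "w : set (claims M N) ==> w ~= plain 3 1 [] & w : set ?V" for w by (auto simp: vertices_def claims_iff plain_def claim_def)
  show ?thesis using v
  proof (cases rule: vertex_kinds)
   case 1
   with u have "u : {plain 0 0 [], plain 2 1 []}" by (simp add: vertex_succs_simps)
   thus ?thesis by (auto simp: vertices_def plain_def)
  next
   case 2
   with u have "u = plain 0 0 []" by (simp add: vertex_succs_simps)
   thus ?thesis by (auto simp: vertices_def plain_def)
  next
   case (3 p)
   hence "u : set (challenges N)" using u by (auto simp: vertex_succs_simps challenges_def)
   thus ?thesis by (rule ch)
  next
   case (4 p ops)
   show ?thesis
   proof (cases "p < N + 3")
    case True
    hence "u : {plain 2 (Suc (Suc p)) [], plain 2 (Suc (Suc p)) (assign (N + p) 1 (%_. True))}"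
     using u 4(1) by (simp add: vertex_succs_simps)
    thus ?thesis using True unfolding vertices_def by (auto simp: plain_def)
   next
    case False
    hence "p = N + 3" using 4(2) by simp
    hence "u = claim [] halt (k - 1) 2 True" using u unfolding 4(1) by (simp only: vertex_succs_simps list.set singleton_iff)
    thus ?thesis using kS by (intro cl) (simp add: claims_iff, auto simp: claim_def)
   qed
  next
   case (5 ops)
   thus ?thesis using u ch by (simp add: vertex_succs_simps)
  next
   case 6
   then obtain ops q i a f where w: "v = claim ops q i a f" "i < k" "a < tm_syms M" by (auto simp: claims_iff)
   have "u ~= plain 3 1 []" using move_claims[OF w(2,3), of u N q f] u w(1) by (auto simp: vertex_succs_simps plain_def move_def)
   thus ?thesis using u 6 by (auto simp: vertices_def)
  next
   case (7 ops q s i a f)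
   have "nthd 0 s i' < tm_syms M" if "i' < k" for i'
   proof -
    have "s ! i' : set s" using that 7 by simp
    hence "s ! i' : {..<tm_syms M}" using 7(5) by blast
    thus ?thesis using 7(4) that by simp
   qed
   hence "u : set (challenges N) | u : set (claims M N)"
    using u 7(2-6) claimI unfolding 7(1) vertex_succs_simps by (auto simp del: nthd_eq_nth)
   thus ?thesis using ch cl by blast
  qed
 qed
 have root: "?V ! 0 = plain 3 1 []" by (simp add: vertices_def)
 show "j = 0" if "j < length ?V" "?V ! j = ?V ! 0" for j
 proof (rule ccontr)
  assume "j ~= 0"
  then obtain n where j: "j = Suc n" by (cases j) auto
  hence "tl ?V ! n = plain 3 1 []" "n < length (tl ?V)" using that root by (simp_all add: nth_tl)
  hence "plain 3 1 [] : set (tl ?V)" by (metis nth_mem)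
  moreover have "plain 3 1 [] \<notin> set (vertex_succs M N x w)" if "w : set (claims M N)" for w
   using no_root[of w "plain 3 1 []"] that by (auto simp: vertices_def)
  ultimately show False by (auto simp: vertices_def challenges_def plain_def claims_iff claim_def)
 qed
 show "set (vertex_succs M N x v) <= set ?V - {?V ! 0}" if "v : set ?V" for v
  unfolding root using no_root[OF that] by blast
 show "vertex_succs M N x v ~= []" if "v : set ?V" for v
  by (auto simp: vertex_succs_def claim_succs_def challenges_def split: prod.splits)
 show "fst (snd v) < N + (N + 3)" if "v : set ?V" "fst v = 1" for v
  using that(1) by (cases rule: vertex_kinds) (use that(2) in "auto simp: plain_def claims_iff claim_def move_def")
 show "EX v:set (vertex_succs M N x (?V ! 0)). fst v = 0"
  unfolding root by (simp add: vertex_succs_simps) (simp add: plain_def)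
 show "v = ?V ! 0 | fst v = 0" if v: "v : set ?V" and u: "u : set (vertex_succs M N x v)" "fst u = 0" for u v
  using v
 proof (cases rule: vertex_kinds)
  case 6
  then obtain ops q i a f where w: "v = claim ops q i a f" "i < k" "a < tm_syms M" by (auto simp: claims_iff)
  show ?thesis using move_claims[OF w(2,3), of u N q f] u w(1) by (auto simp: vertex_succs_simps plain_def move_def)
 next
  case (4 p ops)
  show ?thesis
  proof (cases "p < N + 3")
   case True
   with u(1) 4(1) have "u : {plain 2 (Suc (Suc p)) [], plain 2 (Suc (Suc p)) (assign (N + p) 1 (%_. True))}"
    by (simp add: vertex_succs_simps)
   thus ?thesis using u(2) by (auto simp: plain_def)
  next
   case False
   hence p: "p = N + 3" using 4(2) by simp
   have "u = claim [] halt (k - 1) 2 True" using u(1) unfolding 4(1) p by (simp only: vertex_succs_simps list.set singleton_iff)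
   thus ?thesis using u(2) by (simp add: claim_def)
  qed
 next
  case (3 p)
  hence "u = plain 1 p []" using u(1) by (simp add: vertex_succs_simps)
  thus ?thesis using u(2) by (simp add: plain_def)
 next
  case (5 ops)
  hence "u : set (challenges N)" using u(1) by (simp add: vertex_succs_simps)
  thus ?thesis using u(2) by (auto simp: plain_def challenges_def)
 next
  case (7 ops q s i a f)
  thus ?thesis using u by (auto simp: vertex_succs_simps) (auto simp: plain_def claim_def challenges_def)
 qed (simp_all add: root, simp add: plain_def)
qed

end

locale tm_game = tm_run +
 fixes N :: nat
 assumes N: "2 * length x + 1 <= 2 ^ N" and halts: "state (2 ^ N - 1) = halt"
begin

sublocale game: succinct_game "N + (N + 3)" "start_bits N" "vertices M N x" "vertex_succs M N x" "plain 0 0 []"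
 by (rule succinct)

abbreviation rep where "rep \<equiv> represents (N + (N + 3))"
abbreviation brk where "brk \<equiv> broken (N + (N + 3))"
abbreviation adv :: "vertex => _" where "adv v C \<equiv> step_all (N + (N + 3)) v C"

text \<open>The output stands at an absolute address, whereas offsets are relative to the head. The
  flag \<open>f\<close> bridges this: it follows cell 0 back to time 0, where its offset has to be
  0.\<close>

definition truth :: "nat => nat => nat => nat => nat => bool => bool" where
 "truth t J q i a f \<longleftrightarrow> state t = q & cell t i (int J - 2 ^ (N + 2)) = a & (f --> int J - 2 ^ (N + 2) = - pos t i)"

lemma vertex_ops [simp]: "fst (plain tag idx ops) = tag" "fst (snd (snd (plain tag idx ops))) = ops"
 "fst (claim ops q i a f) = 2" "fst (snd (snd (claim ops q i a f))) = ops"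
 "fst (move ops q s i a f) = 3" "fst (snd (snd (move ops q s i a f))) = ops"
 by (simp_all add: plain_def claim_def move_def)

lemma exec_Nil [simp]: "exec [] C = C"
 by (simp add: exec_def op_step_def)

lemma plain_brk: "rep C \<beta> ==> 1 < tag ==> brk (exec ops C) ==> brk (adv (plain tag p ops) C)"
 by (subst step_all_represents(2)) simp_all

lemma claim_rep:
 assumes "rep C \<beta>" "rep (exec ops C) \<gamma>"
 shows "rep (adv (claim ops q i a f) C) \<gamma>"
 using assms(2) by (subst step_all_represents(1)[OF assms(1)]) simp_all

lemma exec_reset: "rep C (counters N t J) ==> rep (exec (reset N) C) (counters N t (2 ^ (N + 2)))"
 unfolding reset_def by (erule exec_assign[OF _ order_refl]) (unfold counters_def bit_power, auto)

lemma input: "n < 2 * length x + 1 ==> n < 2 ^ (N + 2)" "length x <= 2 ^ (N + 2)"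
 using N by (simp_all add: power_add)

section \<open>Adam refutes false claims\<close>

lemma broken_wins:
 assumes "brk C" "set (challenges N) <= set (vertex_succs M N x v)" "fst v = 3"
 shows "game.adam_wins v C"
proof -
 obtain p where p: "p < N + (N + 3)" "C p = 2" using assms(1) by (auto simp: broken_def)
 show ?thesis
 proof (rule game.adam_move)
  show "plain 1 p [] : set (vertex_succs M N x v)" using assms(2) p(1) by (auto simp: challenges_def)
  show "game.adam_wins (plain 1 p []) (adv (plain 1 p []) C)"
   by (rule game.challenged[OF p(1)]) (simp add: step_all_def letter_def plain_def p(2))
 qed (use assms(3) in simp)
qed

text \<open>Determinism in the form needed for going back: the true state and the symbols truly read
  select one transition, and a cell then holds what was written there or what it held
  before.\<close>

lemma truth_step:
 assumes e: "(q', reads t, q, acts) : set (transitions M)" "state t = q'" and i: "i < k"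
  and J': "int J' = int J + shift (snd (nthd (0, 0) acts i))"
 shows "J' = 2 ^ (N + 2) ==> a = fst (nthd (0, 0) acts i) ==> truth t J' q' i b f ==> truth (Suc t) J q i a f"
  and "J' ~= 2 ^ (N + 2) ==> truth t J' q' i a f \<longleftrightarrow> truth (Suc t) J q i a f"
  and "J' = 2 ^ (N + 2) ==> truth (Suc t) J q i a f ==> a = fst (nthd (0, 0) acts i) & truth t J' q' i (reads t ! i) f"
proof -
 obtain acts' where a: "!!e. e : set (transitions M) ==> fst e = state t ==> fst (snd e) = reads t ==> snd (snd e) = (state (Suc t), acts')"
  "!!i j. i < k ==> cell (Suc t) i j = (if j + shift (snd (acts' ! i)) = 0 then fst (acts' ! i) else cell t i (j + shift (snd (acts' ! i))))"
  "!!i. i < k ==> pos (Suc t) i = pos t i + shift (snd (acts' ! i))" "length acts' = k"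
  using transition_run by metis
 from a(1)[OF e(1)] e(2) have q: "q = state (Suc t)" "acts = acts'" by simp_all
 have d: "nthd (0, 0) acts i = acts' ! i" using a(4) i q by simp
 let ?j = "int J - 2 ^ (N + 2)"
 have j': "?j + shift (snd (acts' ! i)) = int J' - 2 ^ (N + 2)" using J' d by simp
 have z: "int J' - 2 ^ (N + 2) = 0 \<longleftrightarrow> J' = 2 ^ (N + 2)" by (subst of_nat_eq_iff[where 'a = int, symmetric]) auto
 have c: "cell (Suc t) i ?j = (if J' = 2 ^ (N + 2) then fst (acts' ! i) else cell t i (int J' - 2 ^ (N + 2)))"
  unfolding a(2)[OF i] j' z ..
 have p: "?j = - pos (Suc t) i \<longleftrightarrow> int J' - 2 ^ (N + 2) = - pos t i" using j' a(3)[OF i] by linarith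
 show "truth (Suc t) J q i a f" if "J' = 2 ^ (N + 2)" "a = fst (nthd (0, 0) acts i)" "truth t J' q' i b f"
  using that(3) unfolding truth_def c p that(1,2) d q(1) by simp
 show "truth t J' q' i a f \<longleftrightarrow> truth (Suc t) J q i a f" if "J' ~= 2 ^ (N + 2)"
  unfolding truth_def c p using that q e(2) by simp
 show "a = fst (nthd (0, 0) acts i) & truth t J' q' i (reads t ! i) f" if "J' = 2 ^ (N + 2)" "truth (Suc t) J q i a f"
  using that(2) z that(1) e(2) reads_nth[OF i, of t] unfolding truth_def c p d by simp
qed

text \<open>By induction on the time. If an operation was false, a component is broken and Adam
  challenges it. Otherwise the move cannot be true in all respects, as the claim would then be true
  by \<open>truth_step\<close>; Adam pursues the claim about the preceding state and cell if it is
  false, and else a symbol falsely said to be read. At time 0 only final moves leave the components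
  intact, and these are tested against the input.\<close>

lemma false_claim_loses:
 assumes "t < 2 ^ N" "J < 2 ^ (N + 3)" "rep C (counters N t J)" "i < k" "~ truth t J q i a f"
 shows "game.adam_wins (claim ops q i a f) C"
 using assms
proof (induction t arbitrary: J C i q a f ops rule: less_induct)
 case (less t)
 note C = less.prems(3) and J = less.prems(2) and i = less.prems(4)
 have move_wins: "game.adam_wins (move ops q' s i a' f) D"
  if D: "rep D (counters N (t - 1) J')" "J' < 2 ^ (N + 3)" "0 < t" "length s = k"
   and wrong: "~ (state (t - 1) = q' & s = reads (t - 1) & truth (t - 1) J' q' i a' f)" for D J' q' s a' ops
 proof -
  have l: "t - 1 < t" "t - 1 < 2 ^ N" using D(3) less.prems(1) by auto
  show ?thesis
 proof (cases "truth (t - 1) J' q' i a' f")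
  case False
  let ?u = "claim [] q' i a' f"
  have r: "rep (adv ?u D) (counters N (t - 1) J')" by (rule claim_rep[OF D(1)]) (simp only: exec_Nil D(1))
  have "game.adam_wins ?u (adv ?u D)" by (rule less.IH[of "t - 1" J' "adv ?u D" i q' a' f "[]", OF l D(2) r i False])
  thus ?thesis by (rule game.adam_move[of _ ?u, rotated 2]) (simp_all add: vertex_succs_simps)
 next
  case True
  hence "state (t - 1) = q'" "s ~= reads (t - 1)" using wrong by (auto simp: truth_def)
  then obtain i' where i': "i' < k" "s ! i' ~= reads (t - 1) ! i'" using D(4) length_reads by (metis nth_equalityI)
  let ?u = "claim (reset N) q' i' (nthd 0 s i') False"
  have wr: "~ truth (t - 1) (2 ^ (N + 2)) q' i' (nthd 0 s i') False"
   using i' D(4) reads_nth[OF i'(1)] by (simp add: truth_def)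
  have r: "rep (adv ?u D) (counters N (t - 1) (2 ^ (N + 2)))" by (rule claim_rep[OF D(1) exec_reset[OF D(1)]])
  have J0: "2 ^ (N + 2) < (2 :: nat) ^ (N + 3)" by (simp add: power_add)
  have "game.adam_wins ?u (adv ?u D)"
   by (rule less.IH[of "t - 1" "2 ^ (N + 2)" "adv ?u D" i' q' "nthd 0 s i'" False "reset N", OF l J0 r i'(1) wr])
  thus ?thesis by (rule game.adam_move[of _ ?u, rotated 2]) (use i'(1) in "simp_all add: vertex_succs_simps")
 qed
 qed
 have main: "game.adam_wins u (adv u C)"
  if u: "u = move (decrement 0 r @ mv @ ops') q' s i a' f" and e: "(q', s, q, acts) : set (transitions M)" "r < N"
   "mv : set (moves N (snd (nthd (0, 0) acts i)))"
   and ops': "!!D J' t. rep D (counters N t J') ==> J' < 2 ^ (N + 3) ==> ~ brk (exec ops' D) ==> ok J' & rep (exec ops' D) (counters N t J')"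
   and bwd: "!!t J J'. ok J' ==> int J' = int J + shift (snd (nthd (0, 0) acts i)) ==> s = reads t ==> state t = q' ==> truth t J' q' i a' f ==> truth (Suc t) J q i a f"
  for u r mv ops' q' s a' acts ok
 proof (cases "brk (adv u C)")
  case True
  thus ?thesis by (rule broken_wins) (auto simp: u vertex_succs_simps)
 next
  case False
  let ?C1 = "exec (decrement 0 r) C" let ?C2 = "exec mv ?C1"
  have nb: "~ brk (exec ops' ?C2)" using False step_all_represents(2)[OF C, of u] by (simp add: u exec_append)
  hence nb2: "~ brk ?C2" using broken_exec by blast
  hence nb1: "~ brk ?C1" using broken_exec by blast
  from exec_decrement_time(2)[OF C e(2) nb1] have t: "0 < t" and C1: "rep ?C1 (counters N (t - 1) J)" by auto
  from exec_moves(2)[OF C1 J refl e(3) nb2] obtain J' where J': "J' < 2 ^ (N + 3)"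
   "int J' = int J + shift (snd (nthd (0, 0) acts i))" "rep ?C2 (counters N (t - 1) J')" by blast
  from ops'[OF J'(3,1) nb] have ok: "ok J'" and C3: "rep (exec ops' ?C2) (counters N (t - 1) J')" by auto
  have "rep (adv u C) (counters N (t - 1) J')" using C3 step_all_represents(1)[OF C, of u] by (simp add: u exec_append)
  thus ?thesis unfolding u
  proof (rule move_wins[OF _ J'(1) t])
   show "length s = k" using transitions_ok[OF e(1)] by simp
   show "~ (state (t - 1) = q' & s = reads (t - 1) & truth (t - 1) J' q' i a' f)"
    using bwd[OF ok J'(2), of "t - 1"] less.prems(5) t by auto
  qed
 qed
 show ?case
 proof (rule game.eve_moves)
  fix u assume "u : set (vertex_succs M N x (claim ops q i a f))"
  hence "u : set (claim_succs M N x q i a f)" by (simp add: vertex_succs_simps)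
  thus "game.adam_wins u (adv u C)"
  proof (cases rule: claim_cases)
   case fail
   have "C 0 < 2" using C by (auto simp: represents_def)
   hence "exec [(0, 3, False)] C 0 = 2" by (simp add: exec_def op_step_def)
   hence "brk (exec [(0, 3, False)] C)" by (auto simp: broken_def intro!: exI[of _ 0])
   from plain_brk[OF C _ this] show ?thesis unfolding fail by (intro broken_wins) (simp_all add: vertex_succs_simps)
  next
   case (final ops')
   have "brk (exec (expect 0 N (%_. False) @ ops') C)"
   proof (rule ccontr)
    let ?C1 = "exec (expect 0 N (%_. False)) C"
    assume "~ brk (exec (expect 0 N (%_. False) @ ops') C)"
    hence nb: "~ brk (exec ops' ?C1)" by (simp add: exec_append)
    hence "~ brk ?C1" using broken_exec by blast
    from exec_expect(2)[OF C _ this] have z: "ALL p<N. ~ counters N t J p" and C1: "rep ?C1 (counters N t J)" by auto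
    have t0: "t = 0" by (rule bits_eqI[OF less.prems(1)]) (use z in "simp_all add: counters_def")
    consider v where "ops' = near N v" "v < 2 * length x + 1" "f --> v = 0" "a = input_sym i v"
     | r where "ops' = far N r" "r < N + 3" "~ f" "a = 0" "min (length x) (2 ^ r) = length x"
     using final(3) unfolding finals_def input_sym_def by (auto simp del: upt_Suc)
    thus False
    proof cases
     case (1 v)
     have "J = v + 2 ^ (N + 2)" using exec_near(2)[OF C1 J input(1)[OF 1(2)]] nb 1(1) by blast
     hence j: "int J - 2 ^ (N + 2) = int v" by simp
     thus False using less.prems(5) 1 final(2) start(2,3)[OF i] unfolding truth_def j t0 start(1) by auto
    next
     case (2 r)
     have b: "bit J r ~= (r = N + 2)" using exec_far(2)[OF C1 2(2)] nb 2(1) by blast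
     have "length x <= 2 ^ r" using 2(5) by (simp add: min_def split: if_splits)
     from far_beyond[OF J b this, of "int J - 2 ^ (N + 2)"]
     have "cell 0 i (int J - 2 ^ (N + 2)) = 0" unfolding start(3)[OF i] by (auto simp: input_sym_def)
     thus False using less.prems(5) 2 final(2) unfolding truth_def t0 start(1) by simp
    qed
   qed
   from plain_brk[OF C _ this] show ?thesis unfolding final(1) by (intro broken_wins) (simp_all add: vertex_succs_simps)
  next
   case (zero s q' r mv acts)
   show ?thesis
   proof (rule main[OF zero(5,1,2,3), where ok = "%J'. J' = 2 ^ (N + 2)"])
    show "J' = 2 ^ (N + 2) & rep (exec (near N 0) D) (counters N t J')"
     if "rep D (counters N t J')" "J' < 2 ^ (N + 3)" "~ brk (exec (near N 0) D)" for D J' t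
     using exec_near(2)[OF that(1,2) zero_less_power[OF zero_less_numeral] that(3)] unfolding add_0 .
    show "truth (Suc t) J q i a f" if "J' = 2 ^ (N + 2)" "int J' = int J + shift (snd (nthd (0, 0) acts i))" "s = reads t"
     "state t = q'" "truth t J' q' i (nthd 0 s i) f" for t J J'
     using truth_step(1)[OF zero(1)[unfolded that(3)] that(4) i that(2,1) zero(4) that(5)] .
   qed
  next
   case (nonzero s q' r mv acts r')
   show ?thesis
   proof (rule main[OF nonzero(5,1,2,3), where ok = "%J'. J' ~= 2 ^ (N + 2)"])
    show "J' ~= 2 ^ (N + 2) & rep (exec (far N r') D) (counters N t J')"
     if "rep D (counters N t J')" "J' < 2 ^ (N + 3)" "~ brk (exec (far N r') D)" for D J' t
     using exec_far(2)[OF that(1) nonzero(4) that(3)] bit_power[of "N + 2" r'] by auto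
    show "truth (Suc t) J q i a f" if "J' ~= 2 ^ (N + 2)" "int J' = int J + shift (snd (nthd (0, 0) acts i))" "s = reads t"
     "state t = q'" "truth t J' q' i a f" for t J J'
     using truth_step(2)[OF nonzero(1)[unfolded that(3)] that(4) i that(2,1)] that(5) by blast
   qed
  qed
 qed simp
qed

section \<open>The guess of the initial offset\<close>

lemma plain_rep: "rep C \<beta> ==> 1 < tag ==> rep (exec ops C) \<gamma> ==> rep (adv (plain tag p ops) C) \<gamma>"
 by (subst step_all_represents(1)) simp_all

lemma move_rep: "rep C \<beta> ==> rep (exec ops C) \<gamma> ==> rep (adv (move ops q s i a f) C) \<gamma>"
 by (subst step_all_represents(1)) simp_all

lemma set_offset_bit: "rep C (counters N t J) ==> p < N + 3 ==> rep (exec (assign (N + p) 1 (%_. True)) C) (%c. c = N + p | counters N t J c)"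
 by (erule exec_assign) auto

lemma bit_time: "bit (2 ^ N - 1 :: nat) c \<longleftrightarrow> c < N"
 using bit_mask_iff[of N c, where 'a = nat] by (simp add: mask_eq_exp_minus_1)

lemma first_vertex: "vertices M N x ! 0 = plain 3 1 []"
 by (simp add: vertices_def)

lemma start_rep: "rep (game.comps [0]) (counters N (2 ^ N - 1) 0)"
proof -
 have "rep (%c. nthd 0 (start_bits N) c) (counters N (2 ^ N - 1) 0)"
  unfolding represents_def counters_def bit_time by (simp add: start_bits_def num_def)
 thus ?thesis unfolding game.comps_root first_vertex by (intro plain_rep) simp_all
qed

text \<open>The first claim places the symbol 2 in cell 0 of the last tape. If another symbol is
  there, this claim is false for every offset that Eve can compose.\<close>

lemma offset_loses:
 assumes "cell (2 ^ N - 1) (k - 1) (- pos (2 ^ N - 1) (k - 1)) ~= 2"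
  and "p <= N + 3" "J < 2 ^ p" "rep C (counters N (2 ^ N - 1) J)"
 shows "game.adam_wins (plain 2 (Suc p) ops) C"
 using assms(2-4)
proof (induction "N + 3 - p" arbitrary: p J C ops)
 case 0
 hence p: "p = N + 3" by simp
 show ?case
 proof (rule game.eve_moves)
  fix u assume "u : set (vertex_succs M N x (plain 2 (Suc p) ops))"
  hence u: "u = claim [] halt (k - 1) 2 True" unfolding p by (simp only: vertex_succs_simps list.set singleton_iff)
  have r: "rep (adv u C) (counters N (2 ^ N - 1) J)" unfolding u by (rule claim_rep[OF 0(4)]) (simp only: exec_Nil 0(4))
  have w: "~ truth (2 ^ N - 1) J halt (k - 1) 2 True" using assms(1) by (auto simp: truth_def)
  show "game.adam_wins u (adv u C)" unfolding u
   by (rule false_claim_loses[OF _ _ r[unfolded u] _ w]) (use 0(3) p wf in "auto simp: wf_tm_def")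
 qed simp
next
 case (Suc l)
 hence p: "p < N + 3" by simp
 show ?case
 proof (rule game.eve_moves)
  fix u assume u: "u : set (vertex_succs M N x (plain 2 (Suc p) ops))"
  have r: "rep (adv (plain 2 (Suc (Suc p)) []) C) (counters N (2 ^ N - 1) J)"
   by (rule plain_rep[OF Suc.prems(3)]) (simp, simp only: exec_Nil Suc.prems(3))
  have eq: "(%c. c = N + p | counters N (2 ^ N - 1) J c) = counters N (2 ^ N - 1) (J + 2 ^ p)"
   by (rule ext) (auto simp: counters_def bit_add_power[OF Suc.prems(2)])
  have r': "rep (adv (plain 2 (Suc (Suc p)) (assign (N + p) 1 (%_. True))) C) (counters N (2 ^ N - 1) (J + 2 ^ p))"
   by (rule plain_rep[OF Suc.prems(3) _ set_offset_bit[OF Suc.prems(3) p, unfolded eq]]) simp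
  from u p consider "u = plain 2 (Suc (Suc p)) []" | "u = plain 2 (Suc (Suc p)) (assign (N + p) 1 (%_. True))"
   by (auto simp: vertex_succs_simps)
  thus "game.adam_wins u (adv u C)"
  proof cases
   case 1
   show ?thesis unfolding 1 by (rule Suc.hyps(1)[OF _ _ _ r]) (use Suc.hyps(2) p Suc.prems(2) in auto)
  next
   case 2
   show ?thesis unfolding 2 by (rule Suc.hyps(1)[OF _ _ _ r']) (use Suc.hyps(2) p Suc.prems(2) in auto)
  qed
 qed simp
qed

lemma rejecting:
 assumes "cell (2 ^ N - 1) (k - 1) (- pos (2 ^ N - 1) (k - 1)) ~= 2"
 shows "game.adam_wins (vertices M N x ! 0) (game.comps [0])"
proof -
 let ?u = "plain 2 1 []"
 have "rep (adv ?u (game.comps [0])) (counters N (2 ^ N - 1) 0)" by (rule plain_rep[OF start_rep]) (simp, simp only: exec_Nil start_rep)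
 hence "game.adam_wins ?u (adv ?u (game.comps [0]))"
  using offset_loses[OF assms, of 0 0 _ "[]"] by simp
 thus ?thesis unfolding first_vertex by (rule game.adam_move[of _ ?u, rotated 2]) (simp_all add: vertex_succs_simps)
qed

text \<open>Eve's invariant: claims are true and no component is broken. The distance of the offset
  number from \<open>2 ^ (N + 2)\<close> grows by at most one while the time falls by one, so their
  sum stays below \<open>2 ^ (N + 1)\<close> and the offset never overflows. In sinks the states 2
  and 3 are excluded.\<close>

inductive good :: "vertex => (nat => nat) => bool" where
 sink: "fst v <= 1 ==> (!!p. p < N + (N + 3) ==> C p ~= 2 & C p ~= 3) ==> good v C"
| final: "rep C \<beta> ==> good (plain 3 2 ops) C"
| root: "rep C (counters N (2 ^ N - 1) 0) ==> good (plain 3 1 []) C"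
| offset: "p <= N + 3 ==>
  rep C (counters N (2 ^ N - 1) (take_bit p (nat (2 ^ (N + 2) - pos (2 ^ N - 1) (k - 1))))) ==> good (plain 2 (Suc p) ops) C"
| claim: "rep C (counters N t J) ==> \<bar>int J - 2 ^ (N + 2)\<bar> + int t < 2 ^ (N + 1) ==> t < 2 ^ N ==> i < k ==> truth t J q i a f ==>
  good (claim ops q i a f) C"
| move: "rep C (counters N t J) ==> \<bar>int J - 2 ^ (N + 2)\<bar> + int t < 2 ^ (N + 1) ==> t < 2 ^ N ==> i < k ==> truth t J q i a f ==>
  good (move ops q (reads t) i a f) C"

lemma time_less: "t < 2 ^ N ==> int t < 2 ^ (N + 1)"
proof -
 assume "t < 2 ^ N"
 hence "int t < int (2 ^ N)" by (simp only: of_nat_less_iff)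
 also have "... <= 2 ^ (N + 1)" by simp
 finally show ?thesis .
qed

lemma rep_less: "rep C \<beta> ==> p < N + (N + 3) ==> C p < 2"
 by (simp add: represents_def)

lemma good_sink:
 assumes "rep C \<beta> | fst v <= 1 & good v C" "fst u <= 1"
 shows "good u (adv u C)"
proof (rule good.sink[OF assms(2)])
 fix p assume p: "p < N + (N + 3)"
 have "C p < 2 | C p ~= 2 & C p ~= 3"
  using assms(1)
 proof
  assume "rep C \<beta>"
  thus ?thesis using rep_less p by blast
 next
  assume "fst v <= 1 & good v C"
  hence "good v C" "fst v <= 1" by auto
  thus ?thesis by (cases rule: good.cases) (use p in auto)
 qed
 thus "adv u C p ~= 2 & adv u C p ~= 3" using assms(2) p by (auto simp: step_all_def letter_def)
qed

lemma offset_range: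
 assumes "\<bar>int J - 2 ^ (N + 2)\<bar> + int t < 2 ^ (N + 1)"
 shows "0 < J" "J + 1 < 2 ^ (N + 3)"
proof -
 have "(2::int) ^ (N + 2) = 2 * 2 ^ (N + 1)" "(2::int) ^ (N + 3) = 4 * 2 ^ (N + 1)" "(0::int) < 2 ^ (N + 1)" by (simp_all add: power_add)
 hence "0 < int J" "int J + 1 < 2 ^ (N + 3)" using assms by linarith+
 thus "0 < J" by simp
 show "J + 1 < 2 ^ (N + 3)" by (subst of_nat_less_iff[where 'a = int, symmetric]) (use \<open>int J + 1 < 2 ^ (N + 3)\<close> in simp)
qed

text \<open>Eve plays the transition that the machine really made, with the bit positions that the
  counters really have. Every operation then succeeds and the new claim is true.\<close>

lemma claim_move_good:
 assumes C: "rep C (counters N (Suc t) J)" and J: "\<bar>int J - 2 ^ (N + 2)\<bar> + int (Suc t) < 2 ^ (N + 1)"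
  and t: "Suc t < 2 ^ N" and i: "i < k" and tr: "truth (Suc t) J q i a f"
 shows "EX u:set (claim_succs M N x q i a f). good u (adv u C)"
proof -
 note range = offset_range[OF J]
 obtain acts where e: "(state t, reads t, state (Suc t), acts) : set (transitions M)" using transition_run by metis
 have q: "state (Suc t) = q" using tr by (simp add: truth_def)
 note e' = e[unfolded q]
 obtain r where r: "r < N" "rep (exec (decrement 0 r) C) (counters N t J)"
  using exec_decrement_time(1)[OF C _ t] by auto
 obtain mv J' where mv: "mv : set (moves N (snd (nthd (0, 0) acts i)))" "int J' = int J + shift (snd (nthd (0, 0) acts i))"
  "J' < 2 ^ (N + 3)" "rep (exec mv (exec (decrement 0 r) C)) (counters N t J')"
  using exec_moves(1)[OF r(2) _ refl range, of "snd (nthd (0, 0) acts i)"] add_lessD1[OF range(2)] by blast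
 have J': "\<bar>int J' - 2 ^ (N + 2)\<bar> + int t < 2 ^ (N + 1)" using J mv(2) by (auto simp: shift_def split: if_splits)
 have pred: "u : set (claim_succs M N x q i a f)" if "u : set (predecessors N i a f (state t, reads t, q, acts))" for u
  using that e' unfolding claim_succs_def by (auto intro!: bexI[of _ "(state t, reads t, q, acts)"])
 show ?thesis
 proof (cases "J' = 2 ^ (N + 2)")
  case True
  from truth_step(3)[OF e' refl i mv(2) True tr]
  have z: "a = fst (nthd (0, 0) acts i)" "truth t J' (state t) i (reads t ! i) f" by auto
  have "rep (exec (near N 0) (exec mv (exec (decrement 0 r) C))) (counters N t J')"
   using exec_near(1)[OF mv(4,3), of 0] True by simp
  hence "good (move (decrement 0 r @ mv @ near N 0) (state t) (reads t) i (reads t ! i) f)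
    (adv (move (decrement 0 r @ mv @ near N 0) (state t) (reads t) i (reads t ! i) f) C)"
   by (intro good.move[OF move_rep[OF C] J' _ i z(2)]) (use t in "simp_all add: exec_append")
  moreover have "move (decrement 0 r @ mv @ near N 0) (state t) (reads t) i (reads t ! i) f : set (claim_succs M N x q i a f)"
   using r(1) mv(1) z(1) i length_reads by (intro pred) (auto simp: predecessors_def intro!: bexI[of _ r] bexI[of _ mv])
  ultimately show ?thesis by blast
 next
  case False
  obtain r' where r': "r' < N + 3" "bit J' r' ~= (r' = N + 2)" using far_ex[OF mv(3) False] by blast
  have z: "truth t J' (state t) i a f" using truth_step(2)[OF e' refl i mv(2) False] tr by blast
  have "rep (exec (far N r') (exec mv (exec (decrement 0 r) C))) (counters N t J')"
   by (rule exec_far(1)[OF mv(4) r'])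
  hence "good (move (decrement 0 r @ mv @ far N r') (state t) (reads t) i a f)
    (adv (move (decrement 0 r @ mv @ far N r') (state t) (reads t) i a f) C)"
   by (intro good.move[OF move_rep[OF C] J' _ i z]) (use t in "simp_all add: exec_append")
  moreover have "move (decrement 0 r @ mv @ far N r') (state t) (reads t) i a f : set (claim_succs M N x q i a f)"
   using r(1) mv(1) r'(1) by (intro pred) (auto simp: predecessors_def intro!: bexI[of _ r] bexI[of _ mv])
  ultimately show ?thesis by blast
 qed
qed

lemma claim_final_good:
 assumes C: "rep C (counters N 0 J)" and J: "\<bar>int J - 2 ^ (N + 2)\<bar> < 2 ^ (N + 1)" and i: "i < k" and tr: "truth 0 J q i a f"
 shows "EX u:set (claim_succs M N x q i a f). good u (adv u C)"
proof -
 have range: "J < 2 ^ (N + 3)" using offset_range(2)[of J 0] J by simp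
 define j where "j = int J - 2 ^ (N + 2)"
 have q: "q = 0" and a: "a = (if 0 <= j then input_sym i (nat j) else 0)" and f: "f --> j = 0"
  using tr start(1) start(2,3)[OF i] by (auto simp: truth_def j_def)
 have z: "rep (exec (expect 0 N (%_. False)) C) (counters N 0 J)" by (rule exec_expect(1)[OF C]) (simp_all add: counters_def)
 have "EX ops:set (finals N x i a f). rep (exec ops (exec (expect 0 N (%_. False)) C)) (counters N 0 J)"
 proof (cases "0 <= j & j < 2 * int (length x) + 1")
  case True
  then obtain v where v: "j = int v" "v < 2 * length x + 1" using nonneg_int_cases[of j] by auto
  have "J = v + 2 ^ (N + 2)" using v(1) j_def by (subst of_nat_eq_iff[where 'a = int, symmetric]) simp
  hence "rep (exec (near N v) (exec (expect 0 N (%_. False)) C)) (counters N 0 J)"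
   by (rule exec_near(1)[OF z range input(1)[OF v(2)]])
  moreover have "near N v : set (finals N x i a f)"
   unfolding finals_def set_append set_map set_filter by (intro UnI1 image_eqI[OF refl]) (use v a f in "auto simp: input_sym_def simp del: upt_Suc")
  ultimately show ?thesis by blast
 next
  case False
  have "int J = j + 2 ^ (N + 2)" by (simp add: j_def)
  moreover have "j < 0 | 2 * int (length x) + 1 <= j" using False by linarith
  ultimately obtain r where r: "r < N + 3" "bit J r ~= (r = N + 2)" "length x <= 2 ^ r"
   by (rule far_beyond_ex[OF range _ _ input(2)])
  have "rep (exec (far N r) (exec (expect 0 N (%_. False)) C)) (counters N 0 J)" by (rule exec_far(1)[OF z r(1,2)])
  moreover have "a = 0" "~ f" using a f False by (auto simp: input_sym_def nat_less_iff)
  hence "far N r : set (finals N x i a f)"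
   unfolding finals_def set_append set_map set_filter by (intro UnI2 image_eqI[OF refl]) (use r in simp)
  ultimately show ?thesis by blast
 qed
 then obtain ops where ops: "ops : set (finals N x i a f)" "rep (exec ops (exec (expect 0 N (%_. False)) C)) (counters N 0 J)" by blast
 let ?u = "plain 3 2 (expect 0 N (%_. False) @ ops)"
 have "good ?u (adv ?u C)" by (rule good.final[OF plain_rep[OF C, where \<gamma> = "counters N 0 J"]]) (simp, simp only: exec_append ops(2))
 moreover have "?u : set (claim_succs M N x q i a f)" using q ops(1) by (simp add: claim_succs_def)
 ultimately show ?thesis by blast
qed

lemma accepting:
 assumes acc: "cell (2 ^ N - 1) (k - 1) (- pos (2 ^ N - 1) (k - 1)) = 2"
 shows "EX s. game.safe_strategy s"
proof (rule game.safe_strategyI[where Q = good])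
 \<comment> \<open>The number of the offset of cell 0 from the final head position; the bits that
   Eve chooses one by one are those of \<open>?J\<close>.\<close>
 let ?J = "nat (2 ^ (N + 2) - pos (2 ^ N - 1) (k - 1))"
 have k: "k - 1 < k" using wf by (auto simp: wf_tm_def)
 have N2: "(2::int) ^ (N + 2) = 4 * 2 ^ N" "(2::int) ^ (N + 1) = 2 * 2 ^ N" "(0::int) < 2 ^ N" "int (2 ^ N - 1) = 2 ^ N - 1" by (simp_all add: of_nat_diff)
 have pb: "\<bar>pos (2 ^ N - 1) (k - 1)\<bar> <= 2 ^ N - 1" using pos_bound[OF k, of "2 ^ N - 1"] unfolding N2(4) .
 hence "0 <= 2 ^ (N + 2) - pos (2 ^ N - 1) (k - 1)" unfolding N2 using N2(3) by linarith
 hence J: "int ?J = 2 ^ (N + 2) - pos (2 ^ N - 1) (k - 1)" by (rule nat_0_le)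
 have J_bound: "\<bar>int ?J - 2 ^ (N + 2)\<bar> + int (2 ^ N - 1) < 2 ^ (N + 1)" unfolding J using pb N2 by linarith
 show "good (vertices M N x ! 0) (game.comps [0])" unfolding first_vertex by (rule good.root[OF start_rep])
 show "C p ~= 3" if "good v C" "p < N + (N + 3)" for v C p
  using that(1) by (cases rule: good.cases) (use that(2) rep_less[OF _ that(2)] in fastforce)+
 show "good u (adv u C)" if v: "v : set (vertices M N x)" "good v C" "fst v ~= 2" "u : set (vertex_succs M N x v)" for v C u
  using v(2)
 proof (cases rule: good.cases)
  case sink
  have "fst u <= 1" using v(1) by (cases rule: vertex_kinds) (use v(4) sink(1) in "auto simp: vertex_succs_simps claims_iff")
  thus ?thesis using good_sink[of C "%_. True" v u] sink(1) v(2) by blast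
 next
  case (final \<beta> ops)
  hence "u : set (challenges N)" using v(4) by (simp add: vertex_succs_simps)
  hence "fst u <= 1" by (auto simp: challenges_def)
  thus ?thesis using good_sink final(2) by blast
 next
  case root
  from v(4) consider "u = plain 0 0 []" | "u = plain 2 1 []" unfolding root(1) by (auto simp: vertex_succs_simps)
  thus ?thesis
  proof cases
   case 1
   show ?thesis by (rule good_sink[OF disjI1[OF root(2)]]) (simp add: 1)
  next
   case 2
   have "good (plain 2 (Suc 0) []) (adv (plain 2 (Suc 0) []) C)"
    by (rule good.offset[OF _ plain_rep[OF root(2)]]) (simp_all only: exec_Nil take_bit_0 root(2))
   thus ?thesis by (simp add: 2)
  qed
 next
  case (move t J i q a f ops)
  from v(4) consider "u : set (challenges N)" | "u = claim [] q i a f"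
   | i' where "i' < k" "u = claim (reset N) q i' (nthd 0 (reads t) i') False"
   unfolding move(1) by (auto simp: vertex_succs_simps)
  thus ?thesis
  proof cases
   case 1
   hence "fst u <= 1" by (auto simp: challenges_def)
   thus ?thesis using good_sink move(2) by blast
  next
   case 2
   show ?thesis unfolding 2
    by (rule good.claim[OF claim_rep[OF move(2)] move(3-6)]) (simp only: exec_Nil move(2))
  next
   case (3 i')
   have "truth t (2 ^ (N + 2)) q i' (nthd 0 (reads t) i') False"
    using move(6) reads_nth[OF 3(1)] 3(1) length_reads by (simp add: truth_def)
   thus ?thesis unfolding 3(2)
    by (rule good.claim[OF claim_rep[OF move(2) exec_reset[OF move(2)]] _ move(4) 3(1), rotated])
      (use time_less[OF move(4)] in simp)
  qed
 qed (use v(3) in simp_all)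
 show "EX u:set (vertex_succs M N x v). good u (adv u C)" if v: "v : set (vertices M N x)" "good v C" "fst v = 2" for v C
  using v(2)
 proof (cases rule: good.cases)
  case (offset p ops)
  show ?thesis
  proof (cases "p < N + 3")
   case True
   let ?u = "plain 2 (Suc (Suc p)) (if bit ?J p then assign (N + p) 1 (%_. True) else [])"
   have eq: "counters N (2 ^ N - 1) (take_bit (Suc p) ?J) = (if bit ?J p then (%c. c = N + p | counters N (2 ^ N - 1) (take_bit p ?J) c)
     else counters N (2 ^ N - 1) (take_bit p ?J))"
    by (auto simp: counters_def bit_take_bit_iff fun_eq_iff less_Suc_eq)
   have "rep (exec (if bit ?J p then assign (N + p) 1 (%_. True) else []) C) (counters N (2 ^ N - 1) (take_bit (Suc p) ?J))"
    using set_offset_bit[OF offset(3) True] offset(3) unfolding eq by (cases "bit ?J p") (simp_all only: if_True if_False exec_Nil)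
   hence "good ?u (adv ?u C)" using True by (intro good.offset[OF _ plain_rep[OF offset(3)]]) simp_all
   moreover have "?u : set (vertex_succs M N x v)" unfolding offset(1) using True by (simp add: vertex_succs_simps)
   ultimately show ?thesis by blast
  next
   case False
   hence p: "p = N + 3" using offset(2) by simp
   have "?J < 2 ^ p" using add_lessD1[OF offset_range(2)[OF J_bound]] unfolding p .
   hence r: "rep C (counters N (2 ^ N - 1) ?J)" using offset(3) by (simp add: take_bit_nat_eq_self)
   have tr: "truth (2 ^ N - 1) ?J halt (k - 1) 2 True" unfolding truth_def J using acc halts by simp
   have "good (claim [] halt (k - 1) 2 True) (adv (claim [] halt (k - 1) 2 True) C)"
    by (rule good.claim[OF claim_rep[OF r] J_bound _ k tr]) (simp only: exec_Nil r, simp)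
   moreover have "claim [] halt (k - 1) 2 True : set (vertex_succs M N x v)"
    unfolding offset(1) p by (simp only: vertex_succs_simps list.set singleton_iff)
   ultimately show ?thesis by blast
  qed
 next
  case (claim t J i q a f ops)
  show ?thesis
  proof (cases t)
   case 0
   show ?thesis using claim_final_good[of C J i q a f] claim by (simp add: 0 vertex_succs_simps)
  next
   case (Suc t')
   show ?thesis using claim_move_good[of C t' J i q a f] claim by (simp add: Suc vertex_succs_simps del: of_nat_Suc)
  qed
 qed (use v(3) in simp_all)
qed

end

subsection \<open>Feasibility of the reduction\<close>

lemma feasible_op_step [feas]:
 "feasible f ==> feasible g ==> feasible h ==> feasible (%z. op_step (f z) (g z) (h z))"
proof (rule feasible_comp3[of op_step])
 show "feasible (%p. op_step (fst p) (fst (snd p)) (snd (snd p)))"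
  unfolding op_step_def insert_iff empty_iff
  by (rule feasible_fold_inv[where I = "%_ _. True" and r = "%_. 10"])
   (intro feas pb_intros | simp add: csize_simps)+
qed

lemma feasible_letter [THEN feasible_comp4, feas]: "feasible4 letter"
 unfolding letter_def by (intro feas)

lemma feasible_upt_from [feas]: "feasible f ==> feasible g ==> feasible (%z. [f z..<g z])"
proof (rule feasible_comp2[of "%m n. [m..<n]"])
 have "feasible (%p. map (%i. i + fst p) [0..<snd p - fst p])" by (intro feas)
 moreover have "map (%i. i + m) [0..<n - m] = [m..<n]" for m n by (cases "m <= n") (simp_all add: map_add_upt)
 ultimately show "feasible (%p. [fst p..<snd p])" by simp
qed

abbreviation "feasible5 F \<equiv> feasible (%p. F (fst p) (fst (snd p)) (fst (snd (snd p))) (fst (snd (snd (snd p)))) (snd (snd (snd (snd p)))))"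

lemma feasible_comp5:
 assumes "feasible5 F"
  and "feasible f" "feasible g" "feasible h" "feasible k" "feasible l"
 shows "feasible (%x. F (f x) (g x) (h x) (k x) (l x))"
 using feasible_comp[OF assms(1) feasible_pair[OF assms(2) feasible_pair[OF assms(3) feasible_pair[OF assms(4) feasible_pair[OF assms(5,6)]]]]] by simp

lemma feasible_component [THEN feasible_comp5, feas]: "feasible5 component"
 unfolding component_def by (intro feas)

lemma feasible_eve_specs [feas]: "feasible k ==> feasible (%z. eve_specs (k z))"
 unfolding eve_specs_def by (intro feas)

lemma feasible_adam_specs [feas]: "feasible k ==> feasible (%z. adam_specs (k z))"
 unfolding adam_specs_def by (intro feas)

lemma feasible_decrement [THEN feasible_comp2, feas]: "feasible2 decrement"
 unfolding decrement_def ops_on_def num_def by (intro feas)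

lemma feasible_increment [THEN feasible_comp2, feas]: "feasible2 increment"
 unfolding increment_def ops_on_def num_def by (intro feas)

lemma feasible_near [THEN feasible_comp2, feas]: "feasible2 near"
 unfolding near_def expect_def ops_on_def num_def by (intro feas)

lemma feasible_far [THEN feasible_comp2, feas]: "feasible2 far"
 unfolding far_def expect_def ops_on_def num_def by (intro feas)

lemma feasible_reset [THEN feasible_comp, feas]: "feasible (%z. reset z)"
 unfolding reset_def assign_def ops_on_def by (intro feas)

lemma feasible_challenges [THEN feasible_comp, feas]: "feasible (%z. challenges z)"
 unfolding challenges_def plain_def by (intro feas)

lemma feasible_moves [THEN feasible_comp2, feas]: "feasible2 moves"
 unfolding moves_def by (intro feas)

lemma feasible_finals [THEN feasible_comp5, feas]: "feasible5 finals"
 unfolding finals_def by (intro feas)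

lemma feasible_predecessors [THEN feasible_comp5, feas]: "feasible5 predecessors"
 unfolding predecessors_def case_prod_beta move_def by (intro feas)

lemma feasible_vertex_succs [THEN feasible_comp3, feas]: "feasible3 (vertex_succs M)"
 unfolding vertex_succs_def claim_succs_def case_prod_beta plain_def claim_def expect_def assign_def ops_on_def num_def by (intro feas)

lemma feasible_all_vertices [THEN feasible_comp2, feas]: "feasible2 (vertices M)"
 unfolding vertices_def claims_def case_prod_beta plain_def claim_def assign_def ops_on_def by (intro feas)

text \<open>The summand \<open>length x\<close> together with a positive \<open>c\<close> gives
  \<open>2 * length x + 1 <= 2 ^ N\<close>, so that offsets can address the input.\<close>

definition reduction :: "tm => nat => nat => bool list => bool list" where
 "reduction M k c x = (let N = length x ^ k + length x + c in
   enc_instance (game_instance (N + (N + 3)) (start_bits N) (vertices M N x) (vertex_succs M N x) (plain 0 0 [])))"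

lemma feasible_reduction: "feasible (reduction M k c)"
 unfolding reduction_def game_instance_def start_bits_def Let_def plain_def
 by (intro feas)

subsection \<open>Hardness\<close>

text \<open>The constant \<open>c\<close> in the exponent absorbs the constant factor as well as the
  finitely many values before the asymptotic bound sets in.\<close>

lemma exponential_majorant:
 fixes T :: "nat => nat"
 assumes "(%n. real (T n)) : O(%n. 2 ^ (n ^ k))"
 obtains c where "!!n. T n < 2 ^ (n ^ k + n + c)" "0 < c"
proof -
 obtain C where C: "eventually (%n. norm (real (T n)) <= C * norm ((2::real) ^ (n ^ k))) at_top"
  using assms by (auto elim: landau_o.bigE)
 then obtain n0 where n0: "!!n. n >= n0 ==> real (T n) <= C * 2 ^ (n ^ k)"
  by (auto simp: eventually_at_top_linorder)
 define c where "c = nat \<lceil>\<bar>C\<bar>\<rceil> + (\<Sum>m<n0. T m) + 1"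
 have c: "c < 2 ^ c" by (rule less_exp)
 have "T n < 2 ^ (n ^ k + n + c)" for n
 proof (cases "n < n0")
  case True
  hence "T n <= (\<Sum>m<n0. T m)" by (intro member_le_sum) auto
  hence "T n < 2 ^ c" using c by (simp add: c_def)
  also have "... <= 2 ^ (n ^ k + n + c)" by (rule power_increasing) auto
  finally show ?thesis .
 next
  case False
  have "C <= real (nat \<lceil>\<bar>C\<bar>\<rceil>)" by linarith
  also have "... <= real c" by (rule of_nat_mono) (unfold c_def, rule trans_le_add1, rule le_add1)
  finally have "C <= real c" .
  hence "real (T n) <= real c * 2 ^ (n ^ k)" using n0[of n] False by (meson mult_right_mono not_less order_trans zero_le_numeral zero_le_power)
  hence "real (T n) <= real (c * 2 ^ (n ^ k))" by simp
  hence "T n <= c * 2 ^ (n ^ k)" by (simp only: of_nat_le_iff)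
  also have "... < 2 ^ c * 2 ^ (n ^ k)" using c by simp
  also have "... <= 2 ^ (n ^ k + n + c)" by (simp add: power_add)
  finally show ?thesis .
 qed
 thus ?thesis using that[of c] by (simp add: c_def)
qed

lemma reduction_correct:
 assumes tm: "tm_computes_in_time M (%x. [x : L]) T" and T: "!!n. T n < 2 ^ (n ^ d + n + c)" and c: "0 < c"
 shows "reduction M d c x : two_player_instances" "x : L \<longleftrightarrow> reduction M d c x : constrained_SPE_problem"
proof -
 define N where "N = length x ^ d + length x + c"
 interpret tm_run M x using tm by unfold_locales (simp add: tm_computes_in_time_def)
 obtain t q ts where t: "t <= T (length x)" "(tm_step M ^^ t) (tm_init M x) = (q, ts)" "q = halt" "tape_output (last ts) [x : L]"
  using tm unfolding tm_computes_in_time_def by (fastforce split: prod.splits)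
 have stay: "cfg (t + m) = (q, ts)" for m
  by (induction m) (use t(2,3) in "simp_all add: cfg_def")
 have "t <= 2 ^ N - 1" using t(1) T[of "length x"] by (simp add: N_def)
 then obtain m where "2 ^ N - 1 = t + m" using le_Suc_ex by blast
 hence fin: "cfg (2 ^ N - 1) = (halt, ts)" using stay t(3) by simp
 have len: "length ts = k" "1 <= k" using cfg_ok[of "2 ^ N - 1"] fin wf by (simp_all add: wf_tm_def)
 hence "last ts = ts ! (k - 1)" by (cases ts rule: rev_cases) (auto simp: nth_append)
 hence out: "cell (2 ^ N - 1) (k - 1) (- pos (2 ^ N - 1) (k - 1)) = bit_sym (x : L)"
  unfolding cell_def fin using t(4) by (cases "ts ! (k - 1)") simp
 interpret tm_game M x N
 proof
  have "length x + 1 <= 2 ^ length x" using less_exp[of "length x"] by (simp only: Suc_eq_plus1[symmetric] Suc_le_eq)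
  moreover have "2 * 2 ^ length x <= (2::nat) ^ N" using c power_increasing[of "Suc (length x)" N "2::nat"] by (simp add: N_def)
  ultimately show "2 * length x + 1 <= 2 ^ N" by linarith
  show "state (2 ^ N - 1) = halt" unfolding state_def fin by simp
 qed
 have r: "reduction M d c x = enc_instance game.Inst" unfolding reduction_def N_def Let_def ..
 show "reduction M d c x : two_player_instances" unfolding r by (rule game.two_players)
 have "reduction M d c x : constrained_SPE_problem \<longleftrightarrow> (EX s. game.safe_strategy s)" unfolding r by (rule game.problem_iff)
 also have "... \<longleftrightarrow> x : L"
 proof
  assume s: "EX s. game.safe_strategy s"
  show "x : L"
  proof (rule ccontr)
   assume "x \<notin> L"
   hence "game.adam_wins (vertices M N x ! 0) (game.comps [0])" using out by (intro rejecting) (simp add: bit_sym_def)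
   thus False using game.adam_wins_unsafe s by blast
  qed
 qed (use accepting out in "simp add: bit_sym_def")
 finally show "x : L \<longleftrightarrow> reduction M d c x : constrained_SPE_problem" by blast
qed

theorem constrained_SPE_problem_hard: "EXPTIME_hard_on two_player_instances constrained_SPE_problem"
 unfolding EXPTIME_hard_on_def
proof
 fix L assume "L : EXPTIME"
 then obtain k M T where M: "tm_computes_in_time M (%x. [x : L]) T" "(%n. real (T n)) : O(%n. 2 ^ (n ^ k))"
  by (auto simp: EXPTIME_def DTIME_def computable_in_time_def)
 obtain c where "!!n. T n < 2 ^ (n ^ k + n + c)" "0 < c" using exponential_majorant[OF M(2)] by blast
 thus "EX f. polytime_computable f & (ALL x. f x : two_player_instances & (x : L) = (f x : constrained_SPE_problem))"
  using reduction_correct[OF M(1)] polytime_computableI[OF feasible_reduction] by (intro exI[of _ "reduction M k c"]) blast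
qed

theorem theorem4:
  shows "constrained_SPE_problem \<in> EXPTIME \<and>
         EXPTIME_hard_on two_player_instances constrained_SPE_problem"
  using constrained_SPE_problem_EXPTIME constrained_SPE_problem_hard by blast

end
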